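(* Let $k\in\mathbb{N}$ and $n,m\in\mathbb{N}\cup\{\omega\}$. Then: (1) if $k\le m$, then $c_k(\mathbb{Z}^m)\le 2^k-1-\max_{s\le k-2}\binom{k-1}{s-1}$ (maximum over integers $s\le k-2$); (2) if $k\ge4$, then $c_k^B(\mathbb{R}^k)\ge\frac12(k^2+3k-4)$; (3) if $m\ge k\ge4$, then $c_k^B(\mathbb{R}^m)\ge k+4$; (4) if $k\le n$, then $c_k^B(\mathbb{R}^n)<c_{k+1}^B(\mathbb{R}^{n+1})$ and $c_k(\mathbb{R}^n)<c_{k+1}(\mathbb{R}^{n+1})$; (5) if $k\le n+m$, then $c_k^B(\mathbb{R}^n\times\mathbb{Z}^m)<c_{k+1}^B(\mathbb{R}^n\times\mathbb{Z}^{m+1})$ and $c_k(\mathbb{R}^n\times\mathbb{Z}^m)<c_{k+1}(\mathbb{R}^n\times\mathbb{Z}^{m+1})$.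
   Context: The binomial coefficient $\binom{k}{i}$ equals $\frac{k!}{i!(k-i)!}$ if $i\in\{0,\dots,k\}$ and $0$ otherwise. $\omega+1=\omega$. $\mathbb{R}$ has the usual topology, $\mathbb{Z}$ is discrete, products carry the (Tychonoff) product topology. A $k$-coloring of $X$ is a map $\chi:X\to\{0,\dots,k-1\}$, Borel if each color class is Borel. A subset of a topological group is totally bounded if for every neighborhood $U$ of zero it is covered by finitely many shifts $x+U$; otherwise unbounded. For an abelian topological group $G$, $C\subset G$ is $k$-centerpole (resp. for Borel colorings) if for every (Borel) $k$-coloring of $G$ there are $c\in C$ and an unbounded monochromatic $S\subset G$ with $S=2c-S$. $c_k(G)$, resp. $c_k^B(G)$, is the least cardinality of such a set, and is the symbol $\infty$ (larger than every cardinal) if none exists. *)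

theory Defs
  imports "HOL-Analysis.Analysis" "HOL-Algebra.Product_Groups"
    "HOL-Library.Extended_Nat"
begin

text \<open>Integer arguments are needed because the lower index may be negative; the value is then 0.\<close>

definition zbinom :: "int \<Rightarrow> int \<Rightarrow> nat" where
  "zbinom k i = (if i \<in> {0..k} then fact (nat k) div (fact (nat i) * fact (nat (k - i))) else 0)"

text \<open>The datatype adjoins to the cardinals a largest element \<open>Infty\<close>. A cardinal is represented, as in the HOL library of cardinals, by a cardinal order;
  all comparisons are made through \<^const>\<open>ordLeq\<close> and \<^const>\<open>ordLess\<close>, so they do not
  depend on the representative and make sense across types.\<close>

datatype 'a ecard = Card "'a rel" | Infty

fun ecard_le :: "'a ecard \<Rightarrow> 'b ecard \<Rightarrow> bool" (infix "\<le>\<^sub>c" 50) where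
  "Card r \<le>\<^sub>c Card s \<longleftrightarrow> (r, s) \<in> ordLeq"
| "Infty \<le>\<^sub>c Card s \<longleftrightarrow> False"
| "x \<le>\<^sub>c Infty \<longleftrightarrow> True"

fun ecard_less :: "'a ecard \<Rightarrow> 'b ecard \<Rightarrow> bool" (infix "<\<^sub>c" 50) where
  "Card r <\<^sub>c Card s \<longleftrightarrow> (r, s) \<in> ordLess"
| "Card r <\<^sub>c Infty \<longleftrightarrow> True"
| "Infty <\<^sub>c y \<longleftrightarrow> False"

definition ecard_of_nat :: "nat \<Rightarrow> nat ecard" where
  "ecard_of_nat N = Card (card_of {..<N})"

definition least_card :: "'a set set \<Rightarrow> 'a ecard" where
  "least_card \<C> =
     (if \<C> = {} then Infty
      else Card (card_of (SOME C. C \<in> \<C> \<and> (\<forall>D\<in>\<C>. (card_of C, card_of D) \<in> ordLeq))))"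

text \<open>Below, \<open>G\<close> is an abelian group, in the multiplicative notation of HOL-Algebra,
  and \<open>T\<close> is a group topology on its carrier.\<close>

definition neighborhood_of_one :: "('a, 'b) monoid_scheme \<Rightarrow> 'a topology \<Rightarrow> 'a set \<Rightarrow> bool" where
  "neighborhood_of_one G T U \<longleftrightarrow>
     U \<subseteq> carrier G \<and> (\<exists>V. openin T V \<and> \<one>\<^bsub>G\<^esub> \<in> V \<and> V \<subseteq> U)"

definition group_totally_bounded :: "('a, 'b) monoid_scheme \<Rightarrow> 'a topology \<Rightarrow> 'a set \<Rightarrow> bool" where
  "group_totally_bounded G T S \<longleftrightarrow>
     (\<forall>U. neighborhood_of_one G T U \<longrightarrow>
        (\<exists>F. finite F \<and> F \<subseteq> carrier G \<and> S \<subseteq> (\<Union>x\<in>F. x <#\<^bsub>G\<^esub> U)))"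

definition coloring :: "'a set \<Rightarrow> nat \<Rightarrow> ('a \<Rightarrow> nat) \<Rightarrow> bool" where
  "coloring X k \<phi> \<longleftrightarrow> (\<forall>x\<in>X. \<phi> x < k)"

definition borel_sets_of :: "'a topology \<Rightarrow> 'a set set" where
  "borel_sets_of T = sigma_sets (topspace T) {U. openin T U}"

definition borel_coloring :: "'a topology \<Rightarrow> nat \<Rightarrow> ('a \<Rightarrow> nat) \<Rightarrow> bool" where
  "borel_coloring T k \<phi> \<longleftrightarrow>
     coloring (topspace T) k \<phi> \<and> (\<forall>i<k. {x \<in> topspace T. \<phi> x = i} \<in> borel_sets_of T)"

definition monochromatic :: "('a \<Rightarrow> nat) \<Rightarrow> 'a set \<Rightarrow> bool" where
  "monochromatic \<phi> S \<longleftrightarrow> (\<exists>i. \<forall>x\<in>S. \<phi> x = i)"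

text \<open>The image below is \<open>2c - S\<close> in additive notation.\<close>

definition symmetric_about :: "('a, 'b) monoid_scheme \<Rightarrow> 'a \<Rightarrow> 'a set \<Rightarrow> bool" where
  "symmetric_about G c S \<longleftrightarrow> S = (\<lambda>x. (c [^]\<^bsub>G\<^esub> (2::nat)) \<otimes>\<^bsub>G\<^esub> inv\<^bsub>G\<^esub> x) ` S"

definition has_center_in ::
  "('a, 'b) monoid_scheme \<Rightarrow> 'a topology \<Rightarrow> 'a set \<Rightarrow> ('a \<Rightarrow> nat) \<Rightarrow> bool" where
  "has_center_in G T C \<phi> \<longleftrightarrow>
     (\<exists>c\<in>C. \<exists>S\<subseteq>carrier G. \<not> group_totally_bounded G T S \<and> monochromatic \<phi> S \<and> symmetric_about G c S)"

definition centerpole :: "nat \<Rightarrow> ('a, 'b) monoid_scheme \<Rightarrow> 'a topology \<Rightarrow> 'a set \<Rightarrow> bool" where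
  "centerpole k G T C \<longleftrightarrow>
     C \<subseteq> carrier G \<and> (\<forall>\<phi>. coloring (carrier G) k \<phi> \<longrightarrow> has_center_in G T C \<phi>)"

definition borel_centerpole :: "nat \<Rightarrow> ('a, 'b) monoid_scheme \<Rightarrow> 'a topology \<Rightarrow> 'a set \<Rightarrow> bool" where
  "borel_centerpole k G T C \<longleftrightarrow>
     C \<subseteq> carrier G \<and> (\<forall>\<phi>. borel_coloring T k \<phi> \<longrightarrow> has_center_in G T C \<phi>)"

definition centerpole_number :: "nat \<Rightarrow> ('a, 'b) monoid_scheme \<Rightarrow> 'a topology \<Rightarrow> 'a ecard" where
  "centerpole_number k G T = least_card {C. centerpole k G T C}"

definition borel_centerpole_number :: "nat \<Rightarrow> ('a, 'b) monoid_scheme \<Rightarrow> 'a topology \<Rightarrow> 'a ecard" where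
  "borel_centerpole_number k G T = least_card {C. borel_centerpole k G T C}"

text \<open>The exponents range over the natural numbers together with \<open>\<infinity>\<close>, which stands for
  \<open>\<omega>\<close>; addition of \<^typ>\<open>enat\<close> satisfies \<open>\<infinity> + 1 = \<infinity>\<close>. Elements of the powers are
  functions that take the value \<^const>\<open>undefined\<close> outside the index set.\<close>

definition real_group :: "real monoid" where
  "real_group = \<lparr>carrier = UNIV, monoid.mult = (+), one = 0\<rparr>"

definition exponent_set :: "enat \<Rightarrow> nat set" where
  "exponent_set n = {i. enat i < n}"

definition real_power :: "enat \<Rightarrow> (nat \<Rightarrow> real) monoid" where
  "real_power n = product_group (exponent_set n) (\<lambda>_. real_group)"

definition real_power_topology :: "enat \<Rightarrow> (nat \<Rightarrow> real) topology" where
  "real_power_topology n = product_topology (\<lambda>_. euclideanreal) (exponent_set n)"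

definition int_power :: "enat \<Rightarrow> (nat \<Rightarrow> int) monoid" where
  "int_power m = product_group (exponent_set m) (\<lambda>_. integer_group)"

definition int_power_topology :: "enat \<Rightarrow> (nat \<Rightarrow> int) topology" where
  "int_power_topology m = product_topology (\<lambda>_. discrete_topology UNIV) (exponent_set m)"

definition mixed_power :: "enat \<Rightarrow> enat \<Rightarrow> ((nat \<Rightarrow> real) \<times> (nat \<Rightarrow> int)) monoid" where
  "mixed_power n m = real_power n \<times>\<times> int_power m"

definition mixed_power_topology :: "enat \<Rightarrow> enat \<Rightarrow> ((nat \<Rightarrow> real) \<times> (nat \<Rightarrow> int)) topology" where
  "mixed_power_topology n m = prod_topology (real_power_topology n) (int_power_topology m)"

abbreviation "c_R k n \<equiv> centerpole_number k (real_power n) (real_power_topology n)"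
abbreviation "cB_R k n \<equiv> borel_centerpole_number k (real_power n) (real_power_topology n)"
abbreviation "c_Z k m \<equiv> centerpole_number k (int_power m) (int_power_topology m)"
abbreviation "c_RZ k n m \<equiv> centerpole_number k (mixed_power n m) (mixed_power_topology n m)"
abbreviation "cB_RZ k n m \<equiv> borel_centerpole_number k (mixed_power n m) (mixed_power_topology n m)"

end

theory Submission
  imports Defs "HOL-Library.Multiset" "HOL-Library.Function_Algebras"
begin

text \<open>Upper bound: a coloring of \<open>\<int>\<^sup>k\<close> without large symmetric monochromatic pairs around the points
  of a subset of \<open>{0,1}\<^sup>k\<^sup>-\<^sup>1 \<times> {-1,0,1}\<close> would give an antipodal coloring of a large subdivided box,
  which Fan's combinatorial form of the Borsuk-Ulam theorem excludes.

  Monotonicity: if two points of a finite set are merged by a linear map with kernel spanned by their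
  difference, a coloring of the quotient that refutes the image yields one with a further color, used on the two
  far sides of a slab transversal to the kernel.

  Lower bounds: a set all of whose points are removed by successively peeling off the faces on which
  \<open>k - 1\<close> independent functionals attain their maximum is not \<open>k\<close>-centerpole. Facets of the
  convex hull contain at least as many points as the dimension, which gives the quadratic bound by
  induction once it is known in dimension 4; there the only obstruction to peeling 11 points is an octahedron
  in a hyperplane between a facet and a vertex, and tilting the facet around that vertex is contradictory.
  In larger ambient dimension only vertices and edges are peeled.\<close>

section \<open>Antipodal labellings of subdivided boxes\<close>

text \<open>Restricted to vectors \<open>2 * u\<close>, a colouring sees the reflection about
  \<open>u + u'\<close> as the exchange of \<open>2 * u\<close> and \<open>2 * u'\<close>. So it
  suffices to collect the sums \<open>p y + p (- x)\<close> for neighbours \<open>x\<close>,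
  \<open>y\<close> on a common facet of a box, for a suitable map \<open>p\<close> of the box
  boundary to the lattice. The identity gives all 0-1 vectors but one, that is
  \<open>2 ^ k - 1\<close> centres; the binomial coefficient is saved by making the last coordinate
  a floor of the sum of the others plus a time, with step \<open>d - s\<close>.

  In the peeling colourings the obstacle is a hyperplane with several centres on it: their
  reflections preserve it, so the colouring inside must already be good for all of them. An
  auxiliary colouring that is good for every centre is therefore carried through the induction.

  Dimension 4 has its own argument because the general step from dimension 3, where five points are
  always peelable, yields only ten; with the eleventh the formula holds there, and each later step
  raises it by the right amount.\<close>

fun alt_from :: "bool \<Rightarrow> bool list \<Rightarrow> bool" where
  "alt_from b [] \<longleftrightarrow> True"
| "alt_from b (x # xs) \<longleftrightarrow> x = b \<and> alt_from (\<not> b) xs"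

definition del :: "nat \<Rightarrow> 'a list \<Rightarrow> 'a list" where
  "del i xs = take i xs @ drop (Suc i) xs"

lemma del_0 [simp]: "del 0 (x # xs) = xs"
  and del_Suc [simp]: "del (Suc i) (x # xs) = x # del i xs"
  by (simp_all add: del_def)

lemma map_del: "map f (del i xs) = del i (map f xs)"
  by (simp add: del_def take_map drop_map)

lemma mset_del: "i < length xs \<Longrightarrow> mset (del i xs) = mset xs - {#xs ! i#}"
proof (induction xs arbitrary: i)
  case (Cons x xs)
  then show ?case
    by (cases i) (auto simp: add_mset_diff_bothsides)
qed simp

lemma sorted_del: "sorted xs \<Longrightarrow> sorted (del i xs)"
proof (induction xs arbitrary: i)
  case (Cons x xs)
  then show ?case
    by (cases i) (auto simp: del_def dest: in_set_takeD in_set_dropD)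
qed (simp add: del_def)

lemma alt_from_exclusive: "xs \<noteq> [] \<Longrightarrow> alt_from b xs \<Longrightarrow> \<not> alt_from (\<not> b) xs"
  by (cases xs) auto

text \<open>An alternating word stays alternating only if an end is deleted, and exactly one end
  leaves \<open>b\<close> as first letter. Any other word that becomes alternating has one pair of
  equal neighbours, and either of the two may be deleted, so the count is 0 or 2.\<close>

lemma odd_alternating_facets:
  assumes "bs \<noteq> []"
  shows "odd (\<Sum>i<length bs. of_bool (alt_from b (del i bs)) :: nat)
      \<longleftrightarrow> alt_from True bs \<or> alt_from False bs"
  using assms
proof (induction bs arbitrary: b)
  case (Cons x xs)
  have eq: "(\<Sum>i<length (x # xs). of_bool (alt_from b (del i (x # xs))) :: nat)
     = of_bool (alt_from b xs) +
       (if x = b then (\<Sum>i<length xs. of_bool (alt_from (\<not> b) (del i xs))) else 0)"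
    unfolding length_Cons sum.lessThan_Suc_shift by simp
  show ?case
  proof (cases "xs = []")
    case True
    then show ?thesis by (auto simp: eq)
  next
    case False
    show ?thesis
      using Cons.IH[OF False, of "\<not> b"] alt_from_exclusive[OF False, of True]
        alt_from_exclusive[OF False, of False] unfolding eq
      by (cases b; cases x) auto
  qed
qed simp

text \<open>A label \<open>2 * c + e\<close> with \<open>e\<close> in {0, 1} is a signed symbol of
  absolute value \<open>c\<close> whose sign is its parity. Sorting is by absolute value, so the
  condition is the alternation of signs in Fan's lemma.\<close>

definition alt :: "bool \<Rightarrow> nat list \<Rightarrow> bool" where
  "alt b ls = alt_from b (map odd (sort ls))"

lemma alt_cong: "mset xs = mset ys \<Longrightarrow> alt b xs = alt b ys"
  unfolding alt_def by (metis sort_key_def properties_for_sort mset_sort sorted_sort)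

lemma odd_alt_facets:
  assumes "ls \<noteq> []"
  shows "odd (\<Sum>i<length ls. of_bool (alt b (del i ls)) :: nat) \<longleftrightarrow> alt True ls \<or> alt False ls"
proof -
  \<comment> \<open>Counting through multisets makes the number of alternating facets independent of
    the order of the vertices, so the list may be replaced by its sorted version.\<close>
  define g :: "nat multiset \<Rightarrow> nat" where
    "g M = of_bool (alt b (sorted_list_of_multiset M))" for M
  have g: "g (mset xs) = of_bool (alt b xs)" for xs
    unfolding g_def by (subst alt_cong[of _ xs]) auto
  have sum: "(\<Sum>i<length xs. of_bool (alt b (del i xs))) = (\<Sum>x\<in>#mset xs. g (mset xs - {#x#}))" for xs
  proof -
    have "(\<Sum>i<length xs. of_bool (alt b (del i xs)) :: nat)
       = (\<Sum>i<length xs. g (mset xs - {#xs ! i#}))"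
      by (intro sum.cong refl) (simp add: g[symmetric] mset_del)
    also have "\<dots> = sum_list (map (\<lambda>x. g (mset xs - {#x#})) xs)"
      by (simp add: sum_list_sum_nth atLeast0LessThan)
    also have "\<dots> = (\<Sum>x\<in>#mset xs. g (mset xs - {#x#}))"
      by (metis sum_mset_sum_list mset_map)
    finally show ?thesis .
  qed
  have "length (sort ls) \<noteq> 0" using assms by simp
  then have ne: "map odd (sort ls) \<noteq> []" unfolding length_0_conv map_is_Nil_conv .
  have "(\<Sum>i<length ls. of_bool (alt b (del i ls)) :: nat)
      = (\<Sum>i<length (sort ls). of_bool (alt b (del i (sort ls))))"
    unfolding sum by simp
  also have "\<dots> = (\<Sum>i<length (map odd (sort ls)). of_bool (alt_from b (del i (map odd (sort ls)))))"
    by (intro sum.cong) (auto simp: alt_def sorted_sort_id sorted_del map_del)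
  finally show ?thesis
    using odd_alternating_facets[OF ne, of b] unfolding alt_def by (simp only:)
qed

lemma even_card_involution:
  assumes "finite A" "\<And>x. x \<in> A \<Longrightarrow> f x \<in> A \<and> f x \<noteq> x \<and> f (f x) = x"
  shows "even (card A)"
  using assms
proof (induction "card A" arbitrary: A rule: less_induct)
  case less
  show ?case
  proof (cases "A = {}")
    case False
    then obtain x where x: "x \<in> A" by auto
    let ?B = "A - {x, f x}"
    have "card {x, f x} = 2" "{x, f x} \<subseteq> A"
      using less.prems(2)[OF x] x by auto
    then have card: "card A = card ?B + 2"
      using card_Diff_subset[of "{x, f x}" A] card_mono[OF less.prems(1), of "{x, f x}"] by simp
    moreover have "even (card ?B)"
    proof (rule less.hyps)
      show "card ?B < card A" using card by simp
      show "finite ?B" using less.prems(1) by simp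
      show "f y \<in> ?B \<and> f y \<noteq> y \<and> f (f y) = y" if "y \<in> ?B" for y
        using less.prems(2) x that by (metis Diff_iff insertCI insertE singletonD)
    qed
    ultimately show ?thesis by simp
  qed simp
qed

text \<open>Double counting of pairs of a simplex and a facet alternating from \<open>b\<close>. A
  simplex has an odd number of such facets iff it alternates with either sign. A facet omitting a
  vertex \<open>i < j\<close> is shared with the neighbour \<open>v i F\<close> and cancels; of the
  facets omitting the last vertex exactly those in \<open>Bd\<close> are met an odd number of
  times.\<close>

lemma fan_step:
  fixes Fl :: "'a list set" and lab :: "'a \<Rightarrow> nat"
  assumes fin: "finite Fl" and len: "\<And>F. F \<in> Fl \<Longrightarrow> length F = Suc j"
    and inv: "\<And>i F. i < j \<Longrightarrow> F \<in> Fl \<Longrightarrow>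
        v i F \<in> Fl \<and> v i F \<noteq> F \<and> del i (v i F) = del i F \<and> v i (v i F) = F"
    and finB: "finite Bd"
    and top: "\<And>G. length G = j \<Longrightarrow> odd (card {F \<in> Fl. butlast F = G}) \<longleftrightarrow> G \<in> Bd"
    and lenB: "\<And>G. G \<in> Bd \<Longrightarrow> length G = j"
  shows "odd (card {F \<in> Fl. alt True (map lab F) \<or> alt False (map lab F)})
      \<longleftrightarrow> odd (card {G \<in> Bd. alt b (map lab G)})"
proof -
  have par: "even (x - y) \<longleftrightarrow> even x = even y" for x y :: int by auto
  have od: "odd (\<Sum>x\<in>A. f x) \<longleftrightarrow> odd (card {x \<in> A. odd (f x)})" if "finite A" for A and f :: "'b \<Rightarrow> nat"
    using that
  proof (induction A)
    case (insert a A)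
    have "{x \<in> insert a A. odd (f x)} = (if odd (f a) then insert a {x \<in> A. odd (f x)} else {x \<in> A. odd (f x)})"
      by auto
    then show ?case using insert by auto
  qed simp
  let ?t = "\<lambda>F i. of_bool (alt b (map lab (del i F))) :: nat"
  have "odd (\<Sum>F\<in>Fl. \<Sum>i<Suc j. ?t F i)
      \<longleftrightarrow> odd (card {F \<in> Fl. odd (\<Sum>i<Suc j. ?t F i)})"
    by (rule od[OF fin])
  also have "{F \<in> Fl. odd (\<Sum>i<Suc j. ?t F i)} = {F \<in> Fl. alt True (map lab F) \<or> alt False (map lab F)}"
  proof (intro Collect_cong conj_cong refl)
    fix F assume "F \<in> Fl"
    then have "length F = Suc j" by (rule len)
    then have ne: "map lab F \<noteq> []" and "length (map lab F) = Suc j" by auto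
    then show "odd (\<Sum>i<Suc j. ?t F i) \<longleftrightarrow> alt True (map lab F) \<or> alt False (map lab F)"
      using odd_alt_facets[OF ne, of b] by (simp only: map_del)
  qed
  finally have 1: "odd (\<Sum>F\<in>Fl. \<Sum>i<Suc j. ?t F i)
      \<longleftrightarrow> odd (card {F \<in> Fl. alt True (map lab F) \<or> alt False (map lab F)})" .
  have swap: "(\<Sum>F\<in>Fl. \<Sum>i<Suc j. ?t F i) = (\<Sum>i<j. \<Sum>F\<in>Fl. ?t F i) + (\<Sum>F\<in>Fl. ?t F j)"
    by (subst sum.swap) simp
  have ev: "even (\<Sum>F\<in>Fl. ?t F i)" if "i < j" for i
  proof -
    have "even (card {F \<in> Fl. alt b (map lab (del i F))})"
    proof (rule even_card_involution[where f = "v i"])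
      show "v i F \<in> {F \<in> Fl. alt b (map lab (del i F))} \<and> v i F \<noteq> F \<and> v i (v i F) = F"
        if "F \<in> {F \<in> Fl. alt b (map lab (del i F))}" for F
        using inv[OF \<open>i < j\<close>, of F] that by auto
    qed (use fin in auto)
    then show ?thesis by (subst sum.inter_filter[symmetric, OF fin] | simp add: of_bool_def fin Int_def)+
  qed
  have "even (\<Sum>i<j. \<Sum>F\<in>Fl. ?t F i)" by (rule dvd_sum) (rule ev, simp)
  then have 2: "odd (\<Sum>F\<in>Fl. \<Sum>i<Suc j. ?t F i) \<longleftrightarrow> odd (\<Sum>F\<in>Fl. ?t F j)"
    unfolding swap by simp
  have bl: "del j F = butlast F" if "F \<in> Fl" for F
    using len[OF that] by (simp add: del_def butlast_conv_take)
  let ?Gs = "butlast ` Fl \<union> Bd"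
  have finG: "finite ?Gs" using fin finB by simp
  have "(\<Sum>F\<in>Fl. ?t F j) = (\<Sum>G\<in>?Gs. \<Sum>F\<in>{F \<in> Fl. butlast F = G}. ?t F j)"
    by (rule sum.group[symmetric, OF fin finG]) auto
  also have "\<dots> = (\<Sum>G\<in>?Gs. of_bool (alt b (map lab G)) * card {F \<in> Fl. butlast F = G})"
  proof (intro sum.cong refl)
    fix G
    have "(\<Sum>F\<in>{F \<in> Fl. butlast F = G}. ?t F j) = (\<Sum>F\<in>{F \<in> Fl. butlast F = G}. of_bool (alt b (map lab G)))"
      by (intro sum.cong refl) (auto simp: bl)
    then show "(\<Sum>F\<in>{F \<in> Fl. butlast F = G}. ?t F j)
        = of_bool (alt b (map lab G)) * card {F \<in> Fl. butlast F = G}" by simp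
  qed
  also have "odd \<dots> \<longleftrightarrow> odd (card {G \<in> ?Gs. odd (of_bool (alt b (map lab G)) * card {F \<in> Fl. butlast F = G})})"
    by (rule od[OF finG])
  also have "{G \<in> ?Gs. odd (of_bool (alt b (map lab G)) * card {F \<in> Fl. butlast F = G})}
      = {G \<in> Bd. alt b (map lab G)}"
    using top lenB len by (fastforce simp: of_bool_def split: if_splits)
  finally show ?thesis using 1 2 by simp
qed

section \<open>Cells of a subdivided box and the flags that triangulate its boundary\<close>

definition cov :: "(nat \<Rightarrow> int) \<Rightarrow> (nat \<Rightarrow> int) \<Rightarrow> bool" where
  "cov w w' \<longleftrightarrow> (\<exists>a. even (w a) \<and> (w' = w(a := w a + 1) \<or> w' = w(a := w a - 1)))"

text \<open>Cells are coded by integer vectors: an even entry \<open>2 * a\<close> is the point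
  \<open>a\<close>, an odd entry \<open>2 * a + 1\<close> the open interval from \<open>a\<close> to
  \<open>a + 1\<close>. The dimension is the number of odd entries, \<open>face_le\<close> is
  incidence and \<open>cov\<close> incidence in consecutive dimensions.\<close>

definition face_le :: "(nat \<Rightarrow> int) \<Rightarrow> (nat \<Rightarrow> int) \<Rightarrow> bool" where
  "face_le w w' \<longleftrightarrow> (\<forall>i. w i = w' i \<or> (odd (w' i) \<and> \<bar>w i - w' i\<bar> = 1))"

definition flag :: "(nat \<Rightarrow> int) list \<Rightarrow> bool" where
  "flag F \<longleftrightarrow> (F \<noteq> [] \<longrightarrow> (\<forall>i. even ((F ! 0) i))) \<and> (\<forall>i. Suc i < length F \<longrightarrow> cov (F ! i) (F ! Suc i))"

text \<open>The boundary of the box with half-sides \<open>L i\<close> in the coordinates up to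
  \<open>j\<close>: an entry of absolute value \<open>2 * L i\<close> puts the cell on a facet. It
  is a sphere of dimension \<open>j\<close>.\<close>

definition cell_sphere :: "(nat \<Rightarrow> int) \<Rightarrow> nat \<Rightarrow> (nat \<Rightarrow> int) set" where
  "cell_sphere L j = {w. (\<forall>i\<le>j. \<bar>w i\<bar> \<le> 2 * L i) \<and> (\<forall>i>j. w i = 0) \<and> (\<exists>i\<le>j. \<bar>w i\<bar> = 2 * L i)}"

text \<open>These lists run through the dimensions 0 to \<open>j\<close>, so they are the top
  simplices of the barycentric subdivision.\<close>

definition flags :: "(nat \<Rightarrow> int) \<Rightarrow> nat \<Rightarrow> (nat \<Rightarrow> int) list set" where
  "flags L j = {F. length F = Suc j \<and> flag F \<and> set F \<subseteq> cell_sphere L j}"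

definition upper_flags :: "(nat \<Rightarrow> int) \<Rightarrow> nat \<Rightarrow> (nat \<Rightarrow> int) list set" where
  "upper_flags L j = {F \<in> flags L j. last F j > 0}"

lemma face_le_refl: "face_le w w"
  by (simp add: face_le_def)

lemma face_le_trans: "face_le u v \<Longrightarrow> face_le v w \<Longrightarrow> face_le u w"
  unfolding face_le_def by (smt (verit, best) even_add even_diff odd_one)

lemma cov_face_le: "cov w w' \<Longrightarrow> face_le w w'"
  by (auto simp: cov_def face_le_def split: if_splits)

lemma flag_face_le:
  assumes "flag F" "a \<le> b" "b < length F"
  shows "face_le (F ! a) (F ! b)"
  using assms(2,3)
proof (induction b)
  case (Suc b)
  then show ?case
    using assms(1) face_le_trans cov_face_le face_le_refl unfolding flag_def
    by (metis Suc_lessD le_Suc_eq)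
qed (simp add: face_le_refl)

lemma flag_comparable:
  assumes "flag F" "u \<in> set F" "v \<in> set F"
  shows "face_le u v \<or> face_le v u"
  using assms flag_face_le by (metis in_set_conv_nth nle_le)

lemma flag_butlast: "flag F \<Longrightarrow> flag (butlast F)"
  by (cases F rule: rev_cases) (auto simp: flag_def nth_append split: if_splits)

lemma flag_snoc:
  "flag (F @ [w]) \<longleftrightarrow> flag F \<and> (if F = [] then \<forall>i. even (w i) else cov (last F) w)"
proof (cases "F = []")
  case False
  have e: "F ! i = last F" if "Suc i = length F" for i
  proof -
    from that have "length F - 1 = i" by simp
    then show ?thesis using False by (simp add: last_conv_nth)
  qed
  show ?thesis
  proof
    assume fl: "flag (F @ [w])"
    have "Suc (length F - 1) < length (F @ [w])" using False by simp
    then have "cov ((F @ [w]) ! (length F - 1)) ((F @ [w]) ! Suc (length F - 1))"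
      using fl unfolding flag_def by blast
    then have "cov (last F) w" using False by (simp add: nth_append last_conv_nth)
    moreover have "cov (F ! i) (F ! Suc i)" if "Suc i < length F" for i
    proof -
      have "cov ((F @ [w]) ! i) ((F @ [w]) ! Suc i)" using fl that unfolding flag_def by simp
      then show ?thesis using that by (simp add: nth_append)
    qed
    moreover have "even ((F ! 0) i)" for i
      using fl False unfolding flag_def by (simp add: nth_append)
    ultimately show "flag F \<and> (if F = [] then \<forall>i. even (w i) else cov (last F) w)"
      unfolding flag_def using False by simp
  next
    assume r: "flag F \<and> (if F = [] then \<forall>i. even (w i) else cov (last F) w)"
    have "cov ((F @ [w]) ! i) ((F @ [w]) ! Suc i)" if "Suc i < length (F @ [w])" for i
    proof (cases "Suc i < length F")
      case True
      then show ?thesis using r by (simp add: flag_def nth_append)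
    next
      case F: False
      then have "Suc i = length F" using that by simp
      then show ?thesis using r False e[of i] by (simp add: nth_append)
    qed
    moreover have "even (((F @ [w]) ! 0) i)" for i
      using r False unfolding flag_def by (simp add: nth_append)
    ultimately show "flag (F @ [w])" unfolding flag_def by blast
  qed
qed (auto simp: flag_def)

lemma finite_cell_sphere: "finite (cell_sphere L j)"
proof -
  have "cell_sphere L j \<subseteq> {f. \<forall>x. (x \<in> {..j} \<longrightarrow> f x \<in> {- (2 * Max (L ` {..j}))..2 * Max (L ` {..j})}) \<and> (x \<notin> {..j} \<longrightarrow> f x = 0)}"
  proof
    fix w assume w: "w \<in> cell_sphere L j"
    have Mx: "L i \<le> Max (L ` {..j})" if "i \<le> j" for i
      using that by (intro Max_ge) auto
    have "- (2 * Max (L ` {..j})) \<le> w i \<and> w i \<le> 2 * Max (L ` {..j})" if "i \<le> j" for i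
    proof -
      have "\<bar>w i\<bar> \<le> 2 * L i" using w that by (simp add: cell_sphere_def)
      then show ?thesis using Mx[OF that] by linarith
    qed
    then show "w \<in> {f. \<forall>x. (x \<in> {..j} \<longrightarrow> f x \<in> {- (2 * Max (L ` {..j}))..2 * Max (L ` {..j})}) \<and> (x \<notin> {..j} \<longrightarrow> f x = 0)}"
      using w unfolding cell_sphere_def by auto
  qed
  then show ?thesis
    by (rule finite_subset) (rule finite_set_of_finite_funs; simp)
qed

lemma finite_flags: "finite (flags L j)"
  by (rule finite_subset[OF _ finite_lists_length_eq[OF finite_cell_sphere, of L j "Suc j"]])
     (auto simp: flags_def)

lemma finite_upper_flags: "finite (upper_flags L j)"
  using finite_flags by (simp add: upper_flags_def)

lemma card_odd_flag:
  assumes "flag F" "m < length F"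
  shows "finite {i. odd ((F ! m) i)} \<and> card {i. odd ((F ! m) i)} = m"
  using assms(2)
proof (induction m)
  case 0
  then have "{i. odd ((F ! 0) i)} = {}" using assms(1) by (auto simp: flag_def)
  then show ?case by (metis card.empty finite.emptyI)
next
  case (Suc m)
  then obtain a where a: "even ((F ! m) a)"
    "F ! Suc m = (F ! m)(a := (F ! m) a + 1) \<or> F ! Suc m = (F ! m)(a := (F ! m) a - 1)"
    using assms(1) by (auto simp: flag_def cov_def)
  then have "{i. odd ((F ! Suc m) i)} = insert a {i. odd ((F ! m) i)}"
    by (auto split: if_splits)
  then show ?case using Suc a by auto
qed

text \<open>An entry on a facet of the box is even, and passing to a face changes odd entries
  only.\<close>

lemma cell_sphere_le:
  assumes "w \<in> cell_sphere L j" "face_le w' w"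
  shows "w' \<in> cell_sphere L j"
proof -
  have b: "\<bar>w' i\<bar> \<le> 2 * L i" if "i \<le> j" for i
  proof (cases "w' i = w i")
    case False
    then have "odd (w i)" "\<bar>w' i - w i\<bar> = 1" using assms(2) by (auto simp: face_le_def)
    moreover have "\<bar>w i\<bar> \<le> 2 * L i" using assms(1) that by (auto simp: cell_sphere_def)
    moreover have "\<bar>w i\<bar> \<noteq> 2 * L i" using \<open>odd (w i)\<close> by (metis dvd_abs_iff dvd_triv_left)
    ultimately show ?thesis by linarith
  qed (use assms that in \<open>auto simp: cell_sphere_def\<close>)
  moreover have "w' i = 0" if "i > j" for i
    using assms that by (auto simp: cell_sphere_def face_le_def) (metis dvd_0_right)
  moreover have "\<exists>i\<le>j. \<bar>w' i\<bar> = 2 * L i"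
  proof -
    obtain i where i: "i \<le> j" "\<bar>w i\<bar> = 2 * L i" using assms by (auto simp: cell_sphere_def)
    then have "even (w i)" by (metis dvd_abs_iff dvd_triv_left)
    then have "w' i = w i" using assms(2) by (auto simp: face_le_def)
    then show ?thesis using i by auto
  qed
  ultimately show ?thesis by (simp add: cell_sphere_def)
qed

lemma flag_subset_sphere:
  assumes "flag F" "F \<noteq> []" "last F \<in> cell_sphere L j"
  shows "set F \<subseteq> cell_sphere L j"
proof
  fix w assume "w \<in> set F"
  then obtain i where "i < length F" "w = F ! i" by (metis in_set_conv_nth)
  then have "face_le w (last F)"
    using flag_face_le[OF assms(1), of i "length F - 1"] assms(2) by (simp add: last_conv_nth)
  then show "w \<in> cell_sphere L j" using assms(3) cell_sphere_le by blast
qed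

text \<open>Between two incident cells whose dimensions differ by 2 there are exactly two cells, and
  the codes of these add up to the sum of the codes of the ends; so the other one is found by
  subtraction. At the bottom the same holds for the two end points of the edge
  \<open>F ! 1\<close>.\<close>

definition flip_at :: "nat \<Rightarrow> (nat \<Rightarrow> int) list \<Rightarrow> (nat \<Rightarrow> int) list" where
  "flip_at i F = F[i := (if i = 0 then (\<lambda>x. 2 * (F ! 1) x - (F ! 0) x)
                   else (\<lambda>x. (F ! (i - 1)) x + (F ! Suc i) x - (F ! i) x))]"

lemma diamond_bottom:
  assumes "\<forall>x. even (u x)" "cov u v"
  shows "cov (\<lambda>x. 2 * v x - u x) v" "(\<lambda>x. 2 * v x - u x) \<noteq> u" "\<forall>x. even (2 * v x - u x)"
proof -
  obtain a where a: "even (u a)" "v = u(a := u a + 1) \<or> v = u(a := u a - 1)"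
    using assms by (auto simp: cov_def)
  show "cov (\<lambda>x. 2 * v x - u x) v"
    unfolding cov_def using a by (intro exI[of _ a]) (auto simp: fun_eq_iff)
  have "2 * v a - u a \<noteq> u a" using a by auto
  then show "(\<lambda>x. 2 * v x - u x) \<noteq> u" by metis
  show "\<forall>x. even (2 * v x - u x)" using assms(1) by simp
qed

lemma diamond_middle:
  assumes "cov u v" "cov v w"
  shows "cov u (\<lambda>x. u x + w x - v x)" "cov (\<lambda>x. u x + w x - v x) w" "(\<lambda>x. u x + w x - v x) \<noteq> v"
proof -
  obtain a where a: "even (u a)" "v = u(a := u a + 1) \<or> v = u(a := u a - 1)"
    using assms by (auto simp: cov_def)
  obtain b where b: "even (v b)" "w = v(b := v b + 1) \<or> w = v(b := v b - 1)"
    using assms by (auto simp: cov_def)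
  have "a \<noteq> b" using a b by auto
  show "cov u (\<lambda>x. u x + w x - v x)"
    unfolding cov_def using a b \<open>a \<noteq> b\<close> by (intro exI[of _ b]) (auto simp: fun_eq_iff)
  show "cov (\<lambda>x. u x + w x - v x) w"
    unfolding cov_def using a b \<open>a \<noteq> b\<close> by (intro exI[of _ a]) (auto simp: fun_eq_iff)
  have "u a + w a - v a \<noteq> v a" using a b \<open>a \<noteq> b\<close> by auto
  then show "(\<lambda>x. u x + w x - v x) \<noteq> v" by metis
qed

lemma del_list_update: "del i (F[i := x]) = del i F"
  by (simp add: del_def)

lemma del_flip_at: "del i (flip_at i F) = del i F"
  by (simp add: flip_at_def del_list_update)

lemma flip_at_flag:
  assumes "flag F" "Suc i < length F"
  shows "flag (flip_at i F)"
proof -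
  define x where "x = (flip_at i F) ! i"
  have fl: "flip_at i F = F[i := x]" using assms by (simp add: x_def flip_at_def)
  have cv: "cov (F ! m) (F ! Suc m)" if "Suc m < length F" for m
    using assms that by (auto simp: flag_def)
  have ev: "\<forall>y. even ((F ! 0) y)" using assms by (auto simp: flag_def)
  have lenF: "0 < length F" "i < length F" using assms(2) by linarith+
  have x: "i = 0 \<Longrightarrow> x = (\<lambda>x. 2 * (F ! 1) x - (F ! 0) x)"
    "\<And>i'. i = Suc i' \<Longrightarrow> x = (\<lambda>x. (F ! i') x + (F ! Suc i) x - (F ! i) x)"
    using lenF by (auto simp: x_def flip_at_def)
  have up: "cov x (F ! Suc i)"
  proof (cases "i = 0")
    case True
    then show ?thesis using diamond_bottom(1)[OF ev cv[of 0]] x(1) assms by simp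
  next
    case False
    then obtain i' where i': "i = Suc i'" by (cases i) auto
    then show ?thesis using diamond_middle(2)[OF cv[of i'] cv[of "Suc i'"]] x(2)[OF i'] assms by simp
  qed
  have down: "cov (F ! i') x" if "i = Suc i'" for i'
    using that diamond_middle(1)[OF cv[of i'] cv[of "Suc i'"]] x(2)[OF that] assms by simp
  have "even (x y)" if "i = 0" for y
    using x(1)[OF that] ev by simp
  then show ?thesis
    unfolding flag_def fl using up down cv ev assms(2)
    by (auto simp: nth_list_update)
qed

lemma flip_at_involution:
  assumes "flag F" "Suc i < length F"
  shows "flip_at i (flip_at i F) = F" "flip_at i F \<noteq> F"
proof -
  have cv: "cov (F ! m) (F ! Suc m)" if "Suc m < length F" for m
    using assms that by (auto simp: flag_def)
  have ev: "\<forall>y. even ((F ! 0) y)" using assms by (auto simp: flag_def)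
  have lenF: "0 < length F" "i < length F" using assms(2) by linarith+
  show "flip_at i (flip_at i F) = F"
    using lenF assms(2) by (cases i) (auto simp: flip_at_def list_update_same_conv)
  have "flip_at i F ! i \<noteq> F ! i"
  proof (cases "i = 0")
    case True
    then show ?thesis using diamond_bottom(2)[OF ev cv[of 0]] assms(2) lenF by (simp add: flip_at_def)
  next
    case False
    then obtain i' where i': "i = Suc i'" by (cases i) auto
    then show ?thesis using diamond_middle(3)[OF cv[of i'] cv[of "Suc i'"]] assms(2) lenF
      by (simp add: flip_at_def)
  qed
  then show "flip_at i F \<noteq> F" by metis
qed

lemma flip_at_upper:
  assumes "F \<in> upper_flags L j" "i < j"
  shows "flip_at i F \<in> upper_flags L j"
proof -
  have F: "flag F" "length F = Suc j" "set F \<subseteq> cell_sphere L j" "last F j > 0"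
    using assms by (auto simp: upper_flags_def flags_def)
  have l: "last (flip_at i F) = last F" and len: "length (flip_at i F) = Suc j"
    using F assms(2) by (auto simp: flip_at_def last_conv_nth nth_list_update
      simp flip: length_greater_0_conv)
  have fl: "flag (flip_at i F)" using flip_at_flag F assms by simp
  moreover have "set (flip_at i F) \<subseteq> cell_sphere L j"
    by (rule flag_subset_sphere[OF fl]) (use len l F in \<open>auto simp del: length_0_conv\<close>, metis F(2,3) in_mono last_in_set length_Suc_conv list.discI)
  ultimately show ?thesis using l len F by (simp add: upper_flags_def flags_def)
qed

text \<open>A cell of dimension \<open>j - 1\<close> has two even entries, \<open>a\<close> and
  \<open>b\<close>, with \<open>b\<close> on a facet, and it lies in exactly two top cells. If the
  last entry is not 0, both are on its side. If it is 0, then \<open>a = j\<close> and the two cells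
  lie on different sides of the equator.\<close>

lemma upper_completions:
  assumes L: "\<forall>i\<le>j. L i \<ge> 1" and w: "w \<in> cell_sphere L j"
    and odd: "card {i. odd (w i)} = j - 1" and j: "j \<ge> 1"
  shows "odd (card {w' \<in> cell_sphere L j. cov w w' \<and> w' j > 0}) \<longleftrightarrow> w j = 0"
proof -
  let ?C = "{w' \<in> cell_sphere L j. cov w w' \<and> w' j > 0}"
  have wb: "\<bar>w i\<bar> \<le> 2 * L i" if "i \<le> j" for i using w that by (auto simp: cell_sphere_def)
  have w0: "w i = 0" if "i > j" for i using w that by (auto simp: cell_sphere_def)
  have sub: "{i. odd (w i)} \<subseteq> {..j}" using w0 by (metis (mono_tags) atMost_iff dvd_0_right mem_Collect_eq not_le subsetI)
  have "card {i. i \<le> j \<and> even (w i)} = card ({..j} - {i. odd (w i)})"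
    by (rule arg_cong[where f = card]) auto
  also have "\<dots> = 2" using odd j sub by (simp add: card_Diff_subset finite_subset[OF sub])
  finally obtain a0 b0 where ab0: "{i. i \<le> j \<and> even (w i)} = {a0, b0}" "a0 \<noteq> b0"
    by (auto simp: card_2_iff)
  obtain b where b: "b \<le> j" "\<bar>w b\<bar> = 2 * L b" using w by (auto simp: cell_sphere_def)
  then have "even (w b)" by (metis dvd_abs_iff dvd_triv_left)
  then have "b \<in> {a0, b0}" using ab0 b by auto
  then obtain a where ab: "{i. i \<le> j \<and> even (w i)} = {a, b}" "a \<noteq> b"
    using ab0 by (metis insertE insert_commute singletonD)
  have ea: "even (w a)" "a \<le> j" and eb: "even (w b)" using ab by auto
  have bn: "w b \<noteq> 0" using b L by force
  \<comment> \<open>Entry \<open>a\<close> can move both ways inside the box. If it is at its bound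
    as well, one of these moves leaves the box and the inward move of \<open>b\<close> takes its
    place.\<close>
  have covw: "cov w w' \<and> w' \<in> cell_sphere L j \<longleftrightarrow>
     (w' = w(a := w a + 1) \<and> w a < 2 * L a \<or> w' = w(a := w a - 1) \<and> - 2 * L a < w a
      \<or> \<bar>w a\<bar> = 2 * L a \<and> w' = w(b := w b - sgn (w b)))" (is "?l \<longleftrightarrow> ?r") for w'
  proof
    assume l: ?l
    then obtain c where c: "even (w c)" "w' = w(c := w c + 1) \<or> w' = w(c := w c - 1)"
      by (auto simp: cov_def)
    have "c \<le> j"
    proof (rule ccontr)
      assume "\<not> c \<le> j"
      then have "w' c = 0" "w c = 0" using l w0 by (auto simp: cell_sphere_def)
      then show False using c by auto
    qed
    then consider "c = a" | "c = b" using ab c by auto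
    then show ?r
    proof cases
      case 1
      have "\<bar>w' a\<bar> \<le> 2 * L a" using l ea by (auto simp: cell_sphere_def)
      then show ?thesis using c 1 by auto
    next
      case 2
      have "\<bar>w' b\<bar> \<le> 2 * L b" using l b by (auto simp: cell_sphere_def)
      then have w'b: "w' = w(b := w b - sgn (w b))" using c 2 b bn by (auto simp: sgn_if abs_if split: if_splits)
      obtain e where e: "e \<le> j" "\<bar>w' e\<bar> = 2 * L e" using l by (auto simp: cell_sphere_def)
      have "even (w' e)" using e by (metis dvd_abs_iff dvd_triv_left)
      moreover have "odd (w' b)" using w'b eb bn by (auto simp: sgn_if)
      ultimately have "e \<noteq> b" by auto
      then have "w' e = w e" using w'b by simp
      then have "e = a" using \<open>even (w' e)\<close> e ab \<open>e \<noteq> b\<close> by auto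
      then show ?thesis using w'b e \<open>w' e = w e\<close> by auto
    qed
  next
    assume r: ?r
    have "w(b := w b - sgn (w b)) = w(b := w b + 1) \<or> w(b := w b - sgn (w b)) = w(b := w b - 1)"
      using bn by (auto simp: sgn_if)
    then have "cov w w'" using r ea eb unfolding cov_def by metis
    moreover have "w' \<in> cell_sphere L j"
    proof -
      have "\<bar>w' i\<bar> \<le> 2 * L i" if "i \<le> j" for i
        using r wb[OF that] bn L[rule_format, OF that] by (auto simp: sgn_if split: if_splits)
      moreover have "w' i = 0" if "i > j" for i
        using r w0[OF that] ea b that by auto
      moreover have "\<exists>i\<le>j. \<bar>w' i\<bar> = 2 * L i"
        using r ab(2) b ea by (metis fun_upd_apply)
      ultimately show ?thesis by (simp add: cell_sphere_def)
    qed
    ultimately show ?l by simp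
  qed
  show ?thesis
  proof (cases "w j = 0")
    case True
    then have aj: "a = j" using ab bn by (metis (mono_tags, lifting) dvd_0_right insertE le_refl mem_Collect_eq singletonD)
    have Lj: "L j \<ge> 1" using L by simp
    have "?C = {w(a := w a + 1)}"
    proof (rule Set.set_eqI)
      fix w'
      have "w' \<in> ?C \<longleftrightarrow> (cov w w' \<and> w' \<in> cell_sphere L j) \<and> w' j > 0" by blast
      then show "w' \<in> ?C \<longleftrightarrow> w' \<in> {w(a := w a + 1)}"
        unfolding covw using True aj Lj ab(2) by auto
    qed
    then show ?thesis using True by simp
  next
    case False
    show ?thesis
    proof (cases "w j < 0")
      case True
      have "w' j \<le> 0" if "w' \<in> ?C" for w'
        using that covw[of w'] True by (auto split: if_splits simp: sgn_if)
      then have "?C = {}" by force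
      then show ?thesis using False by (metis card.empty even_zero)
    next
      case pos: False
      then have wj: "w j > 0" using False by simp
      have ja: "w j \<ge> 2" if "j = a" using wj ea(1) that by (elim evenE) auto
      have jb: "w j \<ge> 2" if "j = b" using wj eb that by (elim evenE) auto
      have C: "?C = {w'. w' = w(a := w a + 1) \<and> w a < 2 * L a \<or> w' = w(a := w a - 1) \<and> - 2 * L a < w a
            \<or> \<bar>w a\<bar> = 2 * L a \<and> w' = w(b := w b - sgn (w b))}" (is "_ = ?D")
      proof -
        have "w' j > 0" if "w' \<in> ?D" for w'
          using that wj ja jb by (auto split: if_splits simp: sgn_if)
        then show ?thesis using covw by blast
      qed
      have ne: "w(a := w a + 1) \<noteq> w(a := w a - 1)"
        "w(a := w a + 1) \<noteq> w(b := w b - sgn (w b))" "w(a := w a - 1) \<noteq> w(b := w b - sgn (w b))"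
        using ab(2) by (auto dest!: fun_cong[of _ _ a])
      have La: "L a \<ge> 1" using L ea by simp
      have "card ?D = 2"
      proof (cases "\<bar>w a\<bar> = 2 * L a")
        case True
        then consider "w a = 2 * L a" | "w a = - 2 * L a" by linarith
        then show ?thesis
        proof cases
          case 1
          then have "?D = {w(a := w a - 1), w(b := w b - sgn (w b))}" using La True by auto
          then show ?thesis using ne by auto
        next
          case 2
          then have "?D = {w(a := w a + 1), w(b := w b - sgn (w b))}" using La True by auto
          then show ?thesis using ne by auto
        qed
      next
        case False
        then have "- 2 * L a < w a" "w a < 2 * L a" using wb[OF ea(2)] by linarith+
        then have "?D = {w(a := w a + 1), w(a := w a - 1)}" using False by auto
        then show ?thesis using ne by auto
      qed
      then show ?thesis using C False by simp
    qed
  qed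
qed

section \<open>Signed labels, their negation, and alternation\<close>

definition flip :: "nat \<Rightarrow> nat" where
  "flip n = (if even n then n + 1 else n - 1)"

lemma flip_div: "flip n div 2 = n div 2"
  by (cases "even n") (auto simp: flip_def elim!: evenE oddE)

lemma flip_flip [simp]: "flip (flip n) = n"
  by (cases "even n") (auto simp: flip_def elim!: evenE oddE)

lemma odd_flip [simp]: "odd (flip n) \<longleftrightarrow> even n"
  by (auto simp: flip_def elim!: oddE)

lemma eq_or_flip: "m div 2 = n div 2 \<Longrightarrow> m = n \<or> m = flip n"
  unfolding flip_def by (cases "even m"; cases "even n") (auto elim!: evenE oddE)

lemma flip_mono:
  assumes "x \<le> y" "y \<noteq> flip x"
  shows "flip x \<le> flip y"
proof (cases "x div 2 = y div 2")
  case True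
  then show ?thesis using eq_or_flip[of y x] assms by auto
next
  case False
  then have lt: "flip x div 2 < flip y div 2" using div_le_mono[OF assms(1), of 2] by (simp add: flip_div)
  show ?thesis
  proof (rule ccontr)
    assume "\<not> flip x \<le> flip y"
    then have "flip y \<le> flip x" by simp
    from div_le_mono[OF this, of 2] lt show False by simp
  qed
qed

lemma alt_from_Not: "alt_from b (map Not bs) \<longleftrightarrow> alt_from (\<not> b) bs"
  by (induction bs arbitrary: b) auto

text \<open>Negation preserves the order by absolute value; only complementary labels could be
  interchanged by it, and these are excluded.\<close>

lemma alt_flip:
  assumes "\<And>x y. x \<in> set ls \<Longrightarrow> y \<in> set ls \<Longrightarrow> y \<noteq> flip x"
  shows "alt b (map flip ls) \<longleftrightarrow> alt (\<not> b) ls"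
proof -
  have "sorted_wrt (\<lambda>x y. flip x \<le> flip y) (sort ls)"
  proof (rule sorted_wrt_mono_rel[of _ "(\<le>)"])
    show "flip x \<le> flip y" if "x \<in> set (sort ls)" "y \<in> set (sort ls)" "x \<le> y" for x y
      using that assms[of x y] flip_mono by simp
  qed simp
  then have "sorted (map flip (sort ls))" by (simp add: sorted_map)
  then have "sort (map flip ls) = map flip (sort ls)"
    by (intro properties_for_sort) simp_all
  moreover have "map odd (map flip (sort ls)) = map Not (map odd (sort ls))" by simp
  ultimately have "alt b (map flip ls) = alt_from b (map Not (map odd (sort ls)))"
    unfolding alt_def by (simp only:)
  then show ?thesis unfolding alt_from_Not alt_def .
qed

lemma alternating_distinct:
  assumes "sorted xs" "alt_from b (map odd xs)"
    and "\<And>x y. x \<in> set xs \<Longrightarrow> y \<in> set xs \<Longrightarrow> y \<noteq> flip x"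
  shows "sorted_wrt (<) (map (\<lambda>x. x div 2) xs)"
  using assms
proof (induction xs arbitrary: b)
  case (Cons x xs)
  have IH: "sorted_wrt (<) (map (\<lambda>x. x div 2) xs)"
    using Cons.IH[of "\<not> b"] Cons.prems by auto
  show ?case
  proof (cases xs)
    case (Cons y ys)
    have "x \<le> y" "odd x \<noteq> odd y" "y \<noteq> flip x"
      using Cons.prems unfolding Cons by auto
    then have "x div 2 < y div 2"
      using div_le_mono[of x y 2] eq_or_flip[of y x] by fastforce
    moreover have "y div 2 \<le> z div 2" if "z \<in> set xs" for z
      using that Cons.prems(1) Cons by (auto intro: div_le_mono)
    ultimately have "\<forall>z\<in>set xs. x div 2 < z div 2" by (meson less_le_trans)
    then show ?thesis using IH by simp
  qed simp
qed simp

text \<open>Neighbours in an alternating sequence have different parity; with equal absolute values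
  they would be complementary. So the absolute values increase strictly.\<close>

lemma no_alternating:
  assumes "length ls > m" "\<And>x. x \<in> set ls \<Longrightarrow> x div 2 < m"
    and "\<And>x y. x \<in> set ls \<Longrightarrow> y \<in> set ls \<Longrightarrow> y \<noteq> flip x"
  shows "\<not> alt b ls"
proof
  assume "alt b ls"
  then have "sorted_wrt (<) (map (\<lambda>x. x div 2) (sort ls))"
    using alternating_distinct[of "sort ls" b] assms(3) by (simp add: alt_def)
  then have "distinct (map (\<lambda>x. x div 2) (sort ls))" by (simp add: strict_sorted_iff)
  then have "card (set (map (\<lambda>x. x div 2) (sort ls))) = length ls"
    by (subst distinct_card) simp_all
  moreover have "set (map (\<lambda>x. x div 2) (sort ls)) \<subseteq> {..<m}" using assms(2) by auto
  ultimately have "length ls \<le> m" using card_mono[OF finite_lessThan] by (metis card_lessThan)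
  then show False using assms(1) by simp
qed

lemma neg_cov: "cov w w' \<Longrightarrow> cov (- w) (- w')"
  unfolding cov_def
proof (elim exE conjE)
  fix a assume "even (w a)" "w' = w(a := w a + 1) \<or> w' = w(a := w a - 1)"
  then show "\<exists>a. even ((- w) a) \<and> (- w' = (- w)(a := (- w) a + 1) \<or> - w' = (- w)(a := (- w) a - 1))"
    by (intro exI[of _ a]) (auto simp: fun_eq_iff)
qed

section \<open>Fan's parity count for an antipodal labelling, against too few labels\<close>

context
  fixes L :: "nat \<Rightarrow> int" and k :: nat and lab :: "(nat \<Rightarrow> int) \<Rightarrow> nat"
  assumes L: "\<And>i. i < k \<Longrightarrow> L i \<ge> 1"
    and lab_neg: "\<And>w. w \<in> cell_sphere L (k - 1) \<Longrightarrow> lab (- w) = flip (lab w)"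
    and compl: "\<And>w w'. w \<in> cell_sphere L (k - 1) \<Longrightarrow> w' \<in> cell_sphere L (k - 1) \<Longrightarrow>
      face_le w w' \<Longrightarrow> lab w' \<noteq> flip (lab w)"
    and lab_less: "\<And>w. w \<in> cell_sphere L (k - 1) \<Longrightarrow> lab w div 2 < k - 1"
begin

lemma cell_sphere_mono: "i \<le> j \<Longrightarrow> j < k \<Longrightarrow> cell_sphere L i \<subseteq> cell_sphere L j"
proof
  fix w assume ij: "i \<le> j" "j < k" and w: "w \<in> cell_sphere L i"
  have "\<bar>w x\<bar> \<le> 2 * L x" if "x \<le> j" for x
  proof (cases "x \<le> i")
    case False
    then show ?thesis using w L[of x] that ij by (simp add: cell_sphere_def)
  qed (use w in \<open>simp add: cell_sphere_def\<close>)
  then show "w \<in> cell_sphere L j" using w ij by (auto simp: cell_sphere_def intro: order_trans)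
qed

lemma flag_labels:
  assumes "F \<in> flags L j" "j < k" "x \<in> set (map lab F)" "y \<in> set (map lab F)"
  shows "y \<noteq> flip x"
proof -
  have F: "flag F" "set F \<subseteq> cell_sphere L (k - 1)"
    using assms(1,2) subset_trans[OF _ cell_sphere_mono[of j "k - 1"]] by (auto simp: flags_def)
  obtain u v where "u \<in> set F" "v \<in> set F" "x = lab u" "y = lab v" using assms by auto
  moreover then have "face_le u v \<or> face_le v u" using flag_comparable F(1) by blast
  ultimately show ?thesis using compl F(2) by (metis flip_flip subsetD)
qed

lemma flags_neg:
  assumes "F \<in> flags L j"
  shows "map uminus F \<in> flags L j"
proof -
  have "flag (map uminus F)" using assms neg_cov by (auto simp: flags_def flag_def)
  then show ?thesis using assms by (auto simp: flags_def cell_sphere_def)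
qed

text \<open>A top cell has \<open>j\<close> odd entries among \<open>j + 1\<close>, so its only even
  entry is the one on a facet, which is not 0.\<close>

lemma last_nonzero:
  assumes "F \<in> flags L j" "j < k"
  shows "last F j \<noteq> 0"
proof
  assume z: "last F j = 0"
  have F: "flag F" "length F = Suc j" "last F \<in> cell_sphere L j"
    using assms by (auto simp: flags_def dest: subsetD[OF _ last_in_set])
  obtain i where i: "i \<le> j" "\<bar>last F i\<bar> = 2 * L i" using F by (auto simp: cell_sphere_def)
  have "L i \<ge> 1" using L i assms(2) by simp
  then have ij: "i \<noteq> j" using i z by auto
  have ei: "even (last F i)" using i by (metis dvd_abs_iff dvd_triv_left)
  have "last F = F ! j" using F(2) by (metis diff_Suc_1 last_conv_nth length_0_conv nat.simps(3))
  then have "card {x. odd (last F x)} = j" using card_odd_flag[OF F(1), of j] F(2) by simp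
  moreover have "{x. odd (last F x)} \<subseteq> {..j} - {i, j}"
  proof
    fix x assume "x \<in> {x. odd (last F x)}"
    then have x: "odd (last F x)" by simp
    then have "last F x \<noteq> 0" by (metis dvd_0_right)
    then have "\<not> j < x" using F(3) unfolding cell_sphere_def by blast
    moreover have "x \<noteq> i" "x \<noteq> j" using x ei z by auto
    ultimately show "x \<in> {..j} - {i, j}" by simp
  qed
  then have "card {x. odd (last F x)} \<le> card ({..j} - {i, j})" by (intro card_mono) auto
  moreover have "card ({..j} - {i, j}) = Suc j - 2" using i ij by (simp add: card_Diff_subset)
  moreover have "j \<ge> 1" using i ij by simp
  ultimately show False by simp
qed

text \<open>The antipodal map turns flags of the lower half alternating from \<open>True\<close>
  into flags of the upper half alternating from \<open>False\<close>; hence all flags alternating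
  from \<open>True\<close> are counted by the upper half with both signs. The boundary of the upper
  half is the sphere one dimension lower, so \<open>fan_step\<close> carries the parity
  upwards.\<close>

lemma odd_flags:
  assumes "j < k"
  shows "odd (card {F \<in> flags L j. alt True (map lab F)})"
proof -
  have halves: "card {F \<in> flags L j. alt True (map lab F)}
      = card {F \<in> upper_flags L j. alt True (map lab F) \<or> alt False (map lab F)}" if "j < k" for j
  proof -
    let ?P = "\<lambda>b. {F \<in> upper_flags L j. alt b (map lab F)}"
    let ?N = "{F \<in> flags L j. last F j < 0 \<and> alt True (map lab F)}"
    have fin: "finite (?P b)" "finite ?N" for b
      using finite_upper_flags finite_flags by auto
    have altneg: "alt b (map lab (map uminus F)) \<longleftrightarrow> alt (\<not> b) (map lab F)" if F: "F \<in> flags L j" for F b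
    proof -
      have "map lab (map uminus F) = map flip (map lab F)"
        using F subset_trans[OF _ cell_sphere_mono[of j "k - 1"]] \<open>j < k\<close> lab_neg
        by (auto simp: flags_def subset_iff)
      then show ?thesis using alt_flip[of "map lab F" b] flag_labels[OF F \<open>j < k\<close>] by metis
    qed
    have lastneg: "last (map uminus F) j = - last F j" if "F \<in> flags L j" for F
    proof -
      have "F \<noteq> []" using that by (auto simp: flags_def)
      then show ?thesis by (simp add: last_map)
    qed
    have "bij_betw (map uminus) (?P False) ?N"
    proof (rule bij_betw_byWitness[where f' = "map uminus"])
      show "map uminus ` ?P False \<subseteq> ?N"
        using flags_neg altneg lastneg by (auto simp: upper_flags_def)
      show "map uminus ` ?N \<subseteq> ?P False"
        using flags_neg altneg lastneg by (auto simp: upper_flags_def)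
    qed (auto simp: fun_Compl_def intro!: map_idI)
    then have N: "card ?N = card (?P False)" by (simp add: bij_betw_same_card)
    have "{F \<in> flags L j. alt True (map lab F)} = ?P True \<union> ?N"
    proof (intro equalityI subsetI)
      fix F assume F: "F \<in> {F \<in> flags L j. alt True (map lab F)}"
      then have "last F j \<noteq> 0" using last_nonzero[of F j] \<open>j < k\<close> by blast
      then have "last F j > 0 \<or> last F j < 0" by linarith
      then show "F \<in> ?P True \<union> ?N" using F unfolding upper_flags_def by blast
    qed (auto simp: upper_flags_def)
    moreover have "?P True \<inter> ?N = {}" by (auto simp: upper_flags_def)
    ultimately have "card {F \<in> flags L j. alt True (map lab F)} = card (?P True) + card ?N"
      using card_Un_disjoint[OF fin(1)[of True] fin(2)] by argo
    also have "\<dots> = card (?P True \<union> ?P False)"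
    proof -
      have "\<not> (alt True (map lab F) \<and> alt False (map lab F))" if "F \<in> upper_flags L j" for F
      proof -
        have "length F = Suc j" using that by (simp add: upper_flags_def flags_def)
        then have "length (sort (map lab F)) \<noteq> 0" by simp
        then have "sort (map lab F) \<noteq> []" by blast
        then show ?thesis using alt_from_exclusive[of "map odd (sort (map lab F))" True]
          by (auto simp: alt_def)
      qed
      then have "?P True \<inter> ?P False = {}" by blast
      then show ?thesis using fin by (simp add: card_Un_disjoint N)
    qed
    also have "?P True \<union> ?P False = {F \<in> upper_flags L j. alt True (map lab F) \<or> alt False (map lab F)}"
      by auto
    finally show ?thesis .
  qed
  show ?thesis using assms
  proof (induction j)
    case 0
    have "odd (card {F \<in> upper_flags L 0. alt True (map lab F) \<or> alt False (map lab F)})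
        \<longleftrightarrow> odd (card {G \<in> {[]}. alt True (map lab G)})"
    proof (rule fan_step[where v = flip_at and j = 0])
      show "odd (card {F \<in> upper_flags L 0. butlast F = G}) \<longleftrightarrow> G \<in> {[]}" if "length G = 0" for G
      proof -
        \<comment> \<open>In dimension 0 the upper half is a single point, which gives the odd
          number 1 to start from.\<close>
        let ?w = "\<lambda>i::nat. if i = 0 then 2 * L 0 else 0"
        have L0: "L 0 \<ge> 1" using L 0 by simp
        have "{F \<in> upper_flags L 0. butlast F = G} = {[?w]}"
        proof (intro equalityI subsetI)
          fix F assume "F \<in> {F \<in> upper_flags L 0. butlast F = G}"
          then have F: "length F = 1" "set F \<subseteq> cell_sphere L 0" "last F 0 > 0"
            by (auto simp: upper_flags_def flags_def)
          then obtain w where w: "F = [w]" by (auto simp: length_Suc_conv)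
          have "w = ?w" using F w by (auto simp: cell_sphere_def fun_eq_iff)
          then show "F \<in> {[?w]}" using w by simp
        next
          fix F assume "F \<in> {[?w]}"
          then show "F \<in> {F \<in> upper_flags L 0. butlast F = G}"
            using that L0 by (auto simp: upper_flags_def flags_def flag_def cell_sphere_def)
        qed
        then show ?thesis using that by simp
      qed
    qed (use finite_upper_flags in \<open>auto simp: upper_flags_def flags_def\<close>)
    moreover have "{G \<in> {[]}. alt True (map lab G)} = {[]}" by (auto simp: alt_def)
    ultimately show ?case using halves[OF 0] by simp
  next
    case (Suc j)
    have "odd (card {F \<in> upper_flags L (Suc j). alt True (map lab F) \<or> alt False (map lab F)})
        \<longleftrightarrow> odd (card {G \<in> flags L j. alt True (map lab G)})"
    proof (rule fan_step[where v = flip_at and j = "Suc j"])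
      show "flip_at i F \<in> upper_flags L (Suc j) \<and> flip_at i F \<noteq> F \<and>
          del i (flip_at i F) = del i F \<and> flip_at i (flip_at i F) = F"
        if "i < Suc j" "F \<in> upper_flags L (Suc j)" for i F
        using that flip_at_upper[OF that(2,1)] flip_at_involution[of F i] del_flip_at
        by (simp add: upper_flags_def flags_def)
      show "odd (card {F \<in> upper_flags L (Suc j). butlast F = G}) \<longleftrightarrow> G \<in> flags L j"
        if len: "length G = Suc j" for G
      proof (cases "flag G \<and> set G \<subseteq> cell_sphere L (Suc j)")
        case False
        have "{F \<in> upper_flags L (Suc j). butlast F = G} = {}"
          using False flag_butlast by (auto simp: upper_flags_def flags_def dest: in_set_butlastD)
        moreover have "G \<notin> flags L j"
          using False cell_sphere_mono[of j "Suc j"] Suc.prems by (auto simp: flags_def)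
        ultimately show ?thesis by (metis card.empty even_zero)
      next
        case True
        have ne: "G \<noteq> []" using len by auto
        let ?w = "last G"
        have wS: "?w \<in> cell_sphere L (Suc j)" using True ne by auto
        have "?w = G ! j" using len ne by (simp add: last_conv_nth)
        then have od: "card {i. odd (?w i)} = Suc j - 1" using card_odd_flag[of G j] True len by simp
        have "{F \<in> upper_flags L (Suc j). butlast F = G}
            = (\<lambda>w'. G @ [w']) ` {w' \<in> cell_sphere L (Suc j). cov ?w w' \<and> w' (Suc j) > 0}"
        proof (intro equalityI subsetI)
          fix F assume F: "F \<in> {F \<in> upper_flags L (Suc j). butlast F = G}"
          then have Fu: "length F = Suc (Suc j)" "flag F" "set F \<subseteq> cell_sphere L (Suc j)" "last F (Suc j) > 0"
            and bl: "butlast F = G" by (auto simp: upper_flags_def flags_def)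
          then obtain w' where w': "F = G @ [w']"
            by (metis Zero_not_Suc append_butlast_last_id list.size(3))
          have "w' \<in> cell_sphere L (Suc j)" "w' (Suc j) > 0" "cov ?w w'"
            using Fu ne flag_snoc[of G w'] unfolding w' by auto
          then show "F \<in> (\<lambda>w'. G @ [w']) ` {w' \<in> cell_sphere L (Suc j). cov ?w w' \<and> w' (Suc j) > 0}"
            using w' by blast
        next
          fix F assume "F \<in> (\<lambda>w'. G @ [w']) ` {w' \<in> cell_sphere L (Suc j). cov ?w w' \<and> w' (Suc j) > 0}"
          then show "F \<in> {F \<in> upper_flags L (Suc j). butlast F = G}"
            using True len ne flag_snoc by (auto simp: upper_flags_def flags_def)
        qed
        then have "card {F \<in> upper_flags L (Suc j). butlast F = G}
            = card {w' \<in> cell_sphere L (Suc j). cov ?w w' \<and> w' (Suc j) > 0}"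
          by (simp add: card_image inj_on_def)
        moreover have "\<forall>i\<le>Suc j. L i \<ge> 1" using L Suc.prems by simp
        ultimately have "odd (card {F \<in> upper_flags L (Suc j). butlast F = G}) \<longleftrightarrow> ?w (Suc j) = 0"
          using upper_completions[OF _ wS od] by simp
        \<comment> \<open>Faces keep even entries, so a last entry 0 of the top cell places the
          whole of \<open>G\<close> on the equator.\<close>
        also have "\<dots> \<longleftrightarrow> G \<in> flags L j"
        proof
          assume "G \<in> flags L j"
          then have "?w \<in> cell_sphere L j" using ne by (auto simp: flags_def)
          then show "?w (Suc j) = 0" by (simp add: cell_sphere_def)
        next
          assume z: "?w (Suc j) = 0"
          have "?w \<in> cell_sphere L j"
          proof -
            have L1: "L (Suc j) \<ge> 1" using L Suc.prems by simp
            obtain i where i: "i \<le> Suc j" "\<bar>?w i\<bar> = 2 * L i"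
              using wS unfolding cell_sphere_def by blast
            have "i \<noteq> Suc j" using z L1 i by auto
            then have ij: "i \<le> j" using i by simp
            have 0: "?w x = 0" if "x > j" for x
            proof (cases "x = Suc j")
              case False
              then have "x > Suc j" using that by simp
              then show ?thesis using wS unfolding cell_sphere_def by blast
            qed (use z in simp)
            have 1: "\<bar>?w x\<bar> \<le> 2 * L x" if "x \<le> j" for x
              using wS le_SucI[OF that] unfolding cell_sphere_def by blast
            have "\<exists>i\<le>j. \<bar>?w i\<bar> = 2 * L i" using i ij by blast
            then show ?thesis unfolding cell_sphere_def using 0 1 by simp
          qed
          from flag_subset_sphere[OF _ ne this] have "set G \<subseteq> cell_sphere L j" using True by blast
          then show "G \<in> flags L j" unfolding flags_def using True len by blast
        qed
        finally show ?thesis .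
      qed
      show "length F = Suc (Suc j)" if "F \<in> upper_flags L (Suc j)" for F
        using that by (simp add: upper_flags_def flags_def)
      show "length G = Suc j" if "G \<in> flags L j" for G
        using that by (simp add: flags_def)
      show "finite (upper_flags L (Suc j))" by (rule finite_upper_flags)
      show "finite (flags L j)" by (rule finite_flags)
    qed
    moreover have "odd (card {G \<in> flags L j. alt True (map lab G)})"
      by (rule Suc.IH) (use Suc.prems in linarith)
    ultimately show ?case unfolding halves[OF Suc.prems] by (rule iffD2)
  qed
qed

text \<open>A maximal flag has \<open>k\<close> cells but the labels have only \<open>k - 1\<close>
  absolute values, so no flag alternates, although the number of those that do is odd.\<close>

lemma tucker_contradiction: "k \<ge> 1 \<Longrightarrow> False"
proof -
  assume k: "k \<ge> 1"
  then have "k - 1 < k" by linarith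
  from odd_pos[OF odd_flags[OF this]] have "{F \<in> flags L (k - 1). alt True (map lab F)} \<noteq> {}"
    unfolding card_gt_0_iff by (rule conjunct1)
  then have "\<exists>F\<in>flags L (k - 1). alt True (map lab F)"
    unfolding Collect_empty_eq Bex_def by simp
  then obtain F where F: "F \<in> flags L (k - 1)" "alt True (map lab F)" by (rule bexE)
  then have lenF: "length F = Suc (k - 1)" and setF: "set F \<subseteq> cell_sphere L (k - 1)"
    unfolding flags_def by simp_all
  have "\<not> alt True (map lab F)"
  proof (rule no_alternating[of "k - 1"])
    show "k - 1 < length (map lab F)" unfolding length_map lenF by (rule lessI)
    show "x div 2 < k - 1" if "x \<in> set (map lab F)" for x
    proof -
      from that obtain w where w: "w \<in> set F" "x = lab w" by auto
      then have "w \<in> cell_sphere L (k - 1)" by (intro subsetD[OF setF])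
      then show ?thesis unfolding w(2) by (rule lab_less)
    qed
    show "y \<noteq> flip x" if "x \<in> set (map lab F)" "y \<in> set (map lab F)" for x y
      by (rule flag_labels[OF F(1) _ that]) (use k in linarith)
  qed
  then show False using F(2) by (rule notE)
qed

end

section \<open>Antipodal pairs in colourings of the integer points of a box boundary\<close>

lemma even_abs_le_1: "even (x::int) \<Longrightarrow> \<bar>x\<bar> \<le> 1 \<Longrightarrow> x = 0"
  by (auto elim!: evenE)

definition face_vertices :: "(nat \<Rightarrow> int) \<Rightarrow> (nat \<Rightarrow> int) set" where
  "face_vertices w = {u. \<forall>i. \<bar>2 * u i - w i\<bar> \<le> 1}"

lemma face_vertices_mono:
  assumes "face_le w w'"
  shows "face_vertices w \<subseteq> face_vertices w'"
proof
  fix u assume u: "u \<in> face_vertices w"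
  have "\<bar>2 * u i - w' i\<bar> \<le> 1" for i
  proof (cases "w i = w' i")
    case True
    moreover have "\<bar>2 * u i - w i\<bar> \<le> 1" using u by (simp add: face_vertices_def)
    ultimately show ?thesis by simp
  next
    case False
    then have "odd (w' i)" "\<bar>w i - w' i\<bar> = 1" using assms by (auto simp: face_le_def)
    then have "even (w i)" by presburger
    then have "even (2 * u i - w i)" by simp
    then have "2 * u i - w i = 0"
      by (rule even_abs_le_1) (use u in \<open>simp add: face_vertices_def\<close>)
    then show ?thesis using \<open>\<bar>w i - w' i\<bar> = 1\<close> by simp
  qed
  then show "u \<in> face_vertices w'" by (simp add: face_vertices_def)
qed

lemma face_vertices_neg: "face_vertices (- w) = uminus ` face_vertices w"
proof -
  have "\<bar>2 * u i - (- w) i\<bar> = \<bar>2 * (- u) i - w i\<bar>" for u i by simp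
  then have *: "u \<in> face_vertices (- w) \<longleftrightarrow> - u \<in> face_vertices w" for u
    unfolding face_vertices_def by (simp only: mem_Collect_eq)
  have "- (- u) = u" for u :: "nat \<Rightarrow> int" by (simp add: fun_Compl_def)
  then show ?thesis unfolding set_eq_iff image_iff using * by metis
qed

definition box_boundary :: "(nat \<Rightarrow> int) \<Rightarrow> nat \<Rightarrow> (nat \<Rightarrow> int) set" where
  "box_boundary L k = {u. (\<forall>i<k. \<bar>u i\<bar> \<le> L i) \<and> (\<forall>i\<ge>k. u i = 0) \<and> (\<exists>i<k. \<bar>u i\<bar> = L i)}"

text \<open>The colour sets of a face and of its antipode differ in both directions: the lowest vertex
  has an antipodal colour outside the first set, and the highest one a colour outside the second.\<close>

theorem box_antipodal_coloring:
  fixes L :: "nat \<Rightarrow> int" and \<alpha> :: "(nat \<Rightarrow> int) \<Rightarrow> nat"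
  assumes k: "k \<ge> 1" and L: "\<And>i. i < k \<Longrightarrow> L i \<ge> 1"
    and col: "\<And>x. x \<in> box_boundary L k \<Longrightarrow> \<alpha> x < k"
  shows "\<exists>x\<in>box_boundary L k. \<exists>y\<in>box_boundary L k.
      (\<forall>i. x i \<le> y i \<and> y i \<le> x i + 1) \<and> (\<exists>i<k. x i = y i \<and> \<bar>x i\<bar> = L i) \<and> \<alpha> y = \<alpha> (- x)"
proof (rule ccontr)
  assume "\<not> ?thesis"
  then have ne: "\<alpha> y \<noteq> \<alpha> (- x)" if "x \<in> box_boundary L k" "y \<in> box_boundary L k"
    "\<forall>i. x i \<le> y i \<and> y i \<le> x i + 1" "\<exists>i<k. x i = y i \<and> \<bar>x i\<bar> = L i" for x y
    using that by blast
  define S where "S = cell_sphere L (k - 1)"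
  define A where "A w = \<alpha> ` face_vertices w" for w
  \<comment> \<open>The absolute value is the least colour in which the colour sets of
    \<open>w\<close> and \<open>- w\<close> differ, and the sign tells which of the two sets
    contains it. Passing to \<open>- w\<close> thus changes the sign only.\<close>
  define lab where "lab w = 2 * Min ((A w - A (- w)) \<union> (A (- w) - A w))
      + of_bool (Min ((A w - A (- w)) \<union> (A (- w) - A w)) \<in> A w)" for w
  have vert: "u \<in> box_boundary L k" and vert_facet: "\<exists>i<k. \<bar>w i\<bar> = 2 * L i \<and> 2 * u i = w i"
    if w: "w \<in> S" and u: "u \<in> face_vertices w" for u w
  proof -
    have ev: "2 * u i = w i" if "even (w i)" for i
    proof -
      have "2 * u i - w i = 0"
        by (rule even_abs_le_1) (use u that in \<open>simp_all add: face_vertices_def\<close>)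
      then show ?thesis by simp
    qed
    have wb: "\<bar>w i\<bar> \<le> 2 * L i" if "i < k" for i
      using w that unfolding S_def cell_sphere_def by auto
    have "\<bar>u i\<bar> \<le> L i" if "i < k" for i
    proof (cases "even (w i)")
      case True
      then show ?thesis using ev[of i] wb[OF that] by linarith
    next
      case False
      then have "\<bar>w i\<bar> \<noteq> 2 * L i" by (metis dvd_abs_iff dvd_triv_left)
      moreover have "\<bar>2 * u i - w i\<bar> \<le> 1" using u by (simp add: face_vertices_def)
      ultimately show ?thesis using wb[OF that] by linarith
    qed
    moreover have "u i = 0" if "i \<ge> k" for i
    proof -
      have "i > k - 1" using that k by linarith
      then have "w i = 0" using w unfolding S_def cell_sphere_def by blast
      then show ?thesis using ev[of i] by simp
    qed
    moreover obtain i where i: "i \<le> k - 1" "\<bar>w i\<bar> = 2 * L i"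
      using w unfolding S_def cell_sphere_def by blast
    then have "even (w i)" by (metis dvd_abs_iff dvd_triv_left)
    then have "2 * u i = w i" by (rule ev)
    moreover have "i < k" using i k by linarith
    moreover have "\<bar>u i\<bar> = L i" using i \<open>2 * u i = w i\<close> by linarith
    ultimately show "u \<in> box_boundary L k" "\<exists>i<k. \<bar>w i\<bar> = 2 * L i \<and> 2 * u i = w i"
      using i unfolding box_boundary_def by blast+
  qed
  have negS: "- w \<in> S" if "w \<in> S" for w
    using that by (auto simp: S_def cell_sphere_def)
  have finA: "finite (A w)" "A w \<subseteq> {..<k}" if "w \<in> S" for w
  proof -
    show "A w \<subseteq> {..<k}" using vert[OF that] col by (auto simp: A_def)
    then show "finite (A w)" by (rule finite_subset) simp
  qed
  have Aneg: "A (- w) = (\<lambda>u. \<alpha> (- u)) ` face_vertices w" for w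
    by (simp add: A_def face_vertices_neg image_image)
  have pair: "\<alpha> y \<noteq> \<alpha> (- x)" if w: "w \<in> S" and x: "x \<in> face_vertices w" and y: "y \<in> face_vertices w"
    and xy: "\<forall>i. x i \<le> y i \<and> y i \<le> x i + 1" for w x y
  proof -
    obtain i where "i < k" "\<bar>w i\<bar> = 2 * L i" "2 * x i = w i"
      using vert_facet[OF w x] by blast
    moreover have "2 * y i = w i"
    proof -
      have "even (2 * y i - w i)" using \<open>2 * x i = w i\<close> by (metis dvd_diff dvd_triv_left)
      then have "2 * y i - w i = 0"
        by (rule even_abs_le_1) (use y in \<open>simp add: face_vertices_def\<close>)
      then show ?thesis by simp
    qed
    ultimately have "i < k \<and> x i = y i \<and> \<bar>x i\<bar> = L i" by linarith
    then show ?thesis using ne[OF vert[OF w x] vert[OF w y] xy] by blast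
  qed
  have diff1: "A (- w) - A w \<noteq> {}" and diff2: "A w - A (- w) \<noteq> {}" if w: "w \<in> S" for w
  proof -
    let ?lo = "\<lambda>i. w i div 2" and ?hi = "\<lambda>i. (w i + 1) div 2"
    have lo: "?lo \<in> face_vertices w" and hi: "?hi \<in> face_vertices w"
      unfolding face_vertices_def by (auto; presburger)+
    have lo_le: "\<forall>i. w i div 2 \<le> u i \<and> u i \<le> w i div 2 + 1" if "u \<in> face_vertices w" for u
    proof
      fix i
      have "\<bar>2 * u i - w i\<bar> \<le> 1" using that by (simp add: face_vertices_def)
      then show "w i div 2 \<le> u i \<and> u i \<le> w i div 2 + 1" by linarith
    qed
    have hi_ge: "\<forall>i. u i \<le> (w i + 1) div 2 \<and> (w i + 1) div 2 \<le> u i + 1" if "u \<in> face_vertices w" for u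
    proof
      fix i
      have "\<bar>2 * u i - w i\<bar> \<le> 1" using that by (simp add: face_vertices_def)
      then show "u i \<le> (w i + 1) div 2 \<and> (w i + 1) div 2 \<le> u i + 1" by linarith
    qed
    have "\<alpha> (- ?lo) \<notin> A w"
    proof
      assume "\<alpha> (- ?lo) \<in> A w"
      then obtain u where "u \<in> face_vertices w" "\<alpha> (- ?lo) = \<alpha> u" unfolding A_def by blast
      then show False using pair[OF w lo _ lo_le, of u] by simp
    qed
    moreover have "\<alpha> (- ?lo) \<in> A (- w)" unfolding Aneg using lo by blast
    ultimately show "A (- w) - A w \<noteq> {}" by blast
    have "\<alpha> ?hi \<notin> A (- w)"
    proof
      assume "\<alpha> ?hi \<in> A (- w)"
      then obtain u where "u \<in> face_vertices w" "\<alpha> ?hi = \<alpha> (- u)" unfolding Aneg by blast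
      then show False using pair[OF w _ hi hi_ge, of u] by simp
    qed
    moreover have "\<alpha> ?hi \<in> A w" unfolding A_def using hi by blast
    ultimately show "A w - A (- w) \<noteq> {}" by blast
  qed
  define mn where "mn w = Min ((A w - A (- w)) \<union> (A (- w) - A w))" for w
  have mn_in: "mn w \<in> (A w - A (- w)) \<union> (A (- w) - A w)" if "w \<in> S" for w
    unfolding mn_def using finA(1)[OF that] finA(1)[OF negS[OF that]] diff1[OF that] by (intro Min_in) auto
  have mn_le: "mn w \<le> c" if "w \<in> S" "c \<in> (A w - A (- w)) \<union> (A (- w) - A w)" for w c
    unfolding mn_def using finA(1)[OF that(1)] finA(1)[OF negS[OF that(1)]] that(2) by (intro Min_le) auto
  have lab: "lab w = 2 * mn w + of_bool (mn w \<in> A w)" for w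
    by (simp add: lab_def mn_def)
  have mn_neg: "mn (- w) = mn w" for w
    unfolding mn_def by (simp add: Un_commute fun_Compl_def)
  have negneg: "- (- w) = w" for w :: "nat \<Rightarrow> int" by (simp add: fun_Compl_def)
  show False
  proof (rule tucker_contradiction[of k L lab, OF L _ _ _ k], goal_cases)
    case (2 w)
    then have w: "w \<in> S" by (simp add: S_def)
    have "mn w \<in> A (- w) \<longleftrightarrow> mn w \<notin> A w" using mn_in[OF w] by blast
    then show ?case by (simp add: lab mn_neg flip_def)
  next
    case (3 w w')
    then have w: "w \<in> S" "w' \<in> S" by (simp_all add: S_def)
    have sub: "A w \<subseteq> A w'" using face_vertices_mono[OF 3(3)] by (auto simp: A_def)
    have subn: "A (- w) \<subseteq> A (- w')" using face_vertices_mono[OF 3(3)] by (auto simp: Aneg)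
    show ?case
    proof
      \<comment> \<open>Both colour sets grow with the face: a colour in \<open>A w\<close> stays in
        \<open>A w'\<close>, and one in \<open>A (- w)\<close> stays in \<open>A (- w')\<close>. So
        the least distinguishing colour cannot change sides.\<close>
      assume eq: "lab w' = flip (lab w)"
      have "mn w' = lab w' div 2" "mn w = lab w div 2" by (simp_all add: lab)
      then have m: "mn w' = mn w" using eq by (simp add: flip_div)
      have "mn w' \<in> A w' \<longleftrightarrow> odd (lab w')" "mn w \<in> A w \<longleftrightarrow> odd (lab w)" by (simp_all add: lab)
      then have "mn w' \<in> A w' \<longleftrightarrow> mn w \<notin> A w" using eq by simp
      then show False using mn_in[OF w(1)] mn_in[OF w(2)] sub subn m by auto
    qed
  next
    case (4 w)
    then have w: "w \<in> S" by (simp add: S_def)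
    \<comment> \<open>As the sets differ in both directions, two colours distinguish them, and the
      smaller one is not the last of the \<open>k\<close> colours. This saves the one label that
      makes the count contradictory.\<close>
    obtain a b where ab: "a \<in> A w - A (- w)" "b \<in> A (- w) - A w" using diff1[OF w] diff2[OF w] by blast
    then have "a \<noteq> b" "a < k" "b < k" using finA(2)[OF w] finA(2)[OF negS[OF w]] by auto
    moreover have "mn w \<le> a" "mn w \<le> b" using mn_le[OF w] ab by blast+
    ultimately show ?case by (simp add: lab)
  qed
qed

section \<open>A centerpole set in the integer lattice\<close>

lemma div_three:
  fixes X N :: int
  assumes "N > 0" "- N \<le> X" "X < 2 * N"
  shows "X div N = (if X < 0 then -1 else if X < N then 0 else 1)"
proof -
  consider "X < 0" | "0 \<le> X" "X < N" | "N \<le> X" by linarith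
  then show ?thesis
  proof cases
    case 1
    have "X div N = -1" by (rule int_div_pos_eq[of _ _ _ "X + N"]) (use assms 1 in auto)
    then show ?thesis using 1 by simp
  next
    case 2
    then show ?thesis by simp
  next
    case 3
    have "X div N = 1" by (rule int_div_pos_eq[of _ _ _ "X - N"]) (use assms 3 in auto)
    then show ?thesis using 3 assms(1) by simp
  qed
qed

lemma dvd_three:
  fixes X N :: int
  assumes "N > 0" "- N \<le> X" "X < 2 * N" "N dvd X"
  shows "X = - N \<or> X = 0 \<or> X = N"
proof -
  have "X = N * (X div N)" using assms(4) by simp
  then show ?thesis using div_three[OF assms(1-3)] by (auto split: if_splits)
qed

lemma div_mod_four:
  fixes x a r :: int
  assumes "x = 4 * a + r" "0 \<le> r" "r < 4"
  shows "x div 4 = a" "x mod 4 = r"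
  using assms by simp_all

text \<open>Here \<open>t\<close> is the last coordinate of a centre and \<open>l\<close> the number
  of ones among the other \<open>d\<close>; both outer layers avoid the level
  \<open>s\<close>.\<close>

definition level_ok :: "int \<Rightarrow> int \<Rightarrow> int \<Rightarrow> int \<Rightarrow> bool" where
  "level_ok d s t l \<longleftrightarrow> t = 0 \<and> l < d \<or> t = 1 \<and> l > s \<or> t = -1 \<and> l < s"

context
  fixes d s N :: int
  assumes N: "N = d - s" and s: "s \<le> d - 2" "s \<le> N"
begin

text \<open>Only the residue \<open>\<rho>\<close> of \<open>m + s\<close> matters. The values
  \<open>\<rho> + j - s\<close> then stay between \<open>- N\<close> and \<open>2 * N\<close> in all
  uses: below because \<open>s \<le> N\<close>, above because \<open>d - s = N\<close>.\<close>

lemma level_diff: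
  fixes m :: int
  obtains \<rho> where "0 \<le> \<rho>" "\<rho> < N"
    "\<And>j. (m + j) div N - (m + s) div N = (\<rho> + j - s) div N"
    "\<And>j. N dvd m + j \<longleftrightarrow> N dvd \<rho> + j - s"
proof
  have N0: "N > 0" using N s by linarith
  let ?q = "(m + s) div N" and ?r = "(m + s) mod N"
  show "0 \<le> ?r" "?r < N" using N0 by simp_all
  have eq: "m + j = (?r + j - s) + ?q * N" for j
    using div_mult_mod_eq[of "m + s" N] by linarith
  show "(m + j) div N - ?q = (?r + j - s) div N" for j
    unfolding eq[of j] using N0 by simp
  show "N dvd m + j \<longleftrightarrow> N dvd ?r + j - s" for j
    unfolding eq[of j] by (simp only: dvd_add_times_triv_right_iff)
qed

text \<open>A change by \<open>i - s\<close> passes a multiple of \<open>N\<close> upwards only for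
  \<open>i > s\<close> and downwards only for \<open>i < s\<close>, and for \<open>i = d\<close> it
  equals \<open>N\<close> and must pass one. This is the reason for the step
  \<open>N = d - s\<close>.\<close>

lemma level_plain:
  assumes "0 \<le> i" "i \<le> d"
  shows "level_ok d s ((m + i) div N - (m + s) div N) i"
proof -
  obtain \<rho> where r: "0 \<le> \<rho>" "\<rho> < N"
    "\<And>j. (m + j) div N - (m + s) div N = (\<rho> + j - s) div N" using level_diff by metis
  have "(\<rho> + i - s) div N = (if \<rho> + i - s < 0 then -1 else if \<rho> + i - s < N then 0 else 1)"
    by (rule div_three) (use r N s assms in linarith)+
  then show ?thesis unfolding r(3) level_ok_def using r N s assms by (auto split: if_splits)
qed

text \<open>Only the antipode is displaced, just before the heights move; the divisibility then
  forces the residue \<open>N - 1\<close>.\<close>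

lemma level_upper:
  assumes "0 \<le> i" "i < d" "N dvd m + s + 1"
  shows "level_ok d s ((m + i) div N - (m + s) div N) (i + 1)"
proof -
  obtain \<rho> where r: "0 \<le> \<rho>" "\<rho> < N"
    "\<And>j. (m + j) div N - (m + s) div N = (\<rho> + j - s) div N"
    "\<And>j. N dvd m + j \<longleftrightarrow> N dvd \<rho> + j - s" using level_diff by metis
  have "N dvd m + (s + 1)" using assms(3) by (simp add: add.assoc)
  then have "N dvd \<rho> + 1" unfolding r(4) by simp
  then have rho: "\<rho> = N - 1" using dvd_three[of N "\<rho> + 1"] r N s by linarith
  have "(\<rho> + i - s) div N = (if \<rho> + i - s < 0 then -1 else if \<rho> + i - s < N then 0 else 1)"
    by (rule div_three) (use r N s assms in linarith)+
  then show ?thesis unfolding r(3) level_ok_def using rho N s assms by (auto split: if_splits)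
qed

lemma level_lower:
  assumes "0 \<le> i" "i < d" "N dvd m + i"
  shows "level_ok d s ((m + i) div N - (m + s) div N) (i + 1)"
proof -
  obtain \<rho> where r: "0 \<le> \<rho>" "\<rho> < N"
    "\<And>j. (m + j) div N - (m + s) div N = (\<rho> + j - s) div N"
    "\<And>j. N dvd m + j \<longleftrightarrow> N dvd \<rho> + j - s" using level_diff by metis
  have "\<rho> + i - s = - N \<or> \<rho> + i - s = 0 \<or> \<rho> + i - s = N"
    by (rule dvd_three) (use r N s assms in \<open>auto simp: r(4)\<close>)
  moreover have "(\<rho> + i - s) div N = (if \<rho> + i - s < 0 then -1 else if \<rho> + i - s < N then 0 else 1)"
    by (rule div_three) (use r N s assms in linarith)+
  ultimately show ?thesis unfolding r(3) level_ok_def using r N s assms by (auto split: if_splits)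
qed

text \<open>The critical case is \<open>i = s\<close> with \<open>m + s + 1\<close> a multiple of
  \<open>N\<close>: one point has risen and the other not yet, a height difference 1 across
  \<open>s\<close> steps. Then both displacement conditions hold, and \<open>lo\<close> or
  \<open>hi\<close> raises the count above \<open>s\<close>. They cannot push the count past
  \<open>d\<close>: for \<open>i = d - 1\<close> both together would make \<open>N\<close> divide
  \<open>N - 1\<close>, while \<open>N \<ge> 2\<close>.\<close>

lemma level_move:
  assumes "0 \<le> i" "i < d" "lo \<or> hi"
  shows "level_ok d s ((m + i + 1) div N - (m + s) div N)
      (i + of_bool (N dvd m + i + 1 \<and> lo) + of_bool (N dvd m + s + 1 \<and> hi))"
proof -
  obtain \<rho> where r: "0 \<le> \<rho>" "\<rho> < N"
    "\<And>j. (m + j) div N - (m + s) div N = (\<rho> + j - s) div N"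
    "\<And>j. N dvd m + j \<longleftrightarrow> N dvd \<rho> + j - s" using level_diff by metis
  have T: "(m + i + 1) div N - (m + s) div N = (\<rho> + (i + 1) - s) div N"
    using r(3)[of "i + 1"] by (simp add: add.assoc)
  have p: "N dvd m + i + 1 \<longleftrightarrow> N dvd \<rho> + (i + 1) - s"
    using r(4)[of "i + 1"] by (simp add: add.assoc)
  have q: "N dvd m + s + 1 \<longleftrightarrow> N dvd \<rho> + 1"
    using r(4)[of "s + 1"] by (simp add: add.assoc)
  have q': "N dvd \<rho> + 1 \<longleftrightarrow> \<rho> = N - 1"
  proof
    show "N dvd \<rho> + 1 \<Longrightarrow> \<rho> = N - 1" using dvd_three[of N "\<rho> + 1"] r N s by linarith
  qed simp
  let ?X = "\<rho> + (i + 1) - s"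
  have X: "?X div N = (if ?X < 0 then -1 else if ?X < N then 0 else 1)"
    by (rule div_three) (use r N s assms in linarith)+
  have dX: "N dvd ?X \<longleftrightarrow> ?X = - N \<or> ?X = 0 \<or> ?X = N"
  proof
    show "N dvd ?X \<Longrightarrow> ?X = - N \<or> ?X = 0 \<or> ?X = N"
      by (rule dvd_three) (use r N s assms in linarith)+
  qed (elim disjE; simp only: dvd_minus_iff dvd_refl dvd_0_right)
  show ?thesis unfolding T p q q' dX X level_ok_def using r N s assms
    by (cases lo; cases hi) (auto split: if_splits simp: of_bool_def)
qed

text \<open>A time \<open>\<sigma>\<close> splits into a level \<open>\<sigma> div 4\<close> and one of four phases. During phases 2 and 3 the
  points whose height is about to change are displaced sideways, so that the forbidden differences
  (a change of height by 1 across \<open>s\<close> horizontal steps) never occur.\<close>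

definition height :: "int \<Rightarrow> int \<Rightarrow> int" where
  "height n \<sigma> = (n + \<sigma> div 4 + of_bool (\<sigma> mod 4 \<ge> 2)) div N"

definition displaced :: "int \<Rightarrow> int \<Rightarrow> bool" where
  "displaced n \<sigma> \<longleftrightarrow> \<sigma> mod 4 \<ge> 2 \<and> N dvd n + \<sigma> div 4 + 1"

lemma neg_div_ceiling: "(- a) div N = - ((a + N - 1) div N)"
proof -
  have N0: "N > 0" using N s by linarith
  define q where "q = (a + N - 1) div N"
  define r where "r = (a + N - 1) mod N"
  have "a + N - 1 = N * q + r" "0 \<le> r" "r < N"
    using N0 by (simp_all add: q_def r_def)
  then have "(- a) div N = - q"
    by (intro int_div_pos_eq[of _ _ _ "N - 1 - r"]) (auto simp: algebra_simps)
  then show ?thesis by (simp add: q_def)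
qed

text \<open>Negation turns the floor into a ceiling, and \<open>Z = N - 1 - s\<close> makes this a
  floor shifted by \<open>s\<close>. Reversing time exchanges phases 1 and 3: a point has its
  displaced phases 2 and 3 where its antipode has phases 2 and 1. So each of them changes height
  during displaced phases of the other.\<close>

lemma height_antipode:
  assumes "Z = N - 1 - s" "\<sigma> = 4 * z + ph" "0 \<le> ph" "ph < 4"
  shows "height (- n) (4 * Z - \<sigma>) = - ((n + s + z + of_bool (ph = 3)) div N)"
    "displaced (- n) (4 * Z - \<sigma>) \<longleftrightarrow> (ph = 1 \<or> ph = 2) \<and> N dvd n + z + s + 1"
proof -
  have dv: "N dvd - n + (Z - z - 1) + 1 \<longleftrightarrow> N dvd n + z + s + 1"
  proof -
    have eq: "- n + (Z - z - 1) + 1 = - (n + z + s + 1) + 1 * N" using assms(1) by simp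
    show ?thesis unfolding eq by (simp only: dvd_add_times_triv_right_iff dvd_minus_iff)
  qed
  have e2: "n - (Z - z) + N - 1 = n + s + z" using assms(1) by simp
  have e3: "n - (Z - z - 1) + N - 1 = n + s + z + 1" using assms(1) by simp
  consider "ph = 0" | "ph = 1" | "ph = 2" | "ph = 3" using assms(3,4) by linarith
  then have "height (- n) (4 * Z - \<sigma>) = - ((n + s + z + of_bool (ph = 3)) div N)
    \<and> (displaced (- n) (4 * Z - \<sigma>) \<longleftrightarrow> (ph = 1 \<or> ph = 2) \<and> N dvd n + z + s + 1)"
  proof cases
    case 1
    have "4 * Z - \<sigma> = 4 * (Z - z)" using assms(2) 1 by simp
    then have e: "(4 * Z - \<sigma>) div 4 = Z - z" "(4 * Z - \<sigma>) mod 4 = 0" by simp_all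
    show ?thesis unfolding height_def displaced_def e
      using neg_div_ceiling[of "n - (Z - z)"] 1 unfolding e2 by (simp add: algebra_simps)
  next
    case 2
    have "4 * Z - \<sigma> = 4 * (Z - z - 1) + 3" using assms(2) 2 by simp
    note e = div_mod_four[OF this, simplified]
    show ?thesis unfolding height_def displaced_def e dv
      using neg_div_ceiling[of "n - (Z - z)"] 2 unfolding e2 by (simp add: algebra_simps)
  next
    case 3
    have "4 * Z - \<sigma> = 4 * (Z - z - 1) + 2" using assms(2) 3 by simp
    note e = div_mod_four[OF this, simplified]
    show ?thesis unfolding height_def displaced_def e dv
      using neg_div_ceiling[of "n - (Z - z)"] 3 unfolding e2 by (simp add: algebra_simps)
  next
    case 4
    have "4 * Z - \<sigma> = 4 * (Z - z - 1) + 1" using assms(2) 4 by simp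
    note e = div_mod_four[OF this, simplified]
    show ?thesis unfolding height_def displaced_def e
      using neg_div_ceiling[of "n - (Z - z - 1)"] 4 unfolding e3 by (simp add: algebra_simps)
  qed
  then show "height (- n) (4 * Z - \<sigma>) = - ((n + s + z + of_bool (ph = 3)) div N)"
    "displaced (- n) (4 * Z - \<sigma>) \<longleftrightarrow> (ph = 1 \<or> ph = 2) \<and> N dvd n + z + s + 1" by blast+
qed

text \<open>Each combination of the phases of \<open>\<sigma>\<close> and \<open>\<sigma>'\<close>
  reduces to one of the four preceding cases. On lateral facets \<open>i < d\<close> and a displaced
  coordinate is available; on the caps time stands still in phase 0, where nothing is displaced and
  \<open>i = d\<close> is harmless.\<close>

lemma level_step:
  assumes Z: "Z = N - 1 - s" and i: "0 \<le> i" "i \<le> d" and \<sigma>': "\<sigma>' = \<sigma> \<or> \<sigma>' = \<sigma> + 1"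
    and facet: "i < d \<and> (lo \<or> hi) \<or> \<sigma>' = \<sigma> \<and> \<sigma> mod 4 = 0"
  shows "level_ok d s (height (n + i) \<sigma>' + height (- n) (4 * Z - \<sigma>))
     (i + of_bool (displaced (n + i) \<sigma>' \<and> lo) + of_bool (displaced (- n) (4 * Z - \<sigma>) \<and> hi))"
proof -
  define z ph where "z = \<sigma> div 4" and "ph = \<sigma> mod 4"
  have sg: "\<sigma> = 4 * z + ph" "0 \<le> ph" "ph < 4" by (simp_all add: z_def ph_def)
  note anti = height_antipode[OF Z sg, of n]
  let ?m = "n + z"
  have r: "n + s + z + of_bool (ph = 3) = ?m + s + of_bool (ph = 3)" by simp
  have plain0: "level_ok d s ((?m + i) div N - (?m + s) div N) i" using level_plain i by blast
  have plain1: "level_ok d s ((?m + 1 + i) div N - (?m + 1 + s) div N) i" using level_plain i by blast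
  consider "ph = 0" "\<sigma>' = \<sigma>" | "ph = 0" "\<sigma>' = \<sigma> + 1" | "ph = 1" "\<sigma>' = \<sigma>" | "ph = 1" "\<sigma>' = \<sigma> + 1"
    | "ph = 2" "\<sigma>' = \<sigma>" | "ph = 2" "\<sigma>' = \<sigma> + 1" | "ph = 3" "\<sigma>' = \<sigma>" | "ph = 3" "\<sigma>' = \<sigma> + 1"
  proof -
    have "ph = 0 \<or> ph = 1 \<or> ph = 2 \<or> ph = 3" using sg(2,3) by linarith
    then show thesis using \<sigma>' that by blast
  qed
  then show ?thesis
  proof cases
    case 1
    then have "\<sigma>' = 4 * z" using sg by simp
    then have e: "\<sigma>' div 4 = z" "\<sigma>' mod 4 = 0" by simp_all
    show ?thesis unfolding anti unfolding height_def displaced_def e using plain0 1 by (simp add: algebra_simps)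
  next
    case 2
    then have "\<sigma>' = 4 * z + 1" using sg by simp
    note e = div_mod_four[OF this, simplified]
    show ?thesis unfolding anti unfolding height_def displaced_def e using plain0 2 by (simp add: algebra_simps)
  next
    case 3
    then have "\<sigma>' = 4 * z + 1" using sg by simp
    note e = div_mod_four[OF this, simplified]
    have "i < d" using facet 3 sg by auto
    then show ?thesis unfolding anti unfolding height_def displaced_def e
      using plain0 level_upper[of i ?m] i 3 by (simp add: algebra_simps)
  next
    case 4
    then have "\<sigma>' = 4 * z + 2" using sg by simp
    note e = div_mod_four[OF this, simplified]
    have "i < d" "lo \<or> hi" using facet 4 sg by auto
    then show ?thesis unfolding anti unfolding height_def displaced_def e
      using level_move[of i lo hi ?m] i 4 by (simp add: algebra_simps)
  next
    case 5
    then have "\<sigma>' = 4 * z + 2" using sg by simp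
    note e = div_mod_four[OF this, simplified]
    have "i < d" "lo \<or> hi" using facet 5 sg by auto
    then show ?thesis unfolding anti unfolding height_def displaced_def e
      using level_move[of i lo hi ?m] i 5 by (simp add: algebra_simps)
  next
    case 6
    then have "\<sigma>' = 4 * z + 3" using sg by simp
    note e = div_mod_four[OF this, simplified]
    have "i < d" "lo \<or> hi" using facet 6 sg by auto
    then show ?thesis unfolding anti unfolding height_def displaced_def e
      using level_move[of i lo hi ?m] i 6 by (simp add: algebra_simps)
  next
    case 7
    then have "\<sigma>' = 4 * z + 3" using sg by simp
    note e = div_mod_four[OF this, simplified]
    have "i < d" using facet 7 sg by auto
    then show ?thesis unfolding anti unfolding height_def displaced_def e
      using plain1 level_lower[of i "?m + 1"] i 7 by (simp add: algebra_simps)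
  next
    case 8
    then have "\<sigma>' = 4 * (z + 1)" using sg by simp
    then have e: "\<sigma>' div 4 = z + 1" "\<sigma>' mod 4 = 0" by simp_all
    show ?thesis unfolding anti unfolding height_def displaced_def e using plain1 8 by (simp add: algebra_simps)
  qed
qed

end

definition sandwich :: "nat \<Rightarrow> int \<Rightarrow> (nat \<Rightarrow> int) set" where
  "sandwich d s = {c. \<exists>t E. E \<subseteq> {..<d} \<and> level_ok (int d) s t (int (card E)) \<and>
     c = (\<lambda>i. if i < d then of_bool (i \<in> E) else if i = d then t else 0)}"

text \<open>The colouring is pulled back to the box boundary by \<open>2 * p\<close>. A pair found
  by \<open>box_antipodal_coloring\<close> gives the points \<open>2 * p y\<close> and
  \<open>2 * p (- x)\<close>, symmetric about \<open>c = p y + p (- x)\<close>. The first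
  \<open>d\<close> entries of \<open>c\<close> are \<open>y i - x i\<close> corrected by
  displacements, the last is a difference of heights.\<close>

theorem sandwich_symmetric_pairs:
  fixes \<phi> :: "(nat \<Rightarrow> int) \<Rightarrow> nat" and s :: int
  assumes s: "s \<le> int d - 2" "2 * s \<le> int d" and R0: "R0 \<ge> 0"
    and col: "\<And>w. (\<forall>i>d. w i = 0) \<Longrightarrow> \<phi> w < Suc d"
  shows "\<exists>c\<in>sandwich d s. \<exists>w. (\<forall>i>d. w i = 0) \<and> (\<exists>i\<le>d. \<bar>w i\<bar> > R0) \<and> \<phi> (\<lambda>i. 2 * c i - w i) = \<phi> w"
proof -
  define N where "N = int d - s"
  define Z where "Z = N - 1 - s"
  define R where "R = R0 + 2"
  \<comment> \<open>At the times \<open>4 * B\<close> and \<open>4 * (Z - B)\<close> the height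
    exceeds \<open>R0\<close> in absolute value whatever the sum of the other coordinates is, since
    that sum is at most \<open>d * R\<close>. \<open>M\<close> puts the two caps at exactly these
    times, both in phase 0.\<close>
  define B where "B = N * (R0 + 1) + int d * R + \<bar>Z\<bar> + 1"
  define M where "M = 4 * B - 2 * Z"
  have sN: "s \<le> N" "N > 0" using s by (simp_all add: N_def)
  have R: "R \<ge> 2" using R0 by (simp add: R_def)
  have NR: "N * (R0 + 1) \<ge> 0" "int d * R \<ge> 0" using sN R0 R by simp_all
  then have B: "B \<ge> \<bar>Z\<bar> + 1" by (simp add: B_def)
  then have M: "M \<ge> 1" by (simp add: M_def)
  define L where "L i = (if i < d then R else M)" for i
  define sm where "sm x = (\<Sum>i<d. x i)" for x :: "nat \<Rightarrow> int"
  \<comment> \<open>Only the first coordinate equal to \<open>- R\<close> is displaced, so the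
    number of ones changes by one however many such coordinates there are.\<close>
  define low where "low x i \<longleftrightarrow> i < d \<and> x i = - R \<and> (\<forall>j<i. x j \<noteq> - R)" for x i
  \<comment> \<open>The shift gives \<open>tm (- x) = 4 * Z - tm x\<close>, the time reversal of
    \<open>height_antipode\<close>.\<close>
  define tm where "tm x = x d + 2 * Z" for x :: "nat \<Rightarrow> int"
  define p where "p x = (\<lambda>i. if i < d then x i + of_bool (displaced N (sm x) (tm x) \<and> low x i)
      else if i = d then height N (sm x) (tm x) else 0)" for x
  let ?D = "box_boundary L (Suc d)"
  have "\<exists>x\<in>?D. \<exists>y\<in>?D. (\<forall>i. x i \<le> y i \<and> y i \<le> x i + 1) \<and> (\<exists>i<Suc d. x i = y i \<and> \<bar>x i\<bar> = L i)
      \<and> \<phi> (\<lambda>i. 2 * p y i) = \<phi> (\<lambda>i. 2 * p (- x) i)"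
    by (rule box_antipodal_coloring[where \<alpha> = "\<lambda>x. \<phi> (\<lambda>i. 2 * p x i)"])
      (use R M col in \<open>auto simp: L_def p_def\<close>)
  then obtain x y where x: "x \<in> ?D" and y: "y \<in> ?D" and xy: "\<And>i. x i \<le> y i" "\<And>i. y i \<le> x i + 1"
    and facet: "\<exists>i<Suc d. x i = y i \<and> \<bar>x i\<bar> = L i"
    and eq: "\<phi> (\<lambda>i. 2 * p y i) = \<phi> (\<lambda>i. 2 * p (- x) i)" by blast
  have xR: "\<bar>x i\<bar> \<le> R" and yR: "\<bar>y i\<bar> \<le> R" if "i < d" for i
    using x y that by (auto simp: box_boundary_def L_def dest!: spec[of _ i])
  define n where "n = sm x"
  define e where "e = sm y - sm x"
  define \<sigma> \<sigma>' where "\<sigma> = tm x" and "\<sigma>' = tm y"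
  have smneg: "sm (- x) = - n" by (simp add: sm_def n_def sum_negf)
  have smy: "sm y = n + e" by (simp add: n_def e_def)
  have tmneg: "tm (- x) = 4 * Z - \<sigma>" by (simp add: tm_def \<sigma>_def)
  define lo hi where "lo \<longleftrightarrow> (\<exists>i<d. y i = - R)" and "hi \<longleftrightarrow> (\<exists>i<d. x i = R)"
  have esum: "e = (\<Sum>i<d. y i - x i)" by (simp add: e_def sm_def sum_subtractf)
  have e0: "0 \<le> e" unfolding esum by (intro sum_nonneg) (use xy in simp)
  have ed: "e \<le> int d"
    unfolding esum using sum_bounded_above[of "{..<d}" "\<lambda>i. y i - x i" 1] xy(2) by (simp add: algebra_simps)
  have lowsum: "(\<Sum>i<d. of_bool (b \<and> low u i) :: int) = of_bool (b \<and> (\<exists>i<d. u i = - R))" for u b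
  proof (cases "b \<and> (\<exists>i<d. u i = - R)")
    case True
    define j where "j = (LEAST i. u i = - R)"
    have j: "u j = - R" "\<And>i. u i = - R \<Longrightarrow> j \<le> i"
      unfolding j_def using True by (auto intro: LeastI Least_le)
    then have "j < d" using True by (metis le_less_trans)
    have "low u i \<longleftrightarrow> i = j" for i
      unfolding low_def using j \<open>j < d\<close> by (metis leD linorder_neqE_nat)
    then have "(\<Sum>i<d. of_bool (b \<and> low u i) :: int) = (\<Sum>i<d. if i = j then 1 else 0)"
      using True by (intro sum.cong) auto
    then show ?thesis using True \<open>j < d\<close> by simp
  next
    case False
    then have "\<not> (b \<and> low u i)" if "i < d" for i using that by (auto simp: low_def)
    then have "(\<Sum>i<d. of_bool (b \<and> low u i) :: int) = 0" by (intro sum.neutral) auto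
    then show ?thesis using False by simp
  qed
  define c where "c = (\<lambda>i. p y i + p (- x) i)"
  define E where "E = {i. i < d \<and> c i = 1}"
  have ci: "c i = y i - x i + of_bool (displaced N (n + e) \<sigma>' \<and> low y i) + of_bool (displaced N (- n) (4 * Z - \<sigma>) \<and> low (- x) i)"
    if "i < d" for i
    using that unfolding c_def p_def smneg tmneg smy \<sigma>'_def by simp
  \<comment> \<open>A displaced coordinate is at the bound for both \<open>x\<close> and
    \<open>y\<close>, so \<open>y i - x i = 0\<close> there and the increment yields 1. The two
    displacements occur at opposite bounds and never at the same coordinate.\<close>
  have c01: "c i = 0 \<or> c i = 1" if i: "i < d" for i
  proof -
    have ly: "low y i \<Longrightarrow> y i = - R" and lx: "low (- x) i \<Longrightarrow> x i = R" by (auto simp: low_def)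
    have "y i - x i = 0 \<or> y i - x i = 1" using xy[of i] by linarith
    moreover have "y i - x i = 0" "\<not> low (- x) i" if "low y i"
      using ly[OF that] lx xR[OF i] xy[of i] R by linarith+
    moreover have "y i - x i = 0" if "low (- x) i"
      using lx[OF that] yR[OF i] xy[of i] by linarith
    ultimately show ?thesis unfolding ci[OF i] by (cases "low y i"; cases "low (- x) i") auto
  qed
  have cardE: "int (card E) = e + of_bool (displaced N (n + e) \<sigma>' \<and> lo) + of_bool (displaced N (- n) (4 * Z - \<sigma>) \<and> hi)"
  proof -
    have "E = {..<d} \<inter> {i. c i = 1}" by (auto simp: E_def)
    then have "int (card E) = (\<Sum>i<d. of_bool (c i = 1))" by simp
    also have "\<dots> = (\<Sum>i<d. c i)" by (intro sum.cong refl) (use c01 in force)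
    also have "\<dots> = (\<Sum>i<d. y i - x i + of_bool (displaced N (n + e) \<sigma>' \<and> low y i)
        + of_bool (displaced N (- n) (4 * Z - \<sigma>) \<and> low (- x) i))"
      by (intro sum.cong refl) (simp add: ci)
    also have "\<dots> = e + of_bool (displaced N (n + e) \<sigma>' \<and> (\<exists>i<d. y i = - R))
        + of_bool (displaced N (- n) (4 * Z - \<sigma>) \<and> (\<exists>i<d. (- x) i = - R))"
      by (simp only: sum.distrib lowsum esum)
    finally show ?thesis by (simp add: lo_def hi_def)
  qed
  have sig: "\<sigma>' = \<sigma> \<or> \<sigma>' = \<sigma> + 1" using xy[of d] by (auto simp: \<sigma>_def \<sigma>'_def tm_def)
  have cap: "\<sigma>' = \<sigma> \<and> (\<sigma> = 4 * B \<or> \<sigma> = 4 * (Z - B))" if "x d = y d" "\<bar>x d\<bar> = M"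
    using that by (auto simp: \<sigma>_def \<sigma>'_def tm_def M_def abs_if split: if_splits)
  have lateral: "e < int d \<and> (lo \<or> hi)" if i: "i < d" "x i = y i" "\<bar>x i\<bar> = R" for i
  proof
    have "e = (\<Sum>j\<in>{..<d} - {i}. y j - x j)"
      unfolding esum using i by (subst sum.remove[of _ i]) auto
    also have "\<dots> \<le> int (card ({..<d} - {i}))"
      using sum_bounded_above[of "{..<d} - {i}" "\<lambda>i. y i - x i" 1] xy(2) by (simp add: algebra_simps)
    also have "\<dots> < int d" using i by simp
    finally show "e < int d" .
    show "lo \<or> hi" using i unfolding lo_def hi_def by (metis abs_eq_iff' abs_if)
  qed
  have facet': "(\<exists>i<d. x i = y i \<and> \<bar>x i\<bar> = R) \<or> (x d = y d \<and> \<bar>x d\<bar> = M)"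
    using facet by (auto simp: L_def less_Suc_eq split: if_splits)
  have facet'': "e < int d \<and> (lo \<or> hi) \<or> \<sigma>' = \<sigma> \<and> \<sigma> mod 4 = 0"
    using facet'
  proof
    assume "\<exists>i<d. x i = y i \<and> \<bar>x i\<bar> = R"
    then show ?thesis using lateral by blast
  next
    assume "x d = y d \<and> \<bar>x d\<bar> = M"
    then have "\<sigma>' = \<sigma> \<and> (\<sigma> = 4 * B \<or> \<sigma> = 4 * (Z - B))" using cap by blast
    moreover have "4 * B mod 4 = 0" "4 * (Z - B) mod 4 = 0" by simp_all
    ultimately show ?thesis by metis
  qed
  have cd: "c d = height N (n + e) \<sigma>' + height N (- n) (4 * Z - \<sigma>)"
    unfolding c_def p_def smneg tmneg smy \<sigma>'_def by simp
  have "level_ok (int d) s (height N (n + e) \<sigma>' + height N (- n) (4 * Z - \<sigma>))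
     (e + of_bool (displaced N (n + e) \<sigma>' \<and> lo) + of_bool (displaced N (- n) (4 * Z - \<sigma>) \<and> hi))"
    by (rule level_step[OF N_def s(1) sN(1) Z_def e0 ed sig facet''])
  then have "level_ok (int d) s (c d) (int (card E))" unfolding cd cardE .
  moreover have "E \<subseteq> {..<d}" by (auto simp: E_def)
  moreover have "c = (\<lambda>i. if i < d then of_bool (i \<in> E) else if i = d then c d else 0)"
  proof
    fix i
    show "c i = (if i < d then of_bool (i \<in> E) else if i = d then c d else 0)"
    proof (cases "i < d")
      case True
      then show ?thesis using c01[OF True] by (auto simp: E_def)
    next
      case False
      then show ?thesis by (simp add: c_def p_def)
    qed
  qed
  ultimately have "c \<in> sandwich d s" unfolding sandwich_def by blast
  moreover have "\<forall>i>d. 2 * p y i = 0" by (simp add: p_def)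
  moreover have "\<exists>i\<le>d. \<bar>2 * p y i\<bar> > R0"
    using facet'
  proof
    assume "\<exists>i<d. x i = y i \<and> \<bar>x i\<bar> = R"
    then obtain i where i: "i < d" "\<bar>y i\<bar> = R" by auto
    then have "\<bar>2 * p y i\<bar> > R0" using R0 by (auto simp: p_def R_def)
    then show ?thesis using less_imp_le[OF i(1)] by blast
  next
    assume capA: "x d = y d \<and> \<bar>x d\<bar> = M"
    have sy: "\<bar>sm y\<bar> \<le> int d * R"
    proof -
      have "\<bar>sm y\<bar> \<le> (\<Sum>i<d. \<bar>y i\<bar>)" unfolding sm_def by (rule sum_abs)
      also have "\<dots> \<le> (\<Sum>i<d. R)" by (intro sum_mono yR) simp
      finally show ?thesis by simp
    qed
    have pd: "p y d = height N (sm y) \<sigma>'" by (simp add: p_def \<sigma>'_def)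
    from cap capA have "\<sigma>' = 4 * B \<or> \<sigma>' = 4 * (Z - B)" by auto
    then have "\<bar>p y d\<bar> \<ge> R0 + 1"
    proof
      assume "\<sigma>' = 4 * B"
      then have "p y d = (sm y + B) div N" unfolding pd height_def[OF N_def s(1) sN(1)] by simp
      moreover have "N * (R0 + 1) \<le> sm y + B" using sy B_def by linarith
      then have "R0 + 1 \<le> (sm y + B) div N"
        using zdiv_mono1[of "N * (R0 + 1)" "sm y + B" N] sN by simp
      ultimately show ?thesis using R0 by linarith
    next
      assume "\<sigma>' = 4 * (Z - B)"
      then have "p y d = (sm y + (Z - B)) div N" unfolding pd height_def[OF N_def s(1) sN(1)] by simp
      moreover have "sm y + (Z - B) \<le> N * (- (R0 + 1))" using sy B_def by (simp add: algebra_simps)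
      then have "(sm y + (Z - B)) div N \<le> - (R0 + 1)"
        using zdiv_mono1[of "sm y + (Z - B)" "N * (- (R0 + 1))" N] sN by (simp only: nonzero_mult_div_cancel_left)
      ultimately show ?thesis using R0 by linarith
    qed
    then have "\<bar>2 * p y d\<bar> > R0" using R0 by linarith
    then show ?thesis by blast
  qed
  moreover have "\<phi> (\<lambda>i. 2 * c i - 2 * p y i) = \<phi> (\<lambda>i. 2 * p y i)" unfolding eq by (simp add: c_def)
  ultimately show ?thesis by (intro bexI[of _ c] exI[of _ "\<lambda>i. 2 * p y i"] conjI)
qed

text \<open>The middle layer contains every set of ones but the full one; the two outer layers
  together contain each set of size different from \<open>s\<close> once.\<close>

lemma card_sandwich:
  "finite (sandwich d s)" 
  "card (sandwich d s) \<le> 2 ^ Suc d - 1 - (if s \<ge> 0 then d choose nat s else 0)"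
proof -
  define f where "f t E = (\<lambda>i::nat. if i < d then of_bool (i \<in> E) else if i = d then t else (0::int))" for t E
  let ?A = "{E. E \<subseteq> {..<d} \<and> card E < d}"
  let ?P = "{E. E \<subseteq> {..<d} \<and> int (card E) \<noteq> s}"
  have finP: "finite {E. E \<subseteq> {..<d} \<and> Q E}" for Q
    by (rule finite_subset[of _ "Pow {..<d}"]) auto
  have eq: "sandwich d s = f 0 ` ?A \<union> (\<lambda>E. f (if int (card E) > s then 1 else -1) E) ` ?P"
    (is "_ = ?U")
  proof (intro equalityI subsetI)
    fix c assume "c \<in> sandwich d s"
    then obtain t E where tE: "E \<subseteq> {..<d}" "level_ok (int d) s t (int (card E))" "c = f t E"
      by (auto simp: sandwich_def f_def)
    from tE(2) consider "t = 0" "card E < d" | "t = 1" "int (card E) > s" | "t = -1" "int (card E) < s"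
      unfolding level_ok_def by auto
    then show "c \<in> ?U"
    proof cases
      case 1
      then show ?thesis using tE by blast
    next
      case 2
      then have "c = (\<lambda>E. f (if int (card E) > s then 1 else -1) E) E" "E \<in> ?P" using tE by auto
      then show ?thesis by blast
    next
      case 3
      then have "c = (\<lambda>E. f (if int (card E) > s then 1 else -1) E) E" "E \<in> ?P" using tE by auto
      then show ?thesis by blast
    qed
  next
    fix c assume "c \<in> ?U"
    then show "c \<in> sandwich d s"
    proof
      assume "c \<in> f 0 ` ?A"
      then show ?thesis by (auto simp: sandwich_def f_def level_ok_def)
    next
      assume "c \<in> (\<lambda>E. f (if int (card E) > s then 1 else -1) E) ` ?P"
      then obtain E where E: "E \<subseteq> {..<d}" "int (card E) \<noteq> s" "c = f (if int (card E) > s then 1 else -1) E"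
        by blast
      then have "level_ok (int d) s (if int (card E) > s then 1 else -1) (int (card E))"
        by (auto simp: level_ok_def)
      then show ?thesis using E unfolding sandwich_def f_def by blast
    qed
  qed
  show "finite (sandwich d s)" unfolding eq by (intro finite_UnI finite_imageI finP)
  have "?A = Pow {..<d} - {{..<d}}"
  proof (intro equalityI subsetI)
    fix E assume "E \<in> Pow {..<d} - {{..<d}}"
    then have "E \<subset> {..<d}" by blast
    then have "card E < card {..<d}" by (intro psubset_card_mono) auto
    then show "E \<in> ?A" using \<open>E \<subset> {..<d}\<close> by auto
  qed auto
  then have A: "card ?A = 2 ^ d - 1" by (simp add: card_Diff_subset card_Pow)
  have "?P = Pow {..<d} - {E. E \<subseteq> {..<d} \<and> int (card E) = s}" by auto
  then have "card ?P = card (Pow {..<d} - {E. E \<subseteq> {..<d} \<and> int (card E) = s})" by (rule arg_cong)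
  also have "\<dots> = 2 ^ d - card {E. E \<subseteq> {..<d} \<and> int (card E) = s}"
    by (subst card_Diff_subset) (auto simp: card_Pow finP)
  also have "card {E. E \<subseteq> {..<d} \<and> int (card E) = s} = (if s \<ge> 0 then d choose nat s else 0)"
  proof (cases "s \<ge> 0")
    case True
    then have "{E. E \<subseteq> {..<d} \<and> int (card E) = s} = {E. E \<subseteq> {..<d} \<and> card E = nat s}" by auto
    then show ?thesis using True n_subsets[of "{..<d}" "nat s"] by simp
  next
    case False
    then have "{E. E \<subseteq> {..<d} \<and> int (card E) = s} = {}" by auto
    then show ?thesis using False by simp
  qed
  finally have P: "card ?P = 2 ^ d - (if s \<ge> 0 then d choose nat s else 0)" .
  have "card (sandwich d s) \<le> card ?A + card ?P"
    unfolding eq by (rule order_trans[OF card_Un_le]) (intro add_mono card_image_le finP)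
  also have "\<dots> \<le> 2 ^ Suc d - 1 - (if s \<ge> 0 then d choose nat s else 0)"
  proof -
    have "(if s \<ge> 0 then d choose nat s else 0) \<le> (2::nat) ^ d"
      using binomial_le_pow2 by auto
    moreover have "(2::nat) ^ d \<ge> 1" by simp
    ultimately show ?thesis unfolding A P by simp
  qed
  finally show "card (sandwich d s) \<le> 2 ^ Suc d - 1 - (if s \<ge> 0 then d choose nat s else 0)" .
qed

section \<open>Groups with real coordinates\<close>

lemma finite_ordLeq_iff:
  assumes "finite A" "finite B"
  shows "(card_of A, card_of B) \<in> ordLeq \<longleftrightarrow> card A \<le> card B"
  unfolding card_of_ordLeq[symmetric] using inj_on_iff_card_le[OF assms] by simp

lemma ordLess_iff: "(card_of A, card_of B) \<in> ordLess \<longleftrightarrow> (card_of B, card_of A) \<notin> ordLeq"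
  using not_ordLeq_iff_ordLess[OF card_of_Well_order card_of_Well_order] by blast

lemma least_card_witness:
  assumes "\<C> \<noteq> {}"
  shows "\<exists>C\<in>\<C>. least_card \<C> = Card (card_of C) \<and> (\<forall>D\<in>\<C>. (card_of C, card_of D) \<in> ordLeq)"
proof -
  have "\<exists>r\<in>card_of ` \<C>. \<forall>r'\<in>card_of ` \<C>. (r, r') \<in> ordLeq"
    using assms by (intro exists_minim_Well_order) (auto simp: card_of_Well_order)
  then have "\<exists>C. C \<in> \<C> \<and> (\<forall>D\<in>\<C>. (card_of C, card_of D) \<in> ordLeq)" by blast
  from someI_ex[OF this] assms show ?thesis by (auto simp: least_card_def)
qed

lemma least_card_le_nat:
  assumes "C \<in> \<C>" "finite C" "card C \<le> N"
  shows "least_card \<C> \<le>\<^sub>c ecard_of_nat N"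
proof -
  obtain C0 where "C0 \<in> \<C>" "least_card \<C> = Card (card_of C0)" "(card_of C0, card_of C) \<in> ordLeq"
    using least_card_witness assms(1) by (metis empty_iff)
  moreover have "(card_of C, card_of {..<N}) \<in> ordLeq"
    using assms(2,3) finite_ordLeq_iff[of C "{..<N}"] by simp
  ultimately show ?thesis by (auto simp: ecard_of_nat_def intro: ordLeq_transitive)
qed

lemma nat_le_least_card:
  assumes "\<And>C. C \<in> \<C> \<Longrightarrow> finite C \<Longrightarrow> N \<le> card C"
  shows "ecard_of_nat N \<le>\<^sub>c least_card \<C>"
proof (cases "\<C> = {}")
  case True
  then show ?thesis by (simp add: least_card_def ecard_of_nat_def)
next
  case False
  then obtain C where C: "C \<in> \<C>" "least_card \<C> = Card (card_of C)" using least_card_witness by blast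
  have "(card_of {..<N}, card_of C) \<in> ordLeq"
  proof (cases "finite C")
    case True
    then show ?thesis using assms[OF C(1)] finite_ordLeq_iff[of "{..<N}" C] by simp
  next
    case False
    then have "(card_of C, card_of {..<N}) \<notin> ordLeq" using card_of_ordLeq_finite by blast
    then show ?thesis using ordLess_iff ordLess_imp_ordLeq by blast
  qed
  then show ?thesis using C by (simp add: ecard_of_nat_def)
qed

text \<open>A finite member of \<open>\<C>\<close> keeps the left side from being
  \<open>Infty\<close>; infinite members of \<open>\<D>\<close> are then larger in any case, so only
  finite ones have to be compared.\<close>

lemma least_card_less:
  assumes C: "C \<in> \<C>" "finite C"
    and less: "\<And>D. D \<in> \<D> \<Longrightarrow> finite D \<Longrightarrow> \<exists>C\<in>\<C>. finite C \<and> card C < card D"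
  shows "least_card \<C> <\<^sub>c least_card \<D>"
proof -
  obtain C0 where C0: "C0 \<in> \<C>" "least_card \<C> = Card (card_of C0)"
    "\<And>D. D \<in> \<C> \<Longrightarrow> (card_of C0, card_of D) \<in> ordLeq"
    using least_card_witness C(1) by (metis empty_iff)
  have fin: "finite C0" using C0(3)[OF C(1)] C(2) card_of_ordLeq_finite by blast
  show ?thesis
  proof (cases "\<D> = {}")
    case True
    then show ?thesis using C0 by (simp add: least_card_def)
  next
    case False
    then obtain D where D: "D \<in> \<D>" "least_card \<D> = Card (card_of D)" using least_card_witness by blast
    have "(card_of C0, card_of D) \<in> ordLess"
    proof (cases "finite D")
      case True
      then obtain C' where "C' \<in> \<C>" "finite C'" "card C' < card D" using less D(1) by blast
      moreover have "card C0 \<le> card C'"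
        using C0(3)[OF \<open>C' \<in> \<C>\<close>] fin \<open>finite C'\<close> finite_ordLeq_iff by blast
      ultimately show ?thesis using finite_ordLeq_iff[of D C0] fin True unfolding ordLess_iff by simp
    next
      case False
      then show ?thesis unfolding ordLess_iff using card_of_ordLeq_finite fin by blast
    qed
    then show ?thesis using C0 D by simp
  qed
qed

section \<open>Total boundedness and colourings in terms of real coordinates\<close>

definition coord_bounded :: "'i set \<Rightarrow> ('i \<Rightarrow> 'a \<Rightarrow> real) \<Rightarrow> 'a set \<Rightarrow> bool" where
  "coord_bounded I f S \<longleftrightarrow> (\<forall>i\<in>I. \<exists>B. \<forall>x\<in>S. \<bar>f i x\<bar> \<le> B)"

lemma coord_bounded_mono: "coord_bounded I f S \<Longrightarrow> S' \<subseteq> S \<Longrightarrow> coord_bounded I f S'"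
  unfolding coord_bounded_def by blast

lemma coord_bounded_Un:
  assumes "coord_bounded I f S" "coord_bounded I f S'"
  shows "coord_bounded I f (S \<union> S')"
  unfolding coord_bounded_def
proof
  fix i assume i: "i \<in> I"
  obtain B where B: "\<forall>x\<in>S. \<bar>f i x\<bar> \<le> B" using assms(1) i unfolding coord_bounded_def by blast
  obtain B' where B': "\<forall>x\<in>S'. \<bar>f i x\<bar> \<le> B'" using assms(2) i unfolding coord_bounded_def by blast
  have "\<forall>x\<in>S \<union> S'. \<bar>f i x\<bar> \<le> max B B'" using B B' by fastforce
  then show "\<exists>B. \<forall>x\<in>S \<union> S'. \<bar>f i x\<bar> \<le> B" by blast
qed

lemma coord_bounded_empty [simp]: "coord_bounded I f {}"
  by (simp add: coord_bounded_def)

lemma coord_bounded_UN: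
  "finite K \<Longrightarrow> (\<And>j. j \<in> K \<Longrightarrow> coord_bounded I f (S j)) \<Longrightarrow> coord_bounded I f (\<Union>j\<in>K. S j)"
  by (induction K rule: finite_induct) (auto intro: coord_bounded_Un)

text \<open>All groups of the theorem carry homomorphisms to the reals whose strips generate the
  neighbourhoods of the identity. The index set may be infinite, but each neighbourhood involves
  finitely many coordinates.\<close>

locale coord_group = comm_group G for G (structure) +
  fixes T :: "'a topology" and I :: "nat set" and f :: "nat \<Rightarrow> 'a \<Rightarrow> real"
  assumes top: "topspace T = carrier G"
    and cont: "i \<in> I \<Longrightarrow> continuous_map T euclideanreal (f i)"
    and f_mult: "i \<in> I \<Longrightarrow> x \<in> carrier G \<Longrightarrow> y \<in> carrier G \<Longrightarrow> f i (x \<otimes> y) = f i x + f i y"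
    and nbhd: "openin T V \<Longrightarrow> \<one> \<in> V \<Longrightarrow>
      \<exists>J \<epsilon>. finite J \<and> J \<subseteq> I \<and> \<epsilon> > 0 \<and> {x \<in> carrier G. \<forall>i\<in>J. \<bar>f i x\<bar> < \<epsilon>} \<subseteq> V"
begin

abbreviation "bdd \<equiv> coord_bounded I f"

definition refl_at :: "'a \<Rightarrow> 'a \<Rightarrow> 'a" where
  "refl_at c x = c [^] (2::nat) \<otimes> inv x"

lemma f_one: "i \<in> I \<Longrightarrow> f i \<one> = 0"
  using f_mult[of i \<one> \<one>] by simp

lemma f_inv: "i \<in> I \<Longrightarrow> x \<in> carrier G \<Longrightarrow> f i (inv x) = - f i x"
  using f_mult[of i x "inv x"] f_one by simp

lemma refl_closed [simp]: "c \<in> carrier G \<Longrightarrow> x \<in> carrier G \<Longrightarrow> refl_at c x \<in> carrier G"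
  by (simp add: refl_at_def)

lemma refl_refl [simp]:
  assumes "c \<in> carrier G" "x \<in> carrier G"
  shows "refl_at c (refl_at c x) = x"
proof -
  have "inv (c [^] (2::nat) \<otimes> inv x) = inv (c [^] (2::nat)) \<otimes> x"
    using assms by (simp add: inv_mult)
  then show ?thesis using assms by (simp add: refl_at_def m_assoc[symmetric])
qed

lemma f_refl: "i \<in> I \<Longrightarrow> c \<in> carrier G \<Longrightarrow> x \<in> carrier G \<Longrightarrow> f i (refl_at c x) = 2 * f i c - f i x"
  by (simp add: refl_at_def f_mult f_inv numeral_2_eq_2)

text \<open>A coordinate is bounded on finitely many shifts of a strip. Conversely, a neighbourhood
  involves finitely many coordinates, in which a bounded set meets finitely many grid cells of side
  \<open>\<epsilon>\<close>; one point from each cell gives the shifts.\<close>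

lemma totally_bounded_iff:
  assumes S: "S \<subseteq> carrier G"
  shows "group_totally_bounded G T S \<longleftrightarrow> bdd S"
proof
  assume tb: "group_totally_bounded G T S"
  show "bdd S" unfolding coord_bounded_def
  proof
    fix i assume i: "i \<in> I"
    let ?U = "{x \<in> carrier G. f i x \<in> {-1<..<1}}"
    have "openin T ?U"
      using openin_continuous_map_preimage[OF cont[OF i], of "{-1<..<1}"] by (simp add: top)
    then have "neighborhood_of_one G T ?U"
      unfolding neighborhood_of_one_def using f_one[OF i] by (intro conjI exI[of _ ?U]) auto
    then obtain F where F: "finite F" "F \<subseteq> carrier G" "S \<subseteq> (\<Union>x\<in>F. x <# ?U)"
      using tb unfolding group_totally_bounded_def by meson
    have "\<bar>f i y\<bar> \<le> (\<Sum>x\<in>F. \<bar>f i x\<bar>) + 1" if "y \<in> S" for y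
    proof -
      from that F(3) have "y \<in> (\<Union>x\<in>F. x <# ?U)" by blast
      then obtain x u where xu: "x \<in> F" "u \<in> ?U" "y = x \<otimes> u" unfolding l_coset_def by blast
      have "f i y = f i x + f i u" using xu F(2) i by (auto simp: f_mult)
      moreover have "\<bar>f i x\<bar> \<le> (\<Sum>x\<in>F. \<bar>f i x\<bar>)" by (rule member_le_sum) (use xu F in auto)
      moreover have "\<bar>f i u\<bar> < 1" using xu(2) by auto
      ultimately show ?thesis by linarith
    qed
    then show "\<exists>B. \<forall>x\<in>S. \<bar>f i x\<bar> \<le> B" by blast
  qed
next
  assume b: "bdd S"
  show "group_totally_bounded G T S" unfolding group_totally_bounded_def
  proof (intro allI impI)
    fix U assume "neighborhood_of_one G T U"
    then obtain V where V: "openin T V" "\<one> \<in> V" "V \<subseteq> U" unfolding neighborhood_of_one_def by blast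
    from nbhd[OF V(1,2)] obtain J \<epsilon> where J: "finite J" "J \<subseteq> I" and \<epsilon>: "\<epsilon> > 0"
      and sub: "{x \<in> carrier G. \<forall>i\<in>J. \<bar>f i x\<bar> < \<epsilon>} \<subseteq> V" by (elim exE conjE)
    define q where "q x = (\<lambda>i\<in>J. \<lfloor>f i x / \<epsilon>\<rfloor>)" for x
    have "\<forall>i\<in>J. \<exists>B. \<forall>x\<in>S. \<bar>f i x\<bar> \<le> B" using b J(2) unfolding coord_bounded_def by blast
    then obtain B where B: "\<And>i x. i \<in> J \<Longrightarrow> x \<in> S \<Longrightarrow> \<bar>f i x\<bar> \<le> B i"
      unfolding bchoice_iff by blast
    have "q ` S \<subseteq> (\<Pi>\<^sub>E i\<in>J. {\<lfloor>- B i / \<epsilon>\<rfloor>..\<lfloor>B i / \<epsilon>\<rfloor>})"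
    proof
      fix z assume "z \<in> q ` S"
      then obtain x where x: "x \<in> S" "z = q x" by blast
      have "- B i / \<epsilon> \<le> f i x / \<epsilon>" "f i x / \<epsilon> \<le> B i / \<epsilon>" if "i \<in> J" for i
        using B[OF that x(1)] \<epsilon> by (intro divide_right_mono; linarith)+
      then show "z \<in> (\<Pi>\<^sub>E i\<in>J. {\<lfloor>- B i / \<epsilon>\<rfloor>..\<lfloor>B i / \<epsilon>\<rfloor>})"
        unfolding x(2) q_def by (auto intro!: floor_mono)
    qed
    then have finq: "finite (q ` S)" by (rule finite_subset) (simp add: finite_PiE J)
    define r where "r z = (SOME x. x \<in> S \<and> q x = z)" for z
    have r: "r (q x) \<in> S \<and> q (r (q x)) = q x" if "x \<in> S" for x
      unfolding r_def using someI_ex[of "\<lambda>y. y \<in> S \<and> q y = q x"] that by blast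
    show "\<exists>F. finite F \<and> F \<subseteq> carrier G \<and> S \<subseteq> (\<Union>x\<in>F. x <# U)"
    proof (intro exI conjI)
      show "finite (r ` q ` S)" using finq by simp
      show "r ` q ` S \<subseteq> carrier G" using r S by blast
      show "S \<subseteq> (\<Union>x\<in>r ` q ` S. x <# U)"
      proof
        fix x assume x: "x \<in> S"
        define y where "y = r (q x)"
        have y: "y \<in> S" "q y = q x" using r[OF x] by (auto simp: y_def)
        have xc: "x \<in> carrier G" and yc: "y \<in> carrier G" using x y S by auto
        have "\<bar>f i (inv y \<otimes> x)\<bar> < \<epsilon>" if i: "i \<in> J" for i
        proof -
          have fl: "\<lfloor>f i y / \<epsilon>\<rfloor> = \<lfloor>f i x / \<epsilon>\<rfloor>" using y(2) i unfolding q_def by (metis restrict_apply')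
          then have "\<bar>f i x / \<epsilon> - f i y / \<epsilon>\<bar> < 1" by linarith
          then have "\<bar>(f i x - f i y) / \<epsilon>\<bar> < 1" by (simp add: diff_divide_distrib)
          then have "\<bar>f i x - f i y\<bar> < \<epsilon>" using \<epsilon> by (simp add: abs_divide)
          then show ?thesis using i J(2) xc yc by (simp add: f_mult f_inv subset_iff)
        qed
        then have "inv y \<otimes> x \<in> U" using sub V(3) xc yc by blast
        moreover have "x = y \<otimes> (inv y \<otimes> x)" using xc yc by (simp add: m_assoc[symmetric])
        ultimately have "x \<in> y <# U" unfolding l_coset_def by blast
        then show "x \<in> (\<Union>x\<in>r ` q ` S. x <# U)" using x by (auto simp: y_def)
      qed
    qed
  qed
qed

text \<open>The points coloured like their reflections contain every monochromatic symmetric set and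
  split into finitely many colour classes, each of them symmetric. If they are unbounded, so is one
  class.\<close>

lemma has_center_iff:
  assumes C: "C \<subseteq> carrier G" and col: "coloring (carrier G) k \<phi>"
  shows "has_center_in G T C \<phi> \<longleftrightarrow> (\<exists>c\<in>C. \<not> bdd {x \<in> carrier G. \<phi> (refl_at c x) = \<phi> x})"
proof
  assume "has_center_in G T C \<phi>"
  then obtain c S where cS: "c \<in> C" "S \<subseteq> carrier G" "\<not> group_totally_bounded G T S"
    "monochromatic \<phi> S" "symmetric_about G c S" unfolding has_center_in_def by blast
  have "refl_at c x \<in> S" if "x \<in> S" for x
    using cS(5) that unfolding symmetric_about_def refl_at_def by blast
  then have "S \<subseteq> {x \<in> carrier G. \<phi> (refl_at c x) = \<phi> x}"
    using cS(2,4) unfolding monochromatic_def by auto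
  then show "\<exists>c\<in>C. \<not> bdd {x \<in> carrier G. \<phi> (refl_at c x) = \<phi> x}"
    using cS(1,3) totally_bounded_iff[OF cS(2)] coord_bounded_mono by blast
next
  assume "\<exists>c\<in>C. \<not> bdd {x \<in> carrier G. \<phi> (refl_at c x) = \<phi> x}"
  then obtain c where c: "c \<in> C" "\<not> bdd {x \<in> carrier G. \<phi> (refl_at c x) = \<phi> x}" by blast
  have cc: "c \<in> carrier G" using c C by blast
  define U where "U j = {x \<in> carrier G. \<phi> x = j \<and> \<phi> (refl_at c x) = j}" for j
  have "{x \<in> carrier G. \<phi> (refl_at c x) = \<phi> x} = (\<Union>j\<in>{..<k}. U j)"
    using col unfolding U_def coloring_def by auto
  then obtain j where j: "\<not> bdd (U j)" using c(2) coord_bounded_UN[of "{..<k}" I f U] by auto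
  have sub: "U j \<subseteq> carrier G" by (auto simp: U_def)
  have "refl_at c ` U j = U j"
  proof
    show "refl_at c ` U j \<subseteq> U j" using cc by (auto simp: U_def)
    show "U j \<subseteq> refl_at c ` U j"
    proof
      fix x assume "x \<in> U j"
      then have "refl_at c x \<in> U j" "x = refl_at c (refl_at c x)" using cc by (auto simp: U_def)
      then show "x \<in> refl_at c ` U j" by blast
    qed
  qed
  then have "symmetric_about G c (U j)" unfolding symmetric_about_def refl_at_def by simp
  moreover have "monochromatic \<phi> (U j)" unfolding monochromatic_def U_def by auto
  ultimately show "has_center_in G T C \<phi>"
    unfolding has_center_in_def using c(1) sub j totally_bounded_iff by blast
qed

text \<open>The measure space is a parameter so that one argument serves both kinds of colourings:
  the counting space admits all of them, \<open>borel_measure\<close> the Borel ones.\<close>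

definition pole :: "'a measure \<Rightarrow> nat \<Rightarrow> 'a set \<Rightarrow> bool" where
  "pole M k C \<longleftrightarrow> C \<subseteq> carrier G \<and>
     (\<forall>\<phi>. \<phi> \<in> measurable M (count_space UNIV) \<and> (\<forall>x\<in>carrier G. \<phi> x < k) \<longrightarrow>
        (\<exists>c\<in>C. \<not> bdd {x \<in> carrier G. \<phi> (refl_at c x) = \<phi> x}))"

definition borel_measure :: "'a measure" where
  "borel_measure = sigma (carrier G) {U. openin T U}"

lemma space_borel_measure [simp]: "space borel_measure = carrier G"
  unfolding borel_measure_def by (rule space_measure_of) (use openin_subset top in blast)

lemma sets_borel_measure: "sets borel_measure = borel_sets_of T"
  unfolding borel_measure_def borel_sets_of_def top
  by (rule sets_measure_of) (use openin_subset top in blast)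

lemma f_borel: "i \<in> I \<Longrightarrow> f i \<in> borel_measurable borel_measure"
proof (rule borel_measurableI)
  fix S :: "real set" assume i: "i \<in> I" and S: "open S"
  have "f i -` S \<inter> space borel_measure = {x \<in> topspace T. f i x \<in> S}" by (auto simp: top)
  moreover have "openin T \<dots>" using openin_continuous_map_preimage[OF cont[OF i]] S by simp
  ultimately show "f i -` S \<inter> space borel_measure \<in> sets borel_measure"
    unfolding sets_borel_measure borel_sets_of_def by (auto intro: sigma_sets.Basic)
qed

lemma centerpole_iff: "centerpole k G T C \<longleftrightarrow> pole (count_space (carrier G)) k C"
  unfolding centerpole_def pole_def using has_center_iff by (auto simp: coloring_def)

lemma borel_centerpole_iff: "borel_centerpole k G T C \<longleftrightarrow> pole borel_measure k C"
proof -
  have bc: "borel_coloring T k \<phi> \<longleftrightarrow> \<phi> \<in> measurable borel_measure (count_space UNIV) \<and> (\<forall>x\<in>carrier G. \<phi> x < k)" for \<phi>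
  proof -
    have eq: "\<phi> -` {i} \<inter> space borel_measure = {x \<in> carrier G. \<phi> x = i}" for i by auto
    have m: "\<phi> \<in> measurable borel_measure (count_space UNIV) \<longleftrightarrow>
        (\<forall>i. {x \<in> carrier G. \<phi> x = i} \<in> sets borel_measure)"
      unfolding measurable_count_space_eq2_countable eq by simp
    have "{x \<in> carrier G. \<phi> x = i} \<in> sets borel_measure"
      if "\<forall>x\<in>carrier G. \<phi> x < k" "\<forall>i<k. {x \<in> carrier G. \<phi> x = i} \<in> sets borel_measure" for i
    proof (cases "i < k")
      case False
      then have "{x \<in> carrier G. \<phi> x = i} = {}" using that(1) by auto
      then show ?thesis by (metis sets.empty_sets)
    qed (use that in blast)
    then show ?thesis
      unfolding borel_coloring_def coloring_def top sets_borel_measure[symmetric] m by blast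
  qed
  show ?thesis unfolding borel_centerpole_def pole_def bc
    using has_center_iff[of C k] unfolding coloring_def by blast
qed

end

context coord_group
begin

lemma not_poleI:
  assumes "\<phi> \<in> measurable M (count_space UNIV)" "\<And>x. x \<in> carrier G \<Longrightarrow> \<phi> x < k"
    and "\<And>c. c \<in> C \<Longrightarrow> c \<in> carrier G \<Longrightarrow> bdd {x \<in> carrier G. \<phi> (refl_at c x) = \<phi> x}"
  shows "\<not> pole M k C"
  using assms unfolding pole_def by blast

lemma not_poleE:
  assumes "\<not> pole M k C" "C \<subseteq> carrier G"
  obtains \<phi> where "\<phi> \<in> measurable M (count_space UNIV)" "\<And>x. x \<in> carrier G \<Longrightarrow> \<phi> x < k"
    "\<And>c. c \<in> C \<Longrightarrow> bdd {x \<in> carrier G. \<phi> (refl_at c x) = \<phi> x}"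
  using assms unfolding pole_def by blast

lemma pole_zero: "pole M 0 {}"
  unfolding pole_def using one_closed by blast

lemma not_pole_empty: "k \<ge> 1 \<Longrightarrow> \<not> pole M k {}"
  by (rule not_poleI[of "\<lambda>_. 0"]) auto

text \<open>The sign of the first nonzero \<open>w j\<close> decides, and \<open>g\<close> decides
  where all of them vanish. A sequence is used because a point or a line in an infinite power is cut
  out by infinitely many equations.\<close>

definition lex_half :: "(nat \<Rightarrow> 'a \<Rightarrow> real) \<Rightarrow> ('a \<Rightarrow> real) \<Rightarrow> 'a set" where
  "lex_half w g = {x \<in> carrier G. (\<exists>j. w j x > 0 \<and> (\<forall>i<j. w i x = 0)) \<or> (\<forall>j. w j x = 0) \<and> g x > 0}"

lemma lex_half_sets:
  assumes [measurable]: "\<And>j. w j \<in> borel_measurable M" "g \<in> borel_measurable M" and sp: "space M = carrier G"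
  shows "lex_half w g \<in> sets M"
  unfolding lex_half_def sp[symmetric] by measurable

text \<open>Reflection negates the first nonzero \<open>w j\<close> and so changes sides. It can
  preserve the side only where all \<open>w j\<close> vanish, and there \<open>g\<close> must be
  close to \<open>g c\<close>.\<close>

lemma lex_half_symmetric:
  assumes c: "c \<in> carrier G"
    and w: "\<And>j x. x \<in> carrier G \<Longrightarrow> w j (refl_at c x) = - w j x"
    and g: "\<And>x. x \<in> carrier G \<Longrightarrow> g (refl_at c x) = 2 * g c - g x"
    and x: "x \<in> carrier G" and eq: "x \<in> lex_half w g \<longleftrightarrow> refl_at c x \<in> lex_half w g"
  shows "(\<forall>j. w j x = 0) \<and> \<bar>g x\<bar> \<le> 2 * \<bar>g c\<bar>"
proof -
  have z: "w j x = 0" for j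
  proof (rule ccontr)
    assume nz: "w j x \<noteq> 0"
    define m where "m = (LEAST i. w i x \<noteq> 0)"
    have m: "w m x \<noteq> 0" and before: "w i x = 0" if "i < m" for i
      unfolding m_def using LeastI[of "\<lambda>i. w i x \<noteq> 0", OF nz] not_less_Least that unfolding m_def by blast+
    have lex: "u \<in> lex_half w g \<longleftrightarrow> w m u > 0" if "u \<in> carrier G" "w m u \<noteq> 0" "\<And>i. i < m \<Longrightarrow> w i u = 0" for u
    proof
      assume "u \<in> lex_half w g"
      with that(2) obtain j where j: "w j u > 0" "\<forall>i<j. w i u = 0" unfolding lex_half_def by auto
      have "\<not> j < m" using j that(3)[of j] by auto
      moreover have "\<not> m < j" using j that(2) by blast
      ultimately show "w m u > 0" using j by (metis linorder_neqE_nat)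
    next
      assume "w m u > 0"
      then show "u \<in> lex_half w g" unfolding lex_half_def using that by blast
    qed
    have m0: "w m x \<noteq> 0" unfolding m_def using LeastI[of "\<lambda>i. w i x \<noteq> 0", OF nz] .
    have b0: "w i x = 0" if "i < m" for i using not_less_Least[of i "\<lambda>i. w i x \<noteq> 0"] that unfolding m_def by blast
    have "x \<in> lex_half w g \<longleftrightarrow> w m x > 0" by (rule lex[OF x m0 b0])
    moreover have "refl_at c x \<in> lex_half w g \<longleftrightarrow> w m (refl_at c x) > 0"
      by (rule lex) (use x c w m0 b0 in auto)
    ultimately show False using eq w[OF x, of m] m0 by linarith
  qed
  have l: "u \<in> lex_half w g \<longleftrightarrow> g u > 0" if "u \<in> carrier G" "\<And>j. w j u = 0" for u
    using that unfolding lex_half_def by auto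
  have "x \<in> lex_half w g \<longleftrightarrow> g x > 0" by (rule l[OF x z])
  moreover have "refl_at c x \<in> lex_half w g \<longleftrightarrow> g (refl_at c x) > 0" by (rule l) (use x c w z in auto)
  ultimately have "g x > 0 \<longleftrightarrow> 2 * g c - g x > 0" using eq g[OF x] by simp
  then have "\<bar>g x\<bar> \<le> 2 * \<bar>g c\<bar>" by linarith
  then show ?thesis using z by blast
qed

lemma not_pole_split:
  assumes "k \<ge> 2" "E \<in> sets M" "space M = carrier G"
    and "\<And>c. c \<in> C \<Longrightarrow> c \<in> carrier G \<Longrightarrow> bdd {x \<in> carrier G. x \<in> E \<longleftrightarrow> refl_at c x \<in> E}"
  shows "\<not> pole M k C"
proof (rule not_poleI[of "\<lambda>x. if x \<in> E then 1 else 0"])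
  show "(\<lambda>x. if x \<in> E then 1 else 0) \<in> M \<rightarrow>\<^sub>M count_space UNIV"
    using assms(2) by measurable
  fix c assume c: "c \<in> C" "c \<in> carrier G"
  show "bdd {x \<in> carrier G. (if refl_at c x \<in> E then 1 else 0::nat) = (if x \<in> E then 1 else 0)}"
    by (rule coord_bounded_mono[OF assms(4)[OF c]]) (auto split: if_splits)
qed (use assms in auto)

text \<open>The coordinates relative to \<open>c\<close> are negated by the reflection about
  \<open>c\<close>, so the two halves are exchanged outside the points with the same coordinates as
  \<open>c\<close>.\<close>

lemma not_pole_singleton:
  assumes "k \<ge> 2" and M: "space M = carrier G" "\<And>i. i \<in> I \<Longrightarrow> f i \<in> borel_measurable M"
  shows "\<not> pole M k {c}"
proof (cases "c \<in> carrier G")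
  case c: True
  define w where "w j x = (if j \<in> I then f j x - f j c else 0)" for j x
  have wm: "w j \<in> borel_measurable M" for j unfolding w_def using M(2)[of j] by (cases "j \<in> I") simp_all
  show ?thesis
  proof (rule not_pole_split[OF assms(1) _ M(1)])
    show "lex_half w (\<lambda>_. 0) \<in> sets M" by (rule lex_half_sets[OF wm _ M(1)]) simp
    fix c' assume "c' \<in> {c}"
    then have c': "c' = c" by simp
    have "bdd {x \<in> carrier G. \<forall>j. w j x = 0}"
      unfolding coord_bounded_def
    proof (intro ballI exI)
      fix i x assume "i \<in> I" "x \<in> {x \<in> carrier G. \<forall>j. w j x = 0}"
      then have "w i x = 0" by blast
      then show "\<bar>f i x\<bar> \<le> \<bar>f i c\<bar>" using \<open>i \<in> I\<close> by (simp add: w_def)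
    qed
    then show "bdd {x \<in> carrier G. x \<in> lex_half w (\<lambda>_. 0) \<longleftrightarrow> refl_at c' x \<in> lex_half w (\<lambda>_. 0)}"
    proof (rule coord_bounded_mono, intro subsetI CollectI conjI)
      fix x assume x: "x \<in> {x \<in> carrier G. x \<in> lex_half w (\<lambda>_. 0) \<longleftrightarrow> refl_at c' x \<in> lex_half w (\<lambda>_. 0)}"
      then show "x \<in> carrier G" by simp
      have "(\<forall>j. w j x = 0) \<and> \<bar>0::real\<bar> \<le> 2 * \<bar>0\<bar>"
      proof (rule lex_half_symmetric[OF c, where w = w and g = "\<lambda>_. 0"])
        show "w j (refl_at c x) = - w j x" if "x \<in> carrier G" for j x
          using that c by (simp add: w_def f_refl)
      qed (use x c' in auto)
      then show "\<forall>j. w j x = 0" by blast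
    qed
  qed
qed (simp add: pole_def)

end

section \<open>Losing one dimension at the price of one colour\<close>

locale coord_drop = A: coord_group G T I f + B: coord_group H T' I' f'
  for G :: "('a, 'c) monoid_scheme" and T I f and H :: "('b, 'd) monoid_scheme" and T' I' f' +
  fixes \<pi> :: "'a \<Rightarrow> 'b" and h :: "'a \<Rightarrow> real"
  assumes \<pi>_closed: "x \<in> carrier G \<Longrightarrow> \<pi> x \<in> carrier H"
    and \<pi>_refl: "c \<in> carrier G \<Longrightarrow> x \<in> carrier G \<Longrightarrow> \<pi> (A.refl_at c x) = B.refl_at (\<pi> c) (\<pi> x)"
    and h_refl: "c \<in> carrier G \<Longrightarrow> x \<in> carrier G \<Longrightarrow> h (A.refl_at c x) = 2 * h c - h x"
    and bdd_lift: "S \<subseteq> carrier G \<Longrightarrow> B.bdd (\<pi> ` S) \<Longrightarrow> \<forall>x\<in>S. \<bar>h x\<bar> \<le> b \<Longrightarrow> A.bdd S"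
begin

text \<open>The new colour goes to the side above \<open>m\<close>. Two points whose midpoint has
  \<open>h c < m\<close> cannot both be there, so if they agree in colour, both stay in a slab where
  \<open>h\<close> is bounded, and there \<open>\<beta>\<close> decides after projection. A centre
  with \<open>h c = m\<close> exchanges the two sides, which leaves only the hyperplane, to be cut
  by \<open>E\<close>.\<close>

lemma not_pole_drop:
  assumes M: "space M = carrier G" "\<pi> \<in> measurable M M'" "h \<in> borel_measurable M"
    and C: "C \<subseteq> carrier G" "\<And>c. c \<in> C \<Longrightarrow> h c \<le> m"
    and E: "E \<in> sets M"
      "\<And>c. c \<in> C \<Longrightarrow> h c = m \<Longrightarrow> A.bdd {x \<in> carrier G. h x = m \<and> (x \<in> E \<longleftrightarrow> A.refl_at c x \<in> E)}"
    and np: "\<not> B.pole M' k (\<pi> ` {c \<in> C. h c < m})"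
  shows "\<not> A.pole M (Suc k) C"
proof -
  have sub: "\<pi> ` {c \<in> C. h c < m} \<subseteq> carrier H" using C(1) \<pi>_closed by blast
  obtain \<beta> where \<beta>: "\<beta> \<in> measurable M' (count_space UNIV)" "\<And>y. y \<in> carrier H \<Longrightarrow> \<beta> y < k"
    "\<And>c. c \<in> \<pi> ` {c \<in> C. h c < m} \<Longrightarrow> B.bdd {y \<in> carrier H. \<beta> (B.refl_at c y) = \<beta> y}"
    by (rule B.not_poleE[OF np sub]) (rule that; assumption)
  note [measurable] = M(2,3) \<beta>(1) E(1)
  define U where "U x \<longleftrightarrow> m < h x \<or> h x = m \<and> x \<in> E" for x
  define \<phi> where "\<phi> x = (if U x then k else \<beta> (\<pi> x))" for x
  have [measurable]: "Measurable.pred M U" unfolding U_def by measurable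
  have \<beta>k: "\<beta> (\<pi> x) < k" if "x \<in> carrier G" for x using \<beta>(2) \<pi>_closed that by blast
  show ?thesis
  proof (rule A.not_poleI[of \<phi>])
    show "\<phi> \<in> M \<rightarrow>\<^sub>M count_space UNIV" unfolding \<phi>_def by measurable
    show "\<phi> x < Suc k" if "x \<in> carrier G" for x using \<beta>k[OF that] by (auto simp: \<phi>_def)
    fix c assume c: "c \<in> C" "c \<in> carrier G"
    let ?X = "{x \<in> carrier G. \<phi> (A.refl_at c x) = \<phi> x}"
    have same: "U x \<longleftrightarrow> U (A.refl_at c x)" "\<not> U x \<Longrightarrow> \<beta> (B.refl_at (\<pi> c) (\<pi> x)) = \<beta> (\<pi> x)"
      "h (A.refl_at c x) = 2 * h c - h x" if "x \<in> ?X" for x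
    proof -
      have x: "x \<in> carrier G" "A.refl_at c x \<in> carrier G" using that c by auto
      have eq: "\<phi> (A.refl_at c x) = \<phi> x" using that by simp
      then show "U x \<longleftrightarrow> U (A.refl_at c x)" using \<beta>k[OF x(1)] \<beta>k[OF x(2)] by (auto simp: \<phi>_def split: if_splits)
      then show "\<not> U x \<Longrightarrow> \<beta> (B.refl_at (\<pi> c) (\<pi> x)) = \<beta> (\<pi> x)"
        using eq \<pi>_refl[OF c(2) x(1)] by (auto simp: \<phi>_def split: if_splits)
      show "h (A.refl_at c x) = 2 * h c - h x" by (rule h_refl[OF c(2) x(1)])
    qed
    show "A.bdd ?X"
    proof (cases "h c = m")
      case True
      show ?thesis
      proof (rule coord_bounded_mono[OF E(2)[OF c(1) True]], rule subsetI)
        fix x assume x: "x \<in> ?X"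
        show "x \<in> {x \<in> carrier G. h x = m \<and> (x \<in> E \<longleftrightarrow> A.refl_at c x \<in> E)}"
          using x same(1,3)[OF x] True unfolding U_def by auto
      qed
    next
      case False
      then have cm: "h c < m" using C(2)[OF c(1)] by simp
      have nU: "\<not> U x" "\<not> U (A.refl_at c x)" if "x \<in> ?X" for x
        using same(1,3)[OF that] cm unfolding U_def by auto
      show ?thesis
      proof (rule bdd_lift[where b = "\<bar>m\<bar> + 2 * \<bar>h c\<bar>"])
        have "\<pi> ` ?X \<subseteq> {y \<in> carrier H. \<beta> (B.refl_at (\<pi> c) y) = \<beta> y}"
          using same(2) nU \<pi>_closed by auto
        then show "B.bdd (\<pi> ` ?X)" using \<beta>(3)[of "\<pi> c"] c cm coord_bounded_mono by blast
        show "\<forall>x\<in>?X. \<bar>h x\<bar> \<le> \<bar>m\<bar> + 2 * \<bar>h c\<bar>"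
        proof
          fix x assume x: "x \<in> ?X"
          have "h x \<le> m" "2 * h c - h x \<le> m" using nU[OF x] same(3)[OF x] unfolding U_def by auto
          then show "\<bar>h x\<bar> \<le> \<bar>m\<bar> + 2 * \<bar>h c\<bar>" by linarith
        qed
      qed auto
    qed
  qed
qed

text \<open>For \<open>m\<close> above all values of \<open>h\<close> on \<open>C\<close> the top
  face is empty.\<close>

lemma not_pole_project:
  assumes M: "space M = carrier G" "\<pi> \<in> measurable M M'" "h \<in> borel_measurable M"
    and C: "C \<subseteq> carrier G" "finite C"
    and np: "\<not> B.pole M' k (\<pi> ` C)"
  shows "\<not> A.pole M (Suc k) C"
proof -
  define m where "m = (\<Sum>c\<in>C. \<bar>h c\<bar>) + 1"
  have less: "h c < m" if "c \<in> C" for c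
    using member_le_sum[of c C "\<lambda>c. \<bar>h c\<bar>"] that C(2) by (simp add: m_def)
  then have "{c \<in> C. h c < m} = C" by blast
  then show ?thesis
    using not_pole_drop[OF M C(1), of m "{}" k] less np by fastforce
qed

end

context coord_group
begin

text \<open>Merging two points of a pole gives a smaller pole for one colour less. A pole with a
  single point forces \<open>k = 0\<close>, where the empty set is a pole. The finite set
  \<open>C0\<close> makes the left side a cardinal.\<close>

theorem least_pole_strict:
  fixes H :: "('h, 'e) monoid_scheme"
  assumes H: "coord_group H T' I' f'"
    and M: "space M = carrier G" "\<And>i. i \<in> I \<Longrightarrow> f i \<in> borel_measurable M"
    and merge: "\<And>a b. a \<in> carrier G \<Longrightarrow> b \<in> carrier G \<Longrightarrow> a \<noteq> b \<Longrightarrow>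
      \<exists>\<pi> h. coord_drop G T I f H T' I' f' \<pi> h \<and> \<pi> \<in> measurable M M' \<and> h \<in> borel_measurable M \<and> \<pi> a = \<pi> b"
    and fin: "coord_group.pole H I' f' M' k C0" "finite C0"
  shows "least_card {C. coord_group.pole H I' f' M' k C} <\<^sub>c least_card {C. pole M (Suc k) C}"
proof (rule least_card_less[of C0])
  show "C0 \<in> {C. coord_group.pole H I' f' M' k C}" using fin by simp
  show "finite C0" by (rule fin)
  fix D assume "D \<in> {C. pole M (Suc k) C}" and D: "finite D"
  then have pD: "pole M (Suc k) D" by simp
  then have Dc: "D \<subseteq> carrier G" by (simp add: pole_def)
  have ne: "D \<noteq> {}" using pD not_pole_empty by force
  interpret H: coord_group H T' I' f' by (rule H)
  show "\<exists>C\<in>{C. H.pole M' k C}. finite C \<and> card C < card D"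
  proof (cases "\<exists>a\<in>D. \<exists>b\<in>D. a \<noteq> b")
    case True
    then obtain a b where ab: "a \<in> D" "b \<in> D" "a \<noteq> b" by blast
    obtain \<pi> h where p: "coord_drop G T I f H T' I' f' \<pi> h" "\<pi> \<in> measurable M M'" "h \<in> borel_measurable M"
      "\<pi> a = \<pi> b" using merge[of a b] ab Dc by blast
    interpret coord_drop G T I f H T' I' f' \<pi> h by (rule p)
    have "H.pole M' k (\<pi> ` D)" using not_pole_project[OF M(1) p(2,3) Dc D] pD by blast
    moreover have "card (\<pi> ` D) < card D"
    proof -
      have "\<pi> ` D = insert (\<pi> a) (\<pi> ` (D - {a}))" using ab by blast
      also have "\<dots> = \<pi> ` (D - {a})" unfolding p(4) using ab by (intro insert_absorb imageI) auto
      finally have "\<pi> ` D = \<pi> ` (D - {a})" .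
      then have "card (\<pi> ` D) \<le> card (D - {a})" using card_image_le[of "D - {a}" \<pi>] D by simp
      also have "\<dots> < card D" using ab D by (intro psubset_card_mono) auto
      finally show ?thesis .
    qed
    ultimately show ?thesis using D by blast
  next
    case False
    then obtain c where c: "D = {c}" using ne by blast
    then have "k = 0" using pD not_pole_singleton[OF _ M, of "Suc k" c] by (cases k) auto
    then show ?thesis using H.pole_zero c by (intro bexI[of _ "{}"]) auto
  qed
qed

end

section \<open>Groups separated by their coordinates, and transfer of the two main tools to
  them\<close>

locale coord_space = coord_group +
  assumes nbhd_at: "openin T V \<Longrightarrow> x \<in> V \<Longrightarrow>
      \<exists>J \<epsilon>. finite J \<and> J \<subseteq> I \<and> \<epsilon> > 0 \<and> {y \<in> carrier G. \<forall>i\<in>J. \<bar>f i y - f i x\<bar> < \<epsilon>} \<subseteq> V"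
    and sep: "x \<in> carrier G \<Longrightarrow> y \<in> carrier G \<Longrightarrow> \<forall>i\<in>I. f i x = f i y \<Longrightarrow> x = y"

lemma coord_spaceI:
  fixes G (structure)
  assumes cg: "comm_group G" and top: "topspace T = carrier G"
    and cont: "\<And>i. i \<in> I \<Longrightarrow> continuous_map T euclideanreal (f i)"
    and f_mult: "\<And>i x y. i \<in> I \<Longrightarrow> x \<in> carrier G \<Longrightarrow> y \<in> carrier G \<Longrightarrow> f i (x \<otimes> y) = f i x + f i y"
    and nb: "\<And>V x. openin T V \<Longrightarrow> x \<in> V \<Longrightarrow>
      \<exists>J \<epsilon>. finite J \<and> J \<subseteq> I \<and> \<epsilon> > 0 \<and> {y \<in> carrier G. \<forall>i\<in>J. \<bar>f i y - f i x\<bar> < \<epsilon>} \<subseteq> V"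
    and sep: "\<And>x y. x \<in> carrier G \<Longrightarrow> y \<in> carrier G \<Longrightarrow> \<forall>i\<in>I. f i x = f i y \<Longrightarrow> x = y"
  shows "coord_space G T I f"
proof -
  interpret comm_group G by (rule cg)
  have one: "f i \<one> = 0" if "i \<in> I" for i using f_mult[OF that one_closed one_closed] by simp
  have nb1: "\<exists>J \<epsilon>. finite J \<and> J \<subseteq> I \<and> \<epsilon> > 0 \<and> {x \<in> carrier G. \<forall>i\<in>J. \<bar>f i x\<bar> < \<epsilon>} \<subseteq> V"
    if V: "openin T V" "\<one> \<in> V" for V
  proof -
    from nb[OF V] obtain J \<epsilon> where J: "finite J" "J \<subseteq> I" "\<epsilon> > 0"
      "{y \<in> carrier G. \<forall>i\<in>J. \<bar>f i y - f i \<one>\<bar> < \<epsilon>} \<subseteq> V" by (elim exE conjE)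
    have "\<bar>f i x - f i \<one>\<bar> < \<epsilon> \<longleftrightarrow> \<bar>f i x\<bar> < \<epsilon>" if "i \<in> J" for i x
      using one[of i] J(2) that by auto
    then have "{x \<in> carrier G. \<forall>i\<in>J. \<bar>f i x\<bar> < \<epsilon>} \<subseteq> V" using J(4) by auto
    then show ?thesis using J(1-3) by blast
  qed
  have "coord_group G T I f"
    by (intro coord_group.intro coord_group_axioms.intro cg top cont f_mult nb1)
  then show ?thesis by (intro coord_space.intro coord_space_axioms.intro nb sep)
qed

context coord_space
begin

lemma eq_reflI:
  assumes "c \<in> carrier G" "x \<in> carrier G" "y \<in> carrier G" "\<And>i. i \<in> I \<Longrightarrow> f i y = 2 * f i c - f i x"
  shows "y = refl_at c x"
  by (rule sep) (use assms f_refl in auto)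

lemma continuous_borel:
  assumes "continuous_map T euclideanreal h"
  shows "h \<in> borel_measurable borel_measure"
proof (rule borel_measurableI)
  fix S :: "real set" assume S: "open S"
  have "h -` S \<inter> space borel_measure = {x \<in> topspace T. h x \<in> S}" by (auto simp: top)
  moreover have "openin T \<dots>" using openin_continuous_map_preimage[OF assms] S by simp
  ultimately show "h -` S \<inter> space borel_measure \<in> sets borel_measure"
    unfolding sets_borel_measure borel_sets_of_def by (auto intro: sigma_sets.Basic)
qed

text \<open>If every one of the finitely many centres had a bounded set of agreeing points, one box
  would contain all these sets in the coordinates seen by \<open>emb\<close>; but the sandwich
  theorem yields an agreeing pair outside any given box.\<close>

lemma sandwich_pole:
  fixes emb :: "(nat \<Rightarrow> int) \<Rightarrow> 'a"
  assumes s: "s \<le> int d - 2" "2 * s \<le> int d" and cl: "\<And>w. emb w \<in> carrier G"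
    and z: "\<And>i. i \<in> I \<Longrightarrow> (\<forall>w. f i (emb w) = 0) \<or> (\<exists>j. \<forall>w. f i (emb w) = real_of_int (w j))"
    and e: "\<And>j. j \<le> d \<Longrightarrow> \<exists>i\<in>I. \<forall>w. f i (emb w) = real_of_int (w j)"
  shows "pole M (Suc d) (emb ` sandwich d s)"
  unfolding pole_def
proof (intro conjI allI impI)
  show "emb ` sandwich d s \<subseteq> carrier G" using cl by blast
  fix \<phi> assume \<phi>: "\<phi> \<in> measurable M (count_space UNIV) \<and> (\<forall>x\<in>carrier G. \<phi> x < Suc d)"
  show "\<exists>c\<in>emb ` sandwich d s. \<not> bdd {x \<in> carrier G. \<phi> (refl_at c x) = \<phi> x}"
  proof (rule ccontr)
    assume "\<not> ?thesis"
    then have b: "bdd {x \<in> carrier G. \<phi> (refl_at (emb c) x) = \<phi> x}" if "c \<in> sandwich d s" for c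
      using that by blast
    define U where "U = (\<Union>c\<in>sandwich d s. {x \<in> carrier G. \<phi> (refl_at (emb c) x) = \<phi> x})"
    have bU: "bdd U" unfolding U_def by (rule coord_bounded_UN[OF card_sandwich(1)]) (rule b)
    have "\<forall>j\<in>{..d}. \<exists>i. i \<in> I \<and> (\<forall>w. f i (emb w) = real_of_int (w j))" using e by auto
    then obtain \<iota> where \<iota>: "\<And>j. j \<in> {..d} \<Longrightarrow> \<iota> j \<in> I \<and> (\<forall>w. f (\<iota> j) (emb w) = real_of_int (w j))"
      unfolding bchoice_iff by blast
    have "\<forall>j\<in>{..d}. \<exists>B. \<forall>x\<in>U. \<bar>f (\<iota> j) x\<bar> \<le> B" using bU \<iota> unfolding coord_bounded_def by blast
    then obtain B where B: "\<And>j x. j \<in> {..d} \<Longrightarrow> x \<in> U \<Longrightarrow> \<bar>f (\<iota> j) x\<bar> \<le> B j"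
      unfolding bchoice_iff by blast
    define R0 where "R0 = \<lceil>\<Sum>j\<le>d. \<bar>B j\<bar>\<rceil>"
    have le: "(\<Sum>j\<le>d. \<bar>B j\<bar>) \<le> real_of_int R0" unfolding R0_def by (rule le_of_int_ceiling)
    moreover have "0 \<le> (\<Sum>j\<le>d. \<bar>B j\<bar>)" by (rule sum_nonneg) simp
    ultimately have "0 \<le> real_of_int R0" by linarith
    then have R0: "0 \<le> R0" by simp
    have col: "\<phi> (emb w) < Suc d" for w using \<phi> cl by blast
    obtain c w where cw: "c \<in> sandwich d s" "\<exists>i\<le>d. R0 < \<bar>w i\<bar>" "\<phi> (emb (\<lambda>i. 2 * c i - w i)) = \<phi> (emb w)"
      using sandwich_symmetric_pairs[OF s R0, where \<phi> = "\<lambda>w. \<phi> (emb w)"] col by blast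
    have "emb (\<lambda>i. 2 * c i - w i) = refl_at (emb c) (emb w)"
    proof (rule eq_reflI[OF cl cl cl])
      fix i assume "i \<in> I"
      from z[OF this] show "f i (emb (\<lambda>i. 2 * c i - w i)) = 2 * f i (emb c) - f i (emb w)"
        by (elim disjE exE) simp_all
    qed
    then have "\<phi> (refl_at (emb c) (emb w)) = \<phi> (emb w)" using cw(3) by simp
    then have wU: "emb w \<in> U" unfolding U_def using cw(1) cl by blast
    obtain i where i: "i \<le> d" "R0 < \<bar>w i\<bar>" using cw(2) by blast
    have "\<bar>f (\<iota> i) (emb w)\<bar> \<le> B i" by (rule B[OF _ wU]) (use i in simp)
    moreover have "f (\<iota> i) (emb w) = real_of_int (w i)" using \<iota>[of i] i(1) by simp
    moreover have "\<bar>B i\<bar> \<le> (\<Sum>j\<le>d. \<bar>B j\<bar>)" by (rule member_le_sum) (use i in auto)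
    ultimately have "\<bar>real_of_int (w i)\<bar> \<le> real_of_int R0" using le by linarith
    then have "real_of_int \<bar>w i\<bar> \<le> real_of_int R0" by simp
    then show False using i(2) by linarith
  qed
qed

end

lemma coord_measurable:
  assumes A: "coord_space G T I f" and B: "coord_space H T' J g"
    and cl: "\<And>x. x \<in> carrier G \<Longrightarrow> \<pi> x \<in> carrier H"
    and ct: "\<And>j. j \<in> J \<Longrightarrow> continuous_map T euclideanreal (\<lambda>x. g j (\<pi> x))"
  shows "\<pi> \<in> measurable (coord_group.borel_measure G T) (coord_group.borel_measure H T')"
proof -
  interpret A: coord_space G T I f by (rule A)
  interpret B: coord_space H T' J g by (rule B)
  show ?thesis unfolding B.borel_measure_def
  proof (rule measurable_measure_of)
    show "{U. openin T' U} \<subseteq> Pow (carrier H)" using openin_subset B.top by blast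
    show "\<pi> \<in> space A.borel_measure \<rightarrow> carrier H" using cl by simp
    fix V assume "V \<in> {U. openin T' U}"
    then have V: "openin T' V" by simp
    have "openin T (\<pi> -` V \<inter> carrier G)"
    proof (rule iffD2[OF openin_subopen], intro ballI)
      fix x assume x: "x \<in> \<pi> -` V \<inter> carrier G"
      then have "\<pi> x \<in> V" by simp
      from B.nbhd_at[OF V this] obtain K \<epsilon> where K: "finite K" "K \<subseteq> J" "\<epsilon> > 0"
        "{y \<in> carrier H. \<forall>j\<in>K. \<bar>g j y - g j (\<pi> x)\<bar> < \<epsilon>} \<subseteq> V"
        by (elim exE conjE)
      define U where "U j = {y \<in> carrier G. g j (\<pi> y) \<in> {g j (\<pi> x) - \<epsilon><..<g j (\<pi> x) + \<epsilon>}}" for j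
      have "openin T (U j)" if "j \<in> K" for j
        using openin_continuous_map_preimage[OF ct[of j], of "{g j (\<pi> x) - \<epsilon><..<g j (\<pi> x) + \<epsilon>}"] that K(2)
        unfolding U_def by (auto simp: A.top)
      then have "openin T ((\<Inter>j\<in>K. U j) \<inter> topspace T)" using K(1) by (intro openin_INT) auto
      moreover have "x \<in> (\<Inter>j\<in>K. U j) \<inter> topspace T" using x K(3) by (auto simp: U_def A.top)
      moreover have "(\<Inter>j\<in>K. U j) \<inter> topspace T \<subseteq> \<pi> -` V \<inter> carrier G"
      proof
        fix y assume y: "y \<in> (\<Inter>j\<in>K. U j) \<inter> topspace T"
        then have yG: "y \<in> carrier G" by (simp add: A.top)
        have "\<bar>g j (\<pi> y) - g j (\<pi> x)\<bar> < \<epsilon>" if "j \<in> K" for j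
        proof -
          have "y \<in> U j" using y that by blast
          then show ?thesis unfolding U_def abs_diff_less_iff by auto
        qed
        then show "y \<in> \<pi> -` V \<inter> carrier G" using K(4) cl[OF yG] yG by blast
      qed
      ultimately show "\<exists>U. openin T U \<and> x \<in> U \<and> U \<subseteq> \<pi> -` V \<inter> carrier G" by blast
    qed
    then show "\<pi> -` V \<inter> space A.borel_measure \<in> sets A.borel_measure"
      unfolding A.sets_borel_measure borel_sets_of_def A.space_borel_measure by (auto intro: sigma_sets.Basic)
  qed
qed

lemma (in coord_space) refl_measurable:
  assumes c: "c \<in> carrier G"
  shows "refl_at c \<in> measurable borel_measure borel_measure"
proof (rule coord_measurable[OF coord_space_axioms coord_space_axioms])
  show "refl_at c x \<in> carrier G" if "x \<in> carrier G" for x using that c by simp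
  fix j assume j: "j \<in> I"
  have "continuous_map T euclideanreal (\<lambda>x. 2 * f j c - f j x)"
    by (intro continuous_map_diff cont[OF j]) simp
  then show "continuous_map T euclideanreal (\<lambda>x. f j (refl_at c x))"
    by (rule continuous_map_eq) (use c j f_refl top in auto)
qed

lemma coord_dropI:
  assumes A: "coord_space G T I f" and B: "coord_space H T' J g"
    and cl: "\<And>x. x \<in> carrier G \<Longrightarrow> \<pi> x \<in> carrier H"
    and comb: "\<And>j. j \<in> J \<Longrightarrow> \<exists>\<alpha> \<beta> i i'. i \<in> I \<and> i' \<in> I \<and> (\<forall>x\<in>carrier G. g j (\<pi> x) = \<alpha> * f i x + \<beta> * f i' x)"
    and h: "\<And>c x. c \<in> carrier G \<Longrightarrow> x \<in> carrier G \<Longrightarrow> h (coord_group.refl_at G c x) = 2 * h c - h x"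
    and lift: "\<And>S b. S \<subseteq> carrier G \<Longrightarrow> coord_bounded J g (\<pi> ` S) \<Longrightarrow> \<forall>x\<in>S. \<bar>h x\<bar> \<le> b \<Longrightarrow> coord_bounded I f S"
  shows "coord_drop G T I f H T' J g \<pi> h"
    "\<pi> \<in> measurable (coord_group.borel_measure G T) (coord_group.borel_measure H T')"
proof -
  interpret A: coord_space G T I f by (rule A)
  interpret B: coord_space H T' J g by (rule B)
  have odd: "g j (\<pi> (A.refl_at c x)) = 2 * g j (\<pi> c) - g j (\<pi> x)"
    if j: "j \<in> J" and cx: "c \<in> carrier G" "x \<in> carrier G" for j c x
  proof -
    obtain \<alpha> \<beta> i i' where i: "i \<in> I" "i' \<in> I" "\<And>x. x \<in> carrier G \<Longrightarrow> g j (\<pi> x) = \<alpha> * f i x + \<beta> * f i' x"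
      using comb[OF j] by blast
    show ?thesis
      unfolding i(3)[OF cx(1)] i(3)[OF cx(2)] i(3)[OF A.refl_closed[OF cx]] A.f_refl[OF i(1) cx] A.f_refl[OF i(2) cx]
      by (simp add: algebra_simps)
  qed
  show "coord_drop G T I f H T' J g \<pi> h"
  proof (intro coord_drop.intro coord_drop_axioms.intro A.coord_group_axioms B.coord_group_axioms)
    show "\<pi> (A.refl_at c x) = B.refl_at (\<pi> c) (\<pi> x)" if "c \<in> carrier G" "x \<in> carrier G" for c x
      by (rule B.eq_reflI) (use that cl odd in auto)
  qed (use cl h lift in auto)
  show "\<pi> \<in> measurable A.borel_measure B.borel_measure"
  proof (rule coord_measurable[OF A B cl])
    fix j assume "j \<in> J"
    then obtain \<alpha> \<beta> i i' where i: "i \<in> I" "i' \<in> I" "\<And>x. x \<in> carrier G \<Longrightarrow> g j (\<pi> x) = \<alpha> * f i x + \<beta> * f i' x"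
      using comb by blast
    have "continuous_map T euclideanreal (\<lambda>x. \<alpha> * f i x + \<beta> * f i' x)"
      by (intro continuous_map_add continuous_map_real_mult_left A.cont i)
    then show "continuous_map T euclideanreal (\<lambda>x. g j (\<pi> x))"
      by (rule continuous_map_eq) (use i(3) A.top in auto)
  qed
qed

text \<open>\<open>\<pi>\<close> projects along \<open>a - b\<close> and \<open>f i0\<close> is the
  coordinate it eliminates. Each old coordinate is a combination of \<open>f i0\<close> and one new
  coordinate, so boundedness can be lifted back.\<close>

lemma merge_strict:
  fixes G :: "('a, 'c) monoid_scheme" and H :: "('b, 'd) monoid_scheme"
  assumes A: "coord_space G T I f" and B: "coord_space H T' J g"
    and merge: "\<And>a b. a \<in> carrier G \<Longrightarrow> b \<in> carrier G \<Longrightarrow> a \<noteq> b \<Longrightarrow> \<exists>\<pi> i0. i0 \<in> I \<and> \<pi> a = \<pi> b \<and>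
      (\<forall>x\<in>carrier G. \<pi> x \<in> carrier H) \<and>
      (\<forall>j\<in>J. \<exists>\<alpha> \<beta> i i'. i \<in> I \<and> i' \<in> I \<and> (\<forall>x\<in>carrier G. g j (\<pi> x) = \<alpha> * f i x + \<beta> * f i' x)) \<and>
      (\<forall>i\<in>I. \<exists>\<alpha> \<beta> j. (\<beta> = 0 \<or> j \<in> J) \<and> (\<forall>x\<in>carrier G. f i x = \<alpha> * f i0 x + \<beta> * g j (\<pi> x)))"
    and fin: "finite C0" "\<And>M. coord_group.pole H J g M k C0"
  shows "centerpole_number k H T' <\<^sub>c centerpole_number (Suc k) G T"
    "borel_centerpole_number k H T' <\<^sub>c borel_centerpole_number (Suc k) G T"
proof -
  interpret A: coord_space G T I f by (rule A)
  interpret B: coord_space H T' J g by (rule B)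
  have m: "\<exists>\<pi> h. coord_drop G T I f H T' J g \<pi> h \<and> \<pi> \<in> measurable A.borel_measure B.borel_measure \<and>
      h \<in> borel_measurable A.borel_measure \<and> \<pi> a = \<pi> b"
    if ab: "a \<in> carrier G" "b \<in> carrier G" "a \<noteq> b" for a b
  proof -
    from merge[OF ab] obtain \<pi> i0 where p: "i0 \<in> I" "\<pi> a = \<pi> b" and cl: "\<forall>x\<in>carrier G. \<pi> x \<in> carrier H"
      and comb: "\<forall>j\<in>J. \<exists>\<alpha> \<beta> i i'. i \<in> I \<and> i' \<in> I \<and> (\<forall>x\<in>carrier G. g j (\<pi> x) = \<alpha> * f i x + \<beta> * f i' x)"
      and lift: "\<forall>i\<in>I. \<exists>\<alpha> \<beta> j. (\<beta> = 0 \<or> j \<in> J) \<and> (\<forall>x\<in>carrier G. f i x = \<alpha> * f i0 x + \<beta> * g j (\<pi> x))"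
      by (elim exE conjE)
    have h: "f i0 (A.refl_at c x) = 2 * f i0 c - f i0 x" if "c \<in> carrier G" "x \<in> carrier G" for c x
      by (rule A.f_refl[OF p(1) that])
    have l: "A.bdd S" if S: "S \<subseteq> carrier G" "coord_bounded J g (\<pi> ` S)" "\<forall>x\<in>S. \<bar>f i0 x\<bar> \<le> b" for S b
      unfolding coord_bounded_def
    proof
      fix i assume "i \<in> I"
      from bspec[OF lift this] obtain \<alpha> \<beta> j where j: "\<beta> = 0 \<or> j \<in> J"
        "\<forall>x\<in>carrier G. f i x = \<alpha> * f i0 x + \<beta> * g j (\<pi> x)" by (elim exE conjE)
      have "\<exists>B. \<forall>x\<in>S. \<bar>\<beta> * g j (\<pi> x)\<bar> \<le> B"
      proof (cases "\<beta> = 0")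
        case False
        then obtain B where B: "\<forall>z\<in>\<pi> ` S. \<bar>g j z\<bar> \<le> B" using j(1) S(2) unfolding coord_bounded_def by blast
        have "\<bar>\<beta> * g j (\<pi> x)\<bar> \<le> \<bar>\<beta>\<bar> * B" if "x \<in> S" for x
          unfolding abs_mult using B that by (intro mult_left_mono) auto
        then show ?thesis by blast
      qed auto
      then obtain B where B: "\<forall>x\<in>S. \<bar>\<beta> * g j (\<pi> x)\<bar> \<le> B" by blast
      have "\<bar>f i x\<bar> \<le> \<bar>\<alpha>\<bar> * b + B" if x: "x \<in> S" for x
      proof -
        have "\<bar>\<alpha> * f i0 x\<bar> \<le> \<bar>\<alpha>\<bar> * b" unfolding abs_mult using S(3) x by (intro mult_left_mono) auto
        moreover have "f i x = \<alpha> * f i0 x + \<beta> * g j (\<pi> x)" using j(2) x S(1) by blast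
        moreover have "\<bar>\<beta> * g j (\<pi> x)\<bar> \<le> B" using B x by blast
        ultimately show ?thesis by linarith
      qed
      then show "\<exists>B. \<forall>x\<in>S. \<bar>f i x\<bar> \<le> B" by blast
    qed
    show ?thesis
    proof (intro exI[of _ \<pi>] exI[of _ "f i0"] conjI)
      show "coord_drop G T I f H T' J g \<pi> (f i0)"
        by (rule coord_dropI(1)[OF A B bspec[OF cl] bspec[OF comb] h l])
      show "\<pi> \<in> measurable A.borel_measure B.borel_measure"
        by (rule coord_dropI(2)[OF A B bspec[OF cl] bspec[OF comb] h l])
    qed (use p A.f_borel in auto)
  qed
  have m': "\<exists>\<pi> h. coord_drop G T I f H T' J g \<pi> h \<and> \<pi> \<in> measurable (count_space (carrier G)) (count_space (carrier H)) \<and>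
      h \<in> borel_measurable (count_space (carrier G)) \<and> \<pi> a = \<pi> b"
    if ab: "a \<in> carrier G" "b \<in> carrier G" "a \<noteq> b" for a b
  proof -
    obtain \<pi> h where p: "coord_drop G T I f H T' J g \<pi> h" "\<pi> a = \<pi> b" using m[OF ab] by blast
    then have "\<pi> \<in> carrier G \<rightarrow> carrier H" using coord_drop.\<pi>_closed[OF p(1)] by blast
    then show ?thesis using p by (intro exI[of _ \<pi>] exI[of _ h]) simp
  qed
  show "centerpole_number k H T' <\<^sub>c centerpole_number (Suc k) G T"
    unfolding centerpole_number_def A.centerpole_iff B.centerpole_iff
  proof (rule A.least_pole_strict[OF B.coord_group_axioms, where M' = "count_space (carrier H)"])
    show "B.pole (count_space (carrier H)) k C0" by (rule fin(2))
    show "\<exists>\<pi> h. coord_drop G T I f H T' J g \<pi> h \<and> \<pi> \<in> measurable (count_space (carrier G)) (count_space (carrier H)) \<and>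
      h \<in> borel_measurable (count_space (carrier G)) \<and> \<pi> a = \<pi> b"
      if "a \<in> carrier G" "b \<in> carrier G" "a \<noteq> b" for a b by (rule m'[OF that])
  qed (simp_all add: fin(1))
  show "borel_centerpole_number k H T' <\<^sub>c borel_centerpole_number (Suc k) G T"
    unfolding borel_centerpole_number_def A.borel_centerpole_iff B.borel_centerpole_iff
  proof (rule A.least_pole_strict[OF B.coord_group_axioms, where M' = B.borel_measure])
    show "B.pole B.borel_measure k C0" by (rule fin(2))
    show "\<exists>\<pi> h. coord_drop G T I f H T' J g \<pi> h \<and> \<pi> \<in> measurable A.borel_measure B.borel_measure \<and>
      h \<in> borel_measurable A.borel_measure \<and> \<pi> a = \<pi> b"
      if "a \<in> carrier G" "b \<in> carrier G" "a \<noteq> b" for a b by (rule m[OF that])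
  qed (simp_all add: fin(1) A.f_borel)
qed

lemma coord_space_product:
  fixes G0 :: "'b monoid" and r :: "'b \<Rightarrow> real"
  assumes G0: "comm_group G0" "carrier G0 = UNIV" and r: "\<And>x y. r (x \<otimes>\<^bsub>G0\<^esub> y) = r x + r y" "inj r"
    and X: "topspace X0 = UNIV" "continuous_map X0 euclideanreal r"
      "\<And>U x. openin X0 U \<Longrightarrow> x \<in> U \<Longrightarrow> \<exists>\<epsilon>>0. \<forall>y. \<bar>r y - r x\<bar> < \<epsilon> \<longrightarrow> y \<in> U"
  shows "coord_space (product_group I (\<lambda>_. G0)) (product_topology (\<lambda>_. X0) I) I (\<lambda>i x. r (x i))"
proof (rule coord_spaceI)
  interpret G0: comm_group G0 by (rule G0)
  have gp: "group (product_group I (\<lambda>_. G0))" by (rule product_group) (rule G0.group_axioms)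
  show "comm_group (product_group I (\<lambda>_. G0))"
    by (rule group.group_comm_groupI[OF gp]) (simp add: G0.m_comm G0(2))
  show "topspace (product_topology (\<lambda>_. X0) I) = carrier (product_group I (\<lambda>_. G0))"
    by (simp add: X(1) G0(2))
  show "continuous_map (product_topology (\<lambda>_. X0) I) euclideanreal (\<lambda>x. r (x i))" if "i \<in> I" for i
    using continuous_map_compose[OF continuous_map_product_projection[OF that] X(2)] by (simp add: o_def)
  show "r ((x \<otimes>\<^bsub>product_group I (\<lambda>_. G0)\<^esub> y) i) = r (x i) + r (y i)" if "i \<in> I" for i x y
    using that by (simp add: r(1))
  show "x = y" if "x \<in> carrier (product_group I (\<lambda>_. G0))" "y \<in> carrier (product_group I (\<lambda>_. G0))"
    "\<forall>i\<in>I. r (x i) = r (y i)" for x y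
    using that r(2) by (intro PiE_ext[of x I "\<lambda>_. UNIV" y]) (auto simp: G0(2) dest: injD)
  fix V x assume V: "openin (product_topology (\<lambda>_. X0) I) V" "x \<in> V"
  obtain Y where Y: "x \<in> (\<Pi>\<^sub>E i\<in>I. Y i)" "\<And>i. openin X0 (Y i)" "finite {i. Y i \<noteq> topspace X0}" "(\<Pi>\<^sub>E i\<in>I. Y i) \<subseteq> V"
    using product_topology_open_contains_basis[OF V] by blast
  define K where "K = {i \<in> I. Y i \<noteq> UNIV}"
  have K: "finite K" "K \<subseteq> I" using Y(3) X(1) unfolding K_def by (auto intro: finite_subset[rotated])
  have "\<forall>i\<in>K. \<exists>\<epsilon>. \<epsilon> > 0 \<and> (\<forall>y. \<bar>r y - r (x i)\<bar> < \<epsilon> \<longrightarrow> y \<in> Y i)"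
    using X(3)[OF Y(2)] Y(1) K(2) by blast
  then obtain e where e: "\<And>i. i \<in> K \<Longrightarrow> e i > 0 \<and> (\<forall>y. \<bar>r y - r (x i)\<bar> < e i \<longrightarrow> y \<in> Y i)"
    unfolding bchoice_iff by blast
  define \<epsilon> where "\<epsilon> = Min (insert 1 (e ` K))"
  have "\<epsilon> \<in> insert 1 (e ` K)" unfolding \<epsilon>_def using K(1) by (intro Min_in) auto
  then have pos: "\<epsilon> > 0" using e by auto
  have le: "\<epsilon> \<le> e i" if "i \<in> K" for i unfolding \<epsilon>_def using K(1) that by (intro Min_le) auto
  have "{y \<in> carrier (product_group I (\<lambda>_. G0)). \<forall>i\<in>K. \<bar>r (y i) - r (x i)\<bar> < \<epsilon>} \<subseteq> V"
  proof
    fix y assume y: "y \<in> {y \<in> carrier (product_group I (\<lambda>_. G0)). \<forall>i\<in>K. \<bar>r (y i) - r (x i)\<bar> < \<epsilon>}"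
    have "y i \<in> Y i" if "i \<in> I" for i
    proof (cases "i \<in> K")
      case True
      then have "\<bar>r (y i) - r (x i)\<bar> < e i" using y le[OF True] by fastforce
      then show ?thesis using e[OF True] by blast
    qed (use that K_def in auto)
    moreover have "y \<in> extensional I" using y by (simp add: PiE_def)
    ultimately show "y \<in> V" using Y(4) by (auto simp: PiE_def)
  qed
  then show "\<exists>J \<epsilon>. finite J \<and> J \<subseteq> I \<and> \<epsilon> > 0 \<and>
      {y \<in> carrier (product_group I (\<lambda>_. G0)). \<forall>i\<in>J. \<bar>r (y i) - r (x i)\<bar> < \<epsilon>} \<subseteq> V"
    using K pos by blast
qed

text \<open>Both index sets consist of natural numbers, so the coordinates are interleaved: even
  indices for the first factor, odd ones for the second.\<close>

lemma coord_space_prod: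
  assumes A: "coord_space G T I f" and B: "coord_space H T' J g"
  shows "coord_space (G \<times>\<times> H) (prod_topology T T') {i. if even i then i div 2 \<in> I else i div 2 \<in> J}
    (\<lambda>i x. if even i then f (i div 2) (fst x) else g (i div 2) (snd x))"
proof (rule coord_spaceI)
  interpret A: coord_space G T I f by (rule A)
  interpret B: coord_space H T' J g by (rule B)
  let ?I = "{i. if even i then i div 2 \<in> I else i div 2 \<in> J}"
  let ?f = "\<lambda>i x. if even i then f (i div 2) (fst x) else g (i div 2) (snd x)"
  have gp: "group (G \<times>\<times> H)" by (rule DirProd_group[OF A.group_axioms B.group_axioms])
  show "comm_group (G \<times>\<times> H)"
    by (rule group.group_comm_groupI[OF gp]) (auto simp: A.m_comm B.m_comm)
  show "topspace (prod_topology T T') = carrier (G \<times>\<times> H)" by (simp add: A.top B.top)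
  show "continuous_map (prod_topology T T') euclideanreal (?f i)" if "i \<in> ?I" for i
  proof (cases "even i")
    case True
    then have "continuous_map T euclideanreal (f (i div 2))" using that by (intro A.cont) auto
    from continuous_map_compose[OF continuous_map_fst this] True show ?thesis by (simp add: o_def)
  next
    case False
    then have "continuous_map T' euclideanreal (g (i div 2))" using that by (intro B.cont) auto
    from continuous_map_compose[OF continuous_map_snd this] False show ?thesis by (simp add: o_def)
  qed
  show "?f i (x \<otimes>\<^bsub>G \<times>\<times> H\<^esub> y) = ?f i x + ?f i y"
    if "i \<in> ?I" "x \<in> carrier (G \<times>\<times> H)" "y \<in> carrier (G \<times>\<times> H)" for i x y
    using that by (cases "even i") (auto simp: mult_DirProd' A.f_mult B.f_mult mem_Times_iff)
  show "x = y" if xy: "x \<in> carrier (G \<times>\<times> H)" "y \<in> carrier (G \<times>\<times> H)" and eq: "\<forall>i\<in>?I. ?f i x = ?f i y" for x y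
  proof (rule prod_eqI)
    have "f i (fst x) = f i (fst y)" if "i \<in> I" for i using bspec[OF eq, of "2 * i"] that by simp
    then show "fst x = fst y" using xy by (intro A.sep) (auto simp: mem_Times_iff)
    have "g i (snd x) = g i (snd y)" if "i \<in> J" for i using bspec[OF eq, of "Suc (2 * i)"] that by simp
    then show "snd x = snd y" using xy by (intro B.sep) (auto simp: mem_Times_iff)
  qed
  fix V x assume V: "openin (prod_topology T T') V" "x \<in> V"
  then obtain U1 U2 where U: "openin T U1" "openin T' U2" "fst x \<in> U1" "snd x \<in> U2" "U1 \<times> U2 \<subseteq> V"
    unfolding openin_prod_topology_alt by (metis prod.collapse)
  from A.nbhd_at[OF U(1,3)] obtain K1 e1 where 1: "finite K1" "K1 \<subseteq> I" "e1 > 0" "{y \<in> carrier G. \<forall>i\<in>K1. \<bar>f i y - f i (fst x)\<bar> < e1} \<subseteq> U1"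
    by (elim exE conjE)
  from B.nbhd_at[OF U(2,4)] obtain K2 e2 where 2: "finite K2" "K2 \<subseteq> J" "e2 > 0" "{y \<in> carrier H. \<forall>i\<in>K2. \<bar>g i y - g i (snd x)\<bar> < e2} \<subseteq> U2"
    by (elim exE conjE)
  define K where "K = (\<lambda>i. 2 * i) ` K1 \<union> (\<lambda>i. Suc (2 * i)) ` K2"
  have "{y \<in> carrier (G \<times>\<times> H). \<forall>i\<in>K. \<bar>?f i y - ?f i x\<bar> < min e1 e2} \<subseteq> V"
  proof
    fix y assume y: "y \<in> {y \<in> carrier (G \<times>\<times> H). \<forall>i\<in>K. \<bar>?f i y - ?f i x\<bar> < min e1 e2}"
    then have k: "\<And>i. i \<in> K \<Longrightarrow> \<bar>?f i y - ?f i x\<bar> < min e1 e2" and yc: "fst y \<in> carrier G" "snd y \<in> carrier H"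
      by (auto simp: mem_Times_iff)
    have "\<bar>f i (fst y) - f i (fst x)\<bar> < e1" if "i \<in> K1" for i using k[of "2 * i"] that by (simp add: K_def)
    moreover have "\<bar>g i (snd y) - g i (snd x)\<bar> < e2" if "i \<in> K2" for i
      using k[of "Suc (2 * i)"] that by (simp add: K_def)
    ultimately have "fst y \<in> U1" "snd y \<in> U2" using 1(4) 2(4) yc by blast+
    then show "y \<in> V" using U(5) by (metis mem_Sigma_iff prod.collapse subsetD)
  qed
  moreover have "finite K" "K \<subseteq> ?I" "min e1 e2 > 0" using 1 2 by (auto simp: K_def)
  ultimately show "\<exists>J \<epsilon>. finite J \<and> J \<subseteq> ?I \<and> \<epsilon> > 0 \<and>
      {y \<in> carrier (G \<times>\<times> H). \<forall>i\<in>J. \<bar>?f i y - ?f i x\<bar> < \<epsilon>} \<subseteq> V" by blast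
qed

section \<open>Colorings from nested faces\<close>

text \<open>\<open>m\<close> need only be an upper bound, so a functional may also remove
  nothing.\<close>

fun peel :: "('a \<Rightarrow> real) list \<Rightarrow> 'a set \<Rightarrow> bool" where
  "peel [] C \<longleftrightarrow> C = {}"
| "peel (h # hs) C \<longleftrightarrow> (\<exists>m. (\<forall>c\<in>C. h c \<le> m) \<and> peel hs {c \<in> C. h c < m})"

definition list_bounded :: "('a \<Rightarrow> real) list \<Rightarrow> 'a set \<Rightarrow> bool" where
  "list_bounded us S \<longleftrightarrow> (\<forall>h\<in>set us. \<exists>B. \<forall>x\<in>S. \<bar>h x\<bar> \<le> B)"

lemma list_bounded_eq: "list_bounded us S \<longleftrightarrow> coord_bounded (set us) (\<lambda>h. h) S"
  by (simp add: list_bounded_def coord_bounded_def)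

lemma list_bounded_mono: "list_bounded us S \<Longrightarrow> S' \<subseteq> S \<Longrightarrow> list_bounded us S'"
  unfolding list_bounded_eq by (rule coord_bounded_mono)

lemma list_bounded_Un: "list_bounded us S \<Longrightarrow> list_bounded us S' \<Longrightarrow> list_bounded us (S \<union> S')"
  unfolding list_bounded_eq by (rule coord_bounded_Un)

lemma list_bounded_UN:
  "finite K \<Longrightarrow> (\<And>j. j \<in> K \<Longrightarrow> list_bounded us (S j)) \<Longrightarrow> list_bounded us (\<Union>j\<in>K. S j)"
  unfolding list_bounded_eq by (rule coord_bounded_UN)

lemma list_bounded_Cons:
  "list_bounded (h # us) S \<longleftrightarrow> (\<exists>B. \<forall>x\<in>S. \<bar>h x\<bar> \<le> B) \<and> list_bounded us S"
  by (simp add: list_bounded_def)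

context coord_group
begin

definition odd_fn :: "('a \<Rightarrow> real) \<Rightarrow> bool" where
  "odd_fn h \<longleftrightarrow> (\<forall>c\<in>carrier G. \<forall>x\<in>carrier G. h (refl_at c x) = 2 * h c - h x)"

lemma list_bounded_refl:
  assumes "\<And>h. h \<in> set us \<Longrightarrow> odd_fn h" "c \<in> carrier G" "S \<subseteq> carrier G" "list_bounded us S"
  shows "list_bounded us (refl_at c ` S)"
  unfolding list_bounded_def
proof
  fix h assume h: "h \<in> set us"
  then obtain B where B: "\<forall>x\<in>S. \<bar>h x\<bar> \<le> B" using assms(4) by (auto simp: list_bounded_def)
  have "\<bar>h (refl_at c x)\<bar> \<le> 2 * \<bar>h c\<bar> + B" if "x \<in> S" for x
  proof -
    have "h (refl_at c x) = 2 * h c - h x" using assms(1)[OF h] assms(2,3) that by (auto simp: odd_fn_def)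
    then show ?thesis using bspec[OF B that] by linarith
  qed
  then show "\<exists>B. \<forall>x\<in>refl_at c ` S. \<bar>h x\<bar> \<le> B" by blast
qed

text \<open>The auxiliary colouring \<open>\<psi>\<close> uses one colour more than \<open>\<beta>\<close>; it is free of symmetric
  unbounded sets for all centres in \<open>F\<close>, and it colours the hyperplane in which the next
  function attains its maximum. The set of points where it agrees with a reflection of \<open>\<beta>\<close> must be
  free of symmetric unbounded sets as well.\<close>

definition coloring_pair ::
  "'a measure \<Rightarrow> 'a set \<Rightarrow> ('a \<Rightarrow> real) list \<Rightarrow> nat \<Rightarrow> 'a set \<Rightarrow> ('a \<Rightarrow> nat) \<Rightarrow> ('a \<Rightarrow> nat) \<Rightarrow> bool" where
  "coloring_pair M F us k K \<beta> \<psi> \<longleftrightarrow>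
    \<beta> \<in> measurable M (count_space UNIV) \<and> \<psi> \<in> measurable M (count_space UNIV) \<and>
    (\<forall>x\<in>carrier G. \<beta> x < k) \<and> (\<forall>x\<in>carrier G. \<psi> x < Suc k) \<and>
    (\<forall>c\<in>K. list_bounded us {x \<in> carrier G. \<beta> (refl_at c x) = \<beta> x}) \<and>
    (\<forall>c\<in>F. list_bounded us {x \<in> carrier G. \<psi> (refl_at c x) = \<psi> x}) \<and>
    (\<forall>c\<in>K. list_bounded us {x \<in> carrier G. \<psi> x = \<beta> (refl_at c x)}) \<and>
    (\<forall>c\<in>F. list_bounded us {x \<in> carrier G. (\<exists>d\<in>F. \<psi> x = \<beta> (refl_at d x)) \<and>
        (\<exists>d\<in>F. \<psi> (refl_at c x) = \<beta> (refl_at d (refl_at c x)))})"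

text \<open>The list is built up from its last functional. Below the hyperplane \<open>h = m\<close>
  the colouring \<open>\<beta>\<close> is kept, above it there is a new colour, and on it
  \<open>\<psi>\<close> is used, since the centres of the hyperplane reflect it to itself. The work
  is to provide an auxiliary colouring for the next step, with one colour more again.\<close>

lemma peel_coloring:
  assumes "\<And>h. h \<in> set (hs @ [g]) \<Longrightarrow> h \<in> borel_measurable M \<and> odd_fn h"
    and sp: "space M = carrier G" and rm: "\<And>c. c \<in> F \<Longrightarrow> refl_at c \<in> measurable M M"
    and F: "finite F" "F \<subseteq> carrier G" and "K \<subseteq> F" and "peel hs K"
  shows "\<exists>\<beta> \<psi>. coloring_pair M F (hs @ [g]) (Suc (length hs)) K \<beta> \<psi>"
  using assms(1,6,7)
proof (induction hs arbitrary: K)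
  case Nil
  have [measurable]: "g \<in> borel_measurable M" and og: "odd_fn g" using Nil by auto
  have g: "g (refl_at c x) = 2 * g c - g x" if "c \<in> F" "x \<in> carrier G" for c x
    using og F that unfolding odd_fn_def by blast
  \<comment> \<open>No centres are left at this end, so \<open>\<beta>\<close> may be constant,
    while \<open>\<psi>\<close> separates the two sides of \<open>g\<close>.\<close>
  define \<psi> :: "'a \<Rightarrow> nat" where "\<psi> x = (if g x > 0 then 1 else 0)" for x
  have m: "\<psi> \<in> measurable M (count_space UNIV)" unfolding \<psi>_def by measurable
  have a: "list_bounded [g] {x \<in> carrier G. \<psi> (refl_at c x) = \<psi> x}" if c: "c \<in> F" for c
    unfolding list_bounded_Cons
  proof (intro conjI exI ballI)
    fix x assume "x \<in> {x \<in> carrier G. \<psi> (refl_at c x) = \<psi> x}"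
    then show "\<bar>g x\<bar> \<le> 2 * \<bar>g c\<bar>" using g[OF c] by (auto simp: \<psi>_def split: if_splits)
  qed (simp add: list_bounded_def)
  have z: "list_bounded [g] {x \<in> carrier G. (\<exists>d\<in>F. \<psi> x = 0) \<and> (\<exists>d\<in>F. \<psi> (refl_at c x) = 0)}" if c: "c \<in> F" for c
    by (rule list_bounded_mono[OF a[OF c]]) auto
  have "coloring_pair M F [g] 1 K (\<lambda>_. 0) \<psi>"
    unfolding coloring_pair_def using Nil(3) m a z by (auto simp: \<psi>_def)
  then show ?case by auto
next
  case (Cons h hs)
  let ?us = "hs @ [g]" and ?kk = "Suc (length hs)"
  have [measurable]: "h \<in> borel_measurable M" and oh: "odd_fn h" using Cons.prems(1)[of h] by auto
  obtain m where m: "\<forall>c\<in>K. h c \<le> m" and pl: "peel hs {c \<in> K. h c < m}" using Cons.prems(3) by auto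
  have KF: "K \<subseteq> F" by (rule Cons.prems(2))
  then have sub: "{c \<in> K. h c < m} \<subseteq> F" by blast
  have us: "f' \<in> borel_measurable M \<and> odd_fn f'" if "f' \<in> set ?us" for f'
    using Cons.prems(1)[of f'] that by auto
  from Cons.IH[OF us sub pl] obtain \<beta> \<psi> where "coloring_pair M F ?us ?kk {c \<in> K. h c < m} \<beta> \<psi>" by blast
  then have [measurable]: "\<beta> \<in> measurable M (count_space UNIV)" "\<psi> \<in> measurable M (count_space UNIV)"
    and \<beta>k: "\<And>x. x \<in> carrier G \<Longrightarrow> \<beta> x < ?kk" and \<psi>k: "\<And>x. x \<in> carrier G \<Longrightarrow> \<psi> x < Suc ?kk"
    and good: "\<And>c. c \<in> {c \<in> K. h c < m} \<Longrightarrow> list_bounded ?us {x \<in> carrier G. \<beta> (refl_at c x) = \<beta> x}"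
    and psym: "\<And>c. c \<in> F \<Longrightarrow> list_bounded ?us {x \<in> carrier G. \<psi> (refl_at c x) = \<psi> x}"
    and cross: "\<And>c. c \<in> {c \<in> K. h c < m} \<Longrightarrow> list_bounded ?us {x \<in> carrier G. \<psi> x = \<beta> (refl_at c x)}"
    and Zsym: "\<And>c. c \<in> F \<Longrightarrow> list_bounded ?us {x \<in> carrier G. (\<exists>d\<in>F. \<psi> x = \<beta> (refl_at d x)) \<and>
        (\<exists>d\<in>F. \<psi> (refl_at c x) = \<beta> (refl_at d (refl_at c x)))}"
    unfolding coloring_pair_def by blast+
  have cG: "c \<in> carrier G" if "c \<in> F" for c using that F by blast
  have hr: "h (refl_at c x) = 2 * h c - h x" if "c \<in> F" "x \<in> carrier G" for c x
    using oh cG that unfolding odd_fn_def by blast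
  have r: "refl_at c x \<in> carrier G" and rr: "refl_at c (refl_at c x) = x" if "c \<in> F" "x \<in> carrier G" for c x
    using refl_closed refl_refl cG that by blast+
  define Z where "Z x \<longleftrightarrow> (\<exists>d\<in>F. \<psi> x = \<beta> (refl_at d x))" for x
  define s where "s = (\<Sum>c\<in>F. \<bar>h c\<bar>)"
  have s: "\<bar>h c\<bar> \<le> s" if "c \<in> F" for c unfolding s_def by (rule member_le_sum) (use that F in auto)
  have s0: "s \<ge> 0" unfolding s_def by (simp add: sum_nonneg)
  \<comment> \<open>Reflection about any centre takes points with \<open>h x > V\<close> below
    \<open>m\<close>, where colour \<open>?kk\<close> does not occur in \<open>\<psi>'\<close>. So
    if \<open>\<psi>'\<close> has value \<open>?kk\<close> both at a point and at its reflection,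
    both lie in \<open>Z\<close> and in a bounded range of \<open>h\<close>.\<close>
  define V where "V = \<bar>m\<bar> + 2 * s + 1"
  have Vm: "V > m" unfolding V_def using s0 by linarith
  have Vc: "2 * h c - V < m" if "c \<in> F" for c unfolding V_def using s[OF that] by linarith
  define \<beta>' where "\<beta>' x = (if h x > m then ?kk else if h x = m then \<psi> x else \<beta> x)" for x
  \<comment> \<open>The old value \<open>?kk\<close> of \<open>\<psi>\<close> becomes the new colour
    \<open>Suc ?kk\<close> up to \<open>V\<close>, which frees \<open>?kk\<close>. That colour is
    used beyond \<open>V\<close>, to bound \<open>h\<close>, and on \<open>Z\<close> above the
    plane, where the value of \<open>\<psi>\<close> could agree with \<open>\<beta>\<close> at a
    reflected point. It occurs only above the plane, so through a centre with
    \<open>h c \<le> m\<close> it never meets the colour \<open>?kk\<close> of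
    \<open>\<beta>'\<close>.\<close>
  define \<psi>' where "\<psi>' x = (if h x > V then ?kk else if \<psi> x = ?kk then Suc ?kk
      else if h x > m \<and> Z x then ?kk else \<psi> x)" for x
  have [measurable]: "Measurable.pred M Z"
    unfolding Z_def
  proof (rule pred_intros_finite(4)[OF F(1)])
    fix d assume "d \<in> F"
    then have [measurable]: "(\<lambda>x. \<beta> (refl_at d x)) \<in> measurable M (count_space UNIV)"
      by (intro measurable_compose[OF rm]) simp_all
    have "Measurable.pred M (\<lambda>x. \<exists>n. \<psi> x = n \<and> \<beta> (refl_at d x) = n)" by measurable
    then show "Measurable.pred M (\<lambda>x. \<psi> x = \<beta> (refl_at d x))" by (simp add: eq_commute)
  qed
  have \<beta>'_high: "\<beta>' x = ?kk" if "h x > m" for x using that by (simp add: \<beta>'_def)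
  have \<beta>'_mid: "\<beta>' x = \<psi> x" if "h x = m" for x using that by (simp add: \<beta>'_def)
  have \<beta>'_low: "\<beta>' x = \<beta> x" "\<beta>' x < ?kk" if "x \<in> carrier G" "h x < m" for x
    using that \<beta>k by (simp_all add: \<beta>'_def)
  have \<beta>'_le: "\<beta>' x \<le> ?kk" if "x \<in> carrier G" for x
    using \<beta>k[OF that] \<psi>k[OF that] by (auto simp: \<beta>'_def)
  have \<psi>'_kk: "h x > m \<and> (h x \<le> V \<longrightarrow> Z x)" if "x \<in> carrier G" "\<psi>' x = ?kk" for x
    using that Vm by (auto simp: \<psi>'_def split: if_splits)
  have \<psi>'_other: "h x \<le> V" "\<psi>' x < ?kk \<Longrightarrow> \<psi> x = \<psi>' x" "\<psi>' x < ?kk \<Longrightarrow> Z x \<Longrightarrow> h x \<le> m"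
      "\<not> \<psi>' x < ?kk \<Longrightarrow> \<psi> x = ?kk" if "x \<in> carrier G" "\<psi>' x \<noteq> ?kk" for x
    using that \<psi>k[OF that(1)] by (auto simp: \<psi>'_def split: if_splits)
  define A where "A c = {x \<in> carrier G. \<psi> (refl_at c x) = \<psi> x}" for c
  define ZZ where "ZZ c = {x \<in> carrier G. Z x \<and> Z (refl_at c x)}" for c
  define X where "X c = {x \<in> carrier G. \<psi> x = \<beta> (refl_at c x)}" for c
  have A: "list_bounded ?us (A c)" and ZZ: "list_bounded ?us (ZZ c)" if "c \<in> F" for c
    unfolding A_def ZZ_def Z_def using psym[OF that] Zsym[OF that] by simp_all
  have X: "list_bounded ?us (X c)" if "c \<in> K" "h c < m" for c
    unfolding X_def using cross that by simp
  have rb: "list_bounded ?us (refl_at c ` S)" if "list_bounded ?us S" "S \<subseteq> carrier G" "c \<in> F" for c S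
    by (rule list_bounded_refl[OF _ cG[OF that(3)] that(2,1)]) (use us in blast)
  define b where "b = V + 2 * s + \<bar>m\<bar>"
  have bddI: "list_bounded (h # ?us) S" if "list_bounded ?us S'" "\<And>x. x \<in> S \<Longrightarrow> x \<in> S' \<and> \<bar>h x\<bar> \<le> b" for S S'
    unfolding list_bounded_Cons using that list_bounded_mono[of ?us S' S] by blast
  \<comment> \<open>The three ways of agreement, according to whether the reflected point is above,
    on or below the plane. The first requires \<open>m < h c\<close> and is impossible for centres
    in \<open>K\<close>; in the third, \<open>Z\<close> has been recoloured above the plane, so
    \<open>h x\<close> is at most \<open>m\<close>.\<close>
  have cmp: "m < h x \<and> h x \<le> V \<and> Z x \<and> m < h c \<or> h x = 2 * h c - m \<and> x \<in> A c
      \<or> 2 * h c - m < h x \<and> h x \<le> m \<and> Z x \<and> x \<in> X c"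
    if c: "c \<in> F" and x: "x \<in> carrier G" and eq: "\<psi>' x = \<beta>' (refl_at c x)" for c x
  proof (cases "\<psi>' x = ?kk")
    case True
    have "\<not> h (refl_at c x) < m" using \<beta>'_low(2)[OF r[OF c x]] eq True by auto
    then have 1: "2 * h c - h x \<ge> m" using hr[OF c x] by simp
    have 2: "h x > m" "h x \<le> V \<longrightarrow> Z x" using \<psi>'_kk[OF x True] by blast+
    have "h x \<le> V" using 1 Vc[OF c] by linarith
    then show ?thesis using 1 2 by auto
  next
    case False
    have lt: "\<psi>' x < ?kk" using eq \<beta>'_le[OF r[OF c x]] False by simp
    note o = \<psi>'_other(1)[OF x False] \<psi>'_other(2,3)[OF x False lt]
    have hle: "h (refl_at c x) \<le> m" using \<beta>'_high[of "refl_at c x"] eq lt by force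
    show ?thesis
    proof (cases "h (refl_at c x) = m")
      case True
      then have "x \<in> A c" using \<beta>'_mid[OF True] eq o(2) x by (simp add: A_def)
      then show ?thesis using True hr[OF c x] by auto
    next
      case False
      then have "h (refl_at c x) < m" using hle by simp
      then have "\<psi> x = \<beta> (refl_at c x)" "2 * h c - m < h x"
        using \<beta>'_low(1)[OF r[OF c x]] eq o(2) hr[OF c x] by auto
      moreover from this have "Z x" unfolding Z_def using c by blast
      ultimately show ?thesis using o(3) x by (auto simp: X_def)
    qed
  qed
  have cmpb: "\<bar>h x\<bar> \<le> b" if "c \<in> F" "x \<in> carrier G" "\<psi>' x = \<beta>' (refl_at c x)" for c x
  proof -
    have "V \<ge> \<bar>m\<bar>" unfolding V_def using s0 by linarith
    then show ?thesis using cmp[OF that] s[OF that(1)] s0 unfolding b_def by (elim disjE conjE) linarith+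
  qed
  have Vmm: "V \<ge> \<bar>m\<bar>" unfolding V_def using s0 by linarith
  have "coloring_pair M F (h # ?us) (Suc ?kk) K \<beta>' \<psi>'"
    unfolding coloring_pair_def
  proof (intro conjI ballI)
    show "\<beta>' \<in> M \<rightarrow>\<^sub>M count_space UNIV" unfolding \<beta>'_def by measurable
    show "\<psi>' \<in> M \<rightarrow>\<^sub>M count_space UNIV" unfolding \<psi>'_def by measurable
    show "\<beta>' x < Suc ?kk" if "x \<in> carrier G" for x using \<beta>'_le[OF that] by simp
    show "\<psi>' x < Suc (Suc ?kk)" if "x \<in> carrier G" for x using \<psi>k[OF that] by (auto simp: \<psi>'_def)
  next
    fix c assume cK: "c \<in> K"
    then have c: "c \<in> F" and hc: "h c \<le> m" using KF m by auto
    define Y where "Y = (if h c < m then X c \<union> refl_at c ` X c \<union> {x \<in> carrier G. \<beta> (refl_at c x) = \<beta> x} else {})"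
    have "list_bounded ?us Y"
    proof (cases "h c < m")
      case True
      have "X c \<subseteq> carrier G" by (auto simp: X_def)
      then have "list_bounded ?us (refl_at c ` X c)" by (intro rb X cK True c)
      moreover have "c \<in> {c \<in> K. h c < m}" using True cK by simp
      ultimately show ?thesis
        unfolding Y_def if_P[OF True] by (intro list_bounded_Un X[OF cK True] good)
    qed (simp add: Y_def list_bounded_def)
    then have AY: "list_bounded ?us (A c \<union> Y)" using A[OF c] by (intro list_bounded_Un)
    show "list_bounded (h # ?us) {x \<in> carrier G. \<beta>' (refl_at c x) = \<beta>' x}"
    proof (rule bddI[OF AY])
      fix x assume "x \<in> {x \<in> carrier G. \<beta>' (refl_at c x) = \<beta>' x}"
      then have x: "x \<in> carrier G" and eq: "\<beta>' (refl_at c x) = \<beta>' x" by auto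
      note rx = r[OF c x] and h2 = hr[OF c x]
      have hx: "h x \<le> m"
      proof (rule ccontr)
        assume "\<not> h x \<le> m"
        then have "h (refl_at c x) < m" "h x > m" using h2 hc by auto
        then show False using \<beta>'_high[of x] \<beta>'_low(2)[OF rx] eq by simp
      qed
      have hrx: "h (refl_at c x) \<le> m"
      proof (rule ccontr)
        assume "\<not> h (refl_at c x) \<le> m"
        then have "h x < m" "h (refl_at c x) > m" using h2 hc by auto
        then show False using \<beta>'_high[of "refl_at c x"] \<beta>'_low(2)[OF x] eq by simp
      qed
      have "x \<in> A c \<union> Y"
      proof (cases "h x = m")
        case hm: True
        show ?thesis
        proof (cases "h (refl_at c x) = m")
          case True
          then show ?thesis using \<beta>'_mid[OF hm] \<beta>'_mid[OF True] eq x by (simp add: A_def)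
        next
          case False
          then have l: "h (refl_at c x) < m" using hrx by simp
          then have "h c < m" using h2 hm by linarith
          moreover have "x \<in> X c" using \<beta>'_mid[OF hm] \<beta>'_low(1)[OF rx l] eq x by (simp add: X_def)
          ultimately show ?thesis by (simp add: Y_def)
        qed
      next
        case False
        then have hl: "h x < m" using hx by simp
        then have hcm: "h c < m" using h2 hrx by linarith
        show ?thesis
        proof (cases "h (refl_at c x) = m")
          case True
          then have "refl_at c x \<in> X c" using \<beta>'_mid[OF True] \<beta>'_low(1)[OF x hl] eq rx rr[OF c x] by (simp add: X_def)
          then have "refl_at c (refl_at c x) \<in> refl_at c ` X c" by (rule imageI)
          then show ?thesis using hcm rr[OF c x] by (simp add: Y_def)
        next
          case False
          then have "h (refl_at c x) < m" using hrx by simp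
          then have "\<beta> (refl_at c x) = \<beta> x" using \<beta>'_low(1)[OF rx] \<beta>'_low(1)[OF x hl] eq by simp
          then show ?thesis using hcm x by (simp add: Y_def)
        qed
      qed
      moreover have "\<bar>h x\<bar> \<le> b" using hx hrx h2 s[OF c] s0 Vmm unfolding b_def by linarith
      ultimately show "x \<in> A c \<union> Y \<and> \<bar>h x\<bar> \<le> b" by blast
    qed
    show "list_bounded (h # ?us) {x \<in> carrier G. \<psi>' x = \<beta>' (refl_at c x)}"
    proof (rule bddI[OF AY])
      fix x assume "x \<in> {x \<in> carrier G. \<psi>' x = \<beta>' (refl_at c x)}"
      then have x: "x \<in> carrier G" "\<psi>' x = \<beta>' (refl_at c x)" by auto
      have "x \<in> A c \<union> Y" using cmp[OF c x] hc unfolding Y_def by auto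
      then show "x \<in> A c \<union> Y \<and> \<bar>h x\<bar> \<le> b" using cmpb[OF c x] by blast
    qed
  next
    fix c assume c: "c \<in> F"
    have AZ: "list_bounded ?us (A c \<union> ZZ c)" using A[OF c] ZZ[OF c] by (intro list_bounded_Un)
    show "list_bounded (h # ?us) {x \<in> carrier G. \<psi>' (refl_at c x) = \<psi>' x}"
    proof (rule bddI[OF AZ])
      fix x assume "x \<in> {x \<in> carrier G. \<psi>' (refl_at c x) = \<psi>' x}"
      then have x: "x \<in> carrier G" and eq: "\<psi>' (refl_at c x) = \<psi>' x" by auto
      note rx = r[OF c x] and h2 = hr[OF c x]
      show "x \<in> A c \<union> ZZ c \<and> \<bar>h x\<bar> \<le> b"
      proof (cases "\<psi>' x = ?kk")
        case True
        then have 1: "h x > m \<and> (h x \<le> V \<longrightarrow> Z x)" "h (refl_at c x) > m \<and> (h (refl_at c x) \<le> V \<longrightarrow> Z (refl_at c x))"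
          using \<psi>'_kk[OF x] \<psi>'_kk[OF rx] eq by auto
        have "h x \<le> V" "h (refl_at c x) \<le> V" using 1 h2 Vc[OF c] by linarith+
        then have "x \<in> ZZ c" using 1 x by (simp add: ZZ_def)
        moreover have "\<bar>h x\<bar> \<le> b" using 1(1) \<open>h x \<le> V\<close> s0 Vmm unfolding b_def by linarith
        ultimately show ?thesis by blast
      next
        case False
        then have F': "\<psi>' (refl_at c x) \<noteq> ?kk" using eq by simp
        have "\<psi> (refl_at c x) = \<psi> x"
          using \<psi>'_other(2,4)[OF x False] \<psi>'_other(2,4)[OF rx F'] eq by (cases "\<psi>' x < ?kk") simp_all
        then have "x \<in> A c" using x by (simp add: A_def)
        moreover have "\<bar>h x\<bar> \<le> b"
          using \<psi>'_other(1)[OF x False] \<psi>'_other(1)[OF rx F'] h2 s[OF c] s0 Vmm unfolding b_def by linarith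
        ultimately show ?thesis by blast
      qed
    qed
    define W where "W = (\<Union>d\<in>F. A d)"
    have W: "list_bounded ?us W" unfolding W_def by (rule list_bounded_UN[OF F(1) A])
    have Wc: "W \<subseteq> carrier G" by (auto simp: W_def A_def)
    have WZ: "list_bounded ?us (W \<union> refl_at c ` W \<union> ZZ c)"
      using W rb[OF W Wc c] ZZ[OF c] by (intro list_bounded_Un)
    have Z': "y \<in> W \<or> Z y" if "y \<in> carrier G" "\<exists>d\<in>F. \<psi>' y = \<beta>' (refl_at d y)" for y
      using that cmp unfolding W_def by blast
    show "list_bounded (h # ?us) {x \<in> carrier G. (\<exists>d\<in>F. \<psi>' x = \<beta>' (refl_at d x)) \<and>
        (\<exists>d\<in>F. \<psi>' (refl_at c x) = \<beta>' (refl_at d (refl_at c x)))}"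
    proof (rule bddI[OF WZ])
      fix x assume "x \<in> {x \<in> carrier G. (\<exists>d\<in>F. \<psi>' x = \<beta>' (refl_at d x)) \<and>
        (\<exists>d\<in>F. \<psi>' (refl_at c x) = \<beta>' (refl_at d (refl_at c x)))}"
      then have x: "x \<in> carrier G" and 1: "\<exists>d\<in>F. \<psi>' x = \<beta>' (refl_at d x)"
        and 2: "\<exists>d\<in>F. \<psi>' (refl_at c x) = \<beta>' (refl_at d (refl_at c x))" by auto
      have "x \<in> refl_at c ` W" if "refl_at c x \<in> W"
        using imageI[OF that, of "refl_at c"] rr[OF c x] by simp
      then have "x \<in> W \<union> refl_at c ` W \<union> ZZ c"
        using Z'[OF x 1] Z'[OF r[OF c x] 2] x by (auto simp: ZZ_def)
      moreover have "\<bar>h x\<bar> \<le> b" using 1 cmpb[OF _ x] by blast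
      ultimately show "x \<in> W \<union> refl_at c ` W \<union> ZZ c \<and> \<bar>h x\<bar> \<le> b" by blast
    qed
  qed
  then show ?case by auto
qed

theorem not_pole_peel:
  assumes "\<And>h. h \<in> set (hs @ [g]) \<Longrightarrow> h \<in> borel_measurable M \<and> odd_fn h"
    and "space M = carrier G" and "\<And>c. c \<in> C \<Longrightarrow> refl_at c \<in> measurable M M"
    and "finite C" "C \<subseteq> carrier G" and "peel hs C"
    and lift: "\<And>S. S \<subseteq> carrier G \<Longrightarrow> list_bounded (hs @ [g]) S \<Longrightarrow> bdd S"
  shows "\<not> pole M (Suc (length hs)) C"
proof -
  obtain \<beta> \<psi> where "coloring_pair M C (hs @ [g]) (Suc (length hs)) C \<beta> \<psi>"
    using peel_coloring[OF assms(1-5) order_refl assms(6)] by blast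
  then show ?thesis
    unfolding coloring_pair_def by (intro not_poleI[of \<beta>]) (auto intro!: lift)
qed

end

section \<open>Peeling configurations by independent functionals\<close>

text \<open>Functionals that agree at \<open>p\<close> and \<open>q\<close> treat them as one point.
  This merges two points without passing to a quotient.\<close>

lemma peel_insert_copy:
  "peel hs C \<Longrightarrow> p \<in> C \<Longrightarrow> (\<forall>h\<in>set hs. h p = h q) \<Longrightarrow> peel hs (insert q C)"
proof (induction hs arbitrary: C)
  case (Cons h hs)
  then obtain m where m: "\<forall>c\<in>C. h c \<le> m" "peel hs {c \<in> C. h c < m}" by auto
  have hq: "h q = h p" using Cons.prems by simp
  have "peel hs {c \<in> insert q C. h c < m}"
  proof (cases "h p < m")
    case True
    then have "{c \<in> insert q C. h c < m} = insert q {c \<in> C. h c < m}" using hq by auto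
    then show ?thesis using Cons.IH[OF m(2)] Cons.prems True by auto
  next
    case False
    then have "{c \<in> insert q C. h c < m} = {c \<in> C. h c < m}" using hq by auto
    then show ?thesis using m(2) by simp
  qed
  then show ?case using m(1) Cons.prems hq by auto
qed simp

interpretation fs: vector_space "(\<lambda>r f x. r * f x) :: real \<Rightarrow> ('p \<Rightarrow> real) \<Rightarrow> 'p \<Rightarrow> real"
  by unfold_locales (auto simp: fun_eq_iff algebra_simps)

definition fdim :: "('p \<Rightarrow> real) set \<Rightarrow> nat \<Rightarrow> bool" where
  "fdim W w \<longleftrightarrow> (\<exists>B. finite B \<and> fs.independent B \<and> fs.span B = W \<and> card B = w)"

definition const_on :: "('p \<Rightarrow> real) \<Rightarrow> 'p set \<Rightarrow> bool" where
  "const_on g A \<longleftrightarrow> (\<forall>a\<in>A. \<forall>b\<in>A. g a = g b)"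

lemma const_on_iff: "a \<in> A \<Longrightarrow> const_on g A \<longleftrightarrow> (\<forall>b\<in>A. g b = g a)"
  unfolding const_on_def by metis

lemma const_on_insert:
  assumes "a \<in> A"
  shows "const_on g (insert x A) \<longleftrightarrow> const_on g A \<and> g a = g x"
  unfolding const_on_iff[OF assms] const_on_iff[OF insertI2[OF assms]] ball_simps
  using eq_commute[of "g x" "g a"] by blast

lemma const_on_face:
  assumes "const_on g A"
  shows "\<exists>m. (\<forall>c\<in>A. g c \<le> m) \<and> {c \<in> A. g c < m} = {}"
proof (cases "A = {}")
  case False
  then obtain a where a: "a \<in> A" by blast
  have "g c = g a" if "c \<in> A" for c using assms that unfolding const_on_iff[OF a] by blast
  then have "(\<forall>c\<in>A. g c \<le> g a) \<and> {c \<in> A. g c < g a} = {}"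
    by (metis (mono_tags, lifting) empty_Collect_eq less_irrefl order_refl)
  then show ?thesis by blast
qed simp

lemma fdim_subspace: "fdim W w \<Longrightarrow> fs.subspace W"
  unfolding fdim_def using fs.subspace_span by blast

lemma fdim_closed:
  assumes "fdim W w"
  shows "g \<in> W \<Longrightarrow> h \<in> W \<Longrightarrow> (\<lambda>x. g x + h x) \<in> W" "g \<in> W \<Longrightarrow> (\<lambda>x. r * g x) \<in> W"
    "g \<in> W \<Longrightarrow> (\<lambda>x. - g x) \<in> W" "g \<in> W \<Longrightarrow> h \<in> W \<Longrightarrow> (\<lambda>x. g x - h x) \<in> W" "(\<lambda>x. 0) \<in> W"
proof -
  note s = fdim_subspace[OF assms]
  show "g \<in> W \<Longrightarrow> h \<in> W \<Longrightarrow> (\<lambda>x. g x + h x) \<in> W"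
    using fs.subspace_add[OF s, of g h] by (simp add: plus_fun_def)
  show "g \<in> W \<Longrightarrow> (\<lambda>x. r * g x) \<in> W" using fs.subspace_scale[OF s] .
  show "g \<in> W \<Longrightarrow> (\<lambda>x. - g x) \<in> W"
    using fs.subspace_neg[OF s, of g] by (simp add: fun_Compl_def)
  show "g \<in> W \<Longrightarrow> h \<in> W \<Longrightarrow> (\<lambda>x. g x - h x) \<in> W"
    using fs.subspace_diff[OF s, of g h] by (simp add: fun_diff_def)
  show "(\<lambda>x. 0) \<in> W" using fs.subspace_0[OF s] by (simp add: zero_fun_def)
qed

lemma fdim_card_eq:
  assumes "fdim W w" "finite B" "fs.independent B" "fs.span B = W"
  shows "card B = w"
proof -
  obtain B' where B': "finite B'" "fs.independent B'" "fs.span B' = W" "card B' = w"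
    using assms(1) unfolding fdim_def by blast
  have "card B \<le> card B'" using fs.independent_span_bound[OF B'(1) assms(3)] B'(3) assms(4) fs.span_superset by blast
  moreover have "card B' \<le> card B" using fs.independent_span_bound[OF assms(2) B'(2)] B'(3) assms(4) fs.span_superset by blast
  ultimately show ?thesis using B'(4) by simp
qed

lemma subspace_fdim:
  assumes "fdim W w" "fs.subspace W'" "W' \<subseteq> W"
  shows "\<exists>B. finite B \<and> fs.independent B \<and> fs.span B = W' \<and> card B \<le> w"
proof -
  from assms(1) obtain B' where B': "finite B'" "fs.span B' = W" "card B' = w"
    unfolding fdim_def by (elim exE conjE)
  obtain B where B: "B \<subseteq> W'" "fs.independent B" "W' \<subseteq> fs.span B"
    using fs.basis_exists by metis
  have sp: "fs.span B = W'" using B(1,3) assms(2) fs.span_minimal by blast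
  have "finite B \<and> card B \<le> card B'" using fs.independent_span_bound[OF B'(1) B(2)] B(1) assms(3) B'(2) by blast
  then show ?thesis using B(2) sp B'(3) by blast
qed

lemma ann_subspace: "fs.subspace W \<Longrightarrow> fs.subspace {g \<in> W. g p = g q}"
  unfolding fs.subspace_def by auto

lemma ann_pair:
  assumes W: "fdim W w" and h: "h \<in> W" "h p \<noteq> h q"
  shows "\<exists>v. w = Suc v \<and> fdim {g \<in> W. g p = g q} v"
proof -
  let ?W0 = "{g \<in> W. g p = g q}"
  obtain B where B: "finite B" "fs.independent B" "fs.span B = ?W0"
    using subspace_fdim[OF W ann_subspace[OF fdim_subspace[OF W], of p q]] by auto
  have hB: "h \<notin> fs.span B" using B(3) h(2) by blast
  then have ind: "fs.independent (insert h B)" using fs.independent_insertI[OF _ B(2)] by blast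
  have "fs.span (insert h B) = W"
  proof
    have "insert h B \<subseteq> W" using h(1) B(3) fs.span_superset[of B] by blast
    then show "fs.span (insert h B) \<subseteq> W" using fs.span_minimal fdim_subspace[OF W] by blast
    show "W \<subseteq> fs.span (insert h B)"
    proof
      fix g assume g: "g \<in> W"
      define r where "r = (g p - g q) / (h p - h q)"
      let ?g0 = "\<lambda>x. g x - r * h x"
      have "?g0 \<in> W" using fdim_closed(4)[OF W g fdim_closed(2)[OF W h(1)]] .
      moreover have "?g0 p = ?g0 q" using h(2) by (simp add: r_def field_simps)
      ultimately have "?g0 \<in> fs.span B" using B(3) by blast
      then have 1: "?g0 \<in> fs.span (insert h B)" using fs.span_mono[of B "insert h B"] by blast
      have 2: "(\<lambda>x. r * h x) \<in> fs.span (insert h B)" by (intro fs.span_scale fs.span_base) simp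
      have "g = ?g0 + (\<lambda>x. r * h x)" by (simp add: fun_eq_iff)
      then show "g \<in> fs.span (insert h B)" using fs.span_add[OF 1 2] by metis
    qed
  qed
  then have "card (insert h B) = w" by (intro fdim_card_eq[OF W _ ind]) (use B in auto)
  moreover have "h \<notin> B" using hB fs.span_superset by blast
  ultimately have "w = Suc (card B)" using B(1) by simp
  then show ?thesis using B unfolding fdim_def by blast
qed

text \<open>Constancy on \<open>A\<close> amounts to \<open>card A - 1\<close> linear conditions,
  each of which lowers the dimension by at most one.\<close>

lemma ann_set:
  assumes "finite A" "A \<noteq> {}" "fdim W w"
  shows "\<exists>v. fdim {g \<in> W. const_on g A} v \<and> w + 1 \<le> v + card A"
  using assms(1,2)
proof (induction A rule: finite_ne_induct)
  case (singleton x)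
  have "{g \<in> W. const_on g {x}} = W" by (auto simp: const_on_def)
  then show ?case using assms(3) by (intro exI[of _ w]) simp
next
  case (insert x A)
  then obtain v where v: "fdim {g \<in> W. const_on g A} v" "w + 1 \<le> v + card A" by blast
  obtain a where a: "a \<in> A" using insert by blast
  have eq: "{g \<in> W. const_on g (insert x A)} = {g \<in> {g \<in> W. const_on g A}. g a = g x}"
    using const_on_insert[OF a] by blast
  show ?case
  proof (cases "\<exists>h\<in>{g \<in> W. const_on g A}. h a \<noteq> h x")
    case True
    then obtain h where "h \<in> {g \<in> W. const_on g A}" "h a \<noteq> h x" by blast
    from ann_pair[OF v(1) this] obtain v' where "v = Suc v'" "fdim {g \<in> {g \<in> W. const_on g A}. g a = g x} v'"
      by blast
    then show ?thesis unfolding eq using v(2) insert by (intro exI[of _ v']) simp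
  next
    case False
    then have "{g \<in> {g \<in> W. const_on g A}. g a = g x} = {g \<in> W. const_on g A}" by blast
    then show ?thesis unfolding eq using v insert by (intro exI[of _ v]) simp
  qed
qed

lemma fdim_not_span:
  assumes W: "fdim W v" and B: "finite B" "card B < v"
  shows "\<exists>g\<in>W. g \<notin> fs.span B"
proof (rule ccontr)
  assume "\<not> ?thesis"
  then have sub: "W \<subseteq> fs.span B" by blast
  obtain B' where B': "finite B'" "fs.independent B'" "fs.span B' = W" "card B' = v"
    using W unfolding fdim_def by blast
  have "B' \<subseteq> fs.span B" using sub B'(3) fs.span_superset by blast
  then show False using fs.independent_span_bound[OF B(1) B'(2)] B'(4) B(2) by auto
qed

lemma ann_not_span:
  assumes W: "fdim W w" and A: "finite A" and B: "finite B" "card B + card A \<le> w" "card B < w"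
  shows "\<exists>g\<in>W. const_on g A \<and> g \<notin> fs.span B"
proof (cases "A = {}")
  case True
  then show ?thesis using fdim_not_span[OF W B(1,3)] by (auto simp: const_on_def)
next
  case False
  obtain v where v: "fdim {g \<in> W. const_on g A} v" "w + 1 \<le> v + card A" using ann_set[OF A False W] by blast
  then show ?thesis using fdim_not_span[OF v(1) B(1)] B(2) by auto
qed

lemma hyperplane_avoiding:
  assumes W: "fdim W (Suc w)" and h: "h \<in> W" "h \<noteq> (\<lambda>x. 0)"
  shows "\<exists>W'. fdim W' w \<and> W' \<subseteq> W \<and> h \<notin> W'"
proof -
  have "fs.independent {h}" using h(2) by (simp add: zero_fun_def)
  then obtain B where B: "{h} \<subseteq> B" "B \<subseteq> W" "fs.independent B" "W \<subseteq> fs.span B"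
    using fs.maximal_independent_subset_extend[of "{h}" W] h(1) by blast
  have sp: "fs.span B = W" using B(2,4) fdim_subspace[OF W] fs.span_minimal by blast
  have fin: "finite B"
  proof -
    obtain B' where "finite B'" "fs.span B' = W" using W unfolding fdim_def by blast
    then show ?thesis using fs.independent_span_bound[OF _ B(3)] B(2) by blast
  qed
  have card: "card B = Suc w" by (rule fdim_card_eq[OF W fin B(3) sp])
  show ?thesis
  proof (intro exI conjI)
    show "fdim (fs.span (B - {h})) w"
      unfolding fdim_def using fin card B fs.independent_mono[OF B(3), of "B - {h}"]
      by (intro exI[of _ "B - {h}"]) auto
    show "fs.span (B - {h}) \<subseteq> W" using sp fs.span_mono[of "B - {h}" B] by blast
    show "h \<notin> fs.span (B - {h})" using B(1,3) unfolding fs.dependent_def by blast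
  qed
qed

text \<open>Peeling by \<open>w - 1\<close> independent functionals from a space of dimension
  \<open>w\<close>: one basis vector is left over, which is the \<open>g\<close> of
  \<open>not_pole_peel\<close>.\<close>

definition tsh :: "nat \<Rightarrow> ('p \<Rightarrow> real) set \<Rightarrow> 'p set \<Rightarrow> bool" where
  "tsh w W C \<longleftrightarrow> (\<exists>hs. set hs \<subseteq> W \<and> distinct hs \<and> fs.independent (set hs) \<and> Suc (length hs) = w \<and> peel hs C)"

lemma tsh_insert_copy: "tsh w W C \<Longrightarrow> p \<in> C \<Longrightarrow> (\<And>g. g \<in> W \<Longrightarrow> g p = g q) \<Longrightarrow> tsh w W (insert q C)"
  unfolding tsh_def using peel_insert_copy by (metis subsetD)

text \<open>Taking the later functionals from a subspace without \<open>h\<close> secures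
  independence, and leaves freedom to choose that subspace so that it does not separate two given
  points.\<close>

lemma tsh_Cons:
  assumes "h \<in> W" "\<And>c. c \<in> C \<Longrightarrow> h c \<le> m" "W' \<subseteq> W" "fdim W' v" "h \<notin> W'" "tsh w W' {c \<in> C. h c < m}"
  shows "tsh (Suc w) W C"
proof -
  obtain hs where hs: "set hs \<subseteq> W'" "distinct hs" "fs.independent (set hs)" "Suc (length hs) = w"
    "peel hs {c \<in> C. h c < m}" using assms(6) unfolding tsh_def by blast
  have "fs.span (set hs) \<subseteq> W'" using hs(1) fdim_subspace[OF assms(4)] fs.span_minimal by blast
  then have "h \<notin> fs.span (set hs)" using assms(5) by blast
  then have "fs.independent (set (h # hs))" using fs.independent_insertI[OF _ hs(3)] by simp
  moreover have "peel (h # hs) C" using hs(5) assms(2) by auto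
  moreover have "h \<notin> set hs" using hs(1) assms(5) by blast
  ultimately show ?thesis unfolding tsh_def using hs assms(1,3) by (intro exI[of _ "h # hs"]) auto
qed

lemma tsh_empty:
  assumes W: "fdim W w" "w \<ge> 1"
  shows "tsh w W {}"
proof -
  obtain B where B: "finite B" "fs.independent B" "fs.span B = W" "card B = w"
    using W(1) unfolding fdim_def by blast
  obtain bs where bs: "set bs = B" "distinct bs" using finite_distinct_list[OF B(1)] by blast
  then have len: "length bs = w" using B(4) distinct_card by metis
  have peel0: "peel hs {}" for hs :: "('a \<Rightarrow> real) list" by (induction hs) auto
  have "set (take (w - 1) bs) \<subseteq> B" using bs(1) set_take_subset by metis
  then show ?thesis
    unfolding tsh_def using bs len W(2) B(3) fs.independent_mono[OF B(2)] fs.span_superset[of B] peel0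
    by (intro exI[of _ "take (w - 1) bs"]) auto
qed

lemma tsh_const:
  assumes W: "fdim W (Suc w)" "w \<ge> 1" and h: "h \<in> W" "h \<noteq> (\<lambda>x. 0)" "const_on h C"
  shows "tsh (Suc w) W C"
proof (cases "C = {}")
  case True
  then show ?thesis using tsh_empty[OF W(1)] by simp
next
  case False
  then obtain a where a: "a \<in> C" by blast
  obtain W' where W': "fdim W' w" "W' \<subseteq> W" "h \<notin> W'" using hyperplane_avoiding[OF W(1) h(1,2)] by blast
  have eq: "{c \<in> C. h c < h a} = {}"
    using h(3) unfolding const_on_iff[OF a] by (metis (mono_tags, lifting) empty_Collect_eq less_irrefl)
  show ?thesis
  proof (rule tsh_Cons[OF h(1) _ W'(2,1,3)])
    show "h c \<le> h a" if "c \<in> C" for c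
      using h(3) that unfolding const_on_iff[OF a] by (metis order_refl)
    show "tsh w W' {c \<in> C. h c < h a}" unfolding eq by (rule tsh_empty[OF W'(1) W(2)])
  qed
qed

text \<open>A hyperplane is turned about the part of \<open>h = m\<close> on which \<open>g\<close>
  has the value \<open>u\<close>. The number \<open>sl c\<close> is the slope at which it meets
  \<open>c\<close>; coming from \<open>h\<close>, that is from infinite slope, the largest of these
  is the first contact.\<close>

lemma tilt:
  fixes h g :: "'p \<Rightarrow> real"
  assumes W: "fdim W w" and h: "h \<in> W" and g: "g \<in> W" "g \<notin> fs.span {h}"
    and C: "finite C" "C \<noteq> {}" "\<And>c. c \<in> C \<Longrightarrow> h c < m"
  obtains s z where "(\<lambda>x. g x + s * h x) \<in> W" "(\<lambda>x. g x + s * h x) \<noteq> (\<lambda>x. 0)"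
    "z \<in> C" "g z + s * h z = u + s * m" "\<And>c. c \<in> C \<Longrightarrow> g c + s * h c \<le> u + s * m"
proof -
  define sl where "sl c = (g c - u) / (m - h c)" for c
  define s where "s = Max (sl ` C)"
  have "s \<in> sl ` C" unfolding s_def using C by (intro Max_in) auto
  then obtain z where z: "z \<in> C" "s = sl z" by blast
  have le: "sl c \<le> s" if "c \<in> C" for c unfolding s_def using C that by (intro Max_ge) auto
  show thesis
  proof
    show "(\<lambda>x. g x + s * h x) \<in> W" using fdim_closed(1)[OF W g(1) fdim_closed(2)[OF W h]] .
    show "(\<lambda>x. g x + s * h x) \<noteq> (\<lambda>x. 0)"
    proof
      assume "(\<lambda>x. g x + s * h x) = (\<lambda>x. 0)"
      then have "g x + s * h x = 0" for x by (rule fun_cong)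
      then have "g x = - s * h x" for x by (simp add: add_eq_0_iff2)
      then have "g = (\<lambda>x. (- s) * h x)" by (rule ext)
      moreover have "(\<lambda>x. (- s) * h x) \<in> fs.span {h}" by (intro fs.span_scale fs.span_base) simp
      ultimately show False using g(2) by metis
    qed
    show "z \<in> C" by (rule z(1))
    show "g z + s * h z = u + s * m"
      unfolding z(2) sl_def using C(3)[OF z(1)] by (simp add: field_simps)
    fix c assume c: "c \<in> C"
    have "m - h c > 0" using C(3)[OF c] by simp
    then have "g c - u \<le> s * (m - h c)" using le[OF c] unfolding sl_def by (simp add: pos_divide_le_eq)
    then show "g c + s * h c \<le> u + s * m" by (simp add: algebra_simps)
  qed
qed

text \<open>While the face has fewer than \<open>w\<close> points, some functional outside the span
  of \<open>h\<close> is constant on it, and tilting adds a point. This ends with \<open>w\<close>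
  points or with the whole of \<open>C\<close>.\<close>

lemma facet:
  assumes W: "fdim W w" and h: "h \<in> W" "h \<noteq> (\<lambda>x. 0)" and C: "finite C" "\<And>c. c \<in> C \<Longrightarrow> h c \<le> m"
    "\<exists>c\<in>C. h c = m"
  shows "\<exists>h' m'. h' \<in> W \<and> h' \<noteq> (\<lambda>x. 0) \<and> (\<forall>c\<in>C. h' c \<le> m') \<and>
    {c \<in> C. h c = m} \<subseteq> {c \<in> C. h' c = m'} \<and> (w \<le> card {c \<in> C. h' c = m'} \<or> {c \<in> C. h' c = m'} = C)"
  using h C(2,3)
proof (induction "card {c \<in> C. h c \<noteq> m}" arbitrary: h m rule: less_induct)
  case less
  let ?A = "{c \<in> C. h c = m}"
  have finA: "finite ?A" using C(1) by simp
  show ?case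
  proof (cases "w \<le> card ?A \<or> ?A = C")
    case True
    then show ?thesis using less.prems by blast
  next
    case False
    have neA: "?A \<noteq> {}" using less.prems(4) by blast
    then have "card ?A \<ge> 1" using finA by (simp add: Suc_leI card_gt_0_iff)
    then obtain g where g: "g \<in> W" "const_on g ?A" "g \<notin> fs.span {h}"
      using ann_not_span[OF W finA, of "{h}"] False by auto
    obtain a where a: "a \<in> ?A" using neA by blast
    let ?R = "{c \<in> C. h c < m}"
    have R: "finite ?R" "?R \<noteq> {}" using C(1) False less.prems(3) by (auto simp: less_le)
    obtain s z where sz: "(\<lambda>x. g x + s * h x) \<in> W" "(\<lambda>x. g x + s * h x) \<noteq> (\<lambda>x. 0)"
      "z \<in> ?R" "g z + s * h z = g a + s * m" "\<And>c. c \<in> ?R \<Longrightarrow> g c + s * h c \<le> g a + s * m"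
      using tilt[OF W less.prems(1) g(1,3) R, where m = m and u = "g a"] by blast
    define h' m' where "h' = (\<lambda>x. g x + s * h x)" and "m' = g a + s * m"
    have onA: "h' c = m'" if "c \<in> ?A" for c
    proof -
      have "g c = g a" using that g(2) unfolding const_on_iff[OF a] by blast
      moreover have "h c = m" using that by simp
      ultimately show ?thesis unfolding h'_def m'_def by simp
    qed
    have le: "h' c \<le> m'" if "c \<in> C" for c
    proof (cases "h c = m")
      case True
      then show ?thesis using onA that by simp
    next
      case False
      then have "c \<in> ?R" using less.prems(3)[OF that] that by simp
      then show ?thesis using sz(5) by (simp add: h'_def m'_def)
    qed
    have "{c \<in> C. h' c \<noteq> m'} \<subset> {c \<in> C. h c \<noteq> m}"
    proof
      show "{c \<in> C. h' c \<noteq> m'} \<subseteq> {c \<in> C. h c \<noteq> m}" using onA by blast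
      have "z \<in> {c \<in> C. h c \<noteq> m}" "z \<notin> {c \<in> C. h' c \<noteq> m'}" using sz(3,4) by (auto simp: h'_def m'_def)
      then show "{c \<in> C. h' c \<noteq> m'} \<noteq> {c \<in> C. h c \<noteq> m}" by blast
    qed
    then have lt: "card {c \<in> C. h' c \<noteq> m'} < card {c \<in> C. h c \<noteq> m}"
      by (intro psubset_card_mono) (use C(1) in auto)
    have "\<exists>c\<in>C. h' c = m'" using onA a by blast
    from less.hyps[OF lt _ _ le this] sz(1,2)
    obtain h'' m'' where "h'' \<in> W" "h'' \<noteq> (\<lambda>x. 0)" "\<forall>c\<in>C. h'' c \<le> m''"
      "{c \<in> C. h' c = m'} \<subseteq> {c \<in> C. h'' c = m''}" "w \<le> card {c \<in> C. h'' c = m''} \<or> {c \<in> C. h'' c = m''} = C"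
      unfolding h'_def[symmetric] by blast
    moreover have "?A \<subseteq> {c \<in> C. h' c = m'}" using onA by blast
    ultimately show ?thesis by blast
  qed
qed

lemma facet_exists:
  assumes W: "fdim W w" "w \<ge> 1" and C: "finite C" "C \<noteq> {}"
  obtains h m where "h \<in> W" "h \<noteq> (\<lambda>x. 0)" "\<And>c. c \<in> C \<Longrightarrow> h c \<le> m" "w \<le> card {c \<in> C. h c = m}"
  | h where "h \<in> W" "h \<noteq> (\<lambda>x. 0)" "const_on h C"
proof -
  obtain h where h: "h \<in> W" "h \<notin> fs.span {}" using fdim_not_span[OF W(1), of "{}"] W(2) by auto
  then have h0: "h \<noteq> (\<lambda>x. 0)" by (simp add: zero_fun_def)
  define m where "m = Max (h ` C)"
  have m: "h c \<le> m" if "c \<in> C" for c unfolding m_def using C that by (intro Max_ge) auto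
  have "m \<in> h ` C" unfolding m_def using C by (intro Max_in) auto
  then have "\<exists>c\<in>C. h c = m" by blast
  from facet[OF W(1) h(1) h0 C(1) m this] obtain h' m' where
    h': "h' \<in> W" "h' \<noteq> (\<lambda>x. 0)" "\<forall>c\<in>C. h' c \<le> m'" "w \<le> card {c \<in> C. h' c = m'} \<or> {c \<in> C. h' c = m'} = C"
    by blast
  show thesis
  proof (cases "{c \<in> C. h' c = m'} = C")
    case True
    then have "const_on h' C" unfolding const_on_def by (metis (mono_tags, lifting) mem_Collect_eq)
    then show thesis using that(2) h' by blast
  next
    case False
    then show thesis using that(1)[of h' m'] h' by blast
  qed
qed

lemma tsh3I:
  assumes W: "fdim W 3" and h: "h \<in> W" "h \<noteq> (\<lambda>x. 0)" "\<And>c. c \<in> C \<Longrightarrow> h c \<le> m"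
    and g: "g \<in> W" "g \<notin> fs.span {h}" "const_on g {c \<in> C. h c < m}"
  shows "tsh 3 W C"
proof -
  have "fs.independent {h}" using h(2) by (simp add: zero_fun_def)
  then have ind: "fs.independent (set [h, g])"
    using fs.independent_insertI[OF g(2)] by (simp add: insert_commute)
  have "g \<noteq> h" using g(2) fs.span_base[of h "{h}"] by blast
  moreover have "peel [h, g] C"
  proof -
    obtain m' where m': "\<forall>c\<in>{c \<in> C. h c < m}. g c \<le> m'" "{c \<in> {c \<in> C. h c < m}. g c < m'} = {}"
      using const_on_face[OF g(3)] by blast
    then have "peel [g] {c \<in> C. h c < m}" unfolding peel.simps by blast
    then show ?thesis unfolding peel.simps(2)[of h] using h(3) by blast
  qed
  ultimately show ?thesis unfolding tsh_def using h(1) g(1) ind by (intro exI[of _ "[h, g]"]) auto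
qed

text \<open>A facet takes three of five points, and a functional independent of it is constant on
  the other two.\<close>

lemma tsh3_small:
  assumes W: "fdim W 3" and C: "finite C" "card C \<le> 5"
  shows "tsh 3 W C"
proof (cases "C = {}")
  case True
  then show ?thesis using tsh_empty[OF W] by simp
next
  case False
  from W have W3: "fdim W (Suc 2)" by (simp add: numeral_3_eq_3 numeral_2_eq_2)
  show ?thesis
  proof (rule facet_exists[OF W _ C(1) False])
    fix h m assume h: "h \<in> W" "h \<noteq> (\<lambda>x. 0)" "\<And>c. c \<in> C \<Longrightarrow> h c \<le> m" "3 \<le> card {c \<in> C. h c = m}"
    have "card {c \<in> C. h c = m} + card {c \<in> C. h c < m} = card C"
      using h(3) C(1) by (subst card_Un_disjoint[symmetric]) (auto intro!: arg_cong[where f = card] simp: less_le)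
    then have "card {c \<in> C. h c < m} \<le> 2" using h(4) C(2) by simp
    then obtain g where "g \<in> W" "const_on g {c \<in> C. h c < m}" "g \<notin> fs.span {h}"
      using ann_not_span[OF W, of "{c \<in> C. h c < m}" "{h}"] C(1) by auto
    then show ?thesis using tsh3I[OF W h(1-3)] by blast
  next
    fix h assume "h \<in> W" "h \<noteq> (\<lambda>x. 0)" "const_on h C"
    then show ?thesis using tsh_const[OF W3] by (simp add: numeral_3_eq_3 numeral_2_eq_2)
  qed simp
qed

text \<open>A facet takes \<open>w + 1\<close> points and leaves at most \<open>t\<close>. If
  \<open>t\<close> are left, two on different levels of \<open>h\<close> are merged by functionals
  that agree on them, which excludes \<open>h\<close>. If all \<open>t\<close> are on one level,
  they are peeled first by \<open>- h\<close>; the facet remains, with at most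
  \<open>w + 1 < t\<close> points. So the gain \<open>w + 2\<close> consists of a facet and one
  merged point.\<close>

lemma tsh_step:
  assumes IH: "\<And>(W :: ('p \<Rightarrow> real) set) C. fdim W w \<Longrightarrow> finite C \<Longrightarrow> card C < t \<Longrightarrow> tsh w W C"
    and t: "t \<ge> w + 2" and w: "w \<ge> 1"
    and W: "fdim (W :: ('p \<Rightarrow> real) set) (Suc w)" and C: "finite C" "card C < t + w + 2"
  shows "tsh (Suc w) W C"
proof (cases "C = {}")
  case True
  then show ?thesis using tsh_empty[OF W] by simp
next
  case False
  show ?thesis
  proof (rule facet_exists[OF W _ C(1) False])
    fix h m assume h: "h \<in> W" "h \<noteq> (\<lambda>x. 0)" "\<And>c. c \<in> C \<Longrightarrow> h c \<le> m" "Suc w \<le> card {c \<in> C. h c = m}"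
    let ?A = "{c \<in> C. h c = m}" and ?R = "{c \<in> C. h c < m}"
    have cc: "card ?A + card ?R = card C"
      using h(3) C(1) by (subst card_Un_disjoint[symmetric]) (auto intro!: arg_cong[where f = card] simp: less_le)
    obtain W' where W': "fdim W' w" "W' \<subseteq> W" "h \<notin> W'" using hyperplane_avoiding[OF W h(1,2)] by blast
    show ?thesis
    proof (cases "card ?R < t")
      case True
      then show ?thesis using tsh_Cons[OF h(1,3) W'(2,1,3)] IH[OF W'(1)] C(1) by simp
    next
      case False
      then have cR: "card ?R = t" using cc h(4) C(2) by linarith
      show ?thesis
      proof (cases "const_on h ?R")
        case False
        then obtain p q where pq: "p \<in> ?R" "q \<in> ?R" "h p \<noteq> h q" unfolding const_on_def by blast
        let ?W0 = "{g \<in> W. g p = g q}"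
        have W0: "fdim ?W0 w" using ann_pair[OF W h(1) pq(3)] by auto
        have "card (?R - {q}) < t" using cR pq(2) t by (simp add: card_Diff_singleton)
        then have "tsh w ?W0 (?R - {q})" using IH[OF W0] C(1) by simp
        then have "tsh w ?W0 (insert q (?R - {q}))" using pq by (intro tsh_insert_copy[of w ?W0 _ p]) auto
        then have "tsh w ?W0 ?R" using pq(2) by (simp add: insert_absorb)
        then show ?thesis using tsh_Cons[OF h(1,3) _ W0] pq(3) by blast
      next
        case True
        have "card ?R \<noteq> 0" using cR t by linarith
        then have "?R \<noteq> {}" by (metis card.empty)
        then obtain p where p: "p \<in> ?R" by blast
        have Rp: "h c = h p" if "c \<in> ?R" for c using True that p unfolding const_on_def by blast
        let ?n = "\<lambda>x. - h x"
        have low: "{c \<in> C. ?n c < - h p} = ?A"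
        proof (intro Set.set_eqI iffI)
          fix c assume c: "c \<in> {c \<in> C. ?n c < - h p}"
          then have "c \<notin> ?R" using Rp[of c] by auto
          then show "c \<in> ?A" using c h(3)[of c] by auto
        next
          fix c assume "c \<in> ?A"
          then show "c \<in> {c \<in> C. ?n c < - h p}" using p by auto
        qed
        have "tsh (Suc w) W C"
        proof (rule tsh_Cons[OF _ _ W'(2,1)])
          show "?n \<in> W" using fdim_closed(3)[OF W h(1)] .
          show "?n c \<le> - h p" if "c \<in> C" for c 
          proof (cases "h c < m")
            case True
            then show ?thesis using Rp[of c] that by simp
          next
            case False
            then show ?thesis using p by simp
          qed
          show "?n \<notin> W'" using fdim_closed(3)[OF W'(1), of ?n] W'(3) by auto
          show "tsh w W' {c \<in> C. ?n c < - h p}"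
            unfolding low by (rule IH[OF W'(1)]) (use cc cR C t in auto)
        qed
        then show ?thesis .
      qed
    qed
  next
    fix h assume "h \<in> W" "h \<noteq> (\<lambda>x. 0)" "const_on h C"
    then show ?thesis using tsh_const[OF W w] by blast
  qed simp
qed

lemma tsh_neg:
  assumes W: "fdim W (Suc w)" and h: "h \<in> W" "h \<noteq> (\<lambda>x. 0)" and l: "\<And>c. c \<in> C \<Longrightarrow> l \<le> h c"
    and t: "\<And>W'. fdim W' w \<Longrightarrow> tsh w W' {c \<in> C. l < h c}"
  shows "tsh (Suc w) W C"
proof -
  obtain W' where W': "fdim W' w" "W' \<subseteq> W" "h \<notin> W'" using hyperplane_avoiding[OF W h] by blast
  have "(\<lambda>x. - h x) \<notin> W'" using fdim_closed(3)[OF W'(1), of "\<lambda>x. - h x"] W'(3) by auto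
  moreover have "{c \<in> C. - h c < - l} = {c \<in> C. l < h c}" by auto
  ultimately show ?thesis
    using tsh_Cons[OF fdim_closed(3)[OF W h(1)], of C "- l" W' w w] W' l t[OF W'(1)] by simp
qed

lemma tsh4I:
  assumes "h \<in> W" "g \<in> W" "k \<in> W" and nz: "h \<noteq> (\<lambda>x. 0)" "g \<notin> fs.span {h}" "k \<notin> fs.span {g, h}"
    and "\<And>c. c \<in> C \<Longrightarrow> h c \<le> m" "\<And>c. c \<in> C \<Longrightarrow> h c < m \<Longrightarrow> g c \<le> m'"
    and k: "const_on k {c \<in> C. h c < m \<and> g c < m'}"
  shows "tsh 4 W C"
proof -
  have i0: "fs.independent {h}" using nz(1) by (simp add: zero_fun_def)
  then have i1: "fs.independent {g, h}" by (rule fs.independent_insertI[OF nz(2)])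
  then have "fs.independent {k, g, h}" by (rule fs.independent_insertI[OF nz(3)])
  moreover have "{k, g, h} = set [h, g, k]" by auto
  ultimately have ind: "fs.independent (set [h, g, k])" by metis
  have ne: "g \<noteq> h" "k \<noteq> h" "k \<noteq> g" using nz(2,3) fs.span_base by blast+
  obtain m'' where "\<forall>c\<in>{c \<in> C. h c < m \<and> g c < m'}. k c \<le> m''" "{c \<in> {c \<in> C. h c < m \<and> g c < m'}. k c < m''} = {}"
    using const_on_face[OF k] by blast
  moreover have eq: "{c \<in> {c \<in> C. h c < m}. g c < m'} = {c \<in> C. h c < m \<and> g c < m'}" by auto
  ultimately have "peel [k] {c \<in> {c \<in> C. h c < m}. g c < m'}" unfolding eq peel.simps by blast
  then have "peel [g, k] {c \<in> C. h c < m}" unfolding peel.simps(2)[of g] using assms(8) by blast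
  then have "peel [h, g, k] C" unfolding peel.simps(2)[of h] using assms(7) by blast
  then show ?thesis unfolding tsh_def using assms(1-3) ind ne by (intro exI[of _ "[h, g, k]"]) auto
qed

lemma face_partition:
  fixes h :: "'p \<Rightarrow> real"
  assumes "finite C" "\<And>c. c \<in> C \<Longrightarrow> h c \<le> m"
  shows "card {c \<in> C. h c = m} + card {c \<in> C. h c < m} = card C"
  using assms by (subst card_Un_disjoint[symmetric]) (auto intro!: arg_cong[where f = card] simp: less_le)

text \<open>A configuration of six points in dimension 3 that is not peelable is an octahedron:
  every facet is a triangle whose three opposite points lie in a parallel plane.\<close>

locale octahedron =
  fixes W :: "('p \<Rightarrow> real) set" and Q :: "'p set"
  assumes W: "fdim W 3" and card: "card Q = 6" and bad: "\<not> tsh 3 W Q"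
begin

lemma fin: "finite Q" using card card.infinite by fastforce

lemma W3: "fdim W (Suc 2)" using W by (simp add: numeral_3_eq_3 numeral_2_eq_2)

lemma nd: "g \<in> W \<Longrightarrow> const_on g Q \<Longrightarrow> g = (\<lambda>x. 0)"
  using tsh_const[OF W3, of g Q] bad by (auto simp: numeral_3_eq_3 numeral_2_eq_2)

lemma sep:
  assumes "u \<in> Q" "v \<in> Q" "u \<noteq> v"
  shows "\<exists>g\<in>W. g u \<noteq> g v"
proof (rule ccontr)
  assume "\<not> ?thesis"
  then have "tsh 3 W (insert v (Q - {v}))"
    using tsh3_small[OF W, of "Q - {v}"] fin card assms
    by (intro tsh_insert_copy[where p = u]) (auto simp: card_Diff_singleton)
  then show False using bad assms(2) by (simp add: insert_absorb)
qed

text \<open>Otherwise two functionals peel everything: if a functional independent of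
  \<open>h\<close> is constant below the facet, it finishes the peeling. For two points below such a
  functional exists; for three there is a nonzero one constant on them, which must then be a
  multiple of \<open>h\<close>.\<close>

lemma two_valued:
  assumes h: "h \<in> W" "h \<noteq> (\<lambda>x. 0)" "\<And>c. c \<in> Q \<Longrightarrow> h c \<le> m" "card {c \<in> Q. h c = m} \<ge> 3"
  shows "card {c \<in> Q. h c = m} = 3" "card {c \<in> Q. h c < m} = 3" "const_on h {c \<in> Q. h c < m}"
proof -
  let ?R = "{c \<in> Q. h c < m}"
  have part: "card {c \<in> Q. h c = m} + card ?R = 6" using face_partition[OF fin h(3)] card by simp
  have finR: "finite ?R" using fin by simp
  have no: "g \<in> fs.span {h}" if "g \<in> W" "const_on g ?R" for g
    using tsh3I[OF W h(1-3) that(1) _ that(2)] bad by blast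
  have "\<not> card ?R \<le> 2"
  proof
    assume "card ?R \<le> 2"
    then obtain g where "g \<in> W" "const_on g ?R" "g \<notin> fs.span {h}"
      using ann_not_span[OF W finR, of "{h}"] by auto
    then show False using no by blast
  qed
  then show "card {c \<in> Q. h c = m} = 3" and R3: "card ?R = 3" using part h(4) by linarith+
  obtain g where g: "g \<in> W" "const_on g ?R" "g \<notin> fs.span {}"
    using ann_not_span[OF W finR, of "{}"] R3 by auto
  then have "g \<noteq> (\<lambda>x. 0)" by (simp add: zero_fun_def)
  moreover from no[OF g(1,2)] obtain r where r: "g = (\<lambda>x. r * h x)"
    unfolding fs.span_singleton by blast
  ultimately have "r \<noteq> 0" by auto
  then show "const_on h ?R" using g(2) unfolding r const_on_def by simp
qed

text \<open>The facet is tilted about its edge \<open>a\<close>, \<open>b\<close>, with the sign of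
  \<open>g'\<close> chosen so that \<open>c\<close> moves inside. The facet on the other side of the
  edge is again two-valued.\<close>

lemma adjacent:
  assumes h: "h \<in> W" "\<And>c. c \<in> Q \<Longrightarrow> h c \<le> m"
    and F: "{c \<in> Q. h c = m} = {a, b, c}" "a \<noteq> b" "a \<noteq> c" "b \<noteq> c" and R: "{c \<in> Q. h c < m} \<noteq> {}"
  shows "\<exists>h'\<in>W. \<exists>m' \<mu> z. z \<in> {c \<in> Q. h c < m} \<and> h' a = m' \<and> h' b = m' \<and> h' z = m' \<and> \<mu> < m' \<and>
     (\<forall>u\<in>Q - {a, b, z}. h' u = \<mu>)"
proof -
  have abc: "a \<in> Q" "b \<in> Q" "c \<in> Q" "h a = m" "h b = m" "h c = m" using F(1) by auto
  let ?R = "{c \<in> Q. h c < m}"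
  obtain g where g: "g \<in> W" "const_on g {a, b}" "g \<notin> fs.span {h}"
    using ann_not_span[OF W, of "{a, b}" "{h}"] F(2) by auto
  define g' where "g' = (if g c \<le> g a then g else (\<lambda>x. - g x))"
  have gab: "g b = g a" using g(2) unfolding const_on_def by blast
  have g': "g' \<in> W" "g' b = g' a" "g' c \<le> g' a" using g(1) fdim_closed(3)[OF W g(1)] gab by (auto simp: g'_def)
  have g's: "g' \<notin> fs.span {h}"
  proof
    assume "g' \<in> fs.span {h}"
    then obtain r where r: "g' = (\<lambda>x. r * h x)" unfolding fs.span_singleton by blast
    have "g = (\<lambda>x. r * h x) \<or> g = (\<lambda>x. (- r) * h x)"
    proof (cases "g c \<le> g a")
      case True
      then show ?thesis using r by (simp add: g'_def)
    next
      case False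
      then have "- g x = r * h x" for x using r by (simp add: g'_def fun_eq_iff)
      then have "g x = - r * h x" for x by (metis minus_minus mult_minus_left)
      then show ?thesis by blast
    qed
    then show False using g(3) unfolding fs.span_singleton by blast
  qed
  have finR: "finite ?R" using fin by simp
  obtain s z where sz: "(\<lambda>x. g' x + s * h x) \<in> W" "(\<lambda>x. g' x + s * h x) \<noteq> (\<lambda>x. 0)" "z \<in> ?R"
    "g' z + s * h z = g' a + s * m" "\<And>c. c \<in> ?R \<Longrightarrow> g' c + s * h c \<le> g' a + s * m"
    using tilt[OF W h(1) g'(1) g's finR R, where m = m and u = "g' a"] by blast
  define h' m' where "h' = (\<lambda>x. g' x + s * h x)" and "m' = g' a + s * m"
  have v: "h' a = m'" "h' b = m'" "h' z = m'" "h' c \<le> m'"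
    using abc g' sz(4) by (simp_all add: h'_def m'_def)
  have le: "h' u \<le> m'" if "u \<in> Q" for u
  proof (cases "h u < m")
    case True
    then show ?thesis using sz(5)[of u] that by (simp add: h'_def m'_def)
  next
    case False
    then have "u \<in> {a, b, c}" using h(2)[OF that] that F(1) by (auto simp: less_le)
    then show ?thesis using v by auto
  qed
  have zQ: "z \<in> Q" "h z < m" using sz(3) by auto
  then have zabc: "z \<noteq> a" "z \<noteq> b" "z \<noteq> c" using abc by auto
  have sub: "{a, b, z} \<subseteq> {u \<in> Q. h' u = m'}" using v abc zQ by auto
  have c3: "card {a, b, z} = 3" using F(2) zabc by simp
  have "card {u \<in> Q. h' u = m'} \<ge> 3" using card_mono[OF _ sub] fin c3 by simp
  note tv = two_valued[OF sz(1,2)[folded h'_def] le this]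
  have eq: "{u \<in> Q. h' u = m'} = {a, b, z}"
    using card_subset_eq[OF _ sub] fin c3 tv(1) by simp
  have "c \<notin> {a, b, z}" using F(3,4) zabc(3) by auto
  then have "h' c \<noteq> m'" using eq abc(3) by blast
  then have cR: "c \<in> {u \<in> Q. h' u < m'}" using abc(3) v(4) by simp
  have "h' u = h' c" if "u \<in> Q - {a, b, z}" for u
  proof -
    have "u \<in> {u \<in> Q. h' u < m'}" using that eq le[of u] by (auto simp: less_le)
    then show ?thesis using tv(3) cR unfolding const_on_def by blast
  qed
  then show ?thesis
    using sz(1)[folded h'_def] v sz(3) cR
    by (intro bexI[of _ h'] exI[of _ m'] exI[of _ "h' c"] exI[of _ z]) auto
qed

text \<open>Three facets \<open>a b c\<close>, \<open>a b z\<close> and \<open>b c x\<close>, each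
  with its opposite one, whose functionals span \<open>W\<close>. The antipodal pairs are
  \<open>a x\<close>, \<open>b y\<close> and \<open>c z\<close>.\<close>

definition labelling :: "'p \<Rightarrow> 'p \<Rightarrow> 'p \<Rightarrow> 'p \<Rightarrow> 'p \<Rightarrow> 'p \<Rightarrow> ('p \<Rightarrow> real) \<Rightarrow> ('p \<Rightarrow> real) \<Rightarrow> ('p \<Rightarrow> real) \<Rightarrow>
    real \<Rightarrow> real \<Rightarrow> real \<Rightarrow> real \<Rightarrow> real \<Rightarrow> real \<Rightarrow> bool" where
  "labelling a b c x y z h0 h1 h2 m0 m1 m2 n0 n1 n2 \<longleftrightarrow>
    Q = {a, b, c, x, y, z} \<and> distinct [a, b, c, x, y, z] \<and> h0 \<in> W \<and> h1 \<in> W \<and> h2 \<in> W \<and>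
    m0 \<noteq> n0 \<and> m1 \<noteq> n1 \<and> m2 \<noteq> n2 \<and>
    h0 a = m0 \<and> h0 b = m0 \<and> h0 c = m0 \<and> h0 x = n0 \<and> h0 y = n0 \<and> h0 z = n0 \<and>
    h1 a = m1 \<and> h1 b = m1 \<and> h1 z = m1 \<and> h1 c = n1 \<and> h1 x = n1 \<and> h1 y = n1 \<and>
    h2 b = m2 \<and> h2 c = m2 \<and> h2 x = m2 \<and> h2 a = n2 \<and> h2 y = n2 \<and> h2 z = n2 \<and>
    W \<subseteq> fs.span {h2, h1, h0}"

lemma facet_labels:
  "\<exists>a b c x y z h0 h1 h2 m0 m1 m2 n0 n1 n2. labelling a b c x y z h0 h1 h2 m0 m1 m2 n0 n1 n2"
proof -
  have ne: "Q \<noteq> {}" using card by auto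
  obtain h m where h: "h \<in> W" "h \<noteq> (\<lambda>x. 0)" "\<And>c. c \<in> Q \<Longrightarrow> h c \<le> m" "3 \<le> card {c \<in> Q. h c = m}"
  proof (rule facet_exists[OF W _ fin ne])
    show thesis if "h \<in> W" "h \<noteq> (\<lambda>x. 0)" "const_on h Q" for h using nd[OF that(1,3)] that(2) by blast
  qed (auto intro: that)
  note tv = two_valued[OF h]
  obtain a b c where abc: "{c \<in> Q. h c = m} = {a, b, c}" "a \<noteq> b" "a \<noteq> c" "b \<noteq> c"
    using tv(1) unfolding card_3_iff by blast
  let ?R = "{c \<in> Q. h c < m}"
  have Rne: "?R \<noteq> {}" using tv(2) by (metis card.empty zero_neq_numeral)
  obtain h1 m1 n1 z where 1: "h1 \<in> W" "z \<in> ?R" "h1 a = m1" "h1 b = m1" "h1 z = m1" "n1 < m1"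
    "\<And>u. u \<in> Q - {a, b, z} \<Longrightarrow> h1 u = n1" using adjacent[OF h(1,3) abc Rne] by blast
  have abc': "{c \<in> Q. h c = m} = {b, c, a}" using abc(1) by auto
  obtain h2 m2 n2 x where 2: "h2 \<in> W" "x \<in> ?R" "h2 b = m2" "h2 c = m2" "h2 x = m2" "n2 < m2"
    "\<And>u. u \<in> Q - {b, c, x} \<Longrightarrow> h2 u = n2"
    using adjacent[OF h(1,3) abc' abc(4) abc(2)[symmetric] abc(3)[symmetric] Rne] by blast
  have inQ: "a \<in> Q" "b \<in> Q" "c \<in> Q" "z \<in> Q" "x \<in> Q" using abc(1) 1(2) 2(2) by auto
  have hv: "h a = m" "h b = m" "h c = m" "h z < m" "h x < m" using abc(1) 1(2) 2(2) by auto
  have nzx: "z \<noteq> a" "z \<noteq> b" "z \<noteq> c" "x \<noteq> a" "x \<noteq> b" "x \<noteq> c" using hv by auto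
  have v1: "h1 c = n1" using 1(7)[of c] inQ abc nzx by auto
  have v2: "h2 a = n2" using 2(7)[of a] inQ abc nzx by auto
  \<comment> \<open>\<open>h1\<close> separates \<open>a\<close> from \<open>c\<close>, which
    \<open>h\<close> does not, and \<open>h2\<close> separates \<open>a\<close> from
    \<open>b\<close>, which neither \<open>h\<close> nor \<open>h1\<close> does. So these three are
    independent, and a fourth independent functional would exceed the dimension.\<close>
  have Wsp: "W \<subseteq> fs.span {h2, h1, h}"
  proof (rule ccontr)
    assume "\<not> ?thesis"
    then obtain g where g: "g \<in> W" "g \<notin> fs.span {h2, h1, h}" by blast
    have s1: "fs.subspace {g. g u = g v}" for u v :: 'p
      unfolding fs.subspace_def by (simp add: zero_fun_def)
    have "fs.span {h} \<subseteq> {g. g a = g c}" by (rule fs.span_minimal[OF _ s1]) (use hv in auto)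
    then have h1s: "h1 \<notin> fs.span {h}" using 1(3,6) v1 by auto
    have "fs.span {h1, h} \<subseteq> {g. g a = g b}" by (rule fs.span_minimal[OF _ s1]) (use hv 1 in auto)
    then have h2s: "h2 \<notin> fs.span {h1, h}" using 2(3,6) v2 by auto
    have "fs.independent {h}" using h(2) by (simp add: zero_fun_def)
    then have "fs.independent {h1, h}" by (rule fs.independent_insertI[OF h1s])
    then have "fs.independent {h2, h1, h}" by (rule fs.independent_insertI[OF h2s])
    then have ind: "fs.independent {g, h2, h1, h}" by (rule fs.independent_insertI[OF g(2)])
    have b: "u \<in> fs.span B" if "u \<in> B" for u :: "'p \<Rightarrow> real" and B using fs.span_base that .
    have "h1 \<noteq> h" using h1s b[of h "{h}"] by auto
    moreover have "h2 \<notin> {h1, h}" using h2s b[of h2 "{h1, h}"] by blast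
    moreover have "g \<notin> {h2, h1, h}" using g(2) b[of g "{h2, h1, h}"] by blast
    ultimately have "card {g, h2, h1, h} = 4" by simp
    moreover obtain B where B: "finite B" "fs.span B = W" "card B = 3" using W unfolding fdim_def by blast
    moreover have "{g, h2, h1, h} \<subseteq> W" using g(1) h(1) 1(1) 2(1) by blast
    ultimately show False using fs.independent_span_bound[OF B(1) ind] by auto
  qed
  have Wpt: "g u = g v" if "h u = h v" "h1 u = h1 v" "h2 u = h2 v" "g \<in> W" for g u v
  proof -
    have "fs.subspace {g. g u = g v}" unfolding fs.subspace_def by (auto simp: zero_fun_def)
    then have "fs.span {h2, h1, h} \<subseteq> {g. g u = g v}" by (intro fs.span_minimal) (use that in auto)
    then show ?thesis using Wsp that(4) by blast
  qed
  have Rc: "h u = h z" if "u \<in> ?R" for u using tv(3) that 1(2) unfolding const_on_def by blast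
  \<comment> \<open>If the two new facets had the same third vertex, all functionals would agree on
    the other two points below the first facet.\<close>
  have xz: "x \<noteq> z"
  proof
    assume xz: "x = z"
    have "card (?R - {z}) = 2" using tv(2) 1(2) by (simp add: card_Diff_singleton)
    then obtain u v where uv: "?R - {z} = {u, v}" "u \<noteq> v" by (auto simp: card_2_iff)
    then have uvR: "u \<in> ?R" "v \<in> ?R" "u \<noteq> z" "v \<noteq> z" by auto
    then have "u \<in> Q - {a, b, z}" "v \<in> Q - {a, b, z}" "u \<in> Q - {b, c, x}" "v \<in> Q - {b, c, x}" using hv xz by auto
    then have "g u = g v" if "g \<in> W" for g
      using Wpt[of u v g] 1(7) 2(7) Rc[OF uvR(1)] Rc[OF uvR(2)] that by simp
    then show False using sep[of u v] uvR uv(2) by blast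
  qed
  have "card (?R - {z} - {x}) = 1" using tv(2) 1(2) 2(2) xz by (simp add: card_Diff_singleton)
  then obtain y where y: "?R - {z} - {x} = {y}" by (auto simp: card_1_singleton_iff)
  then have yR: "y \<in> ?R" "y \<noteq> z" "y \<noteq> x" by auto
  have R: "?R = {x, y, z}" using y 1(2) 2(2) by auto
  have Q: "Q = {a, b, c, x, y, z}"
  proof -
    have "Q = {c \<in> Q. h c = m} \<union> ?R" using h(3) by (auto simp: less_le)
    then show ?thesis using abc(1) R by auto
  qed
  have yn: "y \<noteq> a" "y \<noteq> b" "y \<noteq> c" "y \<in> Q" using yR hv by auto
  have w: "h1 x = n1" "h1 y = n1" "h2 y = n2" "h2 z = n2"
    using 1(7)[of x] 1(7)[of y] 2(7)[of y] 2(7)[of z] inQ yn nzx xz yR by auto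
  have "labelling a b c x y z h h1 h2 m m1 m2 (h z) n1 n2"
    unfolding labelling_def
  proof (intro conjI)
    show "distinct [a, b, c, x, y, z]" using abc(2-4) nzx xz yR(2,3) yn by simp
    show "h x = h z" "h y = h z" using Rc 2(2) yR(1) by blast+
  qed (use Q Wsp hv 1(1,3-6) 2(1,3-6) v1 v2 w h(1) in simp_all)
  then show ?thesis by blast
qed

text \<open>The relation is linear in \<open>g\<close>, and each of the three spanning functionals
  takes its two values once on every antipodal pair.\<close>

lemma antipode:
  obtains \<sigma> where "\<And>u. u \<in> Q \<Longrightarrow> \<sigma> u \<in> Q \<and> \<sigma> u \<noteq> u \<and> \<sigma> (\<sigma> u) = u"
    "\<And>g u v. g \<in> W \<Longrightarrow> u \<in> Q \<Longrightarrow> v \<in> Q \<Longrightarrow> g u + g (\<sigma> u) = g v + g (\<sigma> v)"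
proof -
  obtain a b c x y z h0 h1 h2 m0 m1 m2 n0 n1 n2 where "labelling a b c x y z h0 h1 h2 m0 m1 m2 n0 n1 n2"
    using facet_labels by blast
  then have
    Q: "Q = {a, b, c, x, y, z}" "distinct [a, b, c, x, y, z]"
    and v: "h0 a = m0" "h0 b = m0" "h0 c = m0" "h0 x = n0" "h0 y = n0" "h0 z = n0"
    "h1 a = m1" "h1 b = m1" "h1 z = m1" "h1 c = n1" "h1 x = n1" "h1 y = n1"
    "h2 b = m2" "h2 c = m2" "h2 x = m2" "h2 a = n2" "h2 y = n2" "h2 z = n2"
    and sp: "W \<subseteq> fs.span {h2, h1, h0}"
    unfolding labelling_def by simp_all
  define \<sigma> where "\<sigma> u = (if u = a then x else if u = x then a else if u = b then y else if u = y then b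
    else if u = c then z else c)" for u
  let ?S = "{g. g a + g x = g b + g y \<and> g b + g y = g c + g z}"
  have "fs.subspace ?S"
    unfolding fs.subspace_def by (auto simp: zero_fun_def algebra_simps) (metis distrib_left)+
  then have "fs.span {h2, h1, h0} \<subseteq> ?S" by (rule fs.span_minimal[rotated]) (use v in auto)
  then have rel: "g a + g x = g b + g y" "g b + g y = g c + g z" if "g \<in> W" for g using sp that by blast+
  show thesis
  proof
    show "\<sigma> u \<in> Q \<and> \<sigma> u \<noteq> u \<and> \<sigma> (\<sigma> u) = u" if "u \<in> Q" for u
      using that Q unfolding \<sigma>_def by auto
    have "g u + g (\<sigma> u) = g a + g x" if "g \<in> W" "u \<in> Q" for g u
      using that(2) rel[OF that(1)] Q unfolding \<sigma>_def by auto
    then show "g u + g (\<sigma> u) = g v + g (\<sigma> v)" if "g \<in> W" "u \<in> Q" "v \<in> Q" for g u v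
      using that by metis
  qed
qed

text \<open>Four two-valued functionals give the eight facets in opposite pairs. The four facets
  that avoid \<open>p\<close> overlap enough to link the five other vertices.\<close>

lemma const_off_vertex:
  fixes f :: "'p \<Rightarrow> real"
  assumes p: "p \<in> Q"
    and f: "\<And>\<gamma> Y \<alpha> \<beta>. \<gamma> \<in> W \<Longrightarrow> Y \<subseteq> Q \<Longrightarrow> p \<notin> Y \<Longrightarrow> card Y = 3 \<Longrightarrow> \<alpha> \<noteq> \<beta> \<Longrightarrow>
      \<forall>u\<in>Y. \<gamma> u = \<alpha> \<Longrightarrow> \<forall>u\<in>Q - Y. \<gamma> u = \<beta> \<Longrightarrow> const_on f Y"
  shows "const_on f (Q - {p})"
proof -
  obtain a b c x y z h0 h1 h2 m0 m1 m2 n0 n1 n2 where "labelling a b c x y z h0 h1 h2 m0 m1 m2 n0 n1 n2"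
    using facet_labels by blast
  then have
    Q: "Q = {a, b, c, x, y, z}" "distinct [a, b, c, x, y, z]" and hW: "h0 \<in> W" "h1 \<in> W" "h2 \<in> W"
    and mn: "m0 \<noteq> n0" "m1 \<noteq> n1" "m2 \<noteq> n2"
    and v: "h0 a = m0" "h0 b = m0" "h0 c = m0" "h0 x = n0" "h0 y = n0" "h0 z = n0"
    "h1 a = m1" "h1 b = m1" "h1 z = m1" "h1 c = n1" "h1 x = n1" "h1 y = n1"
    "h2 b = m2" "h2 c = m2" "h2 x = m2" "h2 a = n2" "h2 y = n2" "h2 z = n2"
    unfolding labelling_def by simp_all
  have both: "(p \<notin> {u1, u2, u3} \<longrightarrow> f u1 = f u2 \<and> f u2 = f u3) \<and> (p \<notin> {w1, w2, w3} \<longrightarrow> f w1 = f w2 \<and> f w2 = f w3)"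
    if "\<gamma> \<in> W" "\<alpha> \<noteq> \<beta>" "Q = {u1, u2, u3, w1, w2, w3}" "distinct [u1, u2, u3, w1, w2, w3]"
      "\<gamma> u1 = \<alpha>" "\<gamma> u2 = \<alpha>" "\<gamma> u3 = \<alpha>" "\<gamma> w1 = \<beta>" "\<gamma> w2 = \<beta>" "\<gamma> w3 = \<beta>"
    for \<gamma> \<alpha> \<beta> u1 u2 u3 w1 w2 w3
  proof (intro conjI impI)
    have "Q - {u1, u2, u3} = {w1, w2, w3}" "Q - {w1, w2, w3} = {u1, u2, u3}" using that(3,4) by auto
    then have "p \<notin> {u1, u2, u3} \<Longrightarrow> const_on f {u1, u2, u3}" "p \<notin> {w1, w2, w3} \<Longrightarrow> const_on f {w1, w2, w3}"
      using f[of \<gamma> "{u1, u2, u3}" \<alpha> \<beta>] f[of \<gamma> "{w1, w2, w3}" \<beta> \<alpha>] that by simp_all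
    then show "p \<notin> {u1, u2, u3} \<Longrightarrow> f u1 = f u2" "p \<notin> {u1, u2, u3} \<Longrightarrow> f u2 = f u3"
      "p \<notin> {w1, w2, w3} \<Longrightarrow> f w1 = f w2" "p \<notin> {w1, w2, w3} \<Longrightarrow> f w2 = f w3"
      unfolding const_on_def by blast+
  qed
  \<comment> \<open>The missing pair of opposite facets, \<open>a c y\<close> and
    \<open>x z b\<close>: once each functional is scaled so that its two values differ by 1, this
    combination takes the values \<open>e\<close> and \<open>e - 1\<close> on them.\<close>
  define h3 where "h3 u = (1 / (m0 - n0)) * h0 u - (1 / (m1 - n1)) * h1 u - (1 / (m2 - n2)) * h2 u" for u
  have h3W: "h3 \<in> W"
    unfolding h3_def by (intro fdim_closed(2,4)[OF W] hW)
  have q: "(1 / (m0 - n0)) * m0 = (1 / (m0 - n0)) * n0 + 1" "(1 / (m1 - n1)) * m1 = (1 / (m1 - n1)) * n1 + 1"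
    "(1 / (m2 - n2)) * m2 = (1 / (m2 - n2)) * n2 + 1"
    using mn by (simp_all add: divide_simps)
  define e where "e = (1 / (m0 - n0)) * n0 - (1 / (m1 - n1)) * n1 - (1 / (m2 - n2)) * n2"
  have v3: "h3 a = e" "h3 c = e" "h3 y = e" "h3 x = e - 1" "h3 z = e - 1" "h3 b = e - 1"
    unfolding h3_def v q e_def by simp_all
  have r0: "(p \<notin> {a, b, c} \<longrightarrow> f a = f b \<and> f b = f c) \<and> (p \<notin> {x, y, z} \<longrightarrow> f x = f y \<and> f y = f z)"
    by (rule both[OF hW(1) mn(1)]) (use Q v in auto)
  have r1: "(p \<notin> {a, b, z} \<longrightarrow> f a = f b \<and> f b = f z) \<and> (p \<notin> {c, x, y} \<longrightarrow> f c = f x \<and> f x = f y)"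
    by (rule both[OF hW(2) mn(2)]) (use Q v in auto)
  have r2: "(p \<notin> {b, c, x} \<longrightarrow> f b = f c \<and> f c = f x) \<and> (p \<notin> {a, y, z} \<longrightarrow> f a = f y \<and> f y = f z)"
    by (rule both[OF hW(3) mn(3)]) (use Q v in auto)
  have r3: "(p \<notin> {a, c, y} \<longrightarrow> f a = f c \<and> f c = f y) \<and> (p \<notin> {x, z, b} \<longrightarrow> f x = f z \<and> f z = f b)"
    by (rule both[OF h3W, of e "e - 1"]) (use Q v3 in auto)
  from p Q(1) consider "p = a" | "p = b" | "p = c" | "p = x" | "p = y" | "p = z" by blast
  then show ?thesis
  proof cases
    case 1
    have "p \<notin> {x, y, z}" "p \<notin> {c, x, y}" "p \<notin> {b, c, x}" "p \<notin> {x, z, b}" using Q(2) 1 by auto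
    then have "f b = f x" "f c = f x" "f y = f x" "f z = f x" using r0 r1 r2 r3 by linarith+
    then have "\<forall>u\<in>Q - {p}. f u = f x" unfolding Q(1) 1 by auto
    then show ?thesis unfolding const_on_def by metis
  next
    case 2
    have "p \<notin> {x, y, z}" "p \<notin> {c, x, y}" "p \<notin> {a, y, z}" "p \<notin> {a, c, y}" using Q(2) 2 by auto
    then have "f a = f y" "f c = f y" "f x = f y" "f z = f y" using r0 r1 r2 r3 by linarith+
    then have "\<forall>u\<in>Q - {p}. f u = f y" unfolding Q(1) 2 by auto
    then show ?thesis unfolding const_on_def by metis
  next
    case 3
    have "p \<notin> {x, y, z}" "p \<notin> {a, b, z}" "p \<notin> {a, y, z}" "p \<notin> {x, z, b}" using Q(2) 3 by auto
    then have "f a = f z" "f b = f z" "f x = f z" "f y = f z" using r0 r1 r2 r3 by linarith+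
    then have "\<forall>u\<in>Q - {p}. f u = f z" unfolding Q(1) 3 by auto
    then show ?thesis unfolding const_on_def by metis
  next
    case 4
    have "p \<notin> {a, b, c}" "p \<notin> {a, b, z}" "p \<notin> {a, y, z}" "p \<notin> {a, c, y}" using Q(2) 4 by auto
    then have "f b = f a" "f c = f a" "f y = f a" "f z = f a" using r0 r1 r2 r3 by linarith+
    then have "\<forall>u\<in>Q - {p}. f u = f a" unfolding Q(1) 4 by auto
    then show ?thesis unfolding const_on_def by metis
  next
    case 5
    have "p \<notin> {a, b, c}" "p \<notin> {a, b, z}" "p \<notin> {b, c, x}" "p \<notin> {x, z, b}" using Q(2) 5 by auto
    then have "f a = f b" "f c = f b" "f x = f b" "f z = f b" using r0 r1 r2 r3 by linarith+
    then have "\<forall>u\<in>Q - {p}. f u = f b" unfolding Q(1) 5 by auto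
    then show ?thesis unfolding const_on_def by metis
  next
    case 6
    have "p \<notin> {a, b, c}" "p \<notin> {c, x, y}" "p \<notin> {b, c, x}" "p \<notin> {a, c, y}" using Q(2) 6 by auto
    then have "f a = f c" "f b = f c" "f x = f c" "f y = f c" using r0 r1 r2 r3 by linarith+
    then have "\<forall>u\<in>Q - {p}. f u = f c" unfolding Q(1) 6 by auto
    then show ?thesis unfolding const_on_def by metis
  qed
qed

end


text \<open>The only possible obstructions in dimension 4: the points strictly below a facet are an
  octahedron in a parallel hyperplane together with one lower point.\<close>

definition obstruction ::
  "('p \<Rightarrow> real) set \<Rightarrow> 'p set \<Rightarrow> ('p \<Rightarrow> real) \<Rightarrow> real \<Rightarrow> 'p \<Rightarrow> real \<Rightarrow> ('p \<Rightarrow> 'p) \<Rightarrow> bool" where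
  "obstruction W C h m p \<kappa> \<sigma> \<longleftrightarrow> h \<in> W \<and> h \<noteq> (\<lambda>x. 0) \<and> p \<in> C \<and> h p < \<kappa> \<and> \<kappa> < m \<and>
    (\<forall>c\<in>C. c = p \<or> h c = \<kappa> \<or> h c = m) \<and> card {c \<in> C. h c = m} = 4 \<and> card {c \<in> C. h c = \<kappa>} = 6 \<and>
    (\<forall>g\<in>W. const_on g {c \<in> C. h c = \<kappa>} \<longrightarrow> g \<in> fs.span {h}) \<and>
    (\<forall>u\<in>{c \<in> C. h c = \<kappa>}. \<sigma> u \<in> {c \<in> C. h c = \<kappa>} \<and> \<sigma> u \<noteq> u \<and> \<sigma> (\<sigma> u) = u) \<and>
    (\<forall>g\<in>W. \<forall>u\<in>{c \<in> C. h c = \<kappa>}. \<forall>v\<in>{c \<in> C. h c = \<kappa>}. g u + g (\<sigma> u) = g v + g (\<sigma> v))"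

text \<open>Five points below the facet are peelable in dimension 3, and so are six after merging
  two on different levels; if all are on one level, peeling from there fails only with more than
  five points on the facet, too many in total. This leaves exactly seven below and four on the
  facet, and merging any two of the seven from different levels produces an octahedron.\<close>

lemma four_dim_obstruction:
  assumes W: "fdim W 4" and C: "finite C" "card C \<le> 11" and bad: "\<not> tsh 4 W C"
    and h: "h \<in> W" "h \<noteq> (\<lambda>x. 0)" "\<And>c. c \<in> C \<Longrightarrow> h c \<le> m" "card {c \<in> C. h c = m} \<ge> 4"
  shows "\<exists>p \<kappa> \<sigma>. obstruction W C h m p \<kappa> \<sigma>"
proof -
  have W4: "fdim W (Suc 3)" using W by simp
  have bad4: "\<not> tsh (Suc 3) W C" using bad by simp
  let ?A = "{c \<in> C. h c = m}" and ?R = "{c \<in> C. h c < m}"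
  have part: "card ?A + card ?R = card C" by (rule face_partition[OF C(1) h(3)])
  have finR: "finite ?R" using C(1) by simp
  have cons: "\<not> tsh 3 W' ?R" if "fdim W' 3" "W' \<subseteq> W" "h \<notin> W'" for W'
    using tsh_Cons[OF h(1,3) that(2,1,3)] bad4 by blast
  have neg: "card {c \<in> C. l < h c} > 5" if "\<And>c. c \<in> C \<Longrightarrow> l \<le> h c" for l
  proof (rule ccontr)
    assume "\<not> ?thesis"
    then have "tsh 3 W' {c \<in> C. l < h c}" if "fdim W' 3" for W' using tsh3_small[OF that] C(1) by simp
    then show False using tsh_neg[OF W4 h(1,2) that] bad4 by blast
  qed
  have pairs: "fdim {g \<in> W. g p = g q} 3 \<and> \<not> tsh 3 {g \<in> W. g p = g q} (?R - {q})"
    if "p \<in> ?R" "q \<in> ?R" "h p \<noteq> h q" for p q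
  proof
    show W0: "fdim {g \<in> W. g p = g q} 3" using ann_pair[OF W4 h(1) that(3)] by auto
    show "\<not> tsh 3 {g \<in> W. g p = g q} (?R - {q})"
    proof
      assume t: "tsh 3 {g \<in> W. g p = g q} (?R - {q})"
      have "tsh 3 {g \<in> W. g p = g q} (insert q (?R - {q}))"
        by (rule tsh_insert_copy[OF t, of p]) (use that in auto)
      moreover have "insert q (?R - {q}) = ?R" using that(2) by blast
      ultimately have t': "tsh 3 {g \<in> W. g p = g q} ?R" by (simp only:)
      have "{g \<in> W. g p = g q} \<subseteq> W" "h \<notin> {g \<in> W. g p = g q}" using that(3) by auto
      then show False using cons[OF W0] t' by blast
    qed
  qed
  have const6: "card ?R \<noteq> 0 \<Longrightarrow> const_on h ?R \<Longrightarrow> card ?A > 5"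
  proof -
    assume "card ?R \<noteq> 0" and co: "const_on h ?R"
    then have "?R \<noteq> {}" by (metis card.empty)
    then obtain r where r: "r \<in> ?R" by blast
    have Rr: "h c = h r" if "c \<in> ?R" for c using co r that unfolding const_on_def by blast
    have le: "h r \<le> h c" if "c \<in> C" for c
    proof (cases "h c = m")
      case False
      then have "c \<in> ?R" using h(3)[OF that] that by simp
      then have "h c = h r" by (rule Rr)
      then show ?thesis by simp
    qed (use r in simp)
    have "{c \<in> C. h r < h c} = ?A"
    proof (intro Set.set_eqI iffI)
      fix c assume c: "c \<in> {c \<in> C. h r < h c}"
      then have "c \<notin> ?R" using Rr[of c] by auto
      then show "c \<in> ?A" using c h(3)[of c] by auto
    qed (use r in auto)
    then show "card ?A > 5" using neg[OF le] by simp
  qed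
  have R7: "card ?R = 7" and A4: "card ?A = 4"
  proof -
    have "card ?R \<ge> 6"
    proof (rule ccontr)
      assume "\<not> ?thesis"
      obtain W' where "fdim W' 3" "W' \<subseteq> W" "h \<notin> W'" using hyperplane_avoiding[OF W4 h(1,2)] by blast
      then show False using cons tsh3_small[of W' ?R] finR \<open>\<not> 6 \<le> card ?R\<close> by auto
    qed
    then have "\<not> const_on h ?R" using const6 part C(2) by linarith
    then obtain p q where pq: "p \<in> ?R" "q \<in> ?R" "h p \<noteq> h q" unfolding const_on_def by blast
    have "\<not> card (?R - {q}) \<le> 5"
      using pairs[OF pq] tsh3_small[of "{g \<in> W. g p = g q}" "?R - {q}"] finR by blast
    then have "card ?R \<ge> 7" using pq(2) by (simp add: card_Diff_singleton)
    then show "card ?R = 7" "card ?A = 4" using part C(2) h(4) by linarith+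
  qed
  have oct: "octahedron {g \<in> W. g p = g q} (?R - {q})" if "p \<in> ?R" "q \<in> ?R" "h p \<noteq> h q" for p q
    by unfold_locales (use pairs[OF that] R7 that(2) in \<open>simp_all add: card_Diff_singleton\<close>)
  \<comment> \<open>Let \<open>Y\<close> be a facet of the octahedron that avoids the merged vertex,
    and let \<open>h\<close> not be constant on it. Then \<open>h\<close>, a functional with its
    maximum on the complement of \<open>Y\<close>, and one constant on \<open>Y\<close> are
    independent and peel everything. So \<open>h\<close> is constant on all such facets.\<close>
  have off: "const_on h (?R - {q} - {p})" if pq: "p \<in> ?R" "q \<in> ?R" "h p \<noteq> h q" for p q
  proof -
    interpret octahedron "{g \<in> W. g p = g q}" "?R - {q}" by (rule oct[OF pq])
    have pq': "p \<noteq> q" using pq(3) by auto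
    show ?thesis
    proof (rule const_off_vertex)
      show "p \<in> ?R - {q}" using pq pq' by blast
      fix \<gamma> Y \<alpha> \<beta>
      assume Y: "\<gamma> \<in> {g \<in> W. g p = g q}" "Y \<subseteq> ?R - {q}" "p \<notin> Y" "card Y = 3" "\<alpha> \<noteq> \<beta>"
        "\<forall>u\<in>Y. \<gamma> u = \<alpha>" "\<forall>u\<in>?R - {q} - Y. \<gamma> u = \<beta>"
      show "const_on h Y"
      proof (rule ccontr)
        assume nc: "\<not> const_on h Y"
        define \<gamma>' where "\<gamma>' x = (if \<alpha> < \<beta> then 1 else -1) * \<gamma> x" for x
        define \<alpha>' \<beta>' where "\<alpha>' = (if \<alpha> < \<beta> then 1 else -1) * \<alpha>" and "\<beta>' = (if \<alpha> < \<beta> then 1 else -1) * \<beta>"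
        have ab: "\<alpha>' < \<beta>'" using Y(5) by (auto simp: \<alpha>'_def \<beta>'_def)
        have \<gamma>W: "\<gamma>' \<in> W" unfolding \<gamma>'_def using fdim_closed(2)[OF W] Y(1) by blast
        have gY: "\<gamma>' u = \<alpha>'" if "u \<in> Y" for u using Y(6) that by (simp add: \<gamma>'_def \<alpha>'_def)
        have gp: "\<gamma>' p = \<beta>'" using Y(3,7) pq pq' by (simp add: \<gamma>'_def \<beta>'_def)
        have gpq: "\<gamma>' q = \<gamma>' p" using Y(1) by (simp add: \<gamma>'_def)
        have gn: "\<gamma>' u = \<beta>'" if "u \<in> ?R" "u \<notin> Y" for u
        proof (cases "u = q")
          case True
          then show ?thesis using gpq gp by simp
        next
          case False
          then show ?thesis using Y(7) that by (simp add: \<gamma>'_def \<beta>'_def)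
        qed
        have gs: "\<gamma>' \<notin> fs.span {h}"
        proof
          assume "\<gamma>' \<in> fs.span {h}"
          then obtain r where r: "\<gamma>' = (\<lambda>x. r * h x)" unfolding fs.span_singleton by blast
          then have "r * h q = r * h p" using gpq by simp
          then have "r = 0" using pq(3) by simp
          then have "\<gamma>' = (\<lambda>x. 0)" using r by simp
          moreover obtain u where "u \<in> Y" using Y(4) by fastforce
          ultimately show False using gY[of u] gp ab by simp
        qed
        have finY: "finite Y" using Y(4) by (metis card.infinite zero_neq_numeral)
        obtain k where k: "k \<in> W" "const_on k Y" "k \<notin> fs.span {\<gamma>'}"
          using ann_not_span[OF assms(1) finY, of "{\<gamma>'}"] Y(4) by fastforce
        have ks: "k \<notin> fs.span {\<gamma>', h}"
        proof
          assume "k \<in> fs.span {\<gamma>', h}"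
          then have "k \<in> fs.span (insert h {\<gamma>'})" by (simp add: insert_commute)
          then obtain t where t: "k - (\<lambda>x. t * h x) \<in> fs.span {\<gamma>'}" unfolding fs.span_breakdown_eq by blast
          then obtain r where r: "k - (\<lambda>x. t * h x) = (\<lambda>x. r * \<gamma>' x)" unfolding fs.span_singleton by blast
          have kx: "k x = t * h x + r * \<gamma>' x" for x using fun_cong[OF r, of x] by simp
          have "t \<noteq> 0"
          proof
            assume "t = 0"
            then have "k = (\<lambda>x. r * \<gamma>' x)" using kx by auto
            then show False using k(3) unfolding fs.span_singleton by blast
          qed
          moreover have "t * h u = t * h v" if "u \<in> Y" "v \<in> Y" for u v
          proof -
            have "k u = k v" using k(2) that unfolding const_on_def by blast
            then show ?thesis using kx[of u] kx[of v] gY[OF that(1)] gY[OF that(2)] by simp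
          qed
          ultimately have "h u = h v" if "u \<in> Y" "v \<in> Y" for u v using that by (metis mult_cancel_left)
          then show False using nc unfolding const_on_def by blast
        qed
        have "{c \<in> C. h c < m \<and> \<gamma>' c < \<beta>'} = Y"
        proof (intro Set.set_eqI iffI)
          fix c assume "c \<in> {c \<in> C. h c < m \<and> \<gamma>' c < \<beta>'}"
          then show "c \<in> Y" using gn[of c] by auto
        next
          fix c assume "c \<in> Y"
          then show "c \<in> {c \<in> C. h c < m \<and> \<gamma>' c < \<beta>'}" using gY[of c] ab Y(2) by auto
        qed
        moreover have "\<gamma>' c \<le> \<beta>'" if "c \<in> C" "h c < m" for c
          using gn[of c] gY[of c] ab that by (cases "c \<in> Y") auto
        ultimately have "tsh 4 W C"
          using tsh4I[OF h(1) \<gamma>W k(1) h(2) gs ks h(3), where C = C and m' = "\<beta>'"] k(2) by simp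
        then show False using assms(4) by blast
      qed
    qed
  qed
  have "\<not> const_on h ?R" using const6 R7 A4 by linarith
  then obtain p0 q0 where pq0: "p0 \<in> ?R" "q0 \<in> ?R" "h p0 \<noteq> h q0" unfolding const_on_def by blast
  have c5: "card (?R - {q} - {p}) = 5" if "p \<in> ?R" "q \<in> ?R" "p \<noteq> q" for p q
    using that R7 finR by (simp add: card_Diff_singleton)
  have "card (?R - {q0} - {p0}) \<noteq> 0" using c5[OF pq0(1,2)] pq0(3) by (cases "p0 = q0") auto
  then have "?R - {q0} - {p0} \<noteq> {}" by (metis card.empty)
  then obtain r0 where r0: "r0 \<in> ?R - {q0} - {p0}" by blast
  define \<kappa> where "\<kappa> = h r0"
  have \<kappa>0: "h r = \<kappa>" if "r \<in> ?R - {q0} - {p0}" for r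
    using off[OF pq0] that r0 unfolding const_on_def \<kappa>_def by blast
  obtain p where p: "p \<in> ?R" "h p \<noteq> \<kappa>" "p = p0 \<or> p = q0"
    using pq0 by (cases "h p0 = \<kappa>") auto
  define q where "q = (if p = p0 then q0 else p0)"
  have q: "q \<in> ?R" "p \<noteq> q" "?R - {q} - {p} = ?R - {q0} - {p0}" using p pq0 by (auto simp: q_def)
  have pr0: "h p \<noteq> h r0" using p(2) by (simp add: \<kappa>_def)
  have r0R: "r0 \<in> ?R" "r0 \<noteq> p" "r0 \<noteq> q" using r0 q(3) by auto
  \<comment> \<open>Apart from \<open>p\<close> and \<open>q\<close> all points below the facet have
    level \<open>\<kappa>\<close>, and \<open>p\<close> does not. Merging \<open>p\<close> with
    \<open>r0\<close> instead shows that \<open>q\<close> is on the level of the others.\<close>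
  have Rk: "h r = \<kappa>" if "r \<in> ?R - {p}" for r
  proof (cases "r = q")
    case True
    have "card (?R - {r0} - {p} - {q}) = 4"
      using c5[OF p(1) r0R(1)] r0R q finR by (simp add: card_Diff_singleton)
    then have "card (?R - {r0} - {p} - {q}) \<noteq> 0" by simp
    then have "?R - {r0} - {p} - {q} \<noteq> {}" by (metis card.empty)
    then obtain r' where r': "r' \<in> ?R - {r0} - {p} - {q}" by blast
    then have "h q = h r'" using off[OF p(1) r0R(1) pr0] q r0R unfolding const_on_def by blast
    also have "h r' = \<kappa>" by (rule \<kappa>0) (use r' q(3) in blast)
    finally show ?thesis using True by simp
  next
    case False
    then show ?thesis using \<kappa>0 that q(3) by blast
  qed
  have km: "\<kappa> < m" using r0R by (auto simp: \<kappa>_def)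
  \<comment> \<open>Otherwise \<open>\<kappa>\<close> is the lowest level, and peeling it first
    leaves at most the four points of the facet and \<open>p\<close>.\<close>
  have pk: "h p < \<kappa>"
  proof (rule ccontr)
    assume "\<not> ?thesis"
    then have kp: "\<kappa> < h p" using p(2) by simp
    have le: "\<kappa> \<le> h c" if "c \<in> C" for c
      using Rk[of c] h(3)[OF that] that kp km by (cases "c = p"; cases "h c = m") auto
    have "{c \<in> C. \<kappa> < h c} \<subseteq> insert p ?A"
    proof
      fix c assume c: "c \<in> {c \<in> C. \<kappa> < h c}"
      then have "c \<notin> ?R - {p}" using Rk[of c] by auto
      then show "c \<in> insert p ?A" using c h(3)[of c] by auto
    qed
    then have "card {c \<in> C. \<kappa> < h c} \<le> card (insert p ?A)" using C(1) by (intro card_mono) auto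
    also have "\<dots> \<le> 5" using A4 C(1) by (simp add: card_insert_if)
    finally show False using neg[OF le] by simp
  qed
  have Keq: "{c \<in> C. h c = \<kappa>} = ?R - {p}" using Rk km pk by auto
  have K6: "card (?R - {p}) = 6" using R7 p(1) by (simp add: card_Diff_singleton)
  have part3: "c = p \<or> h c = \<kappa> \<or> h c = m" if "c \<in> C" for c
    using Rk[of c] h(3)[OF that] that by (cases "h c = m") auto
  let ?W0 = "{g \<in> W. g r0 = g p}"
  interpret octahedron ?W0 "?R - {p}" by (rule oct[OF r0R(1) p(1) pr0[symmetric]])
  obtain \<sigma> where \<sigma>: "\<And>u. u \<in> ?R - {p} \<Longrightarrow> \<sigma> u \<in> ?R - {p} \<and> \<sigma> u \<noteq> u \<and> \<sigma> (\<sigma> u) = u"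
    "\<And>g u v. g \<in> ?W0 \<Longrightarrow> u \<in> ?R - {p} \<Longrightarrow> v \<in> ?R - {p} \<Longrightarrow> g u + g (\<sigma> u) = g v + g (\<sigma> v)"
    by (rule antipode) blast
  \<comment> \<open>Subtracting this multiple of \<open>h\<close> makes a functional agree on
    \<open>r0\<close> and \<open>p\<close>, so that the results for the merged configuration apply.
    On the octahedron \<open>h\<close> is constant, so the relations there are unaffected.\<close>
  define tt where "tt g = (g p - g r0) / (h p - h r0)" for g
  have red: "(\<lambda>x. g x - tt g * h x) \<in> ?W0" if "g \<in> W" for g
  proof -
    have "(\<lambda>x. g x - tt g * h x) \<in> W" using fdim_closed(4)[OF assms(1) that fdim_closed(2)[OF assms(1) h(1)]] .
    moreover have "tt g * (h p - h r0) = g p - g r0" using pr0 by (simp add: tt_def)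
    then have "g r0 - tt g * h r0 = g p - tt g * h p" by (simp add: algebra_simps)
    ultimately show ?thesis by simp
  qed
  have "g \<in> fs.span {h}" if g: "g \<in> W" "const_on g (?R - {p})" for g
  proof -
    have "const_on (\<lambda>x. g x - tt g * h x) (?R - {p})"
      unfolding const_on_def
    proof (intro ballI)
      fix a b assume ab: "a \<in> ?R - {p}" "b \<in> ?R - {p}"
      have "g a = g b" using g(2) ab unfolding const_on_def by blast
      then show "g a - tt g * h a = g b - tt g * h b" using Rk[OF ab(1)] Rk[OF ab(2)] by simp
    qed
    from nd[OF red[OF g(1)] this] have "g x - tt g * h x = 0" for x by (rule fun_cong)
    then have "g = (\<lambda>x. tt g * h x)" by auto
    then show ?thesis unfolding fs.span_singleton by blast
  qed
  moreover have "g u + g (\<sigma> u) = g v + g (\<sigma> v)" if g: "g \<in> W" and uv: "u \<in> ?R - {p}" "v \<in> ?R - {p}" for g u v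
  proof -
    have "\<sigma> u \<in> ?R - {p}" "\<sigma> v \<in> ?R - {p}" using \<sigma>(1) uv by blast+
    then show ?thesis using \<sigma>(2)[OF red[OF g] uv] Rk[OF uv(1)] Rk[OF uv(2)] Rk[of "\<sigma> u"] Rk[of "\<sigma> v"] by simp
  qed
  ultimately have "obstruction W C h m p \<kappa> \<sigma>"
    unfolding obstruction_def Keq
    using h(1,2) p(1) pk km A4 K6 \<sigma>(1) part3 by (intro conjI ballI impI) blast+
  then show ?thesis by blast
qed

text \<open>On the second octahedron \<open>h\<close> takes only the values \<open>\<kappa>\<close>
  and \<open>m\<close>, and antipodal sums are constant, so each antipodal pair takes both: the
  octahedron splits into triples exchanged by \<open>\<sigma>2\<close>. On the first octahedron the
  triple \<open>F'\<close> is odd, so the fixed-point-free involution \<open>\<sigma>\<close> cannot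
  preserve it and exchanges it with the remaining triple.\<close>

lemma obstruction_swap:
  fixes C :: "'p set"
  assumes C: "finite C" and o1: "obstruction W C h m p \<kappa> \<sigma>" and o2: "obstruction W C h2 m2 p2 \<kappa>2 \<sigma>2"
    and hp: "h2 p = m2"
  defines "F \<equiv> {c \<in> C. h c = \<kappa> \<and> h2 c = m2}" and "F' \<equiv> {c \<in> C. h c = \<kappa> \<and> h2 c = \<kappa>2}"
    and "T \<equiv> {c \<in> C. h c = m \<and> h2 c = \<kappa>2}"
  shows "h p2 = m" "card F = 3" "card F' = 3" "card T = 3"
    "c \<in> C \<Longrightarrow> c = p \<or> c = p2 \<or> c \<in> F \<or> c \<in> F' \<or> c \<in> T"
    "u \<in> F \<Longrightarrow> \<sigma> u \<in> F'" "u \<in> F' \<Longrightarrow> \<sigma> u \<in> F" "u \<in> F' \<Longrightarrow> \<sigma>2 u \<in> T" "u \<in> T \<Longrightarrow> \<sigma>2 u \<in> F'"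
proof -
  define Om where "Om = {c \<in> C. h c = \<kappa>}"
  define Om2 where "Om2 = {c \<in> C. h2 c = \<kappa>2}"
  have hW: "h \<in> W" "h2 \<in> W" and pC: "p \<in> C" "p2 \<in> C" and lt: "h p < \<kappa>" "\<kappa> < m" "h2 p2 < \<kappa>2" "\<kappa>2 < m2"
    and cA: "card {c \<in> C. h c = m} = 4" "card {c \<in> C. h2 c = m2} = 4" and cO: "card Om = 6" "card Om2 = 6"
    using o1 o2 unfolding obstruction_def Om_def Om2_def by blast+
  have tri: "\<And>c. c \<in> C \<Longrightarrow> c = p \<or> h c = \<kappa> \<or> h c = m" "\<And>c. c \<in> C \<Longrightarrow> c = p2 \<or> h2 c = \<kappa>2 \<or> h2 c = m2"
    using o1 o2 unfolding obstruction_def by blast+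
  have span: "\<And>g. g \<in> W \<Longrightarrow> const_on g Om \<Longrightarrow> g \<in> fs.span {h}"
    using o1 unfolding obstruction_def Om_def by blast
  have inv: "\<And>u. u \<in> Om \<Longrightarrow> \<sigma> u \<in> Om \<and> \<sigma> u \<noteq> u \<and> \<sigma> (\<sigma> u) = u"
    using o1 unfolding obstruction_def Om_def[symmetric] by blast
  have inv2: "\<And>u. u \<in> Om2 \<Longrightarrow> \<sigma>2 u \<in> Om2 \<and> \<sigma>2 u \<noteq> u \<and> \<sigma>2 (\<sigma>2 u) = u"
    using o2 unfolding obstruction_def Om2_def[symmetric] by blast
  have sum: "\<And>g u v. g \<in> W \<Longrightarrow> u \<in> Om \<Longrightarrow> v \<in> Om \<Longrightarrow> g u + g (\<sigma> u) = g v + g (\<sigma> v)"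
    using o1 unfolding obstruction_def Om_def[symmetric] by blast
  have sum2: "\<And>g u v. g \<in> W \<Longrightarrow> u \<in> Om2 \<Longrightarrow> v \<in> Om2 \<Longrightarrow> g u + g (\<sigma>2 u) = g v + g (\<sigma>2 v)"
    using o2 unfolding obstruction_def Om2_def[symmetric] by blast
  have fin: "finite Om" "finite Om2" "finite F" "finite F'" "finite T"
    using C by (simp_all add: Om_def Om2_def F_def F'_def T_def)
  have val: "h u = \<kappa> \<or> h u = m" if "u \<in> Om2" for u
    using tri(1)[of u] that hp lt by (auto simp: Om2_def)
  \<comment> \<open>One pair with both values \<open>\<kappa>\<close> would put the second
    octahedron into the hyperplane of the first, so the two coincide. Then \<open>h2\<close> is a
    multiple of \<open>h\<close>, and its facet contains no point besides \<open>p\<close>.\<close>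
  have s1: "\<not> (h u = \<kappa> \<and> h (\<sigma>2 u) = \<kappa>)" if u: "u \<in> Om2" for u
  proof
    assume k: "h u = \<kappa> \<and> h (\<sigma>2 u) = \<kappa>"
    have "h v = \<kappa>" if v: "v \<in> Om2" for v
    proof -
      have "h v + h (\<sigma>2 v) = 2 * \<kappa>" using sum2[OF hW(1) u v] k by simp
      then show ?thesis using val[OF v] val[of "\<sigma>2 v"] inv2[OF v] lt by auto
    qed
    then have "Om2 \<subseteq> Om" by (auto simp: Om_def Om2_def)
    then have eq: "Om2 = Om" using card_subset_eq[OF fin(1)] cO by metis
    have "const_on h2 Om" unfolding eq[symmetric] const_on_def Om2_def by simp
    then obtain r where r: "h2 = (\<lambda>x. r * h x)" using span[OF hW(2)] unfolding fs.span_singleton by blast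
    have hx: "h2 x = r * h x" for x unfolding r ..
    have "h2 u = \<kappa>2" using u unfolding Om2_def by blast
    then have "\<kappa>2 = r * \<kappa>" using hx[of u] k by metis
    moreover have "m2 = r * h p" using hx[of p] hp by metis
    ultimately have rk: "\<kappa>2 = r * \<kappa>" "m2 = r * h p" by blast+
    then have r0: "r \<noteq> 0" using lt(4) rk by auto
    have "{c \<in> C. h2 c = m2} \<subseteq> {p}"
    proof
      fix c assume c: "c \<in> {c \<in> C. h2 c = m2}"
      then have "h2 c = m2" by blast
      then have "h2 c = h2 p" unfolding hp .
      then have "r * h c = r * h p" unfolding hx .
      then have "h c = h p" using r0 mult_cancel_left by metis
      then have "h c \<noteq> \<kappa>" "h c \<noteq> m" using lt by linarith+
      then show "c \<in> {p}" using tri(1)[of c] c by blast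
    qed
    then have "card {c \<in> C. h2 c = m2} \<le> card {p}" by (intro card_mono) auto
    then show False using cA(2) by simp
  qed
  have s2: "\<not> (h u = m \<and> h (\<sigma>2 u) = m)" if u: "u \<in> Om2" for u
  proof
    assume k: "h u = m \<and> h (\<sigma>2 u) = m"
    have "h v = m" if v: "v \<in> Om2" for v
    proof -
      have "h v + h (\<sigma>2 v) = 2 * m" using sum2[OF hW(1) u v] k by simp
      then show ?thesis using val[OF v] val[of "\<sigma>2 v"] inv2[OF v] lt by auto
    qed
    then have "Om2 \<subseteq> {c \<in> C. h c = m}" by (auto simp: Om2_def)
    then have "card Om2 \<le> card {c \<in> C. h c = m}" using C by (intro card_mono) auto
    then show False using cA(1) cO(2) by simp
  qed
  have O2: "Om2 = F' \<union> T" using val by (auto simp: Om2_def F'_def T_def)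
  have FT: "\<sigma>2 u \<in> T" if "u \<in> F'" for u
  proof -
    have u: "u \<in> Om2" using that O2 by blast
    then have "\<sigma>2 u \<in> Om2" using inv2 by blast
    then show ?thesis using s1[OF u] val[of "\<sigma>2 u"] that by (auto simp: Om2_def F'_def T_def)
  qed
  have TF: "\<sigma>2 u \<in> F'" if "u \<in> T" for u
  proof -
    have u: "u \<in> Om2" using that O2 by blast
    then have "\<sigma>2 u \<in> Om2" using inv2 by blast
    then show ?thesis using s2[OF u] val[of "\<sigma>2 u"] that by (auto simp: Om2_def F'_def T_def)
  qed
  have "bij_betw \<sigma>2 F' T"
    by (rule bij_betw_byWitness[where f' = \<sigma>2]) (use inv2 O2 FT TF in auto)
  then have "card F' = card T" by (rule bij_betw_same_card)
  moreover have "card F' + card T = 6"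
  proof -
    have "F' \<inter> T = {}" using lt by (auto simp: F'_def T_def)
    then show ?thesis using card_Un_disjoint[OF fin(4,5)] O2 cO(2) by simp
  qed
  ultimately have F'3: "card F' = 3" and T3: "card T = 3" by linarith+
  have F'O: "F' \<subseteq> Om" by (auto simp: F'_def Om_def)
  have nF': "\<sigma> u \<notin> F'" if u: "u \<in> F'" for u
  proof
    assume su: "\<sigma> u \<in> F'"
    have "\<sigma> v \<in> F'" if v: "v \<in> F'" for v
    proof -
      have "v \<in> Om" "u \<in> Om" "\<sigma> v \<in> Om" using F'O u v inv by blast+
      then have "h2 v + h2 (\<sigma> v) = h2 u + h2 (\<sigma> u)" "\<sigma> v \<in> C" "h (\<sigma> v) = \<kappa>"
        using sum[OF hW(2), of v u] unfolding Om_def by blast+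
      moreover have "h2 v = \<kappa>2" "h2 u = \<kappa>2" "h2 (\<sigma> u) = \<kappa>2" using u v su unfolding F'_def by blast+
      ultimately show ?thesis unfolding F'_def by simp
    qed
    then have "even (card F')" using inv F'O fin(4) by (intro even_card_involution[where f = \<sigma>]) auto
    then show False using F'3 by simp
  qed
  have img: "\<sigma> ` F' = Om - F'"
  proof (rule card_subset_eq)
    show "\<sigma> ` F' \<subseteq> Om - F'" using inv F'O nF' by blast
    have "inj_on \<sigma> F'" by (rule inj_on_inverseI[where g = \<sigma>]) (use inv F'O in blast)
    then show "card (\<sigma> ` F') = card (Om - F')" using F'3 cO(1) card_Diff_subset[OF fin(4) F'O]
      by (simp add: card_image)
  qed (use fin in simp)
  have OF3: "card (Om - F') = 3" using F'3 cO(1) card_Diff_subset[OF fin(4) F'O] by simp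
  have cc: "h2 u = h2 v" if uv: "u \<in> Om - F'" "v \<in> Om - F'" for u v
  proof -
    obtain u' v' where "u' \<in> F'" "v' \<in> F'" "u = \<sigma> u'" "v = \<sigma> v'" using uv unfolding img[symmetric] by blast
    moreover from this have "u' \<in> Om" "v' \<in> Om" "h2 u' = \<kappa>2" "h2 v' = \<kappa>2" using F'O unfolding F'_def by blast+
    ultimately show ?thesis using sum[OF hW(2), of u' v'] by simp
  qed
  have OmF: "Om - F' = F"
  \<comment> \<open>The three remaining points have the same value of \<open>h2\<close>; any value
    other than \<open>\<kappa>2\<close> and \<open>m2\<close> would make all of them equal to
    \<open>p2\<close>.\<close>
  proof (intro Set.set_eqI iffI)
    fix u assume u: "u \<in> Om - F'"
    have uC: "u \<in> C" "h u = \<kappa>" "h2 u \<noteq> \<kappa>2" using u by (auto simp: Om_def F'_def)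
    have "h2 u = m2"
    proof (rule ccontr)
      assume nm: "h2 u \<noteq> m2"
      have "v = p2" if v: "v \<in> Om - F'" for v
      proof -
        have "h2 v = h2 u" by (rule cc[OF v u])
        then have "h2 v \<noteq> \<kappa>2" "h2 v \<noteq> m2" using uC(3) nm by argo+
        moreover have "v \<in> C" using v unfolding Om_def by blast
        ultimately show ?thesis using tri(2) by blast
      qed
      then have "card (Om - F') \<le> card {p2}" by (intro card_mono) auto
      then show False using OF3 by simp
    qed
    then show "u \<in> F" using uC by (simp add: F_def)
  qed (use lt in \<open>auto simp: F_def F'_def Om_def\<close>)
  show F3: "card F = 3" "card F' = 3" "card T = 3" using OF3 OmF F'3 T3 by simp_all
  have OFF: "Om = F \<union> F'" using OmF F'O by blast
  show "\<sigma> u \<in> F" if "u \<in> F'" for u using img OmF that by blast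
  show "\<sigma> u \<in> F'" if "u \<in> F" for u
  proof -
    have "u \<in> \<sigma> ` F'" using that unfolding img OmF .
    then obtain u' where u': "u' \<in> F'" "u = \<sigma> u'" by blast
    then have "\<sigma> u = u'" using inv[of u'] F'O by blast
    then show ?thesis using u'(1) by simp
  qed
  show "\<sigma>2 u \<in> T" if "u \<in> F'" for u using FT that .
  show "\<sigma>2 u \<in> F'" if "u \<in> T" for u using TF that .
  have "insert p F = {c \<in> C. h2 c = m2}"
  proof (rule card_subset_eq)
    have "p \<notin> F" using lt by (auto simp: F_def)
    then show "card (insert p F) = card {c \<in> C. h2 c = m2}" using F3(1) cA(2) fin(3) by simp
  qed (use C pC hp in \<open>auto simp: F_def\<close>)
  then have A2: "c = p \<or> c \<in> F" if "c \<in> C" "h2 c = m2" for c using that by blast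
  have A: "c = p2 \<or> c \<in> T" if c: "c \<in> C" "h c = m" for c
  proof -
    have "c \<noteq> p" "c \<notin> F" using c lt unfolding F_def by auto
    then have "h2 c \<noteq> m2" using A2[OF c(1)] by blast
    then show ?thesis using tri(2)[OF c(1)] c unfolding T_def by blast
  qed
  show "h p2 = m"
  proof (rule ccontr)
    assume "\<not> ?thesis"
    then have "{c \<in> C. h c = m} \<subseteq> T" using A by auto
    then have "card {c \<in> C. h c = m} \<le> card T" using fin(5) by (intro card_mono)
    then show False using cA(1) T3 by simp
  qed
  show "c = p \<or> c = p2 \<or> c \<in> F \<or> c \<in> F' \<or> c \<in> T" if "c \<in> C" for c
    using tri(1)[OF that] A[OF that] OFF that by (auto simp: Om_def)
qed

text \<open>The values of \<open>h\<close> and \<open>h2\<close> place the eleven points at five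
  positions in a plane: \<open>p\<close>, \<open>p2\<close> and three triples. The side of the line
  through \<open>p\<close> and \<open>F'\<close> on which \<open>p2\<close> lies, given by the sign
  of \<open>D\<close>, determines a further facet, and each case contradicts the structure forced by
  \<open>obstruction_swap\<close>.\<close>

lemma tsh4_small:
  fixes C :: "'p set"
  assumes W: "fdim W 4" and C: "finite C" "card C \<le> 11"
  shows "tsh 4 W C"
proof (rule ccontr)
  assume bad: "\<not> ?thesis"
  have W4: "fdim W (Suc 3)" using W by simp
  have nc: "\<not> const_on h C" if "h \<in> W" "h \<noteq> (\<lambda>x. 0)" for h
    using tsh_const[OF W4 _ that] bad by auto
  have obs: "\<exists>h' m' p' \<kappa>' \<sigma>'. obstruction W C h' m' p' \<kappa>' \<sigma>' \<and> (\<forall>c\<in>C. h c = m \<longrightarrow> h' c = m')"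
    if h: "h \<in> W" "h \<noteq> (\<lambda>x. 0)" "\<And>c. c \<in> C \<Longrightarrow> h c \<le> m" and ex: "\<exists>c\<in>C. h c = m" for h m
  proof -
    obtain h' m' where h': "h' \<in> W" "h' \<noteq> (\<lambda>x. 0)" "\<forall>c\<in>C. h' c \<le> m'" "{c \<in> C. h c = m} \<subseteq> {c \<in> C. h' c = m'}"
      "4 \<le> card {c \<in> C. h' c = m'} \<or> {c \<in> C. h' c = m'} = C"
      using facet[OF W h(1,2) C(1) h(3) ex] by blast
    have "{c \<in> C. h' c = m'} \<noteq> C"
    proof
      assume "{c \<in> C. h' c = m'} = C"
      then have "h' c = m'" if "c \<in> C" for c using that by blast
      then show False using nc[OF h'(1,2)] unfolding const_on_def by metis
    qed
    then have "4 \<le> card {c \<in> C. h' c = m'}" using h'(5) by blast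
    then have "\<exists>p \<kappa> \<sigma>. obstruction W C h' m' p \<kappa> \<sigma>"
      using four_dim_obstruction[OF W C bad h'(1,2)] h'(3) by blast
    then show ?thesis using h'(4) by blast
  qed
  have ne: "C \<noteq> {}" using bad tsh_empty[OF W] by auto
  obtain h0 where h0: "h0 \<in> W" "h0 \<noteq> (\<lambda>x. 0)"
    using fdim_not_span[OF W, of "{}"] by (auto simp: zero_fun_def)
  have "\<exists>h m p \<kappa> \<sigma>. obstruction W C h m p \<kappa> \<sigma>"
  proof -
    have le: "h0 c \<le> Max (h0 ` C)" if "c \<in> C" for c using C(1) that by simp
    have "Max (h0 ` C) \<in> h0 ` C" using C(1) ne by (intro Max_in) auto
    then obtain c where c: "Max (h0 ` C) = h0 c" "c \<in> C" by (rule imageE)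
    have "\<exists>c\<in>C. h0 c = Max (h0 ` C)" by (rule bexI[OF _ c(2)]) (rule c(1)[symmetric])
    from obs[OF h0 le this] show ?thesis by blast
  qed
  then obtain h m p \<kappa> \<sigma> where o1: "obstruction W C h m p \<kappa> \<sigma>" by blast
  have h: "h \<in> W" "h \<noteq> (\<lambda>x. 0)" "p \<in> C" "h p < \<kappa>" "\<kappa> < m" "\<And>c. c \<in> C \<Longrightarrow> c = p \<or> h c = \<kappa> \<or> h c = m"
    using o1 unfolding obstruction_def by blast+
  have "\<exists>h' m' p' \<kappa>' \<sigma>'. obstruction W C h' m' p' \<kappa>' \<sigma>' \<and> (\<forall>c\<in>C. - h c = - h p \<longrightarrow> h' c = m')"
  proof (rule obs)
    show "(\<lambda>x. - h x) \<in> W" by (rule fdim_closed(3)[OF W h(1)])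
    show "(\<lambda>x. - h x) \<noteq> (\<lambda>x. 0)" using h(2) by (auto simp: fun_eq_iff)
    show "- h c \<le> - h p" if "c \<in> C" for c using h(6)[OF that] h(4,5) by auto
  qed (use h(3) in blast)
  then obtain h2 m2 p2 \<kappa>2 \<sigma>2 where o2: "obstruction W C h2 m2 p2 \<kappa>2 \<sigma>2" and "\<forall>c\<in>C. - h c = - h p \<longrightarrow> h2 c = m2"
    by blast
  then have hp: "h2 p = m2" using h(3) by blast
  have h2: "h2 \<in> W" "p2 \<in> C" "h2 p2 < \<kappa>2" "\<kappa>2 < m2" using o2 unfolding obstruction_def by blast+
  let ?F = "{c \<in> C. h c = \<kappa> \<and> h2 c = m2}" and ?F' = "{c \<in> C. h c = \<kappa> \<and> h2 c = \<kappa>2}" and ?T = "{c \<in> C. h c = m \<and> h2 c = \<kappa>2}"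
  note sw = obstruction_swap[OF C(1) o1 o2 hp]
  define A1 B1 where "A1 = \<kappa> - h p" and "B1 = m2 - \<kappa>2"
  have pos: "A1 > 0" "B1 > 0" using h h2 by (simp_all add: A1_def B1_def)
  define D where "D = A1 * (\<kappa>2 - h2 p2) - (m - \<kappa>) * B1"
  \<comment> \<open>Constant on the line through the positions of \<open>p\<close> and
    \<open>F'\<close>; the triples \<open>?F\<close> and \<open>?T\<close> lie strictly below
    it.\<close>
  define \<eta> where "\<eta> x = (- B1) * h x + (- A1) * h2 x" for x
  define m' where "m' = \<eta> p"
  have \<eta>W: "\<eta> \<in> W" unfolding \<eta>_def by (intro fdim_closed(1,2)[OF W] h h2)
  have e: "\<eta> c = m' - A1 * B1" if "c \<in> ?F" for c
    using that hp by (simp add: \<eta>_def m'_def A1_def B1_def algebra_simps)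
  have e': "\<eta> c = m'" if "c \<in> ?F'" for c
    using that hp by (simp add: \<eta>_def m'_def A1_def B1_def algebra_simps)
  have eT: "\<eta> c = m' - B1 * (m - \<kappa>)" if "c \<in> ?T" for c
    using that hp by (simp add: \<eta>_def m'_def A1_def B1_def algebra_simps)
  have ep: "\<eta> p2 = m' + D"
    using hp sw(1) by (simp add: \<eta>_def m'_def A1_def B1_def D_def algebra_simps)
  have AB: "A1 * B1 > 0" "B1 * (m - \<kappa>) > 0" using pos h(5) by simp_all
  have "?F \<noteq> {}" using sw(2) by (metis card.empty zero_neq_numeral)
  then obtain f0 where f0: "f0 \<in> ?F" by blast
  have \<eta>0: "\<eta> \<noteq> (\<lambda>x. 0)"
  proof
    assume z: "\<eta> = (\<lambda>x. 0)"
    have "\<eta> f0 = 0" "m' = 0" unfolding m'_def z by (rule refl)+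
    then show False using e[OF f0] AB(1) by linarith
  qed
  have obs\<eta>: "\<exists>p \<kappa> \<sigma>. obstruction W C \<eta> m' p \<kappa> \<sigma>" if D: "D \<le> 0"
  proof (rule four_dim_obstruction[OF W C bad \<eta>W \<eta>0])
    show "\<eta> c \<le> m'" if "c \<in> C" for c
      using sw(5)[OF that] e[of c] e'[of c] eT[of c] ep AB D by (auto simp: m'_def)
    have "insert p ?F' \<subseteq> {c \<in> C. \<eta> c = m'}" using h(3) e' by (auto simp: m'_def)
    then have "card (insert p ?F') \<le> card {c \<in> C. \<eta> c = m'}" using C(1) by (intro card_mono) auto
    moreover have "p \<notin> ?F'" using h(4) by auto
    ultimately show "4 \<le> card {c \<in> C. \<eta> c = m'}" using sw(3) C(1) by simp
  qed
  consider "D > 0" | "D = 0" | "D < 0" by linarith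
  then show False
  proof cases
    case 1
    \<comment> \<open>Now the line through \<open>p\<close> and \<open>p2\<close> supports the
      configuration, so some facet contains both. But in the swap of \<open>h\<close> with this
      facet no point with \<open>h\<close> equal to \<open>m\<close> lies on the facet, whereas
      \<open>h p2 = m\<close>.\<close>
    define \<zeta> where "\<zeta> x = (- (m2 - h2 p2)) * h x + (- (m - h p)) * h2 x" for x
    have z: "\<zeta> c = \<zeta> p - (m2 - h2 p2) * A1" if "c \<in> ?F" for c
      using that hp by (simp add: \<zeta>_def A1_def algebra_simps)
    have z': "\<zeta> c = \<zeta> p - D" if "c \<in> ?F'" for c
      using that hp by (simp add: \<zeta>_def A1_def B1_def D_def algebra_simps)
    have zT: "\<zeta> c = \<zeta> p - (m - h p) * (\<kappa>2 - h2 p2)" if "c \<in> ?T" for c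
      using that hp by (simp add: \<zeta>_def algebra_simps)
    have zp: "\<zeta> p2 = \<zeta> p" using hp sw(1) by (simp add: \<zeta>_def algebra_simps)
    have zpos: "(m2 - h2 p2) * A1 > 0" "(m - h p) * (\<kappa>2 - h2 p2) > 0" using pos h h2 by simp_all
    have "\<exists>h' m' p' \<kappa>' \<sigma>'. obstruction W C h' m' p' \<kappa>' \<sigma>' \<and> (\<forall>c\<in>C. \<zeta> c = \<zeta> p \<longrightarrow> h' c = m')"
    proof (rule obs)
      show "\<zeta> \<in> W" unfolding \<zeta>_def by (intro fdim_closed(1,2)[OF W] h h2)
      show "\<zeta> \<noteq> (\<lambda>x. 0)"
      proof
        assume z0: "\<zeta> = (\<lambda>x. 0)"
        have "\<zeta> f0 = 0" "\<zeta> p = 0" unfolding z0 by (rule refl)+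
        then show False using z[OF f0] zpos by linarith
      qed
      show "\<zeta> c \<le> \<zeta> p" if "c \<in> C" for c
        using sw(5)[OF that] z[of c] z'[of c] zT[of c] zp zpos 1 by auto
    qed (use h(3) in blast)
    then obtain h3 m3 p3 \<kappa>3 \<sigma>3 where o3: "obstruction W C h3 m3 p3 \<kappa>3 \<sigma>3" and "\<forall>c\<in>C. \<zeta> c = \<zeta> p \<longrightarrow> h3 c = m3"
      by blast
    then have v3: "h3 p = m3" "h3 p2 = m3" using h(3) h2(2) zp by auto
    have "h3 p3 < \<kappa>3" "\<kappa>3 < m3" using o3 unfolding obstruction_def by blast+
    then show False using obstruction_swap(5)[OF C(1) o1 o3 v3(1) h2(2)] v3(2) sw(1) h(4,5) by auto
  next
    case 2
    \<comment> \<open>The facet would contain the five points \<open>p\<close>, \<open>p2\<close>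
      and \<open>?F'\<close>.\<close>
    then have "card {c \<in> C. \<eta> c = m'} = 4" using obs\<eta> unfolding obstruction_def by auto
    moreover have "insert p2 (insert p ?F') \<subseteq> {c \<in> C. \<eta> c = m'}"
      using h(3) h2(2) e' ep 2 by (auto simp: m'_def)
    then have "card (insert p2 (insert p ?F')) \<le> card {c \<in> C. \<eta> c = m'}" using C(1) by (intro card_mono) auto
    moreover have "p \<notin> ?F'" "p2 \<notin> insert p ?F'" using h(4,5) sw(1) by auto
    ultimately show False using sw(3) C(1) by simp
  next
    case 3
    then obtain p3 \<kappa>3 \<sigma>3 where o3: "obstruction W C \<eta> m' p3 \<kappa>3 \<sigma>3" using obs\<eta> by auto
    have ep3: "\<eta> p = m'" by (simp add: m'_def)
    note sw3 = obstruction_swap[OF C(1) o1 o3 ep3]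
    \<comment> \<open>Here \<open>p\<close> and \<open>?F'\<close> form the facet, and the triples
      of the new octahedron are identified as \<open>?F\<close> and \<open>?T\<close>. Any two of
      the three triples now make up an octahedron.\<close>
    let ?G' = "{c \<in> C. h c = \<kappa> \<and> \<eta> c = \<kappa>3}" and ?S = "{c \<in> C. h c = m \<and> \<eta> c = \<kappa>3}"
    have k3: "\<kappa>3 < m'" using o3 unfolding obstruction_def by blast
    have "?G' \<subseteq> ?F"
    proof
      fix c assume c: "c \<in> ?G'"
      then have "c \<notin> ?F'" using e' k3 by auto
      then show "c \<in> ?F" using sw(5)[of c] c h(4,5) sw(1) by auto
    qed
    then have GF: "?G' = ?F" using sw(2) sw3(3) C(1) by (intro card_subset_eq) auto
    have Sin: "c = p2 \<or> c \<in> ?T" if "c \<in> ?S" for c using sw(5)[of c] that h(4,5) by auto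
    have "\<exists>c\<in>?S. c \<in> ?T"
    proof (rule ccontr)
      assume "\<not> ?thesis"
      then have "?S \<subseteq> {p2}" using Sin by blast
      then have "card ?S \<le> card {p2}" by (intro card_mono) auto
      then show False using sw3(4) by simp
    qed
    then have k3': "\<kappa>3 = m' - B1 * (m - \<kappa>)" using eT by auto
    then have "?T \<subseteq> ?S" using eT by auto
    then have TS: "?T = ?S" using sw(4) sw3(4) C(1) by (intro card_subset_eq) auto
    have sig: "\<sigma> u \<in> ?F'" "\<sigma>3 u \<in> ?T" if "u \<in> ?F" for u
      using sw(6)[OF that] sw3(8)[of u] that unfolding GF TS by blast+
    have sig3: "\<sigma>3 u \<in> ?F" if "u \<in> ?T" for u using sw3(9)[of u] that unfolding GF TS by blast
    \<comment> \<open>Going once around the three octahedra leads from \<open>?F\<close> back to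
      itself; the alternating sum of the three constant antipodal sums is a constant value of
      \<open>g f + g (\<pi> f)\<close>.\<close>
    define \<pi> where "\<pi> f = \<sigma>3 (\<sigma>2 (\<sigma> f))" for f
    have \<pi>: "\<pi> f \<in> ?F" if "f \<in> ?F" for f
      unfolding \<pi>_def by (rule sig3[OF sw(8)[OF sig(1)[OF that]]])
    have sum: "\<And>g u v. g \<in> W \<Longrightarrow> u \<in> C \<Longrightarrow> h u = \<kappa> \<Longrightarrow> v \<in> C \<Longrightarrow> h v = \<kappa> \<Longrightarrow> g u + g (\<sigma> u) = g v + g (\<sigma> v)"
      using o1 unfolding obstruction_def by blast
    have sum2: "\<And>g u v. g \<in> W \<Longrightarrow> u \<in> C \<Longrightarrow> h2 u = \<kappa>2 \<Longrightarrow> v \<in> C \<Longrightarrow> h2 v = \<kappa>2 \<Longrightarrow> g u + g (\<sigma>2 u) = g v + g (\<sigma>2 v)"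
      using o2 unfolding obstruction_def by blast
    have sum3: "\<And>g u v. g \<in> W \<Longrightarrow> u \<in> C \<Longrightarrow> \<eta> u = \<kappa>3 \<Longrightarrow> v \<in> C \<Longrightarrow> \<eta> v = \<kappa>3 \<Longrightarrow> g u + g (\<sigma>3 u) = g v + g (\<sigma>3 v)"
      using o3 unfolding obstruction_def by blast
    have gp: "g f + g (\<pi> f) = g f' + g (\<pi> f')" if g: "g \<in> W" and f: "f \<in> ?F" "f' \<in> ?F" for g f f'
    proof -
      have a: "\<sigma> f \<in> ?F'" "\<sigma> f' \<in> ?F'" using sig(1) f by blast+
      have b: "\<sigma>2 (\<sigma> f) \<in> ?T" "\<sigma>2 (\<sigma> f') \<in> ?T" using sw(8)[OF a(1)] sw(8)[OF a(2)] .
      have b': "\<sigma>2 (\<sigma> f) \<in> ?S" "\<sigma>2 (\<sigma> f') \<in> ?S" using b TS by blast+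
      show ?thesis using sum[OF g, of f f'] sum2[OF g, of "\<sigma> f" "\<sigma> f'"] sum3[OF g, of "\<sigma>2 (\<sigma> f)" "\<sigma>2 (\<sigma> f')"] f a b'
        unfolding \<pi>_def by force
    qed
    have "\<not> ?F \<subseteq> {f0, \<pi> f0}"
    proof
      assume "?F \<subseteq> {f0, \<pi> f0}"
      then have "card ?F \<le> card {f0, \<pi> f0}" by (intro card_mono) auto
      then show False using sw(2) card_insert_le_m1[of 2 "{\<pi> f0}" f0] by simp
    qed
    then obtain f3 where f3: "f3 \<in> ?F" "f3 \<noteq> f0" "f3 \<noteq> \<pi> f0" by blast
    have "card (?F - {f3}) = 2" using sw(2) f3(1) C(1) by (simp add: card_Diff_singleton)
    then have c3: "card (insert (\<sigma> f0) (?F - {f3})) \<le> 3"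
      using card_insert_le_m1[of 3 "?F - {f3}" "\<sigma> f0"] by simp
    have finA: "finite (insert (\<sigma> f0) (?F - {f3}))" using C(1) by simp
    \<comment> \<open>Three points and \<open>h\<close> leave room for \<open>g\<close> in dimension
      4. Since \<open>f0\<close> and \<open>\<pi> f0\<close> are among these points, the constant
      sum along \<open>\<pi>\<close> extends the value \<open>v\<close> to \<open>f3\<close>, and
      the sum along \<open>\<sigma>\<close> extends it to \<open>?F'\<close>. So \<open>g\<close> is
      constant on the first octahedron although it is no multiple of \<open>h\<close>.\<close>
    have "card {h} + card (insert (\<sigma> f0) (?F - {f3})) \<le> 4" using c3 by simp
    then obtain g where g: "g \<in> W" "const_on g (insert (\<sigma> f0) (?F - {f3}))" "g \<notin> fs.span {h}"
      using ann_not_span[OF W finA, of "{h}"] by auto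
    define v where "v = g f0"
    have f0': "f0 \<in> ?F - {f3}" using f0 f3(2) by blast
    have gv: "g u = v" if "u \<in> insert (\<sigma> f0) (?F - {f3})" for u
      using g(2) that f0' unfolding const_on_def v_def by blast
    have "g (\<pi> f0) = v" by (rule gv) (use \<pi>[OF f0] f3(3) in blast)
    then have s: "g f + g (\<pi> f) = 2 * v" if "f \<in> ?F" for f using gp[OF g(1) that f0] by (simp add: v_def)
    have g3: "g f3 = v"
    proof (cases "\<pi> f3 = f3")
      case False
      then have "g (\<pi> f3) = v" using \<pi>[OF f3(1)] by (intro gv) blast
      then show ?thesis using s[OF f3(1)] by simp
    qed (use s[OF f3(1)] in simp)
    have gF: "g u = v" if "u \<in> ?F" for u using gv[of u] g3 that by (cases "u = f3") auto
    have gF': "g u = v" if u: "u \<in> ?F'" for u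
    proof -
      have "g u + g (\<sigma> u) = g f0 + g (\<sigma> f0)" using sum[OF g(1), of u f0] u f0 by blast
      then show ?thesis using gF[OF sw(7)[OF u]] gv[of "\<sigma> f0"] by (simp add: v_def)
    qed
    have "const_on g {c \<in> C. h c = \<kappa>}"
    proof -
      have "g u = v" if "u \<in> {c \<in> C. h c = \<kappa>}" for u
        using sw(5)[of u] gF[of u] gF'[of u] that h(4,5) sw(1) by auto
      then show ?thesis unfolding const_on_def by metis
    qed
    then show False using g(1,3) o1 unfolding obstruction_def by blast
  qed
qed

section \<open>Powers of the reals and of the integers\<close>

lemma exponent_set_enat: "exponent_set (enat N) = {..<N}"
  by (auto simp: exponent_set_def)

lemma exponent_set_enat_Suc: "exponent_set (enat N + 1) = {..<Suc N}"
  by (auto simp: exponent_set_def one_enat_def)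

lemma exponent_set_infinity: "exponent_set \<infinity> = UNIV" "exponent_set (\<infinity> + 1) = UNIV"
  by (auto simp: exponent_set_def)

definition skip :: "nat \<Rightarrow> nat \<Rightarrow> nat" where
  "skip i j = (if j < i then j else Suc j)"

lemma skip_in: "j \<in> exponent_set n \<Longrightarrow> skip i j \<in> exponent_set (n + 1)"
  by (cases n) (auto simp: exponent_set_enat exponent_set_enat_Suc exponent_set_infinity skip_def)

lemma skip_cases:
  assumes "i \<in> exponent_set (n + 1)" "i \<noteq> i0" "i0 \<in> exponent_set (n + 1)"
  shows "\<exists>j\<in>exponent_set n. i = skip i0 j"
proof (cases "i < i0")
  case True
  then show ?thesis using assms
    by (intro bexI[of _ i]; cases n) (auto simp: exponent_set_enat exponent_set_enat_Suc exponent_set_infinity skip_def)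
next
  case False
  then show ?thesis using assms
    by (intro bexI[of _ "i - 1"]; cases n) (auto simp: exponent_set_enat exponent_set_enat_Suc exponent_set_infinity skip_def)
qed

lemma Suc_in_exponent_set: "Suc l \<in> exponent_set (m + 1) \<longleftrightarrow> l \<in> exponent_set m"
  by (cases m) (auto simp: exponent_set_enat exponent_set_enat_Suc exponent_set_infinity)

lemma zero_in_exponent_set: "0 \<in> exponent_set (m + 1)"
  by (cases m) (auto simp: exponent_set_enat_Suc exponent_set_infinity)

lemma le_in_exponent_set: "enat (Suc d) \<le> n \<Longrightarrow> j \<le> d \<Longrightarrow> j \<in> exponent_set n"
  by (cases n) (auto simp: exponent_set_enat exponent_set_infinity)

lemma real_space: "coord_space (real_power n) (real_power_topology n) (exponent_set n) (\<lambda>i x. x i)"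
  unfolding real_power_def real_power_topology_def
proof (rule coord_space_product[where r = "\<lambda>x. x"])
  show "comm_group real_group"
  proof (rule comm_groupI)
    show "\<exists>y\<in>carrier real_group. y \<otimes>\<^bsub>real_group\<^esub> x = \<one>\<^bsub>real_group\<^esub>" for x
      by (rule bexI[of _ "- x"]) (simp_all add: real_group_def)
  qed (simp_all add: real_group_def)
  show "\<exists>\<epsilon>>0. \<forall>y. \<bar>y - x\<bar> < \<epsilon> \<longrightarrow> y \<in> U" if "openin euclideanreal U" "x \<in> U" for U x
    using that unfolding open_openin[symmetric] open_dist dist_real_def by blast
qed (simp_all add: real_group_def)

lemma int_space: "coord_space (int_power m) (int_power_topology m) (exponent_set m) (\<lambda>i x. real_of_int (x i))"
  unfolding int_power_def int_power_topology_def
proof (rule coord_space_product[where r = real_of_int])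
  show "comm_group integer_group"
    by (rule group.group_comm_groupI[OF group_integer_group]) simp
  show "continuous_map (discrete_topology UNIV) euclideanreal real_of_int"
    by (simp add: continuous_map_def)
  show "\<exists>\<epsilon>>0. \<forall>y. \<bar>real_of_int y - real_of_int x\<bar> < \<epsilon> \<longrightarrow> y \<in> U" if "x \<in> U" for x U
  proof (intro exI[of _ 1] conjI allI impI)
    fix y assume "\<bar>real_of_int y - real_of_int x\<bar> < 1"
    then have "y = x" by linarith
    then show "y \<in> U" using that by simp
  qed simp
qed (auto intro: injI)

definition mixed_index :: "enat \<Rightarrow> enat \<Rightarrow> nat set" where
  "mixed_index n m = {i. if even i then i div 2 \<in> exponent_set n else i div 2 \<in> exponent_set m}"

definition mixed_coord :: "nat \<Rightarrow> (nat \<Rightarrow> real) \<times> (nat \<Rightarrow> int) \<Rightarrow> real" where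
  "mixed_coord i x = (if even i then fst x (i div 2) else real_of_int (snd x (i div 2)))"

lemma mixed_space: "coord_space (mixed_power n m) (mixed_power_topology n m) (mixed_index n m) mixed_coord"
proof -
  have "mixed_coord = (\<lambda>i x. if even i then fst x (i div 2) else real_of_int (snd x (i div 2)))"
    by (intro ext) (simp add: mixed_coord_def)
  then show ?thesis
    unfolding mixed_power_def mixed_power_topology_def mixed_index_def
    using coord_space_prod[OF real_space[of n] int_space[of m]] by simp
qed

lemma mixed_index_simps [simp]:
  "2 * l \<in> mixed_index n m \<longleftrightarrow> l \<in> exponent_set n"
  "Suc (2 * l) \<in> mixed_index n m \<longleftrightarrow> l \<in> exponent_set m"
  by (simp_all add: mixed_index_def)

lemma mixed_coord_simps [simp]:
  "mixed_coord (2 * l) x = fst x l" "mixed_coord (Suc (2 * l)) x = real_of_int (snd x l)"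
  by (simp_all add: mixed_coord_def)

lemma mixed_index_cases:
  assumes "q \<in> mixed_index n m"
  shows "(\<exists>l. q = 2 * l \<and> l \<in> exponent_set n) \<or> (\<exists>l. q = Suc (2 * l) \<and> l \<in> exponent_set m)"
proof (cases "even q")
  case True
  then obtain l where "q = 2 * l" by (rule evenE)
  then show ?thesis using assms by simp
next
  case False
  then obtain l where "q = 2 * l + 1" by (rule oddE)
  then show ?thesis using assms by simp
qed

lemma combI:
  "\<beta> = 0 \<or> k \<in> J \<Longrightarrow> (\<And>x. F x = \<alpha> * H x + \<beta> * K k x) \<Longrightarrow>
    \<exists>\<alpha> \<beta> k. (\<beta> = 0 \<or> k \<in> J) \<and> (\<forall>x\<in>A. F x = \<alpha> * H x + \<beta> * K k x)"
  for \<alpha> \<beta> :: real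
  by blast

lemma comb2I:
  "i \<in> I \<Longrightarrow> i' \<in> I \<Longrightarrow> (\<And>x. F x = \<alpha> * f i x + \<beta> * f i' x) \<Longrightarrow>
    \<exists>\<alpha> \<beta> i i'. i \<in> I \<and> i' \<in> I \<and> (\<forall>x\<in>A. F x = \<alpha> * f i x + \<beta> * f i' x)"
  for \<alpha> \<beta> :: real
  by blast

lemma int_pole:
  assumes s: "s \<le> int d - 2" "2 * s \<le> int d" and d: "enat (Suc d) \<le> m"
  shows "coord_group.pole (int_power m) (exponent_set m) (\<lambda>i x. real_of_int (x i)) M (Suc d)
    ((\<lambda>w. \<lambda>j\<in>exponent_set m. if j \<le> d then w j else 0) ` sandwich d s)"
proof (rule coord_space.sandwich_pole[OF int_space s])
  show "(\<lambda>j\<in>exponent_set m. if j \<le> d then w j else 0) \<in> carrier (int_power m)" for w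
    by (simp add: int_power_def)
  show "(\<forall>w. real_of_int ((\<lambda>j\<in>exponent_set m. if j \<le> d then w j else 0) i) = 0) \<or>
      (\<exists>j. \<forall>w. real_of_int ((\<lambda>j\<in>exponent_set m. if j \<le> d then w j else 0) i) = real_of_int (w j))"
    if "i \<in> exponent_set m" for i
  proof (cases "i \<le> d")
    case True
    then show ?thesis using that by (intro disjI2 exI[of _ i]) simp
  qed (use that in simp)
  show "\<exists>i\<in>exponent_set m. \<forall>w. real_of_int ((\<lambda>j\<in>exponent_set m. if j \<le> d then w j else 0) i) = real_of_int (w j)"
    if "j \<le> d" for j
    using le_in_exponent_set[OF d that] that by (intro bexI[of _ j]) simp_all
qed

lemma real_pole:
  assumes s: "s \<le> int d - 2" "2 * s \<le> int d" and d: "enat (Suc d) \<le> n"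
  shows "coord_group.pole (real_power n) (exponent_set n) (\<lambda>i x. x i) M (Suc d)
    ((\<lambda>w. \<lambda>j\<in>exponent_set n. if j \<le> d then real_of_int (w j) else 0) ` sandwich d s)"
proof (rule coord_space.sandwich_pole[OF real_space s])
  show "(\<lambda>j\<in>exponent_set n. if j \<le> d then real_of_int (w j) else 0) \<in> carrier (real_power n)" for w
    by (simp add: real_power_def real_group_def)
  show "(\<forall>w. (\<lambda>j\<in>exponent_set n. if j \<le> d then real_of_int (w j) else 0) i = 0) \<or>
      (\<exists>j. \<forall>w. (\<lambda>j\<in>exponent_set n. if j \<le> d then real_of_int (w j) else 0) i = real_of_int (w j))"
    if "i \<in> exponent_set n" for i
  proof (cases "i \<le> d")
    case True
    then show ?thesis using that by (intro disjI2 exI[of _ i]) simp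
  qed (use that in simp)
  show "\<exists>i\<in>exponent_set n. \<forall>w. (\<lambda>j\<in>exponent_set n. if j \<le> d then real_of_int (w j) else 0) i = real_of_int (w j)"
    if "j \<le> d" for j
    using le_in_exponent_set[OF d that] that by (intro bexI[of _ j]) simp_all
qed

text \<open>The lattice coordinates fill the real factor first and continue in the integer factor;
  \<open>N\<close> is the number that the real factor takes.\<close>

lemma mixed_pole:
  assumes s: "s \<le> int d - 2" "2 * s \<le> int d" and d: "enat (Suc d) \<le> n + m"
  shows "\<exists>emb. \<forall>M. coord_group.pole (mixed_power n m) (mixed_index n m) mixed_coord M (Suc d) (emb ` sandwich d s)"
proof -
  define N where "N = (if enat (Suc d) \<le> n then Suc d else the_enat n)"
  define emb where "emb w = ((\<lambda>j\<in>exponent_set n. if j < N then real_of_int (w j) else 0),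
    (\<lambda>j\<in>exponent_set m. if j + N \<le> d then w (j + N) else (0 :: int)))" for w :: "nat \<Rightarrow> int"
  have fin: "n = enat N" if "\<not> enat (Suc d) \<le> n" using that by (cases n) (auto simp: N_def)
  have "coord_group.pole (mixed_power n m) (mixed_index n m) mixed_coord M (Suc d) (emb ` sandwich d s)" for M
  proof (rule coord_space.sandwich_pole[OF mixed_space s])
    show "emb w \<in> carrier (mixed_power n m)" for w
      by (simp add: emb_def mixed_power_def real_power_def int_power_def real_group_def)
    show "(\<forall>w. mixed_coord i (emb w) = 0) \<or> (\<exists>j. \<forall>w. mixed_coord i (emb w) = real_of_int (w j))"
      if i: "i \<in> mixed_index n m" for i
      using mixed_index_cases[OF i]
    proof (elim disjE exE conjE)
      fix l assume l: "i = 2 * l" "l \<in> exponent_set n"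
      show ?thesis
      proof (cases "l < N")
        case True
        then show ?thesis using l by (intro disjI2 exI[of _ l]) (simp add: emb_def)
      qed (use l in \<open>simp add: emb_def\<close>)
    next
      fix l assume l: "i = Suc (2 * l)" "l \<in> exponent_set m"
      show ?thesis
      proof (cases "l + N \<le> d")
        case True
        then show ?thesis using l by (intro disjI2 exI[of _ "l + N"]) (simp add: emb_def)
      qed (use l in \<open>simp add: emb_def\<close>)
    qed
    show "\<exists>i\<in>mixed_index n m. \<forall>w. mixed_coord i (emb w) = real_of_int (w j)" if j: "j \<le> d" for j
    proof (cases "j < N")
      case True
      have "j \<in> exponent_set n"
      proof (cases "enat (Suc d) \<le> n")
        case False
        then show ?thesis using fin True by (simp add: exponent_set_enat)
      qed (use le_in_exponent_set j in blast)
      then show ?thesis using True by (intro bexI[of _ "2 * j"]) (simp_all add: emb_def)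
    next
      case False
      then have "\<not> enat (Suc d) \<le> n" using j by (auto simp: N_def)
      then have n: "n = enat N" by (rule fin)
      have "j - N \<in> exponent_set m"
        using d j False unfolding n by (cases m) (auto simp: exponent_set_enat exponent_set_infinity)
      then show ?thesis using False j by (intro bexI[of _ "Suc (2 * (j - N))"]) (simp_all add: emb_def)
    qed
  qed
  then show ?thesis by blast
qed

lemma finite_poles:
  "enat k \<le> n \<Longrightarrow> \<exists>C. finite C \<and> (\<forall>M. coord_group.pole (real_power n) (exponent_set n) (\<lambda>i x. x i) M k C)"
  "enat k \<le> n + m \<Longrightarrow> \<exists>C. finite C \<and> (\<forall>M. coord_group.pole (mixed_power n m) (mixed_index n m) mixed_coord M k C)"
proof -
  note z = coord_group.pole_zero[OF coord_space.axioms(1)]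
  show "\<exists>C. finite C \<and> (\<forall>M. coord_group.pole (real_power n) (exponent_set n) (\<lambda>i x. x i) M k C)" if "enat k \<le> n"
  proof (cases k)
    case 0
    then show ?thesis using z[OF real_space] by blast
  next
    case (Suc d)
    show ?thesis unfolding Suc
    proof (intro exI conjI allI)
      \<comment> \<open>Only finiteness of some pole is wanted, and the parameter -2 is admissible
        for every \<open>d\<close>.\<close>
      show "finite ((\<lambda>w. \<lambda>j\<in>exponent_set n. if j \<le> d then real_of_int (w j) else 0) ` sandwich d (-2))"
        by (rule finite_imageI[OF card_sandwich(1)])
    qed (rule real_pole, use that Suc in simp_all)
  qed
  show "\<exists>C. finite C \<and> (\<forall>M. coord_group.pole (mixed_power n m) (mixed_index n m) mixed_coord M k C)" if "enat k \<le> n + m"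
  proof (cases k)
    case 0
    then show ?thesis using z[OF mixed_space] by blast
  next
    case (Suc d)
    have "-2 \<le> int d - 2" "2 * (-2) \<le> int d" by simp_all
    from mixed_pole[OF this, of n m] that Suc card_sandwich(1) show ?thesis by blast
  qed
qed

lemma zbinom_eq:
  assumes "0 \<le> i" "i \<le> int d"
  shows "zbinom (int d) i = d choose nat i"
proof -
  have "nat (int d - i) = d - nat i" using assms by (simp add: nat_diff_distrib')
  moreover have "fact d = fact (nat i) * fact (d - nat i) * (d choose nat i)"
    using binomial_fact_lemma[of "nat i" d] assms by simp
  ultimately show ?thesis using assms by (simp add: zbinom_def)
qed

text \<open>Binomial coefficients are largest in the middle, and for \<open>d \<ge> 3\<close> the
  middle respects the bound \<open>d - 2\<close>; for smaller \<open>d\<close> that bound is taken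
  itself. With \<open>k = d + 1\<close> the lower index in the maximum runs up to
  \<open>d - 2\<close>, the range of the sandwich parameter.\<close>

lemma sandwich_count:
  "\<exists>s. s \<le> int d - 2 \<and> 2 * s \<le> int d \<and>
     card (sandwich d s) \<le> 2 ^ Suc d - 1 - Max {zbinom (int (Suc d) - 1) (s - 1) | s. s \<le> int (Suc d) - 2}"
proof -
  define s where "s = (if d \<ge> 3 then int (d div 2) else int d - 2)"
  have "d div 2 + 2 \<le> d" if "d \<ge> 3" using that by presburger
  then have s1: "s \<le> int d - 2" by (auto simp: s_def)
  have s2: "2 * s \<le> int d" by (auto simp: s_def)
  define N where "N = (if 0 \<le> s then d choose nat s else 0)"
  let ?S = "{zbinom (int (Suc d) - 1) (s - 1) | s. s \<le> int (Suc d) - 2}"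
  have b: "x \<le> N" if x: "x \<in> ?S" for x
  proof -
    obtain t where t: "x = zbinom (int d) (t - 1)" "t \<le> int d - 1" using x by auto
    show ?thesis
    proof (cases "0 \<le> t - 1")
      case True
      then have x: "x = d choose nat (t - 1)" using t by (simp add: zbinom_eq)
      show ?thesis
      proof (cases "d \<ge> 3")
        case True
        then have "N = d choose (d div 2)" by (simp add: N_def s_def)
        then show ?thesis using x binomial_maximum by simp
      next
        case False
        then have "d = 2" "t = 1" using t(2) True by linarith+
        then show ?thesis using x by (simp add: N_def s_def)
      qed
    next
      case False
      then have "x = 0" using t(1) by (simp add: zbinom_def)
      then show ?thesis by simp
    qed
  qed
  have "zbinom (int (Suc d) - 1) (int d - 1 - 1) \<in> ?S"
    by (rule CollectI, intro exI[of _ "int d - 1"] conjI refl) simp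
  then have "?S \<noteq> {}" by (metis empty_iff)
  moreover have "finite ?S" by (rule finite_subset[of _ "{..N}"]) (use b in auto)
  ultimately have "Max ?S \<le> N" using b by (intro Max.boundedI) auto
  then have "card (sandwich d s) \<le> 2 ^ Suc d - 1 - Max ?S"
    using card_sandwich(2)[of d s] unfolding N_def[symmetric] by (rule order_trans[OF _ diff_le_mono2, rotated])
  then show ?thesis using s1 s2 by blast
qed

lemma int_upper_bound:
  assumes "enat k \<le> m"
  shows "c_Z k m \<le>\<^sub>c ecard_of_nat (2 ^ k - 1 - Max {zbinom (int k - 1) (s - 1) | s. s \<le> int k - 2})"
proof -
  interpret Z: coord_space "int_power m" "int_power_topology m" "exponent_set m" "\<lambda>i x. real_of_int (x i)"
    by (rule int_space)
  show ?thesis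
  proof (cases k)
    case 0
    then have "{} \<in> {C. centerpole k (int_power m) (int_power_topology m) C}"
      unfolding Z.centerpole_iff using Z.pole_zero by simp
    then show ?thesis unfolding centerpole_number_def by (rule least_card_le_nat) simp_all
  next
    case (Suc d)
    obtain s where s: "s \<le> int d - 2" "2 * s \<le> int d"
      "card (sandwich d s) \<le> 2 ^ Suc d - 1 - Max {zbinom (int (Suc d) - 1) (s - 1) | s. s \<le> int (Suc d) - 2}"
      using sandwich_count[of d] by blast
    let ?emb = "\<lambda>w. \<lambda>j\<in>exponent_set m. if j \<le> d then w j else 0"
    have "?emb ` sandwich d s \<in> {C. centerpole k (int_power m) (int_power_topology m) C}"
      unfolding Z.centerpole_iff using int_pole[OF s(1,2)] assms Suc by simp
    then show ?thesis
      unfolding centerpole_number_def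
    proof (rule least_card_le_nat)
      show "finite (?emb ` sandwich d s)" using card_sandwich(1) by simp
      show "card (?emb ` sandwich d s) \<le> 2 ^ k - 1 - Max {zbinom (int k - 1) (s - 1) | s. s \<le> int k - 2}"
        unfolding Suc by (rule order_trans[OF card_image_le[OF card_sandwich(1)] s(3)])
    qed
  qed
qed

text \<open>The projection with kernel spanned by \<open>v\<close>, expressed in the coordinates
  other than \<open>i\<close>.\<close>

definition real_merge :: "enat \<Rightarrow> nat \<Rightarrow> (nat \<Rightarrow> real) \<Rightarrow> (nat \<Rightarrow> real) \<Rightarrow> (nat \<Rightarrow> real)" where
  "real_merge n i v x = (\<lambda>j\<in>exponent_set n. x (skip i j) - v (skip i j) / v i * x i)"

lemma real_merge_closed: "real_merge n i v x \<in> carrier (real_power n)"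
  by (simp add: real_merge_def real_power_def real_group_def)

lemma real_merge_line:
  assumes "v i \<noteq> 0" "i \<in> exponent_set (n + 1)" "\<And>j. j \<in> exponent_set (n + 1) \<Longrightarrow> x j = y j + \<tau> * v j"
  shows "real_merge n i v x = real_merge n i v y"
  unfolding real_merge_def
proof (rule restrict_ext)
  fix j assume "j \<in> exponent_set n"
  have "x (skip i j) = y (skip i j) + \<tau> * v (skip i j)" "x i = y i + \<tau> * v i"
    using assms(3)[OF skip_in[OF \<open>j \<in> exponent_set n\<close>]] assms(3)[OF assms(2)] by simp_all
  then show "x (skip i j) - v (skip i j) / v i * x i = y (skip i j) - v (skip i j) / v i * y i"
    using assms(1) by (simp add: field_simps)
qed

lemma real_merge_comb:
  assumes "i \<in> exponent_set (n + 1)" "j \<in> exponent_set n"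
  shows "\<exists>\<alpha> \<beta> i1 i2. i1 \<in> exponent_set (n + 1) \<and> i2 \<in> exponent_set (n + 1) \<and>
    (\<forall>x\<in>carrier (real_power (n + 1)). real_merge n i v x j = \<alpha> * x i1 + \<beta> * x i2)"
  by (rule comb2I[where f = "\<lambda>i x. x i" and \<alpha> = 1 and \<beta> = "- (v (skip i j) / v i)" and i = "skip i j" and i' = i])
    (use assms skip_in[OF assms(2), of i] in \<open>simp_all add: real_merge_def\<close>)

lemma real_strict:
  assumes "enat k \<le> n"
  shows "c_R k n <\<^sub>c c_R (Suc k) (n + 1)" "cB_R k n <\<^sub>c cB_R (Suc k) (n + 1)"
proof -
  obtain C where C: "finite C" "\<And>M. coord_group.pole (real_power n) (exponent_set n) (\<lambda>i x. x i) M k C"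
    using finite_poles(1)[OF assms] by blast
  let ?I = "exponent_set (n + 1)"
  have merge: "\<exists>\<pi> i0. i0 \<in> ?I \<and> \<pi> a = \<pi> b \<and> (\<forall>x\<in>carrier (real_power (n + 1)). \<pi> x \<in> carrier (real_power n)) \<and>
      (\<forall>j\<in>exponent_set n. \<exists>\<alpha> \<beta> i i'. i \<in> ?I \<and> i' \<in> ?I \<and> (\<forall>x\<in>carrier (real_power (n + 1)). \<pi> x j = \<alpha> * x i + \<beta> * x i')) \<and>
      (\<forall>i\<in>?I. \<exists>\<alpha> \<beta> j. (\<beta> = 0 \<or> j \<in> exponent_set n) \<and> (\<forall>x\<in>carrier (real_power (n + 1)). x i = \<alpha> * x i0 + \<beta> * \<pi> x j))"
    if ab: "a \<in> carrier (real_power (n + 1))" "b \<in> carrier (real_power (n + 1))" "a \<noteq> b" for a b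
  proof -
    obtain i where i: "i \<in> ?I" "a i \<noteq> b i" using coord_space.sep[OF real_space ab(1,2)] ab(3) by blast
    define v where "v j = a j - b j" for j
    have v: "v i \<noteq> 0" using i(2) by (simp add: v_def)
    have eq: "real_merge n i v a = real_merge n i v b"
      by (rule real_merge_line[where v = v, OF v i(1), where \<tau> = 1]) (simp add: v_def)
    have lift: "\<exists>\<alpha> \<beta> j. (\<beta> = 0 \<or> j \<in> exponent_set n) \<and>
        (\<forall>x\<in>carrier (real_power (n + 1)). x l = \<alpha> * x i + \<beta> * real_merge n i v x j)" if l: "l \<in> ?I" for l
    proof (cases "l = i")
      case True
      then show ?thesis
        by (intro combI[where \<alpha> = 1 and \<beta> = 0 and k = 0 and K = "\<lambda>k x. real_merge n i v x k"]) simp_all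
    next
      case False
      then obtain j where "j \<in> exponent_set n" "l = skip i j" using skip_cases[OF l False i(1)] by blast
      then show ?thesis
        by (intro combI[where \<alpha> = "v l / v i" and \<beta> = 1 and k = j and K = "\<lambda>k x. real_merge n i v x k"])
            (simp_all add: real_merge_def)
    qed
    show ?thesis
      by (intro exI[of _ "real_merge n i v"] exI[of _ i] conjI ballI)
        (rule i(1) eq real_merge_closed real_merge_comb[OF i(1)] lift; assumption)+
  qed
  show "c_R k n <\<^sub>c c_R (Suc k) (n + 1)"
    by (rule merge_strict(1)[OF real_space real_space _ C]) (rule merge)
  show "cB_R k n <\<^sub>c cB_R (Suc k) (n + 1)"
    by (rule merge_strict(2)[OF real_space real_space _ C]) (rule merge)
qed

text \<open>The merging map must keep integer coordinates integral. If the integer parts of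
  \<open>a\<close> and \<open>b\<close> differ, an integer coordinate \<open>j\<close> is eliminated
  after scaling by \<open>v j\<close>. If they agree, a real coordinate is eliminated and the
  integer coordinate 0 takes its place, which restores the two exponents.\<close>

lemma mixed_strict:
  assumes "enat k \<le> n + m"
  shows "c_RZ k n m <\<^sub>c c_RZ (Suc k) n (m + 1)" "cB_RZ k n m <\<^sub>c cB_RZ (Suc k) n (m + 1)"
proof -
  obtain C where C: "finite C" "\<And>M. coord_group.pole (mixed_power n m) (mixed_index n m) mixed_coord M k C"
    using finite_poles(2)[OF assms] by blast
  let ?G = "carrier (mixed_power n (m + 1))"
  have merge: "\<exists>\<pi> i0. i0 \<in> mixed_index n (m + 1) \<and> \<pi> a = \<pi> b \<and> (\<forall>x\<in>?G. \<pi> x \<in> carrier (mixed_power n m)) \<and>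
      (\<forall>j\<in>mixed_index n m. \<exists>\<alpha> \<beta> i i'. i \<in> mixed_index n (m + 1) \<and> i' \<in> mixed_index n (m + 1) \<and>
        (\<forall>x\<in>?G. mixed_coord j (\<pi> x) = \<alpha> * mixed_coord i x + \<beta> * mixed_coord i' x)) \<and>
      (\<forall>i\<in>mixed_index n (m + 1). \<exists>\<alpha> \<beta> j. (\<beta> = 0 \<or> j \<in> mixed_index n m) \<and>
        (\<forall>x\<in>?G. mixed_coord i x = \<alpha> * mixed_coord i0 x + \<beta> * mixed_coord j (\<pi> x)))"
    if ab: "a \<in> ?G" "b \<in> ?G" "a \<noteq> b" for a b
  proof -
    define u where "u l = fst a l - fst b l" for l
    define v where "v l = snd a l - snd b l" for l
    show ?thesis
    proof (cases "\<exists>j\<in>exponent_set (m + 1). v j \<noteq> 0")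
      case True
      then obtain j where j: "j \<in> exponent_set (m + 1)" "v j \<noteq> 0" by blast
      define V where "V = real_of_int (v j)"
      have V: "V \<noteq> 0" using j(2) by (simp add: V_def)
      define \<pi> where "\<pi> x = ((\<lambda>l\<in>exponent_set n. V * fst x l - real_of_int (snd x j) * u l),
        (\<lambda>l\<in>exponent_set m. v j * snd x (skip j l) - snd x j * v (skip j l)))" for x
      have div: "X = U / V * Z + 1 / V * (V * X - Z * U)" for X U Z :: real
        using V by (simp add: field_simps)
      have eq: "\<pi> a = \<pi> b" unfolding \<pi>_def V_def u_def v_def
        by (intro arg_cong2[where f = Pair] restrict_ext) (simp_all add: algebra_simps)
      have cl: "\<pi> x \<in> carrier (mixed_power n m)" for x
        by (simp add: \<pi>_def mixed_power_def real_power_def int_power_def real_group_def)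
      have comb: "\<exists>\<alpha> \<beta> i i'. i \<in> mixed_index n (m + 1) \<and> i' \<in> mixed_index n (m + 1) \<and>
        (\<forall>x\<in>?G. mixed_coord q (\<pi> x) = \<alpha> * mixed_coord i x + \<beta> * mixed_coord i' x)" if q: "q \<in> mixed_index n m" for q
        using mixed_index_cases[OF q]
      proof (elim disjE exE conjE)
        fix l assume l: "q = 2 * l" "l \<in> exponent_set n"
        show ?thesis
          by (rule comb2I[where f = mixed_coord and \<alpha> = V and \<beta> = "- u l" and i = "2 * l" and i' = "Suc (2 * j)"])
            (use l j in \<open>simp_all add: \<pi>_def\<close>)
      next
        fix l assume l: "q = Suc (2 * l)" "l \<in> exponent_set m"
        show ?thesis
          by (rule comb2I[where f = mixed_coord and \<alpha> = V and \<beta> = "- real_of_int (v (skip j l))" and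
                i = "Suc (2 * skip j l)" and i' = "Suc (2 * j)"])
            (use l j skip_in[OF l(2), of j] in \<open>simp_all add: \<pi>_def V_def\<close>)
      qed
      have lift: "\<exists>\<alpha> \<beta> i. (\<beta> = 0 \<or> i \<in> mixed_index n m) \<and>
        (\<forall>x\<in>?G. mixed_coord q x = \<alpha> * mixed_coord (Suc (2 * j)) x + \<beta> * mixed_coord i (\<pi> x))"
        if q: "q \<in> mixed_index n (m + 1)" for q
        using mixed_index_cases[OF q]
      proof (elim disjE exE conjE)
        fix l assume l: "q = 2 * l" "l \<in> exponent_set n"
        have e: "mixed_coord q x = u l / V * mixed_coord (Suc (2 * j)) x + 1 / V * mixed_coord (2 * l) (\<pi> x)" for x
          using l div[of "fst x l" "u l" "real_of_int (snd x j)"] by (simp add: \<pi>_def)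
        show ?thesis by (rule combI[where K = "\<lambda>k x. mixed_coord k (\<pi> x)", OF _ e]) (use l in simp)
      next
        fix l assume l: "q = Suc (2 * l)" "l \<in> exponent_set (m + 1)"
        show ?thesis
        proof (cases "l = j")
          case True
          show ?thesis by (rule combI[where \<alpha> = 1 and \<beta> = 0 and k = 0]) (use l True in simp_all)
        next
          case False
          obtain t where t: "t \<in> exponent_set m" "l = skip j t" using skip_cases[OF l(2) False j(1)] by blast
          have e: "mixed_coord q x = real_of_int (v l) / V * mixed_coord (Suc (2 * j)) x + 1 / V * mixed_coord (Suc (2 * t)) (\<pi> x)" for x
            using l t div[of "real_of_int (snd x l)" "real_of_int (v l)" "real_of_int (snd x j)"] by (simp add: \<pi>_def V_def)
          show ?thesis by (rule combI[where K = "\<lambda>k x. mixed_coord k (\<pi> x)", OF _ e]) (use t in simp)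
        qed
      qed
      have j': "Suc (2 * j) \<in> mixed_index n (m + 1)" using j(1) by simp
      show ?thesis
        by (intro exI[of _ \<pi>] exI[of _ "Suc (2 * j)"] conjI ballI) (rule j' eq cl comb lift; assumption)+
    next
      case False
      then have v0: "snd a j = snd b j" if "j \<in> exponent_set (m + 1)" for j using that by (auto simp: v_def)
      obtain q0 where q0: "q0 \<in> mixed_index n (m + 1)" "mixed_coord q0 a \<noteq> mixed_coord q0 b"
        using coord_space.sep[OF mixed_space ab(1,2)] ab(3) by blast
      from mixed_index_cases[OF q0(1)] have "\<exists>i\<in>exponent_set n. fst a i \<noteq> fst b i"
        using q0(2) v0 by (elim disjE exE conjE) auto
      then obtain i where i: "i \<in> exponent_set n" "u i \<noteq> 0" by (auto simp: u_def)
      define \<pi> where "\<pi> x = ((\<lambda>l\<in>exponent_set n. if l = i then real_of_int (snd x 0) else u i * fst x l - fst x i * u l),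
        (\<lambda>l\<in>exponent_set m. snd x (Suc l)))" for x :: "(nat \<Rightarrow> real) \<times> (nat \<Rightarrow> int)"
      have div: "X = U / u i * Z + 1 / u i * (u i * X - Z * U)" for X U Z :: real
        using i(2) by (simp add: field_simps)
      have z0: "snd a 0 = snd b 0" by (rule v0[OF zero_in_exponent_set])
      have zS: "snd a (Suc l) = snd b (Suc l)" if "l \<in> exponent_set m" for l
        by (rule v0) (use that in \<open>simp only: Suc_in_exponent_set\<close>)
      have eq: "\<pi> a = \<pi> b" unfolding \<pi>_def u_def
        by (intro arg_cong2[where f = Pair] restrict_ext) (simp_all add: z0 zS algebra_simps)
      have cl: "\<pi> x \<in> carrier (mixed_power n m)" for x
        by (simp add: \<pi>_def mixed_power_def real_power_def int_power_def real_group_def)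
      have comb: "\<exists>\<alpha> \<beta> i i'. i \<in> mixed_index n (m + 1) \<and> i' \<in> mixed_index n (m + 1) \<and>
        (\<forall>x\<in>?G. mixed_coord q (\<pi> x) = \<alpha> * mixed_coord i x + \<beta> * mixed_coord i' x)" if q: "q \<in> mixed_index n m" for q
        using mixed_index_cases[OF q]
      proof (elim disjE exE conjE)
        fix l assume l: "q = 2 * l" "l \<in> exponent_set n"
        show ?thesis
        proof (cases "l = i")
          case True
          show ?thesis
            by (rule comb2I[where f = mixed_coord and \<alpha> = 1 and \<beta> = 0 and i = "Suc (2 * 0)" and i' = "Suc (2 * 0)"];
              (unfold mixed_index_simps mixed_coord_simps, rule zero_in_exponent_set)?)
              (use l True in \<open>unfold l(1) mixed_coord_simps, simp add: \<pi>_def\<close>)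
        next
          case False
          then show ?thesis
            by (intro comb2I[where f = mixed_coord and \<alpha> = "u i" and \<beta> = "- u l" and i = "2 * l" and i' = "2 * i"])
              (use l i in \<open>simp_all add: \<pi>_def\<close>)
        qed
      next
        fix l assume l: "q = Suc (2 * l)" "l \<in> exponent_set m"
        have SlI: "Suc l \<in> exponent_set (m + 1)" using l(2) Suc_in_exponent_set by blast
        show ?thesis
          by (rule comb2I[where f = mixed_coord and \<alpha> = 1 and \<beta> = 0 and i = "Suc (2 * Suc l)" and i' = "Suc (2 * Suc l)"];
              (unfold mixed_index_simps mixed_coord_simps, rule SlI)?)
            (use l in \<open>unfold l(1) mixed_coord_simps, simp add: \<pi>_def\<close>)
      qed
      have lift: "\<exists>\<alpha> \<beta> k. (\<beta> = 0 \<or> k \<in> mixed_index n m) \<and>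
        (\<forall>x\<in>?G. mixed_coord q x = \<alpha> * mixed_coord (2 * i) x + \<beta> * mixed_coord k (\<pi> x))"
        if q: "q \<in> mixed_index n (m + 1)" for q
        using mixed_index_cases[OF q]
      proof (elim disjE exE conjE)
        fix l assume l: "q = 2 * l" "l \<in> exponent_set n"
        show ?thesis
        proof (cases "l = i")
          case True
          show ?thesis by (rule combI[where \<alpha> = 1 and \<beta> = 0 and k = 0]) (use l True in simp_all)
        next
          case False
          have e: "mixed_coord q x = u l / u i * mixed_coord (2 * i) x + 1 / u i * mixed_coord (2 * l) (\<pi> x)" for x
            using l False div[of "fst x l" "u l" "fst x i"] by (simp add: \<pi>_def)
          show ?thesis by (rule combI[where K = "\<lambda>k x. mixed_coord k (\<pi> x)", OF _ e]) (use l in simp)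
        qed
      next
        fix l assume l: "q = Suc (2 * l)" "l \<in> exponent_set (m + 1)"
        show ?thesis
        proof (cases l)
          case 0
          have e: "mixed_coord q x = 0 * mixed_coord (2 * i) x + 1 * mixed_coord (2 * i) (\<pi> x)" for x
            using i(1) unfolding l(1) 0 mixed_coord_simps by (simp add: \<pi>_def)
          show ?thesis by (rule combI[where K = "\<lambda>k x. mixed_coord k (\<pi> x)", OF _ e]) (use i(1) in simp)
        next
          case (Suc t)
          have t: "t \<in> exponent_set m" using l(2) unfolding Suc Suc_in_exponent_set .
          have e: "mixed_coord q x = 0 * mixed_coord (2 * i) x + 1 * mixed_coord (Suc (2 * t)) (\<pi> x)" for x
            using t unfolding l(1) Suc mixed_coord_simps by (simp add: \<pi>_def)
          show ?thesis by (rule combI[where K = "\<lambda>k x. mixed_coord k (\<pi> x)", OF _ e]) (use t in simp)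
        qed
      qed
      have i': "2 * i \<in> mixed_index n (m + 1)" using i(1) by simp
      show ?thesis
        by (intro exI[of _ \<pi>] exI[of _ "2 * i"] conjI ballI) (rule i' eq cl comb lift; assumption)+
    qed
  qed
  show "c_RZ k n m <\<^sub>c c_RZ (Suc k) n (m + 1)"
    by (rule merge_strict(1)[OF mixed_space mixed_space _ C]) (rule merge)
  show "cB_RZ k n m <\<^sub>c cB_RZ (Suc k) n (m + 1)"
    by (rule merge_strict(2)[OF mixed_space mixed_space _ C]) (rule merge)
qed

section \<open>Lower bounds\<close>

lemma span_fun_induct:
  assumes "h \<in> fs.span F" "P (\<lambda>x. 0)" "\<And>g h. P g \<Longrightarrow> P h \<Longrightarrow> P (\<lambda>x. g x + h x)" "\<And>r g. P g \<Longrightarrow> P (\<lambda>x. r * g x)"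
    "\<And>g. g \<in> F \<Longrightarrow> P g"
  shows "P h"
proof -
  have "fs.span F \<subseteq> {h. P h}"
  proof (rule fs.span_minimal)
    show "F \<subseteq> {h. P h}" using assms(5) by blast
    show "fs.subspace {h. P h}"
      unfolding fs.subspace_def zero_fun_def plus_fun_def using assms(2-4) by simp
  qed
  then show ?thesis using assms(1) by blast
qed

definition forms :: "nat set \<Rightarrow> ((nat \<Rightarrow> real) \<Rightarrow> real) set" where
  "forms I = fs.span ((\<lambda>i x. x i) ` I)"

lemma coord_in_forms: "i \<in> I \<Longrightarrow> (\<lambda>x. x i) \<in> forms I"
  unfolding forms_def by (rule fs.span_base) blast

lemma form_cong:
  assumes "h \<in> forms I" "\<And>i. i \<in> I \<Longrightarrow> x i = y i"
  shows "h x = h y"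
  by (rule span_fun_induct[OF assms(1)[unfolded forms_def], where P = "\<lambda>h. h x = h y"]) (use assms(2) in auto)

lemma form_linear:
  assumes "h \<in> forms I"
  shows "h (\<lambda>i. r * x i + t * y i) = r * h x + t * h y"
  by (rule span_fun_induct[OF assms[unfolded forms_def], where P = "\<lambda>h. h (\<lambda>i. r * x i + t * y i) = r * h x + t * h y"])
    (auto simp: algebra_simps)

lemma form_zero:
  assumes "h \<in> forms I"
  shows "h (\<lambda>i. 0) = 0"
  using form_linear[OF assms, of 0 "\<lambda>i. 0" 0 "\<lambda>i. 0"] by simp

lemma form_diff:
  assumes "h \<in> forms I"
  shows "h (\<lambda>i. x i - y i) = h x - h y"
  using form_linear[OF assms, of 1 x "-1" y] by simp

lemma forms_add: "g \<in> forms I \<Longrightarrow> h \<in> forms I \<Longrightarrow> (\<lambda>x. g x + s * h x) \<in> forms I"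
  unfolding forms_def using fs.span_add[OF _ fs.span_scale[of h _ s], of g] by (simp add: plus_fun_def)

lemma span_bounded:
  fixes F :: "('p \<Rightarrow> real) set"
  assumes "h \<in> fs.span F" "\<And>g. g \<in> F \<Longrightarrow> \<exists>B. \<forall>x\<in>S. \<bar>g x\<bar> \<le> B"
  shows "\<exists>B. \<forall>x\<in>S. \<bar>h x\<bar> \<le> B"
proof (rule span_fun_induct[OF assms(1), where P = "\<lambda>h. \<exists>B. \<forall>x\<in>S. \<bar>h x\<bar> \<le> B"])
  fix g h :: "'p \<Rightarrow> real" assume "\<exists>B. \<forall>x\<in>S. \<bar>g x\<bar> \<le> B" "\<exists>B. \<forall>x\<in>S. \<bar>h x\<bar> \<le> B"
  then obtain B B' where B: "\<And>x. x \<in> S \<Longrightarrow> \<bar>g x\<bar> \<le> B" "\<And>x. x \<in> S \<Longrightarrow> \<bar>h x\<bar> \<le> B'" by blast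
  have "\<bar>g x + h x\<bar> \<le> B + B'" if "x \<in> S" for x using B[OF that] by linarith
  then show "\<exists>B. \<forall>x\<in>S. \<bar>g x + h x\<bar> \<le> B" by blast
next
  fix r :: real and g :: "'p \<Rightarrow> real" assume "\<exists>B. \<forall>x\<in>S. \<bar>g x\<bar> \<le> B"
  then obtain B where B: "\<And>x. x \<in> S \<Longrightarrow> \<bar>g x\<bar> \<le> B" by blast
  have "\<bar>r * g x\<bar> \<le> \<bar>r\<bar> * B" if "x \<in> S" for x unfolding abs_mult by (intro mult_left_mono B that) simp
  then show "\<exists>B. \<forall>x\<in>S. \<bar>r * g x\<bar> \<le> B" by blast
qed (use assms(2) in auto)

lemma form_continuous:
  assumes "h \<in> forms (exponent_set n)"
  shows "continuous_map (real_power_topology n) euclideanreal h"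
proof (rule span_fun_induct[OF assms[unfolded forms_def], where P = "continuous_map (real_power_topology n) euclideanreal"])
  fix g :: "(nat \<Rightarrow> real) \<Rightarrow> real" assume "g \<in> (\<lambda>i x. x i) ` exponent_set n"
  then obtain i where i: "i \<in> exponent_set n" "g = (\<lambda>x. x i)" by blast
  show "continuous_map (real_power_topology n) euclideanreal g"
    unfolding i(2) real_power_topology_def by (rule continuous_map_product_projection[OF i(1)])
qed (simp_all add: continuous_map_add continuous_map_real_mult_left)

lemma form_refl:
  assumes h: "h \<in> forms (exponent_set n)" and c: "c \<in> carrier (real_power n)" "x \<in> carrier (real_power n)"
  shows "h (coord_group.refl_at (real_power n) c x) = 2 * h c - h x"
proof -
  interpret R: coord_space "real_power n" "real_power_topology n" "exponent_set n" "\<lambda>i x. x i" by (rule real_space)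
  have "h (R.refl_at c x) = h (\<lambda>i. 2 * c i + (- 1) * x i)"
    by (rule form_cong[OF h]) (simp add: R.f_refl c)
  also have "\<dots> = 2 * h c - h x" using form_linear[OF h, of 2 c "-1" x] by simp
  finally show ?thesis .
qed

text \<open>Along the functions \<open>g + s * h\<close> each of the finitely many points excludes
  at most one value of \<open>s\<close>.\<close>

lemma generic_combination:
  assumes "finite X" "\<And>g h s. g \<in> L \<Longrightarrow> h \<in> L \<Longrightarrow> (\<lambda>x. g x + s * h x) \<in> L" "L \<noteq> {}"
    and "\<And>x. x \<in> X \<Longrightarrow> \<exists>g\<in>L. g x \<noteq> (0::real)"
  shows "\<exists>g\<in>L. \<forall>x\<in>X. g x \<noteq> 0"
  using assms(1,4)
proof (induction X rule: finite_induct)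
  case empty
  then show ?case using assms(3) by blast
next
  case (insert x X)
  obtain g where g: "g \<in> L" "\<And>y. y \<in> X \<Longrightarrow> g y \<noteq> 0" using insert.IH insert.prems by blast
  obtain h where h: "h \<in> L" "h x \<noteq> 0" using insert.prems by blast
  have "finite ((\<lambda>y. - g y / h y) ` insert x X)" using insert.hyps(1) by simp
  then obtain s where s: "s \<notin> insert 0 ((\<lambda>y. - g y / h y) ` insert x X)"
    using ex_new_if_finite[OF infinite_UNIV_char_0] by (metis finite_insert)
  have nz: "g y + s * h y \<noteq> 0" if y: "y \<in> insert x X" for y
  proof
    assume z: "g y + s * h y = 0"
    show False
    proof (cases "h y = 0")
      case True
      then have "g y = 0" "y \<noteq> x" using z h(2) by auto
      then show False using g(2) y by blast
    next
      case False
      have "s * h y = - g y" using z by linarith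
      moreover have "s = s * h y / h y" using False by simp
      ultimately have "s = - g y / h y" by (simp only:)
      then show False using s y by blast
    qed
  qed
  show ?case by (rule bexI[OF _ assms(2)[OF g(1) h(1), of s]]) (intro ballI nz)
qed

lemma generic_form:
  assumes "finite X" "\<And>x. x \<in> X \<Longrightarrow> \<exists>i\<in>I. x i \<noteq> 0"
  shows "\<exists>g\<in>forms I. \<forall>x\<in>X. g x \<noteq> 0"
proof (rule generic_combination[OF assms(1)])
  show "forms I \<noteq> {}" unfolding forms_def using fs.span_zero by blast
  show "\<exists>g\<in>forms I. g x \<noteq> 0" if x: "x \<in> X" for x
  proof -
    obtain i where "i \<in> I" "x i \<noteq> 0" using assms(2)[OF x] by blast
    then show ?thesis using coord_in_forms[of i I] by (intro bexI[of _ "\<lambda>x. x i"])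
  qed
qed (rule forms_add)

lemma real_drop:
  assumes i: "i \<in> exponent_set (n + 1)" "v i \<noteq> 0" and h: "h \<in> forms (exponent_set (n + 1))" "h v \<noteq> 0"
  shows "coord_drop (real_power (n + 1)) (real_power_topology (n + 1)) (exponent_set (n + 1)) (\<lambda>i x. x i)
      (real_power n) (real_power_topology n) (exponent_set n) (\<lambda>i x. x i) (real_merge n i v) h"
    "real_merge n i v \<in> measurable (coord_group.borel_measure (real_power (n + 1)) (real_power_topology (n + 1)))
      (coord_group.borel_measure (real_power n) (real_power_topology n))"
proof -
  let ?I = "exponent_set (n + 1)"
  have lift: "coord_bounded ?I (\<lambda>i x. x i) S"
    if S: "coord_bounded (exponent_set n) (\<lambda>i x. x i) (real_merge n i v ` S)" "\<forall>x\<in>S. \<bar>h x\<bar> \<le> b" for S b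
  proof -
    \<comment> \<open>\<open>y x\<close> is \<open>x\<close> moved along \<open>v\<close> until
      entry \<open>i\<close> vanishes; its other entries are those of the projection. As
      \<open>h v\<close> is not 0, bounds for \<open>h x\<close> and \<open>h (y x)\<close> bound
      the distance moved.\<close>
    define y where "y x = (\<lambda>j. 1 * x j + (- (x i / v i)) * v j)" for x :: "nat \<Rightarrow> real"
    have yc: "\<exists>B. \<forall>x\<in>S. \<bar>y x j\<bar> \<le> B" if j: "j \<in> ?I" for j
    proof (cases "j = i")
      case True
      then have "y x j = 0" for x using i(2) by (simp add: y_def)
      then show ?thesis by (intro exI[of _ 0]) simp
    next
      case False
      obtain l where l: "l \<in> exponent_set n" "j = skip i l" using skip_cases[OF j False i(1)] by blast
      obtain B where B: "\<forall>z\<in>real_merge n i v ` S. \<bar>z l\<bar> \<le> B" using S(1) l(1) unfolding coord_bounded_def by blast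
      have "y x j = real_merge n i v x l" for x using l by (simp add: y_def real_merge_def)
      then show ?thesis using B by (intro exI[of _ B]) simp
    qed
    have "\<exists>B. \<forall>z\<in>y ` S. \<bar>h z\<bar> \<le> B"
    proof (rule span_bounded[OF h(1)[unfolded forms_def]])
      fix g :: "(nat \<Rightarrow> real) \<Rightarrow> real" assume "g \<in> (\<lambda>i x. x i) ` ?I"
      then obtain j where "j \<in> ?I" "g = (\<lambda>x. x j)" by blast
      then show "\<exists>B. \<forall>z\<in>y ` S. \<bar>g z\<bar> \<le> B" using yc[of j] by auto
    qed
    then obtain B where B: "\<And>x. x \<in> S \<Longrightarrow> \<bar>h (y x)\<bar> \<le> B" by blast
    have xi: "\<bar>x i\<bar> \<le> \<bar>v i / h v\<bar> * (b + B)" if x: "x \<in> S" for x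
    proof -
      have "h (y x) = 1 * h x + (- (x i / v i)) * h v" unfolding y_def by (rule form_linear[OF h(1)])
      then have "x i = v i / h v * (h x - h (y x))" using i(2) h(2) by (simp add: field_simps)
      then have "\<bar>x i\<bar> = \<bar>v i / h v\<bar> * \<bar>h x - h (y x)\<bar>" by (metis abs_mult)
      also have "\<dots> \<le> \<bar>v i / h v\<bar> * (b + B)"
      proof (rule mult_left_mono)
        have "\<bar>h x\<bar> \<le> b" using S(2) x by blast
        then show "\<bar>h x - h (y x)\<bar> \<le> b + B" using B[OF x] by linarith
      qed simp
      finally show ?thesis .
    qed
    show ?thesis unfolding coord_bounded_def
    proof
      fix j assume j: "j \<in> ?I"
      obtain B' where B': "\<forall>x\<in>S. \<bar>y x j\<bar> \<le> B'" using yc[OF j] by blast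
      have "\<bar>x j\<bar> \<le> B' + \<bar>v j / v i\<bar> * (\<bar>v i / h v\<bar> * (b + B))" if x: "x \<in> S" for x
      proof -
        have "x j = y x j + v j / v i * x i" by (simp add: y_def)
        then have "\<bar>x j\<bar> \<le> \<bar>y x j\<bar> + \<bar>v j / v i\<bar> * \<bar>x i\<bar>" by (metis abs_mult abs_triangle_ineq)
        moreover have "\<bar>v j / v i\<bar> * \<bar>x i\<bar> \<le> \<bar>v j / v i\<bar> * (\<bar>v i / h v\<bar> * (b + B))"
          by (rule mult_left_mono[OF xi[OF x]]) simp
        moreover have "\<bar>y x j\<bar> \<le> B'" using B' x by blast
        ultimately show ?thesis by linarith
      qed
      then show "\<exists>B. \<forall>x\<in>S. \<bar>x j\<bar> \<le> B" by blast
    qed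
  qed
  show "coord_drop (real_power (n + 1)) (real_power_topology (n + 1)) ?I (\<lambda>i x. x i)
      (real_power n) (real_power_topology n) (exponent_set n) (\<lambda>i x. x i) (real_merge n i v) h"
    "real_merge n i v \<in> measurable (coord_group.borel_measure (real_power (n + 1)) (real_power_topology (n + 1)))
      (coord_group.borel_measure (real_power n) (real_power_topology n))"
    by (rule coord_dropI(1)[OF real_space real_space] coord_dropI(2)[OF real_space real_space, where h = h];
      (rule real_merge_closed | rule real_merge_comb[OF i(1)] | rule form_refl[OF h(1)] | rule lift); assumption?)+
qed

section \<open>The linear bound: peeling vertices and edges in any larger dimension\<close>

abbreviation "real_not_pole k n C \<equiv> \<not> borel_centerpole k (real_power n) (real_power_topology n) C"

lemma real_not_pole_iff:
  "real_not_pole k n C \<longleftrightarrow> \<not> coord_group.pole (real_power n) (exponent_set n) (\<lambda>i x. x i)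
     (coord_group.borel_measure (real_power n) (real_power_topology n)) k C"
  using coord_group.borel_centerpole_iff[OF coord_space.axioms(1)[OF real_space]] by simp

text \<open>The functions \<open>w j\<close> vanish exactly on the line and are negated by
  reflections about its points; on the line the entry \<open>i\<close> serves to tell the two
  directions apart.\<close>

lemma line_set:
  assumes v: "i \<in> exponent_set n" "v i \<noteq> 0" and C: "C \<subseteq> carrier (real_power n)"
    and line: "\<And>c. c \<in> C \<Longrightarrow> \<exists>\<tau>. \<forall>j\<in>exponent_set n. c j = p j + \<tau> * v j"
  shows "\<exists>E\<in>sets (coord_group.borel_measure (real_power n) (real_power_topology n)). \<forall>c\<in>C.
    coord_bounded (exponent_set n) (\<lambda>i x. x i)
      {x \<in> carrier (real_power n). x \<in> E \<longleftrightarrow> coord_group.refl_at (real_power n) c x \<in> E}"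
proof -
  interpret R: coord_space "real_power n" "real_power_topology n" "exponent_set n" "\<lambda>i x. x i" by (rule real_space)
  define w where "w j x = (if j \<in> exponent_set n then (x j - p j) - v j / v i * (x i - p i) else 0)" for j x
  have wm: "w j \<in> borel_measurable R.borel_measure" for j
  proof (cases "j \<in> exponent_set n")
    case True
    note [measurable] = R.f_borel[OF True] R.f_borel[OF v(1)]
    have "w j = (\<lambda>x. (x j - p j) - v j / v i * (x i - p i))" using True by (simp add: w_def fun_eq_iff)
    then show ?thesis by simp
  next
    case False
    then have "w j = (\<lambda>x. 0)" by (simp add: w_def fun_eq_iff)
    then show ?thesis by simp
  qed
  define E where "E = R.lex_half w (\<lambda>x. x i)"
  have "E \<in> sets R.borel_measure" unfolding E_def by (rule R.lex_half_sets[OF wm R.f_borel[OF v(1)]]) simp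
  moreover have "R.bdd {x \<in> carrier (real_power n). x \<in> E \<longleftrightarrow> R.refl_at c x \<in> E}" if c: "c \<in> C" for c
  proof -
    have cc: "c \<in> carrier (real_power n)" using c C by blast
    obtain \<tau> where \<tau>: "\<And>j. j \<in> exponent_set n \<Longrightarrow> c j = p j + \<tau> * v j" using line[OF c] by blast
    have wr: "w j (R.refl_at c x) = - w j x" if x: "x \<in> carrier (real_power n)" for j x
    proof (cases "j \<in> exponent_set n")
      case True
      define q where "q = v j / v i"
      have q: "v j = q * v i" using v(2) by (simp add: q_def)
      have r: "R.refl_at c x j = 2 * (p j + \<tau> * (q * v i)) - x j" "R.refl_at c x i = 2 * (p i + \<tau> * v i) - x i"
        using R.f_refl[OF True cc x] R.f_refl[OF v(1) cc x] \<tau>[OF True] \<tau>[OF v(1)] unfolding q by simp_all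
      show ?thesis using True unfolding w_def r q_def[symmetric] by (simp add: algebra_simps)
    qed (simp add: w_def)
    have gr: "R.refl_at c x i = 2 * c i - x i" if "x \<in> carrier (real_power n)" for x
      using R.f_refl[OF v(1) cc that] by simp
    show ?thesis unfolding coord_bounded_def
    proof
      fix j assume j: "j \<in> exponent_set n"
      have "\<bar>x j\<bar> \<le> \<bar>p j\<bar> + \<bar>v j / v i\<bar> * (2 * \<bar>c i\<bar> + \<bar>p i\<bar>)"
        if x: "x \<in> {x \<in> carrier (real_power n). x \<in> E \<longleftrightarrow> R.refl_at c x \<in> E}" for x
      proof -
        have z: "(\<forall>j. w j x = 0) \<and> \<bar>x i\<bar> \<le> 2 * \<bar>c i\<bar>"
          by (rule R.lex_half_symmetric[OF cc, where w = w and g = "\<lambda>x. x i"])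
            (use x wr gr in \<open>auto simp: E_def\<close>)
        then have "w j x = 0" by blast
        then have "x j = p j + v j / v i * (x i - p i)" using j by (simp add: w_def)
        then have "\<bar>x j\<bar> \<le> \<bar>p j\<bar> + \<bar>v j / v i\<bar> * \<bar>x i - p i\<bar>" by (metis abs_mult abs_triangle_ineq)
        moreover have "\<bar>v j / v i\<bar> * \<bar>x i - p i\<bar> \<le> \<bar>v j / v i\<bar> * (2 * \<bar>c i\<bar> + \<bar>p i\<bar>)"
        proof (rule mult_left_mono)
          show "\<bar>x i - p i\<bar> \<le> 2 * \<bar>c i\<bar> + \<bar>p i\<bar>" using z by linarith
        qed simp
        ultimately show ?thesis by linarith
      qed
      then show "\<exists>B. \<forall>x\<in>{x \<in> carrier (real_power n). x \<in> E \<longleftrightarrow> R.refl_at c x \<in> E}. \<bar>x j\<bar> \<le> B" by blast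
    qed
  qed
  ultimately show ?thesis by blast
qed

lemma two_points:
  assumes k: "k \<ge> 2" and n: "enat 1 \<le> n" and C: "C \<subseteq> {a, b}" "C \<subseteq> carrier (real_power n)"
  shows "real_not_pole k n C"
proof -
  interpret R: coord_space "real_power n" "real_power_topology n" "exponent_set n" "\<lambda>i x. x i" by (rule real_space)
  have "0 \<in> exponent_set n" using n le_in_exponent_set[of 0 n 0] by simp
  have "\<exists>i v. i \<in> exponent_set n \<and> v i \<noteq> 0 \<and> (\<forall>c\<in>C. \<exists>\<tau>. \<forall>j\<in>exponent_set n. c j = a j + \<tau> * v j)"
  proof (cases "\<exists>i\<in>exponent_set n. b i \<noteq> a i")
    case True
    then obtain i where i: "i \<in> exponent_set n" "b i \<noteq> a i" by blast
    have "\<exists>\<tau>. \<forall>j\<in>exponent_set n. c j = a j + \<tau> * (b j - a j)" if "c \<in> C" for c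
    proof -
      have "c = a \<or> c = b" using that C(1) by blast
      then show ?thesis by (elim disjE) (rule exI[of _ 0], simp, rule exI[of _ 1], simp)
    qed
    then show ?thesis using i by (intro exI[of _ i] exI[of _ "\<lambda>j. b j - a j"]) simp
  next
    case False
    have "\<exists>\<tau>. \<forall>j\<in>exponent_set n. c j = a j + \<tau> * 1" if "c \<in> C" for c
      using that C(1) False by (intro exI[of _ 0]) auto
    then show ?thesis using \<open>0 \<in> exponent_set n\<close> by (intro exI[of _ 0] exI[of _ "\<lambda>j. 1"]) simp
  qed
  then obtain i v where iv: "i \<in> exponent_set n" "v i \<noteq> 0"
    "\<And>c. c \<in> C \<Longrightarrow> \<exists>\<tau>. \<forall>j\<in>exponent_set n. c j = a j + \<tau> * v j" by blast
  obtain E where E: "E \<in> sets R.borel_measure"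
    "\<forall>c\<in>C. R.bdd {x \<in> carrier (real_power n). x \<in> E \<longleftrightarrow> R.refl_at c x \<in> E}"
    using line_set[where v = v, OF iv(1,2) C(2) iv(3)] by blast
  show ?thesis unfolding real_not_pole_iff
    by (rule R.not_pole_split[OF k E(1)]) (use E(2) in auto)
qed

lemma small_two_points:
  assumes "k \<ge> 2" "enat 1 \<le> n" "finite C" "card C \<le> 2" "C \<subseteq> carrier (real_power n)"
  shows "real_not_pole k n C"
proof -
  have "\<exists>a b. C \<subseteq> {a, b}"
  proof -
    consider "card C = 0" | "card C = 1" | "card C = 2" using assms(4) by linarith
    then show ?thesis
    proof cases
      case 1
      then have "C = {}" using assms(3) by simp
      then show ?thesis by simp
    next
      case 2
      then obtain a where "C = {a}" by (auto simp: card_1_singleton_iff)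
      then show ?thesis by blast
    next
      case 3
      then obtain a b where "C = {a, b}" by (auto simp: card_2_iff)
      then show ?thesis by blast
    qed
  qed
  then obtain a b where "C \<subseteq> {a, b}" by blast
  then show ?thesis using two_points[OF assms(1,2) _ assms(5)] by blast
qed

text \<open>One colour pays for two savings: the points on the top face of \<open>h\<close>, which
  must lie on a line so that \<open>line_set\<close> can cut the hyperplane, and one of
  \<open>a\<close>, \<open>b\<close>, merged along a direction transversal to the levels of
  \<open>h\<close>.\<close>

lemma peel_merge:
  assumes C: "finite C" "C \<subseteq> carrier (real_power (n + 1))" and h: "h \<in> forms (exponent_set (n + 1))"
    "\<And>c. c \<in> C \<Longrightarrow> h c \<le> m"
    and i: "i \<in> exponent_set (n + 1)" "v i \<noteq> 0"
    and line: "\<And>c. c \<in> C \<Longrightarrow> h c = m \<Longrightarrow> \<exists>\<tau>. \<forall>j\<in>exponent_set (n + 1). c j = p j + \<tau> * v j"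
    and ab: "a \<in> C" "b \<in> C" "h a < m" "h b < m" "h a \<noteq> h b"
    and np: "\<And>D. finite D \<Longrightarrow> D \<subseteq> carrier (real_power n) \<Longrightarrow> card D < card {c \<in> C. h c < m} \<Longrightarrow> real_not_pole k n D"
  shows "real_not_pole (Suc k) (n + 1) C"
proof -
  interpret R: coord_space "real_power (n + 1)" "real_power_topology (n + 1)" "exponent_set (n + 1)" "\<lambda>i x. x i"
    by (rule real_space)
  define u where "u j = a j - b j" for j
  have hu: "h u \<noteq> 0" unfolding u_def form_diff[OF h(1)] using ab(5) by simp
  have "a \<noteq> b" using ab(5) by auto
  then obtain i' where i': "i' \<in> exponent_set (n + 1)" "a i' \<noteq> b i'" using R.sep[of a b] ab(1,2) C(2) by blast
  have u: "u i' \<noteq> 0" using i'(2) by (simp add: u_def)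
  note drop = real_drop[where v = u, OF i'(1) u h(1) hu]
  let ?D = "{c \<in> C. h c < m}"
  have eq: "real_merge n i' u a = real_merge n i' u b"
    by (rule real_merge_line[where v = u, OF u i'(1), where \<tau> = 1]) (simp add: u_def)
  have fin: "finite ?D" using C(1) by simp
  have aD: "a \<in> ?D" using ab by simp
  have bD: "b \<in> ?D - {a}" using ab \<open>a \<noteq> b\<close> by simp
  have "real_merge n i' u ` ?D = real_merge n i' u ` (?D - {a})"
  proof
    show "real_merge n i' u ` ?D \<subseteq> real_merge n i' u ` (?D - {a})"
    proof
      fix z assume "z \<in> real_merge n i' u ` ?D"
      then obtain c where c: "c \<in> ?D" "z = real_merge n i' u c" by blast
      show "z \<in> real_merge n i' u ` (?D - {a})"
      proof (cases "c = a")
        case True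
        then have "z = real_merge n i' u b" using c(2) eq by simp
        then show ?thesis using bD by blast
      qed (use c in blast)
    qed
  qed blast
  then have "card (real_merge n i' u ` ?D) \<le> card (?D - {a})" using fin card_image_le[of "?D - {a}"] by simp
  also have "\<dots> < card ?D" by (rule psubset_card_mono[OF fin]) (use aD in blast)
  finally have "real_not_pole k n (real_merge n i' u ` ?D)"
    using fin real_merge_closed by (intro np) auto
  note np' = this[unfolded real_not_pole_iff]
  obtain E where E: "E \<in> sets R.borel_measure"
    "\<forall>c\<in>{c \<in> C. h c = m}. R.bdd {x \<in> carrier (real_power (n + 1)). x \<in> E \<longleftrightarrow> R.refl_at c x \<in> E}"
    using line_set[where v = v, OF i, of "{c \<in> C. h c = m}" p] line C(2) by blast
  show ?thesis unfolding real_not_pole_iff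
  proof (rule coord_drop.not_pole_drop[OF drop(1) R.space_borel_measure drop(2) R.continuous_borel[OF form_continuous[OF h(1)]]
        C(2) h(2) E(1) _ np'])
    fix c assume "c \<in> C" "h c = m"
    then have "R.bdd {x \<in> carrier (real_power (n + 1)). x \<in> E \<longleftrightarrow> R.refl_at c x \<in> E}" using E(2) by blast
    then show "R.bdd {x \<in> carrier (real_power (n + 1)). h x = m \<and> (x \<in> E \<longleftrightarrow> R.refl_at c x \<in> E)}"
      by (rule coord_bounded_mono) blast
  qed
qed

lemma injective_form:
  assumes "finite C" "C \<subseteq> carrier (real_power n)"
  shows "\<exists>h\<in>forms (exponent_set n). inj_on h C"
proof -
  let ?X = "(\<lambda>(a, b). \<lambda>i. a i - b i) ` {(a, b) \<in> C \<times> C. a \<noteq> b}"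
  have "\<exists>g\<in>forms (exponent_set n). \<forall>x\<in>?X. g x \<noteq> 0"
  proof (rule generic_form)
    have "finite {(a, b) \<in> C \<times> C. a \<noteq> b}" by (rule finite_subset[of _ "C \<times> C"]) (use assms(1) in auto)
    then show "finite ?X" by (rule finite_imageI)
    fix x assume "x \<in> ?X"
    then obtain a b where ab: "a \<in> C" "b \<in> C" "a \<noteq> b" "x = (\<lambda>i. a i - b i)" by auto
    then obtain i where "i \<in> exponent_set n" "a i \<noteq> b i"
      using coord_space.sep[OF real_space, of a n b] assms(2) by blast
    then show "\<exists>i\<in>exponent_set n. x i \<noteq> 0" unfolding ab(4) by (intro bexI[of _ i]) simp
  qed
  then obtain g where g: "g \<in> forms (exponent_set n)" "\<And>x. x \<in> ?X \<Longrightarrow> g x \<noteq> 0" by blast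
  have "g a \<noteq> g b" if "a \<in> C" "b \<in> C" "a \<noteq> b" for a b
  proof -
    have "(\<lambda>i. a i - b i) \<in> ?X" using that by (intro image_eqI[of _ _ "(a, b)"]) auto
    then have "g (\<lambda>i. a i - b i) \<noteq> 0" by (rule g(2))
    then show ?thesis unfolding form_diff[OF g(1)] by simp
  qed
  then have "inj_on g C" by (intro inj_onI) blast
  then show ?thesis using g(1) by blast
qed

lemma vertex_exists:
  assumes C: "finite C" "C \<noteq> {}" and h: "inj_on h C"
  shows "\<exists>p\<in>C. \<forall>c\<in>C. c \<noteq> p \<longrightarrow> h c < (h p :: real)"
proof -
  have "Max (h ` C) \<in> h ` C" using C by (intro Max_in) auto
  then obtain p where p: "Max (h ` C) = h p" "p \<in> C" by (rule imageE)
  have "h c < h p" if "c \<in> C" "c \<noteq> p" for c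
  proof -
    have "h c \<le> h p" unfolding p(1)[symmetric] using C(1) that(1) by (intro Max_ge) auto
    moreover have "h c \<noteq> h p" using h that p(2) by (meson inj_onD)
    ultimately show ?thesis by simp
  qed
  then show ?thesis using p(2) by blast
qed

definition small_not_pole :: "nat \<Rightarrow> enat \<Rightarrow> nat \<Rightarrow> bool" where
  "small_not_pole k n t \<longleftrightarrow> (\<forall>C. finite C \<longrightarrow> C \<subseteq> carrier (real_power n) \<longrightarrow> card C < t \<longrightarrow> real_not_pole k n C)"

text \<open>A generic form has a single point on its top face; this point and one merged point make
  up the 2.\<close>

lemma vertex_step:
  assumes np: "small_not_pole k n t" and k: "k \<ge> 1"
  shows "small_not_pole (Suc k) (n + 1) (t + 2)"
  unfolding small_not_pole_def
proof (intro allI impI)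
  fix C assume C: "finite C" "C \<subseteq> carrier (real_power (n + 1))" "card C < t + 2"
  have z: "0 \<in> exponent_set (n + 1)" by (rule zero_in_exponent_set)
  have n1: "enat 1 \<le> n + 1" by (cases n) (auto simp: one_enat_def)
  show "real_not_pole (Suc k) (n + 1) C"
  proof (cases "card C \<le> 2")
    case True
    then show ?thesis using small_two_points[OF _ n1 C(1) _ C(2)] k by simp
  next
    case False
    obtain h where h: "h \<in> forms (exponent_set (n + 1))" "inj_on h C" using injective_form[OF C(1,2)] by blast
    have "C \<noteq> {}" using False by auto
    then obtain p where p: "p \<in> C" "\<And>c. c \<in> C \<Longrightarrow> c \<noteq> p \<Longrightarrow> h c < h p" using vertex_exists[OF C(1) _ h(2)] by blast
    have D: "{c \<in> C. h c < h p} = C - {p}" using p(2) by auto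
    have cD: "card (C - {p}) = card C - 1" using p(1) C(1) by (simp add: card_Diff_singleton)
    then have "\<not> card (C - {p}) \<le> 1" using False by linarith
    then obtain a b where ab: "a \<in> C - {p}" "b \<in> C - {p}" "a \<noteq> b"
      using card_le_Suc0_iff_eq[of "C - {p}"] C(1) by auto
    show ?thesis
    proof (rule peel_merge[OF C(1,2) h(1), where m = "h p" and i = 0 and v = "\<lambda>j. 1" and p = p and a = a and b = b])
      show "h c \<le> h p" if "c \<in> C" for c using p(2)[OF that] by (cases "c = p") auto
      show "\<exists>\<tau>. \<forall>j\<in>exponent_set (n + 1). c j = p j + \<tau> * 1" if "c \<in> C" "h c = h p" for c
        using p(2)[OF that(1)] that(2) by (intro exI[of _ 0]) auto
      show "h a \<noteq> h b" using h(2) ab by (meson Diff_iff inj_onD)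
      show "real_not_pole k n D" if "finite D" "D \<subseteq> carrier (real_power n)" "card D < card {c \<in> C. h c < h p}" for D
      proof -
        have "card D < t" using that(3) C(3) cD unfolding D by linarith
        then show ?thesis using np that(1,2) unfolding small_not_pole_def by blast
      qed
    qed (use z ab p(2) in auto)
  qed
qed

lemma cancel_fraction: "D \<noteq> 0 \<Longrightarrow> D * (1 / D * x + - (1 / D) * y) = x - y" for D x y :: real
  by (simp add: field_simps)

text \<open>An edge takes two of five points, and merging reduces the other three to two. Merging
  requires two different levels; if there is only one, genericity puts the rest on a line parallel
  to the edge, and projecting along the edge leaves two points of the whole set.\<close>

lemma edge_step:
  assumes np: "small_not_pole 2 n 3"
  shows "small_not_pole 3 (n + 1) 6"
  unfolding small_not_pole_def
proof (intro allI impI)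
  fix C assume C: "finite C" "C \<subseteq> carrier (real_power (n + 1))" "card C < 6"
  let ?I = "exponent_set (n + 1)"
  interpret R: coord_space "real_power (n + 1)" "real_power_topology (n + 1)" ?I "\<lambda>i x. x i" by (rule real_space)
  have n1: "enat 1 \<le> n + 1" by (cases n) (auto simp: one_enat_def)
  have three: "3 = Suc (2 :: nat)" by simp
  show "real_not_pole 3 (n + 1) C"
  proof (cases "card C \<le> 2")
    case True
    then show ?thesis using small_two_points[OF _ n1 C(1) _ C(2)] by simp
  next
    case False
    obtain h where h: "h \<in> forms ?I" "inj_on h C" using injective_form[OF C(1,2)] by blast
    have "C \<noteq> {}" using False by auto
    then obtain p where p: "p \<in> C" "\<And>c. c \<in> C \<Longrightarrow> c \<noteq> p \<Longrightarrow> h c < h p" using vertex_exists[OF C(1) _ h(2)] by blast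
    define C1 where "C1 = C - {p}"
    have C1: "finite C1" "C1 \<noteq> {}" "\<And>c. c \<in> C1 \<Longrightarrow> h c < h p" "C1 \<subseteq> C"
    proof -
      have "card C1 = card C - 1" using p(1) C(1) by (simp add: C1_def card_Diff_singleton)
      then have "card C1 \<noteq> 0" using False by linarith
      then show "C1 \<noteq> {}" by (metis card.empty)
    qed (use C(1) p(2) in \<open>auto simp: C1_def\<close>)
    \<comment> \<open>The direction from \<open>p\<close> to \<open>c\<close>, normalised so that
      \<open>h\<close> takes the value -1; points on a common ray from \<open>p\<close> have the
      same \<open>V\<close>.\<close>
    define V where "V c = (\<lambda>i. (1 / (h p - h c)) * c i + (- (1 / (h p - h c))) * p i)" for c
    \<comment> \<open>Not vanishing on \<open>X1\<close> makes the direction of largest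
      \<open>g\<close> unique, so that the top face of \<open>k\<close> lies on a line. Not
      vanishing on \<open>X2\<close> makes \<open>k a = k b\<close> possible only for
      \<open>a - b\<close> parallel to that line.\<close>
    define X1 where "X1 = (\<lambda>(c, d) i. V c i - V d i) ` (C1 \<times> C1)"
    define X2 where "X2 = (\<lambda>(a, b, c) i. 1 * (a i - b i) + (h a - h b) * V c i) ` (C \<times> C \<times> C1)"
    have "\<exists>g\<in>forms ?I. \<forall>x\<in>{x \<in> X1 \<union> X2. \<exists>i\<in>?I. x i \<noteq> 0}. g x \<noteq> 0"
      by (rule generic_form) (use C(1) C1(1) in \<open>auto simp: X1_def X2_def\<close>)
    then obtain g where g: "g \<in> forms ?I" "\<And>x. x \<in> X1 \<union> X2 \<Longrightarrow> g x = 0 \<Longrightarrow> \<forall>i\<in>?I. x i = 0" by blast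
    have gV: "(h p - h c) * g (V c) = g c - g p" if "c \<in> C1" for c
    proof -
      have Vc: "g (V c) = 1 / (h p - h c) * g c + - (1 / (h p - h c)) * g p"
        unfolding V_def by (rule form_linear[OF g(1)])
      show ?thesis unfolding Vc by (rule cancel_fraction) (use C1(3)[OF that] in simp)
    qed
    define s where "s = Max ((\<lambda>c. g (V c)) ` C1)"
    have "s \<in> (\<lambda>c. g (V c)) ` C1" unfolding s_def using C1 by (intro Max_in) auto
    then obtain q where q: "s = g (V q)" "q \<in> C1" by (rule imageE)
    have s: "g (V c) \<le> s" if "c \<in> C1" for c unfolding s_def using C1(1) that by (intro Max_ge) auto
    define k where "k x = g x + s * h x" for x
    have kf: "k \<in> forms ?I" unfolding k_def by (rule forms_add[OF g(1) h(1)])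
    have kd: "k p - k c = (h p - h c) * (s - g (V c))" if "c \<in> C1" for c
      using gV[OF that] by (simp add: k_def algebra_simps)
    have kle: "k c \<le> k p" if "c \<in> C" for c
    proof (cases "c = p")
      case False
      then have c: "c \<in> C1" using that by (simp add: C1_def)
      have "(h p - h c) * (s - g (V c)) \<ge> 0" using C1(3)[OF c] s[OF c] by simp
      then show ?thesis using kd[OF c] by linarith
    qed simp
    define v where "v = V q"
    have hv: "h v = - 1"
    proof -
      have hq: "h p - h q \<noteq> 0" using C1(3)[OF q(2)] by simp
      have e: "h v = 1 / (h p - h q) * h q + - (1 / (h p - h q)) * h p"
        unfolding v_def V_def by (rule form_linear[OF h(1)])
      have "(h p - h q) * h v = h q - h p" unfolding e by (rule cancel_fraction[OF hq])
      then have "(h p - h q) * h v = (h p - h q) * (- 1)" by simp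
      then show ?thesis by (rule iffD1[OF mult_left_cancel[OF hq]])
    qed
    have "\<exists>i\<in>?I. v i \<noteq> 0"
    proof (rule ccontr)
      assume "\<not> ?thesis"
      then have "h v = h (\<lambda>i. 0)" by (intro form_cong[OF h(1)]) auto
      then show False using hv form_zero[OF h(1)] by simp
    qed
    then obtain i where i: "i \<in> ?I" "v i \<noteq> 0" by blast
    have top: "\<exists>\<tau>. \<forall>j\<in>?I. c j = p j + \<tau> * v j" if c: "c \<in> C" "k c = k p" for c
    proof (cases "c = p")
      case True
      then show ?thesis by (intro exI[of _ 0]) simp
    next
      case False
      then have c1: "c \<in> C1" using c by (simp add: C1_def)
      have hc: "h p - h c > 0" using C1(3)[OF c1] by simp
      have "(h p - h c) * (s - g (V c)) = 0" using kd[OF c1] c(2) by simp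
      then have "g (V c) = g v" using hc q(1) by (simp add: v_def)
      then have "g (\<lambda>i. V c i - V q i) = 0" using form_diff[OF g(1), of "V c" "V q"] by (simp add: v_def)
      moreover have "(\<lambda>i. V c i - V q i) \<in> X1" unfolding X1_def
        by (rule image_eqI[of _ _ "(c, q)"]) (use c1 q(2) in auto)
      ultimately have "\<forall>j\<in>?I. V c j - V q j = 0" using g(2) by blast
      then have "\<forall>j\<in>?I. V c j = v j" by (simp add: v_def)
      moreover have "c j = p j + (h p - h c) * V c j" for j
      proof -
        have "(h p - h c) * V c j = c j - p j" unfolding V_def by (rule cancel_fraction) (use hc in simp)
        then show ?thesis by linarith
      qed
      ultimately show ?thesis by (intro exI[of _ "h p - h c"]) simp
    qed
    let ?D = "{c \<in> C. k c < k p}"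
    have qC: "q \<in> C" "q \<noteq> p" using q(2) by (auto simp: C1_def)
    have kq: "k q = k p" using kd[OF q(2)] q(1) by simp
    have "?D \<subseteq> C - {p, q}" using kq by auto
    then have "card ?D \<le> card (C - {p, q})" using C(1) by (intro card_mono) auto
    also have "\<dots> = card C - 2" using qC p(1) C(1) by (subst card_Diff_subset) auto
    finally have cD: "card ?D \<le> 3" using C(3) by linarith
    show ?thesis
    proof (cases "\<exists>a\<in>?D. \<exists>b\<in>?D. k a \<noteq> k b")
      case True
      then obtain a b where ab: "a \<in> ?D" "b \<in> ?D" "k a \<noteq> k b" by blast
      show ?thesis unfolding three
      proof (rule peel_merge[OF C(1,2) kf, where m = "k p" and i = i and v = v and p = p and a = a and b = b])
        show "real_not_pole 2 n D" if "finite D" "D \<subseteq> carrier (real_power n)" "card D < card ?D" for D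
          by (rule np[unfolded small_not_pole_def, rule_format, OF that(1,2)]) (use that(3) cD in linarith)
      qed (use kle i top ab in auto)
    next
      case False
      have par: "\<exists>\<tau>. \<forall>j\<in>?I. a j = b j + \<tau> * v j" if ab: "a \<in> ?D" "b \<in> ?D" for a b
      proof -
        have "k a = k b" using False ab by blast
        then have e: "(g a - g b) + (h a - h b) * g v = 0" using q(1) by (simp add: k_def v_def algebra_simps)
        have "g (\<lambda>i. 1 * (\<lambda>i. a i - b i) i + (h a - h b) * V q i) = 1 * g (\<lambda>i. a i - b i) + (h a - h b) * g (V q)"
          by (rule form_linear[OF g(1)])
        then have "g (\<lambda>i. 1 * (a i - b i) + (h a - h b) * V q i) = 0"
          using e form_diff[OF g(1), of a b] by (simp add: v_def)
        moreover have "(\<lambda>i. 1 * (a i - b i) + (h a - h b) * V q i) \<in> X2" unfolding X2_def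
          by (rule image_eqI[of _ _ "(a, b, q)"]) (use ab q(2) in auto)
        ultimately have "\<forall>j\<in>?I. 1 * (a j - b j) + (h a - h b) * V q j = 0" using g(2) by blast
        then have "a j = b j + (h b - h a) * v j" if "j \<in> ?I" for j
          using bspec[of ?I _ j] that by (simp add: v_def algebra_simps)
        then show ?thesis by (intro exI[of _ "h b - h a"]) blast
      qed
      note drop = real_drop[where v = v and h = "\<lambda>x. x i", OF i coord_in_forms[OF i(1)] i(2)]
      define d where "d = (SOME d. d \<in> ?D)"
      have img: "real_merge n i v ` C \<subseteq> {real_merge n i v p, real_merge n i v d}"
      proof
        fix z assume "z \<in> real_merge n i v ` C"
        then obtain c where c: "c \<in> C" "z = real_merge n i v c" by blast
        show "z \<in> {real_merge n i v p, real_merge n i v d}"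
        proof (cases "k c = k p")
          case True
          then obtain \<tau> where "\<And>j. j \<in> ?I \<Longrightarrow> c j = p j + \<tau> * v j" using top[OF c(1)] by blast
          then have "real_merge n i v c = real_merge n i v p" by (rule real_merge_line[where \<tau> = \<tau> and v = v, OF i(2,1)])
          then show ?thesis using c(2) by simp
        next
          case False
          then have cD': "c \<in> ?D" using kle[OF c(1)] c(1) by simp
          then have "d \<in> ?D" unfolding d_def by (rule someI[of "\<lambda>d. d \<in> ?D"])
          then obtain \<tau> where "\<And>j. j \<in> ?I \<Longrightarrow> c j = d j + \<tau> * v j" using par[OF cD'] by blast
          then have "real_merge n i v c = real_merge n i v d" by (rule real_merge_line[where \<tau> = \<tau> and v = v, OF i(2,1)])
          then show ?thesis using c(2) by simp
        qed
      qed
      have "card (real_merge n i v ` C) \<le> card {real_merge n i v p, real_merge n i v d}"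
        using img by (intro card_mono) auto
      also have "\<dots> \<le> 2" by (simp add: card_insert_if)
      finally have lt: "card (real_merge n i v ` C) < 3" by simp
      have "real_merge n i v ` C \<subseteq> carrier (real_power n)" by (rule image_subsetI) (rule real_merge_closed)
      then have "real_not_pole 2 n (real_merge n i v ` C)"
        using np[unfolded small_not_pole_def, rule_format, OF finite_imageI[OF C(1)] _ lt] by blast
      then have np': "\<not> coord_group.pole (real_power n) (exponent_set n) (\<lambda>i x. x i)
          (coord_group.borel_measure (real_power n) (real_power_topology n)) 2 (real_merge n i v ` C)"
        unfolding real_not_pole_iff .
      show ?thesis unfolding three real_not_pole_iff
        by (rule coord_drop.not_pole_project[OF drop(1) R.space_borel_measure drop(2) R.f_borel[OF i(1)] C(2,1) np'])
    qed
  qed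
qed

lemma enat_Suc_le:
  assumes "enat (Suc k) \<le> m"
  shows "\<exists>n. m = n + 1 \<and> enat k \<le> n"
proof (cases m)
  case (enat N)
  then show ?thesis using assms by (intro exI[of _ "enat (N - 1)"]) (simp add: one_enat_def)
next
  case infinity
  then show ?thesis by (intro exI[of _ \<infinity>]) simp
qed

text \<open>The thresholds 3, 6 and 8 for two, three and four colours come from a line, an edge and
  a vertex; each further vertex raises the threshold by 2, and the claim asks for 1.\<close>

lemma small_not_pole_general:
  assumes "k \<ge> 4" "enat k \<le> m"
  shows "small_not_pole k m (k + 4)"
  using assms
proof (induction k arbitrary: m rule: dec_induct)
  case base
  have "4 = Suc 3" "3 = Suc (2 :: nat)" by simp_all
  then obtain n n' where n: "m = n + 1" "n = n' + 1" "enat 2 \<le> n'" using base enat_Suc_le by metis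
  have "small_not_pole 2 n' 3" unfolding small_not_pole_def
  proof (intro allI impI)
    fix C assume C: "finite C" "C \<subseteq> carrier (real_power n')" "card C < 3"
    have "enat 1 \<le> n'" using n(3) by (rule order_trans[rotated]) simp
    then show "real_not_pole 2 n' C" using C by (intro small_two_points) auto
  qed
  from vertex_step[OF edge_step[OF this]] show ?case unfolding n by simp
next
  case (step k)
  obtain n where n: "m = n + 1" "enat k \<le> n" using enat_Suc_le[OF step.prems] by blast
  have "small_not_pole (Suc k) (n + 1) (k + 4 + 2)" by (rule vertex_step[OF step.IH[OF n(2)]]) (use step in simp)
  then show ?case unfolding n(1) small_not_pole_def by simp
qed

lemma real_linear_bound:
  assumes "enat k \<le> m" "4 \<le> k"
  shows "ecard_of_nat (k + 4) \<le>\<^sub>c cB_R k m"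
  unfolding borel_centerpole_number_def
proof (rule nat_le_least_card)
  fix C assume "C \<in> {C. borel_centerpole k (real_power m) (real_power_topology m) C}" "finite C"
  then show "k + 4 \<le> card C"
    using small_not_pole_general[OF assms(2,1)] unfolding small_not_pole_def
    by (metis borel_centerpole_def mem_Collect_eq not_le)
qed

section \<open>The quadratic bound\<close>

lemma fdim_forms: "fdim (forms {..<k}) k"
proof -
  have "fs.independent ((\<lambda>i x. x i) ` {..<k}) \<and> card ((\<lambda>i (x :: nat \<Rightarrow> real). x i) ` {..<k}) = k"
  proof (induction k)
    case 0
    then show ?case by (simp add: fs.independent_empty)
  next
    case (Suc k)
    have ns: "(\<lambda>x. x k) \<notin> fs.span ((\<lambda>i (x :: nat \<Rightarrow> real). x i) ` {..<k})"
    proof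
      assume "(\<lambda>x. x k) \<in> fs.span ((\<lambda>i (x :: nat \<Rightarrow> real). x i) ` {..<k})"
      then have "(\<lambda>x. x k) \<in> forms {..<k}" by (simp add: forms_def)
      from form_cong[OF this, of "\<lambda>j. 0" "\<lambda>j. if j = k then 1 else 0"] show False by simp
    qed
    have "(\<lambda>x. x k) \<notin> (\<lambda>i (x :: nat \<Rightarrow> real). x i) ` {..<k}"
      using ns by (rule contrapos_nn) (rule fs.span_base)
    then show ?case
      using Suc fs.independent_insertI[OF ns] by (simp add: lessThan_Suc)
  qed
  then show ?thesis unfolding fdim_def forms_def by (intro exI[of _ "(\<lambda>i x. x i) ` {..<k}"]) simp
qed

text \<open>The formula has the value 12 in dimension 4, one more than the eleven points handled
  there, and it grows by \<open>k + 2\<close> from \<open>k\<close> to \<open>k + 1\<close>, exactly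
  as the threshold in \<open>tsh_step\<close>.\<close>

lemma tsh_quadratic:
  assumes "k \<ge> 4" "fdim W k" "finite C" "card C < (k ^ 2 + 3 * k - 4) div 2"
  shows "tsh k W C"
  using assms
proof (induction k arbitrary: W C rule: dec_induct)
  case base
  then show ?case by (intro tsh4_small) simp_all
next
  case (step k)
  have kk: "4 * k \<le> k * k" using step.hyps(1) by (intro mult_right_mono) auto
  have a: "Suc k ^ 2 + 3 * Suc k - 4 = (k ^ 2 + 3 * k - 4) + 2 * (k + 2)"
    using step.hyps(1) by (simp add: power2_eq_square)
  show ?case
  proof (rule tsh_step[where t = "(k ^ 2 + 3 * k - 4) div 2"])
    have "2 * (k + 2) \<le> k ^ 2 + 3 * k - 4" unfolding power2_eq_square using kk step.hyps(1) by arith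
    then show "(k ^ 2 + 3 * k - 4) div 2 \<ge> k + 2" by presburger
    show "card C < (k ^ 2 + 3 * k - 4) div 2 + k + 2" using step.prems(3) unfolding a by simp
  qed (use step in auto)
qed

lemma tsh_not_pole:
  assumes C: "finite C" "C \<subseteq> carrier (real_power (enat k))" and t: "tsh k (forms {..<k}) C"
  shows "real_not_pole k (enat k) C"
proof -
  interpret R: coord_space "real_power (enat k)" "real_power_topology (enat k)" "exponent_set (enat k)" "\<lambda>i x. x i"
    by (rule real_space)
  have ek: "exponent_set (enat k) = {..<k}" by (rule exponent_set_enat)
  obtain hs where hs: "set hs \<subseteq> forms {..<k}" "distinct hs" "fs.independent (set hs)" "Suc (length hs) = k" "peel hs C"
    using t unfolding tsh_def by blast
  have ch: "card (set hs) = length hs" using hs(2) by (rule distinct_card)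
  \<comment> \<open>\<open>g\<close> completes the \<open>k - 1\<close> peeling functionals to a
    basis of all forms, so that bounds on the list bound every coordinate.\<close>
  obtain g where g: "g \<in> forms {..<k}" "g \<notin> fs.span (set hs)"
    using fdim_not_span[OF fdim_forms, of "set hs" k] ch hs(4) by auto
  have ind: "fs.independent (insert g (set hs))" by (rule fs.independent_insertI[OF g(2) hs(3)])
  have gn: "g \<notin> set hs" using g(2) fs.span_base by blast
  have full: "f \<in> fs.span (insert g (set hs))" if f: "f \<in> forms {..<k}" for f
  proof (rule ccontr)
    assume n: "f \<notin> fs.span (insert g (set hs))"
    then have ind': "fs.independent (insert f (insert g (set hs)))" using fs.independent_insertI[OF _ ind] by blast
    have "f \<notin> insert g (set hs)" using n fs.span_base by blast
    then have "card (insert f (insert g (set hs))) = Suc k" using gn ch hs(4) by simp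
    moreover obtain B where B: "finite B" "fs.span B = forms {..<k}" "card B = k"
      using fdim_forms[of k] unfolding fdim_def by blast
    moreover have "insert f (insert g (set hs)) \<subseteq> fs.span B" using f g(1) hs(1) B(2) by blast
    ultimately show False using fs.independent_span_bound[OF B(1) ind'] by simp
  qed
  have "\<not> R.pole R.borel_measure (Suc (length hs)) C"
  proof (rule R.not_pole_peel[OF _ R.space_borel_measure _ C hs(5), where g = g])
    show "h \<in> borel_measurable R.borel_measure \<and> R.odd_fn h" if "h \<in> set (hs @ [g])" for h
    proof -
      have hf: "h \<in> forms (exponent_set (enat k))" using that hs(1) g(1) ek by auto
      show ?thesis unfolding R.odd_fn_def
        using R.continuous_borel[OF form_continuous[OF hf]] form_refl[OF hf] by blast
    qed
    show "R.refl_at c \<in> measurable R.borel_measure R.borel_measure" if "c \<in> C" for c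
      using R.refl_measurable C(2) that by blast
    show "R.bdd S" if S: "list_bounded (hs @ [g]) S" for S
      unfolding coord_bounded_def
    proof
      fix i assume "i \<in> exponent_set (enat k)"
      then have "(\<lambda>x. x i) \<in> forms {..<k}" unfolding ek by (rule coord_in_forms)
      then have sp: "(\<lambda>x. x i) \<in> fs.span (insert g (set hs))" by (rule full)
      show "\<exists>B. \<forall>x\<in>S. \<bar>x i\<bar> \<le> B"
      proof (rule span_bounded[OF sp])
        fix f assume "f \<in> insert g (set hs)"
        then show "\<exists>B. \<forall>x\<in>S. \<bar>f x\<bar> \<le> B" using S unfolding list_bounded_def by auto
      qed
    qed
  qed
  then show ?thesis unfolding real_not_pole_iff hs(4) .
qed

lemma real_quadratic_bound:
  assumes "4 \<le> k"
  shows "ecard_of_nat ((k ^ 2 + 3 * k - 4) div 2) \<le>\<^sub>c cB_R k (enat k)"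
  unfolding borel_centerpole_number_def
proof (rule nat_le_least_card)
  fix C assume C: "C \<in> {C. borel_centerpole k (real_power (enat k)) (real_power_topology (enat k)) C}" "finite C"
  then have b: "borel_centerpole k (real_power (enat k)) (real_power_topology (enat k)) C" by simp
  then have "C \<subseteq> carrier (real_power (enat k))" by (simp add: borel_centerpole_def)
  then show "(k ^ 2 + 3 * k - 4) div 2 \<le> card C"
    using tsh_not_pole[OF C(2)] tsh_quadratic[OF assms fdim_forms C(2)] b by (meson not_le)
qed

theorem theorem1p4:
  fixes k :: nat and n m :: enat
  shows "(enat k \<le> m \<longrightarrow>
            c_Z k m \<le>\<^sub>c
              ecard_of_nat (2 ^ k - 1 - Max {zbinom (int k - 1) (s - 1) | s. s \<le> int k - 2}))
       \<and> (4 \<le> k \<longrightarrow> ecard_of_nat ((k ^ 2 + 3 * k - 4) div 2) \<le>\<^sub>c cB_R k (enat k))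
       \<and> (enat k \<le> m \<and> 4 \<le> k \<longrightarrow> ecard_of_nat (k + 4) \<le>\<^sub>c cB_R k m)
       \<and> (enat k \<le> n \<longrightarrow> cB_R k n <\<^sub>c cB_R (k + 1) (n + 1) \<and> c_R k n <\<^sub>c c_R (k + 1) (n + 1))
       \<and> (enat k \<le> n + m \<longrightarrow>
            cB_RZ k n m <\<^sub>c cB_RZ (k + 1) n (m + 1) \<and> c_RZ k n m <\<^sub>c c_RZ (k + 1) n (m + 1))"
  unfolding Suc_eq_plus1[symmetric]
  using int_upper_bound[of k m] real_quadratic_bound[of k] real_linear_bound[of k m] real_strict[of k n]
    mixed_strict[of k n m] by blast

end
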